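(* Let $f\in \mathrm{Lip}_{\rm loc}(\mathbb{R})$ be convex, and let $\Omega\subset \mathbb{R}^+\times\mathbb{R}$ be an open set. Assume that $u\in L^\infty_{\rm loc}(\Omega)$ satisfies $$u_t+f(u)_x=0\qquad\text{in }\mathcal{D}'(\Omega)$$ and $$\eta(u)_t+q(u)_x\le \mu\qquad\text{in }\mathcal{D}'(\Omega)$$ for some strictly convex function $\eta\in \mathrm{Lip}_{\rm loc}(\mathbb{R})$, with entropy flux $q$ satisfying $q'(u)=\eta'(u)f'(u)$ for a.e. $u\in\mathbb{R}$, and some non-negative Radon measure $\mu$ satisfying $$\liminf_{r\downarrow 0}\frac{1}{r}\,\mu(B_r(t,x))=0\qquad\text{for every }(t,x)\in\Omega .$$ Then the locally Lipschitz function $w=w(t,x)$ with $w_x=u$ and $w_t=-f(u)$ is a viscosity solution of the Hamilton-Jacobi equation $w_t+f(w_x)=0$ in $\Omega$, and $u$ is an entropy solution of the scalar conservation law $u_t+f(u)_x=0$ in $\Omega$.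
   Context: Notation: $\mathbb{R}^+\times\mathbb{R}=(0,\infty)\times(-\infty,\infty)$ with points $(t,x)$; $B_r(t,x)$ is the disk with center $(t,x)$ and radius $r>0$; $\mathrm{Lip}_{\rm loc}(\mathbb{R})$ denotes the locally Lipschitz functions on $\mathbb{R}$; $\mathcal{D}'(\Omega)$ denotes distributions on $\Omega$. A function $g:\mathbb{R}\to\mathbb{R}$ is convex if $g(\lambda u_1+(1-\lambda)u_2)\le \lambda g(u_1)+(1-\lambda)g(u_2)$ for all $u_1\ne u_2$ and $\lambda\in[0,1]$ (equivalently, $g$ is locally Lipschitz and $g'$ is nondecreasing); it is strictly convex if the inequality is strict for all $u_1\neq u_2$ and $\lambda\in(0,1)$ (equivalently, $g$ is locally Lipschitz and $g'$ is strictly increasing). No second-order differentiability or uniform convexity is assumed. Entropy solution: a function $u\in L^1_{\rm loc}(\Omega)$ is an entropy solution of $u_t+f(u)_x=0$ in $\Omega$ if $u$ satisfies $u_t+f(u)_x=0$ in $\mathcal{D}'(\Omega)$ and, for any convex entropy-entropy flux pair $(\tilde\eta,\tilde q)\in \mathrm{Lip}_{\rm loc}(\mathbb{R})$ ($\tilde\eta$ convex and $\tilde q'=\tilde\eta' f'$ almost everywhere), $\tilde\eta(u)_t+\tilde q(u)_x\le 0$ in $\mathcal{D}'(\Omega)$. Viscosity solution: a function $w\in C(\Omega)$ is a viscosity solution of $w_t+f(w_x)=0$ in $\Omega$ if (i) for any $C^1$-function $\varphi$ such that $w-\varphi$ has a local maximum at some point $(t,x)$, $\varphi_t(t,x)+f(\varphi_x(t,x))\le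 0$; and (ii) for any $C^1$-function $\varphi$ such that $w-\varphi$ has a local minimum at some point $(t,x)$, $\varphi_t(t,x)+f(\varphi_x(t,x))\ge 0$. The relations $w_x=u$, $w_t=-f(u)$ are understood almost everywhere in $\Omega$.
   Formalization: On a general open Ω the function w with w_x = u, w_t = -f(u) need not exist (f = 0 on an annulus), so existence of w is proved on each simply connected open subset, and every such w on Ω is shown to be a viscosity solution. *)

theory Defs
  imports "HOL-Analysis.Analysis"
begin

text \<open>Points of the plane are pairs \<open>(t, x) :: real \<times> real\<close>, with time first; the metric on
  \<^typ>\<open>real \<times> real\<close> is the Euclidean one, so \<open>ball (t, x) r\<close> is the open disk.\<close>

definition Lip_loc :: "'a::metric_space set \<Rightarrow> ('a \<Rightarrow> real) \<Rightarrow> bool" where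
  "Lip_loc S g \<longleftrightarrow> (\<forall>x\<in>S. \<exists>r>0. \<exists>L. L-lipschitz_on (cball x r \<inter> S) g)"

definition strictly_convex :: "(real \<Rightarrow> real) \<Rightarrow> bool" where
  "strictly_convex g \<longleftrightarrow>
     (\<forall>u1 u2 l. u1 \<noteq> u2 \<longrightarrow> 0 < l \<longrightarrow> l < 1 \<longrightarrow>
        g (l * u1 + (1 - l) * u2) < l * g u1 + (1 - l) * g u2)"

definition d_t :: "(real \<times> real \<Rightarrow> real) \<Rightarrow> real \<times> real \<Rightarrow> real" where
  "d_t \<phi> p = deriv (\<lambda>s. \<phi> (s, snd p)) (fst p)"

definition d_x :: "(real \<times> real \<Rightarrow> real) \<Rightarrow> real \<times> real \<Rightarrow> real" where
  "d_x \<phi> p = deriv (\<lambda>y. \<phi> (fst p, y)) (snd p)"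

text \<open>\<open>C_k_on k S \<phi>\<close>: \<open>\<phi>\<close> is of class \<open>C\<^sup>k\<close> on the open set \<open>S\<close>.\<close>

fun C_k_on :: "nat \<Rightarrow> (real \<times> real) set \<Rightarrow> (real \<times> real \<Rightarrow> real) \<Rightarrow> bool" where
  "C_k_on 0 S \<phi> \<longleftrightarrow> continuous_on S \<phi>"
| "C_k_on (Suc k) S \<phi> \<longleftrightarrow>
     (\<forall>p\<in>S. \<phi> differentiable (at p)) \<and> C_k_on k S (d_t \<phi>) \<and> C_k_on k S (d_x \<phi>)"

text \<open>\<open>C\<^sub>c\<^sup>\<infinity>(\<Omega>)\<close>, each test function being extended by zero to the whole plane.\<close>

definition test_functions :: "(real \<times> real) set \<Rightarrow> (real \<times> real \<Rightarrow> real) set" where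
  "test_functions \<Omega> =
     {\<phi>. (\<forall>k. C_k_on k UNIV \<phi>) \<and> compact (closure {p. \<phi> p \<noteq> 0}) \<and> closure {p. \<phi> p \<noteq> 0} \<subseteq> \<Omega>}"

definition L1_loc :: "(real \<times> real) set \<Rightarrow> (real \<times> real \<Rightarrow> real) \<Rightarrow> bool" where
  "L1_loc \<Omega> u \<longleftrightarrow> (\<forall>K. compact K \<longrightarrow> K \<subseteq> \<Omega> \<longrightarrow> set_integrable lebesgue K u)"

definition Linf_loc :: "(real \<times> real) set \<Rightarrow> (real \<times> real \<Rightarrow> real) \<Rightarrow> bool" where
  "Linf_loc \<Omega> u \<longleftrightarrow> u \<in> borel_measurable (lebesgue_on \<Omega>) \<and>
     (\<forall>K. compact K \<longrightarrow> K \<subseteq> \<Omega> \<longrightarrow> (\<exists>C. AE p in lebesgue. p \<in> K \<longrightarrow> \<bar>u p\<bar> \<le> C))"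

text \<open>\<open>weak_div \<Omega> A B \<phi>\<close> is the pairing of the distribution \<open>A\<^sub>t + B\<^sub>x\<close> on \<open>\<Omega>\<close> with \<open>\<phi>\<close>.  The three
  (in)equalities below include the local integrability of \<open>A\<close> and \<open>B\<close>, without which \<open>A\<^sub>t + B\<^sub>x\<close>
  would not denote a distribution (and Bochner integrals could default to 0).\<close>

definition weak_div ::
  "(real \<times> real) set \<Rightarrow> (real \<times> real \<Rightarrow> real) \<Rightarrow> (real \<times> real \<Rightarrow> real) \<Rightarrow> (real \<times> real \<Rightarrow> real) \<Rightarrow> real"
where
  "weak_div \<Omega> A B \<phi> = - (LINT p:\<Omega>|lebesgue. A p * d_t \<phi> p + B p * d_x \<phi> p)"

definition weak_div_eq_0 ::
  "(real \<times> real) set \<Rightarrow> (real \<times> real \<Rightarrow> real) \<Rightarrow> (real \<times> real \<Rightarrow> real) \<Rightarrow> bool" where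
  "weak_div_eq_0 \<Omega> A B \<longleftrightarrow> L1_loc \<Omega> A \<and> L1_loc \<Omega> B \<and>
     (\<forall>\<phi>\<in>test_functions \<Omega>. weak_div \<Omega> A B \<phi> = 0)"

definition weak_div_le_0 ::
  "(real \<times> real) set \<Rightarrow> (real \<times> real \<Rightarrow> real) \<Rightarrow> (real \<times> real \<Rightarrow> real) \<Rightarrow> bool" where
  "weak_div_le_0 \<Omega> A B \<longleftrightarrow> L1_loc \<Omega> A \<and> L1_loc \<Omega> B \<and>
     (\<forall>\<phi>\<in>test_functions \<Omega>. (\<forall>p. 0 \<le> \<phi> p) \<longrightarrow> weak_div \<Omega> A B \<phi> \<le> 0)"

definition weak_div_le_measure ::
  "(real \<times> real) set \<Rightarrow> (real \<times> real \<Rightarrow> real) \<Rightarrow> (real \<times> real \<Rightarrow> real) \<Rightarrow> (real \<times> real) measure \<Rightarrow> bool"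
where
  "weak_div_le_measure \<Omega> A B \<mu> \<longleftrightarrow> L1_loc \<Omega> A \<and> L1_loc \<Omega> B \<and>
     (\<forall>\<phi>\<in>test_functions \<Omega>. (\<forall>p. 0 \<le> \<phi> p) \<longrightarrow> weak_div \<Omega> A B \<phi> \<le> (LINT p|\<mu>. \<phi> p))"

text \<open>Non-negative Borel measures on \<open>\<Omega>\<close> that are finite on compact sets; on an open subset of the
  plane these are automatically regular.\<close>

definition radon_measure_on :: "(real \<times> real) set \<Rightarrow> (real \<times> real) measure \<Rightarrow> bool" where
  "radon_measure_on \<Omega> \<mu> \<longleftrightarrow> sets \<mu> = sets (restrict_space borel \<Omega>) \<and>
     (\<forall>K. compact K \<longrightarrow> K \<subseteq> \<Omega> \<longrightarrow> emeasure \<mu> K < \<infinity>)"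

text \<open>\<open>q' = \<eta>' f'\<close> almost everywhere, all three derivatives existing almost everywhere.\<close>

definition entropy_flux :: "(real \<Rightarrow> real) \<Rightarrow> (real \<Rightarrow> real) \<Rightarrow> (real \<Rightarrow> real) \<Rightarrow> bool" where
  "entropy_flux f \<eta> q \<longleftrightarrow>
     (AE v in lebesgue. \<exists>a b. (\<eta> has_real_derivative a) (at v) \<and> (f has_real_derivative b) (at v) \<and>
        (q has_real_derivative a * b) (at v))"

definition entropy_solution ::
  "(real \<Rightarrow> real) \<Rightarrow> (real \<times> real) set \<Rightarrow> (real \<times> real \<Rightarrow> real) \<Rightarrow> bool" where
  "entropy_solution f \<Omega> u \<longleftrightarrow> L1_loc \<Omega> u \<and> weak_div_eq_0 \<Omega> u (\<lambda>p. f (u p)) \<and>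
     (\<forall>\<eta> q. Lip_loc UNIV \<eta> \<longrightarrow> Lip_loc UNIV q \<longrightarrow> convex_on UNIV \<eta> \<longrightarrow> entropy_flux f \<eta> q \<longrightarrow>
        weak_div_le_0 \<Omega> (\<lambda>p. \<eta> (u p)) (\<lambda>p. q (u p)))"

text \<open>For open \<open>\<Omega>\<close> and \<open>p \<in> \<Omega>\<close>, the filter \<open>nhds p\<close> lives on \<open>\<Omega>\<close>, so the two eventualities say
  that \<open>w - \<phi>\<close> has a local maximum, respectively a local minimum, at \<open>p\<close>.\<close>

definition viscosity_solution ::
  "(real \<Rightarrow> real) \<Rightarrow> (real \<times> real) set \<Rightarrow> (real \<times> real \<Rightarrow> real) \<Rightarrow> bool" where
  "viscosity_solution f \<Omega> w \<longleftrightarrow> continuous_on \<Omega> w \<and>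
     (\<forall>\<phi>. C_k_on 1 \<Omega> \<phi> \<longrightarrow> (\<forall>p\<in>\<Omega>.
        ((\<forall>\<^sub>F y in nhds p. w y - \<phi> y \<le> w p - \<phi> p) \<longrightarrow> d_t \<phi> p + f (d_x \<phi> p) \<le> 0) \<and>
        ((\<forall>\<^sub>F y in nhds p. w y - \<phi> y \<ge> w p - \<phi> p) \<longrightarrow> d_t \<phi> p + f (d_x \<phi> p) \<ge> 0)))"

text \<open>\<open>w\<close> is locally Lipschitz on \<open>\<Omega>\<close> with \<open>w\<^sub>x = u\<close> and \<open>w\<^sub>t = -f(u)\<close> almost everywhere in \<open>\<Omega>\<close>.\<close>

definition potential ::
  "(real \<Rightarrow> real) \<Rightarrow> (real \<times> real) set \<Rightarrow> (real \<times> real \<Rightarrow> real) \<Rightarrow> (real \<times> real \<Rightarrow> real) \<Rightarrow> bool" where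
  "potential f \<Omega> u w \<longleftrightarrow> Lip_loc \<Omega> w \<and>
     (AE p in lebesgue. p \<in> \<Omega> \<longrightarrow>
        ((\<lambda>y. w (fst p, y)) has_real_derivative u p) (at (snd p)) \<and>
        ((\<lambda>s. w (s, snd p)) has_real_derivative - f (u p)) (at (fst p)))"

end

theory Submission imports Defs "HOL-Complex_Analysis.Complex_Analysis" begin

text \<open>The semidifferentials of a potential \<open>w\<close> (\<open>w\<^sub>x = u\<close>, \<open>w\<^sub>t = -f(u)\<close>) are analysed by testing with
  \<open>((w(p) + affine - 2 \<epsilon> |y - p| + \<delta> - w)\<^sup>+)\<^sup>2\<close> (with the sign of \<open>w\<close> and its tangent reversed
  for superdifferentials), which is supported near \<open>p\<close> at scale \<open>\<delta> / \<epsilon>\<close>.  Weighted averages of \<open>u\<close>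
  and \<open>f(u)\<close> then recover the slope \<open>(a, b)\<close>; Jensen's inequality gives \<open>a + f(b) \<le> 0\<close>.  For
  subdifferentials, Chebyshev's inequality \<open>(\<eta>(v) - \<eta>(b)) (f(v) - f(b)) \<le> (v - b) (q(v) - q(b))\<close>,
  the entropy inequality and strict convexity of \<open>\<eta>\<close> give \<open>a + f(b) \<ge> 0\<close>, the vanishing density of
  \<open>\<mu>\<close> making its contribution negligible.

  Hence every slope \<open>(p\<^sub>t, p\<^sub>x)\<close> of the inf-convolution of \<open>w\<close> satisfies \<open>p\<^sub>t + f(p\<^sub>x) = 0\<close>.  Mollifying this
  semiconcave function and using its one-sided bound on \<open>\<partial>\<^sub>x\<^sub>x\<close> yields all entropy inequalities in the
  limit.  Potentials on simply connected sets are glued from local ones via the Riemann mapping theorem.\<close>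

text \<open>The weights are the truncated functions \<open>pen\<close>; their squares are the test
  functions. The gradient of the square is \<open>2 * pen\<close> times that of the penalised
  function, and integrals of such gradients vanish, so the \<open>pen\<close>-average of the
  gradient of \<open>w\<close> is within \<open>2 * eps\<close> of the slope in each coordinate. The
  exponents explain the hypothesis on \<open>\<mu>\<close>: the test function is at most
  \<open>\<delta>\<^sup>2\<close>, it lives in a ball of radius proportional to
  \<open>\<delta> / eps\<close>, and the weight has mass at least a multiple of
  \<open>\<delta> ^ 3\<close>. A measure of order o(r) on that ball is small against this mass, and
  for each \<open>eps\<close> one good radius is enough, which is all that a lower limit provides.
  For the mollified slopes \<open>v\<close>, \<open>m\<close> of the inf-convolution, Jensen gives
  \<open>f v + m \<le> 0\<close>, while the x-derivative of \<open>v\<close> is at most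
  \<open>\<kappa>\<close>. These one-sided bounds fit together: the entropy production is controlled
  by \<open>\<kappa>\<close> times a residual that tends to zero. Since \<open>u\<close> is only
  bounded, derivatives are almost everywhere limits of difference quotients with steps
  \<open>1 / Suc n\<close>, and dominated convergence takes the place of the divergence
  theorem.\<close>

type_synonym plane = "real \<times> real"

section \<open>Difference quotients and almost everywhere derivatives of Lipschitz functions\<close>

definition dq :: "'a::euclidean_space => ('a => real) => nat => 'a => real" where
  "dq e g n z = real (Suc n) * (g (z + (1 / real (Suc n)) *\<^sub>R e) - g z)"

lemma AE_LIMSEQ_borel:
  fixes X :: "nat => 'a => real"
  assumes "!!n. X n \<in> borel_measurable M" "AE x in M. (%n. X n x) \<longlonglongrightarrow> G x"
  obtains G' where "G' \<in> borel_measurable M" "AE x in M. G x = G' x"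
proof
  show "(%x. lim (%n. X n x)) \<in> borel_measurable M"
    using assms(1) by (rule borel_measurable_lim_metric)
  show "AE x in M. G x = lim (%n. X n x)"
    using assms(2) by eventually_elim (simp add: limI)
qed

lemma dq_measurable:
  assumes [measurable]: "g \<in> borel_measurable borel"
  shows "dq e g n \<in> borel_measurable borel"
  unfolding dq_def by measurable

lemma lborel_integral_translate:
  fixes f :: "'a::euclidean_space => real"
  assumes f: "f \<in> borel_measurable borel"
  shows "(LBINT z. f (z + c)) = (LBINT z. f z)"
proof -
  have "(LBINT z. f z) = (\<integral>z. f z \<partial>(distr lborel borel ((+) c)))"
    by (simp add: lborel_distr_plus)
  also have "\<dots> = (LBINT z. f (c + z))"
    using f by (subst integral_distr) auto
  finally show ?thesis by (simp add: add.commute)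
qed

lemma norm_le_shift:
  fixes z e :: "'a::real_normed_vector"
  shows "norm z \<le> norm (z + (1 / real (Suc n)) *\<^sub>R e) + norm e"
proof -
  have "norm z \<le> norm (z + (1 / real (Suc n)) *\<^sub>R e) + norm ((1 / real (Suc n)) *\<^sub>R e)"
    using norm_triangle_ineq4[of "z + (1 / real (Suc n)) *\<^sub>R e" "(1 / real (Suc n)) *\<^sub>R e"] by simp
  also have "norm ((1 / real (Suc n)) *\<^sub>R e) \<le> norm e"
    using mult_right_mono[of "1 / real (Suc n)" 1 "norm e"] by simp
  finally show ?thesis by simp
qed

lemma integrable_bounded_support:
  fixes g :: "'a::euclidean_space => real"
  assumes "g \<in> borel_measurable borel" "!!z. \<bar>g z\<bar> \<le> B" "!!z. R < norm z ==> g z = 0"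
  shows "integrable lborel g"
proof (rule Bochner_Integration.integrable_bound)
  show "integrable lborel (%z. B * indicator (cball (0::'a) R) z)"
    using emeasure_compact_finite[of "cball (0::'a) R"] by (intro integrable_mult_right) (auto intro!: integrable_real_indicator)
  show "AE x in lborel. norm (g x) \<le> norm (B * indicator (cball 0 R) x)"
  proof (rule AE_I2)
    fix z :: 'a
    have "0 \<le> B" using assms(2)[of 0] by linarith
    then show "norm (g z) \<le> norm (B * indicator (cball 0 R) z)"
      using assms(2)[of z] assms(3)[of z] by (auto simp: indicator_def)
  qed
qed (use assms in auto)

text \<open>Every \<open>dq e g n\<close> has integral zero, since Lebesgue measure is translation
  invariant; the common bound \<open>C\<close> and a common bounded support allow dominated
  convergence. The quotients need to converge only along the steps \<open>1 / Suc n\<close> and only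
  almost everywhere, which is what Lipschitz functions offer.\<close>

lemma integral_derivative_zero:
  fixes g :: "'a::euclidean_space => real"
  assumes g [measurable]: "g \<in> borel_measurable borel" and B: "!!z. \<bar>g z\<bar> \<le> B"
    and supp: "!!z. R < norm z ==> g z = 0"
    and lip: "!!n z. \<bar>dq e g n z\<bar> \<le> C"
    and lim: "AE z in lborel. (%n. dq e g n z) \<longlonglongrightarrow> G z"
    and G [measurable]: "G \<in> borel_measurable borel"
  shows "integrable lborel G" "(LBINT z. G z) = 0"
proof -
  \<comment> \<open>The quotient looks at a point at distance at most \<open>norm e\<close>, which
    is why the dominating ball has radius \<open>R + norm e\<close>.\<close>
  define D where "D = (%z::'a. C * indicator (cball 0 (R + norm e)) z :: real)"
  have D: "integrable lborel D"
    unfolding D_def using emeasure_compact_finite[of "cball (0::'a) (R + norm e)"]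
    by (intro integrable_mult_right) (auto intro!: integrable_real_indicator)
  have bd: "norm (dq e g n z) \<le> D z" for n z
  proof (cases "norm z \<le> R + norm e")
    case True then show ?thesis using lip[of n z] by (simp add: D_def)
  next
    case False
    have "norm z \<le> norm (z + (1 / real (Suc n)) *\<^sub>R e) + norm e" by (rule norm_le_shift)
    moreover have "R < norm z" using False norm_ge_zero[of e] by linarith
    ultimately have "g (z + (1 / real (Suc n)) *\<^sub>R e) = 0" "g z = 0" using False supp by auto
    then show ?thesis using False by (simp add: dq_def D_def)
  qed
  have meas: "dq e g n \<in> borel_measurable lborel" for n using dq_measurable[OF g] by simp
  have lim': "AE z in lborel. (%n. dq e g n z) \<longlonglongrightarrow> G z" by (rule lim)
  show "integrable lborel G"
    by (rule integrable_dominated_convergence[OF _ meas D lim']) (use bd G in auto)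
  have "(%n. LBINT z. dq e g n z) \<longlonglongrightarrow> (LBINT z. G z)"
    by (rule integral_dominated_convergence[OF _ meas D lim']) (use bd G in auto)
  moreover have "(LBINT z. dq e g n z) = 0" for n
  proof -
    have ig: "integrable lborel g" by (rule integrable_bounded_support[OF g B supp])
    have ig2: "integrable lborel (%z. g (z + (1 / real (Suc n)) *\<^sub>R e))"
    proof (rule integrable_bounded_support[where R="R + norm e"])
      fix z :: 'a assume "R + norm e < norm z"
      moreover have "norm z \<le> norm (z + (1 / real (Suc n)) *\<^sub>R e) + norm e" by (rule norm_le_shift)
      ultimately show "g (z + (1 / real (Suc n)) *\<^sub>R e) = 0" by (intro supp) linarith
    qed (use B in auto)
    show ?thesis unfolding dq_def
      using lborel_integral_translate[OF g, of "(1 / real (Suc n)) *\<^sub>R e"] ig ig2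
      by simp
  qed
  ultimately show "(LBINT z. G z) = 0" by (simp add: LIMSEQ_const_iff)
qed

lemma dq_limit_real:
  fixes g :: "real => real"
  assumes "DERIV g x :> d"
  shows "(%n. dq 1 g n x) \<longlonglongrightarrow> d"
proof -
  have "((%h. (g (x + h) - g x) / h) \<longlongrightarrow> d) (at 0)"
    using assms by (simp add: DERIV_def)
  moreover have "filterlim (%n. 1 / real (Suc n)) (at 0) sequentially"
    by (simp add: filterlim_at lim_1_over_n) (use LIMSEQ_inverse_real_of_nat in \<open>simp add: inverse_eq_divide\<close>)
  ultimately have "(%n. (g (x + 1 / real (Suc n)) - g x) / (1 / real (Suc n))) \<longlonglongrightarrow> d"
    by (rule filterlim_compose[of _ _ "at 0"])
  then show ?thesis by (simp add: dq_def mult.commute)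
qed

lemma DERIV_transform_nhds:
  fixes f k :: "real => real"
  assumes "DERIV f x :> d" "\<forall>\<^sub>F y in nhds x. k y = f y"
  shows "DERIV k x :> d"
  using assms(1) DERIV_cong_ev[OF refl assms(2) refl] by simp

text \<open>Subtracting the chord of slope \<open>s\<close> and freezing the argument outside
  \<open>{a..b}\<close> turns \<open>g\<close> into a Lipschitz function \<open>k\<close> on the
  line that vanishes off the interval. Its derivative \<open>G - s\<close> has integral zero by
  \<open>integral_derivative_zero\<close>, which is the claim.\<close>

lemma lipschitz_real_integral_deriv:
  fixes g G :: "real => real"
  assumes ab: "a < b" and lip: "L-lipschitz_on {a..b} g"
    and der: "AE x in lborel. x \<in> {a<..<b} --> DERIV g x :> G x"
    and G [measurable]: "G \<in> borel_measurable borel"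
  shows "integrable lborel (%x. indicator {a..b} x * G x)"
    "(LBINT x. indicator {a..b} x * G x) = g b - g a"
proof -
  define s where "s = (g b - g a) / (b - a)"
  define k where "k = (%x. g (max a (min b x)) - g a - s * (max a (min b x) - a))"
  define R where "R = \<bar>a\<bar> + \<bar>b\<bar>"
  have L0: "0 \<le> L" using lip by (rule lipschitz_on_nonneg)
  have kl: "\<bar>k x - k y\<bar> \<le> (L + \<bar>s\<bar>) * \<bar>x - y\<bar>" for x y
  proof -
    let ?x = "max a (min b x)" and ?y = "max a (min b y)"
    have c: "\<bar>?x - ?y\<bar> \<le> \<bar>x - y\<bar>" by linarith
    have "?x \<in> {a..b}" "?y \<in> {a..b}" using ab by auto
    then have k1: "\<bar>g ?x - g ?y\<bar> \<le> L * \<bar>?x - ?y\<bar>"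
      using lipschitz_onD[OF lip] by (simp add: dist_real_def)
    have k2: "\<bar>s * (?x - a) - s * (?y - a)\<bar> = \<bar>s\<bar> * \<bar>?x - ?y\<bar>"
      by (simp add: abs_mult[symmetric] algebra_simps)
    have k3: "\<bar>k x - k y\<bar> \<le> \<bar>g ?x - g ?y\<bar> + \<bar>s * (?x - a) - s * (?y - a)\<bar>"
    proof -
      have e: "k x - k y = (g ?x - g ?y) - (s * (?x - a) - s * (?y - a))" by (simp add: k_def)
      show ?thesis unfolding e by (rule abs_triangle_ineq4)
    qed
    have "\<bar>k x - k y\<bar> \<le> L * \<bar>?x - ?y\<bar> + \<bar>s\<bar> * \<bar>?x - ?y\<bar>"
      by (rule order_trans[OF k3 add_mono[OF k1 eq_refl[OF k2]]])
    then have "\<bar>k x - k y\<bar> \<le> (L + \<bar>s\<bar>) * \<bar>?x - ?y\<bar>"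
      by (simp only: distrib_right)
    also have "\<dots> \<le> (L + \<bar>s\<bar>) * \<bar>x - y\<bar>" using c L0 by (intro mult_left_mono) auto
    finally show ?thesis .
  qed
  have "(L + \<bar>s\<bar>)-lipschitz_on UNIV k"
    by (rule lipschitz_onI) (use kl L0 in \<open>auto simp: dist_real_def\<close>)
  then have kc: "continuous_on UNIV k" by (rule lipschitz_on_continuous_on)
  have km: "k \<in> borel_measurable borel" by (rule borel_measurable_continuous_onI[OF kc])
  have k0: "k x = 0" if "x \<le> a \<or> b \<le> x" for x
    using that ab by (auto simp: k_def s_def max_def min_def)
  define K where "K = (%x. indicator {a<..<b} x * (G x - s))"
  have Km: "K \<in> borel_measurable borel" unfolding K_def by measurable
  have lim: "AE x in lborel. (%n. dq 1 k n x) \<longlonglongrightarrow> K x"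
  proof -
    have "AE x in lborel. x \<noteq> a" "AE x in lborel. x \<noteq> b"
      by (auto intro!: AE_lborel_singleton)
    with der show ?thesis
    proof eventually_elim
      case (elim x)
      note d = elim(1) and ne = elim(2-3)
      have "DERIV k x :> K x"
      proof (cases "x \<in> {a<..<b}")
        case True
        have "DERIV (%x. g x - g a - s * (x - a)) x :> G x - s"
          using d True by (auto intro!: derivative_eq_intros)
        moreover have "\<forall>\<^sub>F y in nhds x. k y = g y - g a - s * (y - a)"
          using True by (intro eventually_nhds[THEN iffD2] exI[of _ "{a<..<b}"]) (auto simp: k_def)
        ultimately have "DERIV k x :> G x - s"
          by (rule DERIV_transform_nhds)
        then show ?thesis using True by (simp add: K_def)
      next
        case False
        have "open (- {a..b})" by auto
        moreover have "x \<in> - {a..b}" using False ne by auto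
        moreover have "\<forall>y\<in>-{a..b}. k y = 0" using k0 by auto
        ultimately have "\<forall>\<^sub>F y in nhds x. k y = 0"
          by (intro eventually_nhds[THEN iffD2] exI[of _ "-{a..b}"]) auto
        then have "DERIV k x :> 0"
          by (rule DERIV_transform_nhds[rotated]) auto
        then show ?thesis using False by (simp add: K_def)
      qed
      then show ?case by (rule dq_limit_real)
    qed
  qed
  have kB: "\<bar>k x\<bar> \<le> (L + \<bar>s\<bar>) * (b - a)" for x
  proof (cases "x \<le> a \<or> b \<le> x")
    case True then show ?thesis using k0 L0 ab by auto
  next
    case False
    then have "\<bar>k x - k a\<bar> \<le> (L + \<bar>s\<bar>) * \<bar>x - a\<bar>" by (intro kl)
    also have "\<dots> \<le> (L + \<bar>s\<bar>) * (b - a)" using False L0 by (intro mult_left_mono) auto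
    finally show ?thesis using k0[of a] by simp
  qed
  have dqb: "\<bar>dq 1 k n x\<bar> \<le> L + \<bar>s\<bar>" for n x
  proof -
    have "\<bar>dq 1 k n x\<bar> = real (Suc n) * \<bar>k (x + 1 / real (Suc n)) - k x\<bar>"
      by (simp add: dq_def abs_mult)
    also have "\<dots> \<le> real (Suc n) * ((L + \<bar>s\<bar>) * \<bar>(x + 1 / real (Suc n)) - x\<bar>)"
      by (intro mult_left_mono kl) auto
    also have "\<dots> = L + \<bar>s\<bar>" by simp
    finally show ?thesis .
  qed
  have supp: "k x = 0" if "R < norm x" for x
    using that by (intro k0) (auto simp: R_def)
  have Z: "integrable lborel K" "(LBINT x. K x) = 0"
    by (rule integral_derivative_zero[OF km kB _ dqb lim Km, of R], use supp in auto)+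
  have I: "integrable lborel (%x. K x + s * indicator {a<..<b} x)"
    using Z(1) ab by (intro Bochner_Integration.integrable_add integrable_mult_right integrable_real_indicator) auto
  have ae: "AE x in lborel. indicator {a..b} x * G x = K x + s * indicator {a<..<b} x"
  proof -
    have "AE x in lborel. x \<noteq> a" "AE x in lborel. x \<noteq> b" by (auto intro!: AE_lborel_singleton)
    then show ?thesis by eventually_elim (auto simp: K_def indicator_def algebra_simps)
  qed
  show "integrable lborel (%x. indicator {a..b} x * G x)"
    by (rule integrable_cong_AE_imp[OF I]) (use ae in auto)
  have "(LBINT x. indicator {a..b} x * G x) = (LBINT x. K x + s * indicator {a<..<b} x)"
    by (rule integral_cong_AE) (use ae Km in auto)
  also have "\<dots> = 0 + s * (b - a)"
    using Z ab by (subst Bochner_Integration.integral_add) auto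
  finally show "(LBINT x. indicator {a..b} x * G x) = g b - g a" using ab by (simp add: s_def)
qed

text \<open>A pointwise choice of the derivative need not be measurable. It agrees almost everywhere
  with the limit of difference quotients of the clamped, continuous function \<open>k\<close>, and
  that limit has a Borel version.\<close>

lemma lipschitz_AE_deriv_borel:
  fixes g G :: "real => real"
  assumes lip: "L-lipschitz_on {a..b} g"
    and der: "AE x in lborel. x \<in> {a<..<b} --> DERIV g x :> G x"
  obtains G' where "G' \<in> borel_measurable borel" "AE x in lborel. x \<in> {a<..<b} --> G x = G' x"
proof -
  define k where "k = (%x. g (max a (min b x)))"
  have "continuous_on UNIV k" if "a < b"
  proof -
    have "continuous_on {a..b} g" using lip by (rule lipschitz_on_continuous_on)
    then show ?thesis unfolding k_def
      by (rule continuous_on_compose2) (use that in \<open>auto intro!: continuous_intros\<close>)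
  qed
  then have km: "k \<in> borel_measurable borel" if "a < b" using that by (simp add: borel_measurable_continuous_onI)
  show thesis
  proof (cases "a < b")
    case False
    then show thesis by (intro that[of "%_. 0"]) auto
  next
    case True
    have lim: "AE x in lborel. (%n. indicator {a<..<b} x * dq 1 k n x) \<longlonglongrightarrow> (if x \<in> {a<..<b} then G x else 0)"
      using der
    proof eventually_elim
      case (elim x)
      note d = elim
      show ?case
      proof (cases "x \<in> {a<..<b}")
        case x: True
        have "\<forall>\<^sub>F y in nhds x. k y = g y"
          using x by (intro eventually_nhds[THEN iffD2] exI[of _ "{a<..<b}"]) (auto simp: k_def)
        then have "DERIV k x :> G x"
          using d x DERIV_transform_nhds by metis
        then show ?thesis using x dq_limit_real by auto
      qed auto
    qed
    have meas: "(%x. indicator {a<..<b} x * dq 1 k n x) \<in> borel_measurable lborel" for n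
      using dq_measurable[OF km[OF True]] by (auto intro!: borel_measurable_times)
    obtain G' where G': "G' \<in> borel_measurable lborel"
        "AE x in lborel. (if x \<in> {a<..<b} then G x else 0) = G' x"
      by (rule AE_LIMSEQ_borel[OF meas lim])
    show thesis
      by (rule that[of G']) (use G' in auto)
  qed
qed

lemma lipschitz_AE_deriv_nonneg_mono:
  fixes g G :: "real => real"
  assumes ab: "a \<le> b" and lip: "L-lipschitz_on {a..b} g"
    and der: "AE x in lborel. x \<in> {a<..<b} --> (\<exists>d\<ge>0. DERIV g x :> d)"
  shows "g a \<le> g b"
proof (cases "a < b")
  case True
  define G where "G = (%x. SOME d. d \<ge> 0 \<and> DERIV g x :> d)"
  have der': "AE x in lborel. x \<in> {a<..<b} --> DERIV g x :> G x \<and> G x \<ge> 0"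
    using der by eventually_elim (auto simp: G_def intro: someI2)
  have d1: "AE x in lborel. x \<in> {a<..<b} --> DERIV g x :> G x"
    using der' by eventually_elim auto
  obtain G' where G': "G' \<in> borel_measurable borel" "AE x in lborel. x \<in> {a<..<b} --> G x = G' x"
    using lipschitz_AE_deriv_borel[OF lip d1] by blast
  have d2: "AE x in lborel. x \<in> {a<..<b} --> DERIV g x :> G' x"
    using d1 G'(2) by eventually_elim auto
  have "0 \<le> (LBINT x. indicator {a..b} x * G' x)"
  proof (rule integral_nonneg_AE)
    have "AE x in lborel. x \<noteq> a" "AE x in lborel. x \<noteq> b" by (auto intro!: AE_lborel_singleton)
    then show "AE x in lborel. 0 \<le> indicator {a..b} x * G' x"
      using der' G'(2) by eventually_elim (auto simp: indicator_def)
  qed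
  with lipschitz_real_integral_deriv(2)[OF True lip d2 G'(1)] show ?thesis by simp
qed (use ab in auto)

text \<open>\<open>E k\<close> collects the points where the difference quotient misses
  \<open>v x\<close> by at least \<open>1 / Suc k\<close> at arbitrarily small steps. The offending
  intervals form a Vitali cover of it; finitely many disjoint ones are a tagged partial division, on
  which the Henstock lemma bounds the sum of the errors and hence of the lengths.\<close>

lemma lebesgue_differentiation_real:
  fixes v :: "real => real"
  assumes v: "v integrable_on {a..b}"
  shows "negligible {x \<in> {a<..<b}. \<not> DERIV (%y. integral {a..y} v) x :> v x}"
proof -
  define F where "F = (%y. integral {a..y} v)"
  define bad where "bad = (%k x h. x \<in> {a<..<b} \<and> h \<noteq> 0 \<and> x + h \<in> {a..b} \<and> \<bar>F (x + h) - F x - h * v x\<bar> \<ge> \<bar>h\<bar> / real (Suc k))"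
  define E where "E = (%k. {x. \<forall>d>0. \<exists>h. \<bar>h\<bar> < d \<and> bad k x h})"
  have Fdiff: "integral {x..y} v = F y - F x" if "a \<le> x" "x \<le> y" "y \<le> b" for x y
  proof -
    have "v integrable_on {a..y}" using v by (rule integrable_on_subinterval) (use that in auto)
    from Henstock_Kurzweil_Integration.integral_combine[OF that(1,2) this] show ?thesis by (simp add: F_def)
  qed
  have neg: "negligible (E k)" for k
  proof (rule negligible_outer_le[THEN iffD2], intro allI impI)
    fix e :: real assume "e > 0"
    have vab: "v integrable_on cbox a b" using v by simp
    \<comment> \<open>An offending interval contributes at least its length over
      \<open>Suc k\<close> to the Henstock sum, so this tolerance bounds the total length by
      \<open>e\<close>.\<close>
    have e': "e / real (Suc k) > 0" using \<open>e > 0\<close> by simp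
    obtain \<gamma> where g: "gauge \<gamma>" and
      H: "!!p. p tagged_partial_division_of (cbox a b) ==> \<gamma> fine p ==>
             (\<Sum>(x,k)\<in>p. norm (measure lborel k *\<^sub>R v x - integral k v)) < e / real (Suc k)"
      using Henstock_lemma[OF vab e'] by blast
    \<comment> \<open>A pair \<open>(x, h)\<close> stands for the interval between \<open>x\<close>
      and \<open>x + h\<close>, written as the ball about its midpoint because the covering theorem
      is about balls. The tag \<open>x\<close> is an end point.\<close>
    define cc where "cc = (%(x::real,h::real). x + h / 2)"
    define rr where "rr = (%(x::real,h::real). \<bar>h\<bar> / 2)"
    define K where "K = {(x,h). bad k x h \<and> cball (x + h/2) (\<bar>h\<bar>/2) \<subseteq> \<gamma> x}"
    have seg: "cball (x + h/2) (\<bar>h\<bar>/2) = {min x (x+h)..max x (x+h)}" for x h :: real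
      by (auto simp: dist_real_def abs_if split: if_splits)
    obtain C where C: "countable C" "C \<subseteq> K"
      "pairwise (%i j. disjnt (cball (cc i) (rr i)) (cball (cc j) (rr j))) C"
      "negligible (E k - (\<Union>i \<in> C. cball (cc i) (rr i)))"
    proof (rule Vitali_covering_theorem_cballs[of K rr "E k" cc])
      fix i assume "i \<in> K" then show "0 < rr i" by (auto simp: K_def rr_def bad_def)
    next
      fix x d :: real assume x: "x \<in> E k" and d: "d > 0"
      have "open (\<gamma> x)" "x \<in> \<gamma> x" using g by (auto simp: gauge_def)
      then obtain r where r: "r > 0" "ball x r \<subseteq> \<gamma> x" by (rule openE)
      have "0 < min d r" using d r(1) by simp
      then obtain h where h: "\<bar>h\<bar> < min d r" "bad k x h" using x unfolding E_def by blast
      have "cball (x + h/2) (\<bar>h\<bar>/2) \<subseteq> ball x r"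
        unfolding seg using h(1) by (auto simp: dist_real_def)
      then have "(x,h) \<in> K" using r h by (auto simp: K_def)
      moreover have "x \<in> cball (cc (x,h)) (rr (x,h))" by (simp add: cc_def rr_def dist_real_def)
      moreover have "rr (x,h) < d" using h by (auto simp: rr_def)
      ultimately show "\<exists>i. i \<in> K \<and> x \<in> cball (cc i) (rr i) \<and> rr i < d" by blast
    qed
    have fin: "(\<Sum>i\<in>I. \<bar>snd i\<bar>) \<le> e" if I: "finite I" "I \<subseteq> C" for I
    proof -
      define m where "m = (%i. (fst i, cball (cc i) (rr i)))"
      have IK: "i \<in> K" if "i \<in> I" for i using that I C(2) by blast
      have ne: "cball (cc i) (rr i) \<noteq> {}" for i by (auto simp: rr_def split: prod.split)
      have inj: "inj_on m I"
      proof (rule inj_onI, rule ccontr)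
        fix i j assume ij: "i \<in> I" "j \<in> I" "m i = m j" "i \<noteq> j"
        then have "disjnt (cball (cc i) (rr i)) (cball (cc j) (rr j))"
          using C(3) I(2) by (auto simp: pairwise_def)
        then show False using ij(3) ne[of i] by (auto simp: m_def disjnt_def)
      qed
      have sub: "cball (cc i) (rr i) \<subseteq> cbox a b" if "i \<in> K" for i
        using that by (auto simp: K_def bad_def cc_def rr_def seg simp del: mem_cball)
      have tp: "(m ` I) tagged_partial_division_of (cbox a b)"
        unfolding tagged_partial_division_of_def
      proof (intro conjI allI impI)
        show "finite (m ` I)" using I by simp
        fix x k' assume "(x, k') \<in> m ` I"
        then obtain i where i: "i \<in> I" "x = fst i" "k' = cball (cc i) (rr i)" by (auto simp: m_def)
        show "x \<in> k'" unfolding i by (cases i) (simp add: cc_def rr_def dist_real_def)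
        show "k' \<subseteq> cbox a b" unfolding i using sub IK i by blast
        show "\<exists>a b. k' = cbox a b" unfolding i by (simp add: cball_eq_atLeastAtMost) blast
      next
        fix x k' x2 k2 assume A: "(x, k') \<in> m ` I \<and> (x2, k2) \<in> m ` I \<and> (x, k') \<noteq> (x2, k2)"
        then obtain i where i: "i \<in> I" "x = fst i" "k' = cball (cc i) (rr i)" by (auto simp: m_def)
        with A obtain j where j: "j \<in> I" "x2 = fst j" "k2 = cball (cc j) (rr j)" "i \<noteq> j"
          using i by (auto simp: m_def)
        have "disjnt (cball (cc i) (rr i)) (cball (cc j) (rr j))"
          using C(3) I(2) i j by (auto simp: pairwise_def)
        then show "interior k' \<inter> interior k2 = {}" unfolding i j
          using interior_subset by (fastforce simp: disjnt_def)
      qed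
      have fine: "\<gamma> fine (m ` I)"
        using IK by (fastforce simp: fine_def m_def K_def cc_def rr_def)
      have "(\<Sum>i\<in>I. \<bar>snd i\<bar> / real (Suc k)) \<le> (\<Sum>i\<in>I. norm (measure lborel (cball (cc i) (rr i)) *\<^sub>R v (fst i) - integral (cball (cc i) (rr i)) v))"
      proof (rule sum_mono)
        fix i assume "i \<in> I"
        then have "i \<in> K" by (rule IK)
        obtain x h where i: "i = (x,h)" by (cases i)
        have b: "bad k x h" using \<open>i \<in> K\<close> by (simp add: i K_def)
        show "\<bar>snd i\<bar> / real (Suc k) \<le> norm (measure lborel (cball (cc i) (rr i)) *\<^sub>R v (fst i) - integral (cball (cc i) (rr i)) v)"
        proof (cases "h > 0")
          case True
          have c: "cball (cc i) (rr i) = {x..x+h}" using True seg[of x h] by (simp add: i cc_def rr_def)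
          have "integral {x..x+h} v = F (x+h) - F x" using b True by (intro Fdiff) (auto simp: bad_def)
          moreover have "\<bar>h\<bar> / real (Suc k) \<le> \<bar>F (x + h) - F x - h * v x\<bar>" using b by (simp add: bad_def)
          moreover have "\<bar>F (x + h) - F x - h * v x\<bar> = \<bar>h * v x - (F (x + h) - F x)\<bar>" by linarith
          ultimately show ?thesis using True unfolding c by (simp add: i)
        next
          case False
          then have h: "h < 0" using b by (auto simp: bad_def)
          have "cball (cc i) (rr i) = {x+h..x}" using h seg[of x h] by (simp add: i cc_def rr_def)
          note c = this
          have "integral {x+h..x} v = F x - F (x+h)" using b h by (intro Fdiff) (auto simp: bad_def)
          moreover have "\<bar>h\<bar> / real (Suc k) \<le> \<bar>F (x + h) - F x - h * v x\<bar>" using b by (simp add: bad_def)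
          moreover have "\<bar>F (x + h) - F x - h * v x\<bar> = \<bar>- h * v x - (F x - F (x + h))\<bar>" by linarith
          ultimately show ?thesis using h unfolding c by (simp add: i)
        qed
      qed
      also have "\<dots> = (\<Sum>(x,k)\<in>m ` I. norm (measure lborel k *\<^sub>R v x - integral k v))"
        by (subst sum.reindex[OF inj]) (simp add: m_def)
      also have "\<dots> < e / real (Suc k)" by (rule H[OF tp fine])
      finally show ?thesis by (simp add: sum_divide_distrib[symmetric] divide_less_cancel split: if_splits)
    qed
    define T where "T = (\<Union>i \<in> C. cball (cc i) (rr i)) \<union> (E k - (\<Union>i \<in> C. cball (cc i) (rr i)))"
    have mfin: "measure lebesgue (\<Union>i\<in>I. cball (cc i) (rr i)) \<le> e" if I: "finite I" "I \<subseteq> C" for I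
    proof -
      have "measure lebesgue (\<Union>i\<in>I. cball (cc i) (rr i)) \<le> (\<Sum>i\<in>I. measure lebesgue (cball (cc i) (rr i)))"
        using I by (intro measure_UNION_le) auto
      also have "\<dots> = (\<Sum>i\<in>I. \<bar>snd i\<bar>)"
        by (rule sum.cong) (auto simp: cball_eq_atLeastAtMost rr_def split: prod.splits)
      finally show ?thesis using fin[OF I] by simp
    qed
    have U: "(\<Union>i \<in> C. cball (cc i) (rr i)) \<in> lmeasurable" "measure lebesgue (\<Union>i \<in> C. cball (cc i) (rr i)) \<le> e"
      by (rule fmeasurable_UN_bound[OF C(1)] measure_UN_bound[OF C(1)], simp, erule (1) mfin)+
    have N: "(E k - (\<Union>i \<in> C. cball (cc i) (rr i))) \<in> lmeasurable" "measure lebesgue (E k - (\<Union>i \<in> C. cball (cc i) (rr i))) = 0"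
      using C(4) by (auto simp: negligible_iff_measure)
    show "\<exists>T. E k \<subseteq> T \<and> T \<in> lmeasurable \<and> measure lebesgue T \<le> e"
    proof (intro exI conjI)
      show "E k \<subseteq> T" by (auto simp: T_def)
      show "T \<in> lmeasurable" unfolding T_def using U N by (intro fmeasurable.Un) auto
      show "measure lebesgue T \<le> e" unfolding T_def
        using measure_Un_le[of "\<Union>i \<in> C. cball (cc i) (rr i)" lebesgue "E k - (\<Union>i \<in> C. cball (cc i) (rr i))"] U N
        by (auto dest: fmeasurableD)
    qed
  qed
  have "{x \<in> {a<..<b}. \<not> DERIV F x :> v x} \<subseteq> (\<Union>k. E k)"
  proof safe
    fix x assume x: "x \<in> {a<..<b}" and nd: "\<not> DERIV F x :> v x"
    have "\<not> ((%h. (F (x + h) - F x) / h) \<longlongrightarrow> v x) (at 0)" using nd by (simp add: DERIV_def)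
    then obtain eps where ep0: "eps > 0" "\<not> (\<exists>d>0. \<forall>h. h \<noteq> 0 \<and> norm (h - 0) < d --> norm ((F (x + h) - F x) / h - v x) < eps)"
      unfolding LIM_eq by blast
    have ep: "\<exists>h. h \<noteq> 0 \<and> \<bar>h\<bar> < d \<and> eps \<le> \<bar>(F (x + h) - F x) / h - v x\<bar>" if "d > 0" for d
      using ep0(2) that by (force simp: not_less)
    obtain k where k: "1 / real (Suc k) < eps" using nat_approx_posE[OF ep0(1)] by blast
    have "x \<in> E k" unfolding E_def
    proof (safe)
      fix d :: real assume "d > 0"
      then obtain h where h: "h \<noteq> 0" "\<bar>h\<bar> < min d (min (x - a) (b - x))" "eps \<le> \<bar>(F (x + h) - F x) / h - v x\<bar>"
        using ep[of "min d (min (x - a) (b - x))"] x by auto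
      have "\<bar>F (x + h) - F x - h * v x\<bar> = \<bar>h\<bar> * \<bar>(F (x + h) - F x) / h - v x\<bar>"
      proof -
        have e: "F (x + h) - F x - h * v x = h * ((F (x + h) - F x) / h - v x)"
          using h(1) by (simp add: field_simps)
        show ?thesis unfolding e abs_mult by simp
      qed
      also have "\<dots> \<ge> \<bar>h\<bar> * (1 / real (Suc k))" using k h(3) by (intro mult_left_mono) auto
      finally have "bad k x h" using h x by (auto simp: bad_def)
      then show "\<exists>h. \<bar>h\<bar> < d \<and> bad k x h" using h by auto
    qed
    then show "x \<in> (\<Union>k. E k)" by blast
  qed
  moreover have "negligible (\<Union>k. E k)" using neg by (intro negligible_countable_Union) auto
  ultimately show ?thesis unfolding F_def using negligible_subset by blast
qed

section \<open>Smooth bump functions\<close>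

text \<open>The powers of \<open>inverse s\<close> make the family closed under differentiation:
  \<open>flat_exp_deriv\<close> expresses the derivative of member \<open>k\<close> through members
  \<open>k + 1\<close> and \<open>k + 2\<close>, also at the flat point 0.\<close>

definition flat_exp :: "nat => real => real" where
  "flat_exp k s = (if s \<le> 0 then 0 else exp (- inverse s) * inverse s ^ k)"

lemma flat_exp_deriv:
  "DERIV (flat_exp k) s :> flat_exp (k + 2) s - real k * flat_exp (k + 1) s"
proof -
  consider "s < 0" | "s = 0" | "s > 0" by linarith
  then show ?thesis
  proof cases
    case 1
    have "\<forall>\<^sub>F y in nhds s. flat_exp k y = 0"
      using 1 by (intro eventually_nhds[THEN iffD2] exI[of _ "{..<0}"]) (auto simp: flat_exp_def)
    then have "DERIV (flat_exp k) s :> 0"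
      by (rule DERIV_transform_nhds[rotated]) auto
    then show ?thesis using 1 by (simp add: flat_exp_def)
  next
    case 2
    have r: "((%h. flat_exp k h / h) \<longlongrightarrow> 0) (at_right 0)"
    proof -
      have "((%h. inverse h ^ (k + 1) / exp (inverse h)) \<longlongrightarrow> (0::real)) (at_right 0)"
        by (rule filterlim_compose[OF tendsto_power_div_exp_0 filterlim_inverse_at_top_right])
      then show ?thesis
        by (rule tendsto_cong[THEN iffD1, rotated])
           (auto simp: eventually_at_filter flat_exp_def exp_minus field_simps intro!: always_eventually)
    qed
    have l: "((%h. flat_exp k h / h) \<longlongrightarrow> 0) (at_left 0)"
      by (rule tendsto_eventually) (auto simp: eventually_at_filter flat_exp_def intro!: always_eventually)
    have "((%h. flat_exp k h / h) \<longlongrightarrow> 0) (at 0)"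
      using l r by (simp add: filterlim_split_at)
    then have "DERIV (flat_exp k) 0 :> 0"
      by (simp add: DERIV_def flat_exp_def)
    then show ?thesis using 2 by (simp add: flat_exp_def)
  next
    case 3
    have "((%s. exp (- inverse s) * inverse s ^ k) has_real_derivative
            flat_exp (k + 2) s - real k * flat_exp (k + 1) s) (at s)"
    proof (cases k)
      case 0 then show ?thesis using 3
        by (auto intro!: derivative_eq_intros simp: flat_exp_def power2_eq_square)
    next
      case (Suc m)
      have i: "DERIV inverse s :> - (inverse s * inverse s)"
        using DERIV_inverse'[OF DERIV_ident, of s UNIV] 3 by simp
      have "DERIV (%s. inverse s ^ Suc m) s :> (1 + real m) * (- (inverse s * inverse s) * inverse s ^ m)"
        by (rule DERIV_power_Suc[OF i])
      moreover have "DERIV (%s. exp (- inverse s)) s :> exp (- inverse s) * (inverse s * inverse s)"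
        using DERIV_chain2[OF DERIV_exp DERIV_minus[OF i]] by simp
      ultimately have "((%s. exp (- inverse s) * inverse s ^ Suc m) has_real_derivative
        exp (- inverse s) * (inverse s * inverse s) * inverse s ^ Suc m + (1 + real m) * (- (inverse s * inverse s) * inverse s ^ m) * exp (- inverse s)) (at s)"
        by (rule DERIV_mult[rotated])
      then show ?thesis using 3 Suc
        by (simp add: flat_exp_def algebra_simps power2_eq_square)
    qed
    moreover have "\<forall>\<^sub>F y in nhds s. flat_exp k y = exp (- inverse y) * inverse y ^ k"
      using 3 by (intro eventually_nhds[THEN iffD2] exI[of _ "{0<..}"]) (auto simp: flat_exp_def)
    ultimately show ?thesis by (rule DERIV_transform_nhds)
  qed
qed

text \<open>A class of smooth functions of one variable that visibly is closed under differentiation.\<close>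

inductive smooth1 :: "(real => real) => bool" where
  flat: "smooth1 (%s. flat_exp k (a * s + b))"
| const: "smooth1 (%s. c)"
| add: "smooth1 f ==> smooth1 g ==> smooth1 (%s. f s + g s)"
| mult: "smooth1 f ==> smooth1 g ==> smooth1 (%s. f s * g s)"

lemma smooth1_deriv:
  assumes "smooth1 f"
  shows "\<exists>f'. smooth1 f' \<and> (\<forall>s. DERIV f s :> f' s)"
  using assms
proof induction
  case (flat k a b)
  have "smooth1 (%s. a * (flat_exp (k + 2) (a * s + b) + (- real k) * flat_exp (k + 1) (a * s + b)))"
    by (intro smooth1.intros)
  moreover have "((%s. flat_exp k (a * s + b)) has_real_derivative
     a * (flat_exp (k + 2) (a * s + b) + (- real k) * flat_exp (k + 1) (a * s + b))) (at s)" for s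
  proof -
    have "DERIV (%s. a * s + b) s :> a" by (auto intro!: derivative_eq_intros)
    from DERIV_chain2[OF flat_exp_deriv this] show ?thesis by (simp add: algebra_simps)
  qed
  ultimately show ?case by blast
next
  case (const c)
  have "smooth1 (%s. 0)" by (rule smooth1.const)
  then show ?case by (intro exI[of _ "%s. 0"]) auto
next
  case (add f g)
  then obtain f' g' where *: "smooth1 f'" "smooth1 g'" "!!s. DERIV f s :> f' s"
    "!!s. DERIV g s :> g' s" by blast
  show ?case
    by (intro exI[of _ "%s. f' s + g' s"] conjI smooth1.add allI DERIV_add *)
next
  case (mult f g)
  then obtain f' g' where *: "smooth1 f'" "smooth1 g'" "!!s. DERIV f s :> f' s"
    "!!s. DERIV g s :> g' s" by blast
  show ?case
    by (intro exI[of _ "%s. f' s * g s + g' s * f s"] conjI smooth1.add smooth1.mult allI DERIV_mult *)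
       (use mult in auto)
qed

lemma smooth1_affine: "smooth1 f ==> smooth1 (%s. f (a * s + b))"
proof (induction rule: smooth1.induct)
  case (flat k c d)
  have "(%s. flat_exp k (c * (a * s + b) + d)) = (%s. flat_exp k ((c * a) * s + (c * b + d)))"
    by (simp add: algebra_simps)
  then show ?case using smooth1.flat[of k "c * a" "c * b + d"] by simp
qed (auto intro: smooth1.intros)

section \<open>Functions of two variables and their partial derivatives\<close>

definition has_partials ::
  "(plane => real) => (plane => real) => (plane => real) => bool" where
  "has_partials phi phit phix \<longleftrightarrow> (\<forall>t x. DERIV (%s. phi (s, x)) t :> phit (t, x)) \<and>
     (\<forall>t x. DERIV (%y. phi (t, y)) x :> phix (t, x))"

lemma has_partials_d:
  assumes "has_partials phi phit phix"
  shows "d_t phi = phit" "d_x phi = phix"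
  using assms by (auto simp: has_partials_def d_t_def d_x_def fun_eq_iff intro!: DERIV_imp_deriv)

lemma has_partials_differentiable:
  assumes p: "has_partials phi phit phix" and c: "continuous_on UNIV phix"
  shows "(phi has_derivative (%v. phit p * fst v + phix p * snd v)) (at p)"
proof -
  obtain t x where tx: "p = (t, x)" by (cases p)
  have "((%(s, y). phi (s, y)) has_derivative
      (%(a, b). (%a. phit (t, x) * a) a + blinfun_apply (blinfun_scaleR_left (phix (t, x))) b)) (at (t, x) within UNIV \<times> UNIV)"
  proof (rule has_derivative_partialsI[where fy = "%s y. blinfun_scaleR_left (phix (s, y))"])
    show "((%s. phi (s, x)) has_derivative (*) (phit (t, x))) (at t within UNIV)"
      using p by (simp add: has_partials_def has_field_derivative_def)
    show "((%y. phi (s, y)) has_derivative blinfun_apply (blinfun_scaleR_left (phix (s, y)))) (at y within UNIV)" for s y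
    proof -
      have "blinfun_apply (blinfun_scaleR_left (phix (s, y))) = (%h. phix (s, y) * h)"
        by (auto simp: fun_eq_iff mult.commute)
      then show ?thesis
        using p by (simp add: has_partials_def has_field_derivative_def)
    qed
    have "isCont phix (t, x)" using c by (simp add: continuous_on_eq_continuous_at)
    then have "isCont (%z. blinfun_scaleR_left (phix z)) (t, x)"
      by (intro continuous_intros)
    moreover have "(%(s, y). blinfun_scaleR_left (phix (s, y))) = (%z. blinfun_scaleR_left (phix z))" by auto
    ultimately show "continuous (at (t, x) within UNIV \<times> UNIV) (%(s, y). blinfun_scaleR_left (phix (s, y)) :: real \<Rightarrow>\<^sub>L real)"
      by simp
  qed auto
  moreover have "(%(s, y). phi (s, y)) = phi" by auto
  moreover have "(%(a, b). (%a. phit (t, x) * a) a + blinfun_apply (blinfun_scaleR_left (phix (t, x))) b) = (%v. phit p * fst v + phix p * snd v)"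
    by (auto simp: tx mult.commute fun_eq_iff)
  ultimately show ?thesis by (simp add: tx)
qed

text \<open>Products of one-variable functions are stable under both partial derivatives, which
  gives smoothness of all orders at little cost. Bounded support is asked of the product alone, so
  that the factors carry no side conditions.\<close>

definition bump_fun :: "(plane => real) => bool" where
  "bump_fun phi \<longleftrightarrow> (\<exists>f g. smooth1 f \<and> smooth1 g \<and> phi = (%z. f (fst z) * g (snd z))) \<and>
     (\<exists>R. \<forall>z. R < norm z --> phi z = 0)"

lemma bump_fun_partials:
  assumes "bump_fun phi"
  obtains phit phix where "bump_fun phit" "bump_fun phix" "has_partials phi phit phix"
proof -
  obtain f g R where fg: "smooth1 f" "smooth1 g" "phi = (%z. f (fst z) * g (snd z))"
    and R: "!!z. R < norm z ==> phi z = 0"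
    using assms unfolding bump_fun_def by blast
  obtain f' g' where *: "smooth1 f'" "smooth1 g'" "!!s. DERIV f s :> f' s"
    "!!s. DERIV g s :> g' s" using smooth1_deriv fg by metis
  have hp: "has_partials phi (%z. f' (fst z) * g (snd z)) (%z. f (fst z) * g' (snd z))"
    unfolding has_partials_def fg(3) by (auto intro!: derivative_eq_intros *)
  have op: "open {z::plane. R < norm z}" by (intro open_Collect_less continuous_intros)
  have z1: "f' (fst z) * g (snd z) = 0" if z: "R < norm z" for z
  proof -
    have c: "continuous_on UNIV (%s::real. (s, snd z))" by (intro continuous_intros)
    have "open ((%s::real. (s, snd z)) -` {z. R < norm z})" by (rule open_vimage[OF op c])
    then have "\<forall>\<^sub>F s in nhds (fst z). phi (s, snd z) = 0"
      using z R by (intro eventually_nhds[THEN iffD2] exI[of _ "(%s. (s, snd z)) -` {z. R < norm z}"]) auto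
    then have "DERIV (%s. phi (s, snd z)) (fst z) :> 0"
      by (rule DERIV_transform_nhds[rotated]) auto
    moreover have "DERIV (%s. phi (s, snd z)) (fst z) :> f' (fst z) * g (snd z)"
      using hp unfolding has_partials_def by (metis fst_conv snd_conv)
    ultimately show ?thesis using DERIV_unique by blast
  qed
  have z2: "f (fst z) * g' (snd z) = 0" if z: "R < norm z" for z
  proof -
    have c: "continuous_on UNIV (%s::real. (fst z, s))" by (intro continuous_intros)
    have "open ((%s::real. (fst z, s)) -` {z. R < norm z})" by (rule open_vimage[OF op c])
    then have "\<forall>\<^sub>F s in nhds (snd z). phi (fst z, s) = 0"
      using z R by (intro eventually_nhds[THEN iffD2] exI[of _ "(%s. (fst z, s)) -` {z. R < norm z}"]) auto
    then have "DERIV (%s. phi (fst z, s)) (snd z) :> 0"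
      by (rule DERIV_transform_nhds[rotated]) auto
    moreover have "DERIV (%s. phi (fst z, s)) (snd z) :> f (fst z) * g' (snd z)"
      using hp unfolding has_partials_def by (metis fst_conv snd_conv)
    ultimately show ?thesis using DERIV_unique by blast
  qed
  show thesis
  proof (rule that[OF _ _ hp])
    show "bump_fun (%z. f' (fst z) * g (snd z))" unfolding bump_fun_def using fg * z1 by blast
    show "bump_fun (%z. f (fst z) * g' (snd z))" unfolding bump_fun_def using fg * z2 by blast
  qed
qed

lemma smooth1_continuous: "smooth1 f ==> continuous_on UNIV f"
  using smooth1_deriv by (metis DERIV_continuous_on has_field_derivative_at_within)

lemma bump_fun_continuous:
  assumes "bump_fun phi" shows "continuous_on UNIV phi"
proof -
  obtain f g where fg: "smooth1 f" "smooth1 g" "phi = (%z. f (fst z) * g (snd z))"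
    using assms by (auto simp: bump_fun_def)
  show ?thesis unfolding fg(3)
    by (intro continuous_intros continuous_on_compose2[OF smooth1_continuous[OF fg(1)]]
         continuous_on_compose2[OF smooth1_continuous[OF fg(2)]]) auto
qed

lemma continuous_support_bounded:
  fixes phi :: "'a::euclidean_space => real"
  assumes "continuous_on UNIV phi" "!!z. R < norm z ==> phi z = 0"
  obtains C where "!!z. \<bar>phi z\<bar> \<le> C"
proof -
  have "compact (phi ` cball 0 R)"
    using assms(1) by (intro compact_continuous_image) (auto intro: continuous_on_subset)
  then have "bounded (phi ` cball 0 R)" by (rule compact_imp_bounded)
  then obtain C where C: "!!y. y \<in> phi ` cball 0 R ==> norm y \<le> C" by (auto simp: bounded_iff)
  show thesis
  proof
    fix z show "\<bar>phi z\<bar> \<le> \<bar>C\<bar>"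
      using C[of "phi z"] assms(2)[of z] by (cases "norm z \<le> R") auto
  qed
qed

lemma bump_fun_bounded:
  assumes "bump_fun phi"
  obtains C where "!!z. \<bar>phi z\<bar> \<le> C"
proof -
  obtain R where "!!z. R < norm z ==> phi z = 0" using assms by (auto simp: bump_fun_def)
  with bump_fun_continuous[OF assms] that show thesis using continuous_support_bounded by blast
qed

lemma real_deriv_bound:
  fixes f :: "real => real"
  assumes "!!s. DERIV f s :> f' s" "!!s. \<bar>f' s\<bar> \<le> C"
  shows "\<bar>f a - f b\<bar> \<le> C * \<bar>a - b\<bar>"
  using field_differentiable_bound[of UNIV f f' C a b] assms by auto

lemma has_partials_lipschitz:
  assumes p: "has_partials phi phit phix" and b: "!!z. \<bar>phit z\<bar> \<le> C" "!!z. \<bar>phix z\<bar> \<le> C"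
  shows "\<bar>phi z - phi z'\<bar> \<le> 2 * C * norm (z - z')"
proof -
  obtain t x t' x' where z: "z = (t, x)" "z' = (t', x')" by (cases z, cases z')
  have "\<bar>phi (t, x) - phi (t', x)\<bar> \<le> C * \<bar>t - t'\<bar>"
    using p b by (intro real_deriv_bound[where f="%s. phi (s, x)" and f'="%s. phit (s, x)"]) (auto simp: has_partials_def)
  moreover have "\<bar>phi (t', x) - phi (t', x')\<bar> \<le> C * \<bar>x - x'\<bar>"
    using p b by (intro real_deriv_bound[where f="%s. phi (t', s)" and f'="%s. phix (t', s)"]) (auto simp: has_partials_def)
  moreover have C0: "0 \<le> C" using b(1)[of 0] by linarith
  moreover have "\<bar>t - t'\<bar> \<le> norm (z - z')" "\<bar>x - x'\<bar> \<le> norm (z - z')"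
    using norm_fst_le[of "t - t'" "x - x'"] norm_snd_le[of "x - x'" "t - t'"] by (auto simp: z)
  then have "C * \<bar>t - t'\<bar> \<le> C * norm (z - z')" "C * \<bar>x - x'\<bar> \<le> C * norm (z - z')"
    using C0 by (auto intro: mult_left_mono)
  ultimately show ?thesis unfolding z by linarith
qed

section \<open>Convolution\<close>

definition conv :: "('a::euclidean_space => real) => ('a => real) => 'a => real" where
  "conv G phi z = (LBINT y. G y * phi (z - y))"

lemma has_derivative_integral_real:
  fixes k k' :: "real => 'a => real"
  assumes G: "integrable M G"
    and m [measurable]: "!!s. k s \<in> borel_measurable M" "!!s. k' s \<in> borel_measurable M"
    and der: "!!s y. DERIV (%s. k s y) s :> k' s y"
    and bk: "!!s y. \<bar>k s y\<bar> \<le> B" and bk': "!!s y. \<bar>k' s y\<bar> \<le> C"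
  shows "DERIV (%s. \<integral>y. G y * k s y \<partial>M) s :> (\<integral>y. G y * k' s y \<partial>M)"
proof -
  have Gm [measurable]: "G \<in> borel_measurable M" using G by auto
  have int: "integrable M (%y. G y * k s y)" for s
  proof (rule Bochner_Integration.integrable_bound[of _ "%y. B * \<bar>G y\<bar>"])
    show "AE y in M. norm (G y * k s y) \<le> norm (B * \<bar>G y\<bar>)"
    proof (rule AE_I2)
      fix y show "norm (G y * k s y) \<le> norm (B * \<bar>G y\<bar>)"
        using mult_left_mono[OF bk[of s y], of "\<bar>G y\<bar>"] bk[of s y] by (simp add: abs_mult mult.commute)
    qed
  qed (use G in auto)
  have "((%h. ((\<integral>y. G y * k (s + h) y \<partial>M) - (\<integral>y. G y * k s y \<partial>M)) / h) \<longlongrightarrow> (\<integral>y. G y * k' s y \<partial>M)) (at 0)"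
    unfolding tendsto_at_iff_sequentially
  proof (intro allI impI)
    fix X :: "nat => real" assume X: "\<forall>i. X i \<in> UNIV - {0}" "X \<longlonglongrightarrow> 0"
    have eq: "((\<integral>y. G y * k (s + X n) y \<partial>M) - (\<integral>y. G y * k s y \<partial>M)) / X n
       = (\<integral>y. G y * ((k (s + X n) y - k s y) / X n) \<partial>M)" for n
    proof -
      have "(\<integral>y. G y * k (s + X n) y \<partial>M) - (\<integral>y. G y * k s y \<partial>M) = (\<integral>y. G y * k (s + X n) y - G y * k s y \<partial>M)"
        using int by simp
      then show ?thesis by (simp add: right_diff_distrib[symmetric])
    qed
    have "(%n. \<integral>y. G y * ((k (s + X n) y - k s y) / X n) \<partial>M) \<longlonglongrightarrow> (\<integral>y. G y * k' s y \<partial>M)"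
    proof (rule integral_dominated_convergence[where w="%y. C * \<bar>G y\<bar>"])
      show "AE y in M. (%n. G y * ((k (s + X n) y - k s y) / X n)) \<longlonglongrightarrow> G y * k' s y"
      proof (rule AE_I2)
        fix y
        have "((%h. (k (s + h) y - k s y) / h) \<longlongrightarrow> k' s y) (at 0)" using der by (simp add: DERIV_def)
        then have "(%n. (k (s + X n) y - k s y) / X n) \<longlonglongrightarrow> k' s y"
          unfolding tendsto_at_iff_sequentially using X by (auto simp: o_def)
        then show "(%n. G y * ((k (s + X n) y - k s y) / X n)) \<longlonglongrightarrow> G y * k' s y"
          by (intro tendsto_intros)
      qed
      show "AE y in M. norm (G y * ((k (s + X n) y - k s y) / X n)) \<le> C * \<bar>G y\<bar>" for n
      proof (rule AE_I2)
        fix y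
        have "\<bar>k (s + X n) y - k s y\<bar> \<le> C * \<bar>s + X n - s\<bar>"
          by (rule real_deriv_bound[OF der bk'])
        then have "\<bar>(k (s + X n) y - k s y) / X n\<bar> \<le> C"
          using X(1) by (simp add: divide_le_eq)
        then show "norm (G y * ((k (s + X n) y - k s y) / X n)) \<le> C * \<bar>G y\<bar>"
          using mult_left_mono[of "\<bar>(k (s + X n) y - k s y) / X n\<bar>" C "\<bar>G y\<bar>"] by (simp add: abs_mult mult.commute)
      qed
    qed (use G in auto)
    then show "((%h. ((\<integral>y. G y * k (s + h) y \<partial>M) - (\<integral>y. G y * k s y \<partial>M)) / h) \<circ> X) \<longlonglongrightarrow> (\<integral>y. G y * k' s y \<partial>M)"
      unfolding o_def eq .
  qed
  then show ?thesis by (simp add: DERIV_def)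
qed

lemma conv_continuous:
  fixes G phi :: "'a::euclidean_space => real"
  assumes G: "integrable lborel G" and c: "continuous_on UNIV phi" and b: "!!z. \<bar>phi z\<bar> \<le> C"
  shows "continuous_on UNIV (conv G phi)"
  unfolding continuous_on_sequentially
proof (intro allI ballI impI)
  fix X :: "nat => 'a" and a assume X: "(\<forall>n. X n \<in> UNIV) \<and> X \<longlonglongrightarrow> a"
  have pm [measurable]: "phi \<in> borel_measurable borel" using c by (rule borel_measurable_continuous_onI)
  have Gm [measurable]: "G \<in> borel_measurable borel" using G by auto
  show "(conv G phi \<circ> X) \<longlonglongrightarrow> conv G phi a"
    unfolding o_def conv_def
  proof (rule integral_dominated_convergence[where w="%y. C * \<bar>G y\<bar>"])
    show "AE y in lborel. (%n. G y * phi (X n - y)) \<longlonglongrightarrow> G y * phi (a - y)"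
    proof (rule AE_I2)
      fix y
      have "isCont phi (a - y)" using c by (simp add: continuous_on_eq_continuous_at)
      moreover have "(%n. X n - y) \<longlonglongrightarrow> a - y" using X by (intro tendsto_intros) auto
      ultimately have "(%n. phi (X n - y)) \<longlonglongrightarrow> phi (a - y)" by (rule isCont_tendsto_compose)
      then show "(%n. G y * phi (X n - y)) \<longlonglongrightarrow> G y * phi (a - y)" by (intro tendsto_intros)
    qed
    show "AE y in lborel. norm (G y * phi (X n - y)) \<le> C * \<bar>G y\<bar>" for n
    proof (rule AE_I2)
      fix y show "norm (G y * phi (X n - y)) \<le> C * \<bar>G y\<bar>"
        using mult_left_mono[OF b[of "X n - y"], of "\<bar>G y\<bar>"] by (simp add: abs_mult mult.commute)
    qed
  qed (use G in auto)
qed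

lemma conv_partials:
  assumes G: "integrable lborel G" and p: "has_partials phi phit phix"
    and c: "continuous_on UNIV phi" "continuous_on UNIV phit" "continuous_on UNIV phix"
    and b: "!!z. \<bar>phi z\<bar> \<le> C" "!!z. \<bar>phit z\<bar> \<le> C" "!!z. \<bar>phix z\<bar> \<le> C"
  shows "has_partials (conv G phi) (conv G phit) (conv G phix)"
proof -
  have m [measurable]: "phi \<in> borel_measurable borel" "phit \<in> borel_measurable borel" "phix \<in> borel_measurable borel"
    using c by (auto intro: borel_measurable_continuous_onI)
  have "DERIV (%s. conv G phi (s, x)) t :> conv G phit (t, x)" for t x
    unfolding conv_def
  proof (rule has_derivative_integral_real[where B=C and C=C])
    fix s y
    have "DERIV (%s. phi (s, x - snd y)) (s - fst y) :> phit (s - fst y, x - snd y)"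
      using p by (simp add: has_partials_def)
    then have "DERIV (%s. phi (s - fst y, x - snd y)) s :> phit (s - fst y, x - snd y) * (1 - 0)"
      by (rule DERIV_chain2) (auto intro!: derivative_eq_intros)
    then show "DERIV (%s. phi ((s, x) - y)) s :> phit ((s, x) - y)"
      by (cases y) simp
  qed (use G b in auto)
  moreover have "DERIV (%y. conv G phi (t, y)) x :> conv G phix (t, x)" for t x
    unfolding conv_def
  proof (rule has_derivative_integral_real[where B=C and C=C])
    fix s y
    have "DERIV (%s. phi (t - fst y, s)) (s - snd y) :> phix (t - fst y, s - snd y)"
      using p by (simp add: has_partials_def)
    then have "DERIV (%s. phi (t - fst y, s - snd y)) s :> phix (t - fst y, s - snd y) * (1 - 0)"
      by (rule DERIV_chain2) (auto intro!: derivative_eq_intros)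
    then show "DERIV (%s. phi ((t, s) - y)) s :> phix ((t, s) - y)"
      by (cases y) simp
  qed (use G b in auto)
  ultimately show ?thesis by (simp add: has_partials_def)
qed

lemma conv_bump_partials:
  assumes G: "integrable lborel G" and "bump_fun phi"
  obtains phit phix where "bump_fun phit" "bump_fun phix" "has_partials phi phit phix"
    "has_partials (conv G phi) (conv G phit) (conv G phix)"
proof -
  obtain phit phix where p: "bump_fun phit" "bump_fun phix" "has_partials phi phit phix"
    using bump_fun_partials[OF assms(2)] .
  obtain C1 C2 C3 where C: "!!z. \<bar>phi z\<bar> \<le> C1" "!!z. \<bar>phit z\<bar> \<le> C2" "!!z. \<bar>phix z\<bar> \<le> C3"
    using bump_fun_bounded assms(2) p(1,2) by metis
  have "has_partials (conv G phi) (conv G phit) (conv G phix)"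
    by (rule conv_partials[OF G p(3), of "max C1 (max C2 C3)"])
       (use bump_fun_continuous assms p C in \<open>auto simp: le_max_iff_disj\<close>)
  with p that show thesis by blast
qed

lemma conv_bump_continuous:
  assumes G: "integrable lborel G" and "bump_fun phi"
  shows "continuous_on UNIV (conv G phi)"
  using conv_continuous[OF G bump_fun_continuous] bump_fun_bounded assms(2) by metis

text \<open>\<open>C_k_on\<close> recurses through \<open>d_t\<close> and \<open>d_x\<close>; a
  class of differentiable functions that both operators preserve is therefore smooth to every order,
  without any formula for higher derivatives.\<close>

lemma C_k_on_coinduct:
  assumes "S phi"
    and "!!phi. S phi ==> (\<forall>p. phi differentiable (at p)) \<and> S (d_t phi) \<and> S (d_x phi)"
  shows "C_k_on k UNIV phi"
  using assms(1)
proof (induction k arbitrary: phi)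
  case 0
  have "\<forall>p. isCont phi p" using assms(2)[OF 0] differentiable_imp_continuous_within by blast
  then show ?case by (simp add: continuous_on_eq_continuous_at)
next
  case (Suc k)
  then show ?case using assms(2)[OF Suc.prems] by simp
qed

lemma conv_bump_smooth:
  assumes G: "integrable lborel G" and "bump_fun phi"
  shows "C_k_on k UNIV (conv G phi)"
proof (rule C_k_on_coinduct[where S="%psi. \<exists>phi. bump_fun phi \<and> psi = conv G phi"])
  fix psi assume "\<exists>phi. bump_fun phi \<and> psi = conv G phi"
  then obtain phi where f: "bump_fun phi" "psi = conv G phi" by blast
  obtain phit phix where p: "bump_fun phit" "bump_fun phix" "has_partials (conv G phi) (conv G phit) (conv G phix)"
    using conv_bump_partials[OF G f(1)] .
  show "(\<forall>p. psi differentiable at p) \<and> (\<exists>phi. bump_fun phi \<and> d_t psi = conv G phi) \<and> (\<exists>phi. bump_fun phi \<and> d_x psi = conv G phi)"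
    using has_partials_differentiable[OF p(3) conv_bump_continuous[OF G p(2)]] has_partials_d[OF p(3)] p(1,2)
    unfolding f(2) differentiable_def by blast
qed (use assms in blast)

lemma bump_smooth:
  assumes "bump_fun phi"
  shows "C_k_on k UNIV phi"
proof (rule C_k_on_coinduct[where S=bump_fun])
  fix psi assume "bump_fun psi"
  then obtain phit phix where p: "bump_fun phit" "bump_fun phix" "has_partials psi phit phix"
    by (rule bump_fun_partials)
  show "(\<forall>p. psi differentiable at p) \<and> bump_fun (d_t psi) \<and> bump_fun (d_x psi)"
    using has_partials_differentiable[OF p(3) bump_fun_continuous[OF p(2)]] has_partials_d[OF p(3)] p(1,2)
    unfolding differentiable_def by metis
qed (rule assms)

section \<open>The mollifier\<close>

lemma integral_ge_on_ball:
  fixes g :: "'a::euclidean_space => real"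
  assumes g: "integrable lborel g" "!!z. 0 \<le> g z" and c: "!!z. z \<in> ball a r ==> c \<le> g z"
  shows "c * measure lborel (ball a r) \<le> (LBINT z. g z)"
proof -
  have i: "integrable lborel (%z. c * indicator (ball a r) z)"
    using emeasure_bounded_finite[of "ball a r"] by (intro integrable_mult_right integrable_real_indicator) auto
  have "(LBINT z. c * indicator (ball a r) z) \<le> (LBINT z. g z)"
    by (rule integral_mono[OF i g(1)]) (use g(2) c in \<open>auto simp: indicator_def\<close>)
  then show ?thesis by simp
qed

text \<open>The half-width 1/2 is chosen for the product at scale \<open>h\<close>: where
  \<open>bump2 h\<close> is nonzero, both coordinates are below \<open>h / 2\<close> in modulus, so
  the point lies in the open ball of radius \<open>h\<close>.\<close>

definition bump0 :: "real => real" where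
  "bump0 s = flat_exp 0 (1 * s + 1/2) * flat_exp 0 ((-1) * s + 1/2)"

lemma bump0_smooth: "smooth1 bump0"
proof -
  have "bump0 = (%s. flat_exp 0 (1 * s + 1/2) * flat_exp 0 ((-1) * s + 1/2))" by (simp add: bump0_def fun_eq_iff)
  moreover have "smooth1 (%s. flat_exp 0 (1 * s + 1/2) * flat_exp 0 ((-1) * s + 1/2))"
    by (intro smooth1.mult smooth1.flat)
  ultimately show ?thesis by simp
qed

lemma bump0_nonneg: "0 \<le> bump0 s" by (simp add: bump0_def flat_exp_def)

lemma bump0_zero: "1/2 \<le> \<bar>s\<bar> ==> bump0 s = 0" by (auto simp: bump0_def flat_exp_def)

lemma bump0_0: "0 < bump0 0" by (simp add: bump0_def flat_exp_def)

definition bump2 :: "real => plane => real" where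
  "bump2 h z = bump0 (fst z / h) * bump0 (snd z / h)"

definition moll :: "real => plane => real" where
  "moll h z = bump2 h z / (LBINT y. bump2 h y)"

lemma bump2_zero:
  assumes "h > 0" "h \<le> norm z" shows "bump2 h z = 0"
proof (rule ccontr)
  assume "bump2 h z \<noteq> 0"
  then have "\<bar>fst z / h\<bar> < 1/2" "\<bar>snd z / h\<bar> < 1/2"
    using bump0_zero[of "fst z / h"] bump0_zero[of "snd z / h"] by (force simp: bump2_def)+
  then have "\<bar>fst z\<bar> < h/2" "\<bar>snd z\<bar> < h/2" using assms(1) by (auto simp: field_simps)
  moreover have "norm z \<le> \<bar>fst z\<bar> + \<bar>snd z\<bar>" using norm_Pair_le[of "fst z" "snd z"] by simp
  ultimately show False using assms(2) by linarith
qed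

lemma smooth1_div: "smooth1 f ==> smooth1 (%s. f (s / h))"
  using smooth1_affine[of f "1/h" 0] by simp

lemma bump2_bump_fun:
  assumes "h > 0" shows "bump_fun (bump2 h)"
  unfolding bump_fun_def
proof (intro conjI exI allI impI)
  show "smooth1 (%s. bump0 (s / h))" "smooth1 (%s. bump0 (s / h))" using smooth1_div[OF bump0_smooth] by auto
  show "bump2 h = (%z. bump0 (fst z / h) * bump0 (snd z / h))" by (simp add: bump2_def fun_eq_iff)
  show "h < norm z ==> bump2 h z = 0" for z using bump2_zero assms by simp
qed

lemma bump2_nonneg: "0 \<le> bump2 h z" by (simp add: bump2_def bump0_nonneg)

lemma bump_fun_integrable: "bump_fun phi ==> integrable lborel phi"
proof -
  assume b: "bump_fun phi"
  obtain C where C: "!!z. \<bar>phi z\<bar> \<le> C" using bump_fun_bounded[OF b] by blast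
  obtain R where R: "!!z. R < norm z ==> phi z = 0" using b unfolding bump_fun_def by blast
  show ?thesis
    by (rule integrable_bounded_support[OF borel_measurable_continuous_onI[OF bump_fun_continuous[OF b]] C R])
qed

lemma bump2_integral_pos:
  assumes h: "h > 0" shows "0 < (LBINT y. bump2 h y)"
proof -
  have c: "isCont (bump2 h) 0"
    using bump_fun_continuous[OF bump2_bump_fun[OF h]] continuous_on_eq_continuous_at[OF open_UNIV] by blast
  have p: "0 < bump2 h 0" using bump0_0 by (simp add: bump2_def)
  have "\<forall>\<^sub>F z in nhds 0. bump2 h 0 / 2 < bump2 h z"
    using c p by (intro order_tendstoD) (auto simp: isCont_def tendsto_nhds_iff)
  then obtain r where r: "r > 0" "!!z. dist z 0 < r ==> bump2 h 0 / 2 < bump2 h z"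
    by (auto simp: eventually_nhds_metric)
  have "bump2 h 0 / 2 * measure lborel (ball (0::plane) r) \<le> (LBINT y. bump2 h y)"
    by (rule integral_ge_on_ball[OF bump_fun_integrable[OF bump2_bump_fun[OF h]] bump2_nonneg])
       (use r(2) in \<open>auto simp: dist_commute less_imp_le\<close>)
  moreover have "0 < measure lborel (ball (0::plane) r)" using r(1) content_ball_pos by blast
  ultimately show ?thesis using p by (smt (verit) half_gt_zero mult_pos_pos)
qed

lemma moll_bump_fun: assumes "h > 0" shows "bump_fun (moll h)"
proof -
  define I where "I = (LBINT y. bump2 h y)"
  have "moll h = (%z. (bump0 (fst z / h) * (1 / I)) * bump0 (snd z / h))"
    by (simp add: moll_def bump2_def I_def fun_eq_iff)
  moreover have "smooth1 (%s. bump0 (s / h) * (1 / I))" "smooth1 (%s. bump0 (s / h))"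
    using smooth1_div[OF bump0_smooth] smooth1.mult[OF smooth1_div[OF bump0_smooth] smooth1.const] by blast+
  moreover have "\<exists>R. \<forall>z. R < norm z --> moll h z = 0"
    using bump2_zero[OF assms] by (intro exI[of _ h]) (auto simp: moll_def)
  ultimately show ?thesis unfolding bump_fun_def by blast
qed

lemma moll_nonneg: "h > 0 ==> 0 \<le> moll h z"
  using bump2_integral_pos[of h] bump2_nonneg[of h z] by (simp add: moll_def)

lemma moll_zero: "h > 0 ==> h \<le> norm z ==> moll h z = 0"
  by (simp add: moll_def bump2_zero)

lemma moll_integral: "h > 0 ==> (LBINT z. moll h z) = 1"
  using bump2_integral_pos[of h] by (simp add: moll_def)

lemma bump_fun_reflect:
  assumes "bump_fun phi" shows "bump_fun (%y. phi (z - y))"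
proof -
  obtain f g R where fg: "smooth1 f" "smooth1 g" "phi = (%z. f (fst z) * g (snd z))"
    and R: "!!z. R < norm z ==> phi z = 0"
    using assms unfolding bump_fun_def by blast
  have "smooth1 (%s. f (-1 * s + fst z))" "smooth1 (%s. g (-1 * s + snd z))"
    using smooth1_affine[OF fg(1)] smooth1_affine[OF fg(2)] by blast+
  moreover have "(%y. phi (z - y)) = (%y. f (-1 * fst y + fst z) * g (-1 * snd y + snd z))"
    by (simp add: fg(3))
  moreover have "phi (z - y) = 0" if "R + norm z < norm y" for y
    using that norm_triangle_ineq2[of y z] by (intro R) (simp add: norm_minus_commute)
  ultimately show ?thesis unfolding bump_fun_def by blast
qed

lemma has_partials_reflect:
  assumes "has_partials phi phit phix"
  shows "has_partials (%y. phi (z - y)) (%y. - phit (z - y)) (%y. - phix (z - y))"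
  unfolding has_partials_def
proof (intro conjI allI)
  fix t x
  have "DERIV (%s. phi (s, snd z - x)) (fst z - t) :> phit (fst z - t, snd z - x)"
    using assms by (simp add: has_partials_def)
  then have "DERIV (%s. phi (fst z - s, snd z - x)) t :> phit (fst z - t, snd z - x) * (0 - 1)"
    by (rule DERIV_chain2) (auto intro!: derivative_eq_intros)
  then show "DERIV (%s. phi (z - (s, x))) t :> - phit (z - (t, x))" by (cases z) simp
  have "DERIV (%s. phi (fst z - t, s)) (snd z - x) :> phix (fst z - t, snd z - x)"
    using assms by (simp add: has_partials_def)
  then have "DERIV (%s. phi (fst z - t, snd z - s)) x :> phix (fst z - t, snd z - x) * (0 - 1)"
    by (rule DERIV_chain2) (auto intro!: derivative_eq_intros)
  then show "DERIV (%s. phi (z - (t, s))) x :> - phix (z - (t, x))" by (cases z) simp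
qed

lemma lborel_integral_reflect:
  fixes f :: "'a::euclidean_space => real"
  assumes f [measurable]: "f \<in> borel_measurable borel"
  shows "(LBINT y. f (z - y)) = (LBINT y. f y)"
proof -
  have d: "lborel = distr lborel borel (%x::'a. z - x)"
    using lborel_affine[of "-1" z] by (simp add: density_1)
  have "(LBINT y. f y) = (\<integral>y. f y \<partial>distr lborel borel (%x::'a. z - x))"
    using d by simp
  also have "\<dots> = (LBINT y. f (z - y))" by (subst integral_distr) auto
  finally show ?thesis by simp
qed

lemma lborel_nn_integral_translate:
  fixes f :: "'a::euclidean_space => ennreal"
  assumes f [measurable]: "f \<in> borel_measurable borel"
  shows "(\<integral>\<^sup>+z. f (z - y) \<partial>lborel) = (\<integral>\<^sup>+z. f z \<partial>lborel)"
proof -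
  have "(\<integral>\<^sup>+z. f z \<partial>lborel) = (\<integral>\<^sup>+z. f z \<partial>distr lborel borel ((+) (-y)))"
    by (simp add: lborel_distr_plus)
  also have "\<dots> = (\<integral>\<^sup>+z. f (- y + z) \<partial>lborel)" by (subst nn_integral_distr) auto
  finally show ?thesis by simp
qed

lemma conv_flip:
  fixes G phi :: "'a::euclidean_space => real"
  assumes [measurable]: "G \<in> borel_measurable borel" "phi \<in> borel_measurable borel"
  shows "conv G phi z = (LBINT y. G (z - y) * phi y)"
  unfolding conv_def using lborel_integral_reflect[of "%y. G y * phi (z - y)" z] by simp

lemma moll_measurable [measurable]: "h > 0 ==> moll h \<in> borel_measurable borel"
  using bump_fun_continuous[OF moll_bump_fun] by (rule borel_measurable_continuous_onI)

lemma moll_integrable: "h > 0 ==> integrable lborel (moll h)"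
  by (rule bump_fun_integrable[OF moll_bump_fun])

lemma integrable_mult_bounded:
  fixes G phi :: "'a => real"
  assumes "integrable M G" "phi \<in> borel_measurable M" "!!z. \<bar>phi z\<bar> \<le> C"
  shows "integrable M (%y. G y * phi y)"
proof (rule Bochner_Integration.integrable_bound[of _ "%y. C * \<bar>G y\<bar>"])
  show "AE y in M. norm (G y * phi y) \<le> norm (C * \<bar>G y\<bar>)"
  proof (rule AE_I2)
    fix y show "norm (G y * phi y) \<le> norm (C * \<bar>G y\<bar>)"
      using mult_left_mono[OF assms(3)[of y], of "\<bar>G y\<bar>"] assms(3)[of y] by (simp add: abs_mult mult.commute)
  qed
qed (use assms in auto)

text \<open>Tonelli's theorem, with the translated kernel having total mass one. Contraction in L1
  is what allows \<open>conv_mo_L1\<close> to discard the part of a function that is not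
  continuous.\<close>

lemma conv_moll_contraction:
  assumes D: "integrable lborel D" and h: "h > 0"
  shows "integrable lborel (conv D (moll h))"
    "(LBINT z. \<bar>conv D (moll h) z\<bar>) \<le> (LBINT z. \<bar>D z\<bar>)"
proof -
  have [measurable]: "D \<in> borel_measurable borel" using D by auto
  note [measurable] = moll_measurable[OF h]
  have cm [measurable]: "conv D (moll h) \<in> borel_measurable borel"
    using conv_bump_continuous[OF D moll_bump_fun[OF h]] by (rule borel_measurable_continuous_onI)
  obtain C where C: "!!z. \<bar>moll h z\<bar> \<le> C" using bump_fun_bounded[OF moll_bump_fun[OF h]] by blast
  have i1: "(\<integral>\<^sup>+z. ennreal (moll h z) \<partial>lborel) = 1"
    using nn_integral_eq_integral[OF moll_integrable[OF h]] moll_nonneg[OF h] moll_integral[OF h] by simp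
  have le: "ennreal \<bar>conv D (moll h) z\<bar> \<le> (\<integral>\<^sup>+y. ennreal \<bar>D y\<bar> * ennreal (moll h (z - y)) \<partial>lborel)" for z
  proof -
    have "integrable lborel (%y. D y * moll h (z - y))"
      by (rule integrable_mult_bounded[OF D _ C]) measurable
    then have "ennreal (norm (LBINT y. D y * moll h (z - y))) \<le> (\<integral>\<^sup>+y. ennreal (norm (D y * moll h (z - y))) \<partial>lborel)"
      by (rule integral_norm_bound_ennreal)
    also have "\<dots> = (\<integral>\<^sup>+y. ennreal \<bar>D y\<bar> * ennreal (moll h (z - y)) \<partial>lborel)"
      by (intro nn_integral_cong) (use moll_nonneg[OF h] in \<open>simp add: abs_mult ennreal_mult\<close>)
    finally show ?thesis by (simp add: conv_def)
  qed
  have "(\<integral>\<^sup>+z. ennreal \<bar>conv D (moll h) z\<bar> \<partial>lborel) \<le> (\<integral>\<^sup>+z. (\<integral>\<^sup>+y. ennreal \<bar>D y\<bar> * ennreal (moll h (z - y)) \<partial>lborel) \<partial>lborel)"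
    by (intro nn_integral_mono le)
  also have "\<dots> = (\<integral>\<^sup>+y. (\<integral>\<^sup>+z. ennreal \<bar>D y\<bar> * ennreal (moll h (z - y)) \<partial>lborel) \<partial>lborel)"
    by (rule lborel_pair.Fubini') measurable
  also have "\<dots> = (\<integral>\<^sup>+y. ennreal \<bar>D y\<bar> \<partial>lborel)"
  proof (rule nn_integral_cong)
    fix y
    have "(\<integral>\<^sup>+z. ennreal \<bar>D y\<bar> * ennreal (moll h (z - y)) \<partial>lborel) = ennreal \<bar>D y\<bar> * (\<integral>\<^sup>+z. ennreal (moll h (z - y)) \<partial>lborel)"
      by (rule nn_integral_cmult) measurable
    also have "(\<integral>\<^sup>+z. ennreal (moll h (z - y)) \<partial>lborel) = 1"
      using lborel_nn_integral_translate[of "%z. ennreal (moll h z)" y] i1 by simp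
    finally show "(\<integral>\<^sup>+z. ennreal \<bar>D y\<bar> * ennreal (moll h (z - y)) \<partial>lborel) = ennreal \<bar>D y\<bar>" by simp
  qed
  finally have *: "(\<integral>\<^sup>+z. ennreal \<bar>conv D (moll h) z\<bar> \<partial>lborel) \<le> (\<integral>\<^sup>+y. ennreal \<bar>D y\<bar> \<partial>lborel)" .
  have Dn: "(\<integral>\<^sup>+y. ennreal \<bar>D y\<bar> \<partial>lborel) = ennreal (LBINT y. \<bar>D y\<bar>)"
    using D by (intro nn_integral_eq_integral) auto
  show i: "integrable lborel (conv D (moll h))"
  proof (rule integrableI_bounded)
    show "(\<integral>\<^sup>+z. ennreal (norm (conv D (moll h) z)) \<partial>lborel) < \<infinity>"
      using * unfolding Dn by (simp add: le_less_trans)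
  qed simp
  have "(\<integral>\<^sup>+z. ennreal \<bar>conv D (moll h) z\<bar> \<partial>lborel) = ennreal (LBINT z. \<bar>conv D (moll h) z\<bar>)"
    using i by (intro nn_integral_eq_integral) auto
  with * show "(LBINT z. \<bar>conv D (moll h) z\<bar>) \<le> (LBINT z. \<bar>D z\<bar>)"
    unfolding Dn by (simp add: ennreal_le_iff)
qed

lemma conv_moll_diff_le:
  fixes H :: "plane => real"
  assumes H: "integrable lborel H" and h: "h > 0"
    and d: "!!y. norm y < h ==> \<bar>H (z - y) - H z\<bar> \<le> e"
  shows "\<bar>conv H (moll h) z - H z\<bar> \<le> e"
proof -
  have [measurable]: "H \<in> borel_measurable borel" using H by auto
  note [measurable] = moll_measurable[OF h]
  obtain C where C: "!!z. \<bar>moll h z\<bar> \<le> C" using bump_fun_bounded[OF moll_bump_fun[OF h]] by blast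
  have e0: "0 \<le> e" using d[of 0] h by simp
  have i: "integrable lborel (%y. H (z - y) * moll h y)"
  proof -
    have iH: "integrable lborel (%y. H (z - y))"
    proof -
      have "lborel = distr lborel borel (%x::real\<times>real. z - x)"
        using lborel_affine[of "-1" z] by (simp add: density_1)
      then have "integrable (distr lborel borel (%x. z - x)) H" using H by simp
      then show ?thesis by (subst (asm) integrable_distr_eq) auto
    qed
    show ?thesis by (rule integrable_mult_bounded[OF iH _ C]) measurable
  qed
  have i2: "integrable lborel (%y. H z * moll h y)" using moll_integrable[OF h] by simp
  have "conv H (moll h) z - H z = (LBINT y. H (z - y) * moll h y) - (LBINT y. H z * moll h y)"
    using moll_integral[OF h] by (simp add: conv_flip)
  also have "\<dots> = (LBINT y. (H (z - y) - H z) * moll h y)"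
    using i i2 by (simp add: left_diff_distrib)
  finally have eq: "conv H (moll h) z - H z = (LBINT y. (H (z - y) - H z) * moll h y)" .
  have "\<bar>LBINT y. (H (z - y) - H z) * moll h y\<bar> \<le> (LBINT y. e * moll h y)"
  proof (rule order_trans[OF integral_abs_bound], rule integral_mono)
    show "integrable lborel (%y. \<bar>(H (z - y) - H z) * moll h y\<bar>)"
      using i i2 by (simp add: left_diff_distrib)
    show "integrable lborel (%y. e * moll h y)" using moll_integrable[OF h] by simp
    fix y
    show "\<bar>(H (z - y) - H z) * moll h y\<bar> \<le> e * moll h y"
    proof (cases "norm y < h")
      case True
      then show ?thesis using d[OF True] moll_nonneg[OF h, of y] by (simp add: abs_mult mult_right_mono)
    next
      case False
      then show ?thesis using moll_zero[OF h, of y] by simp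
    qed
  qed
  also have "\<dots> = e" using moll_integral[OF h] by simp
  finally show ?thesis unfolding eq .
qed

text \<open>Only the case of a bounded function with bounded support is needed; there the continuous
  approximants come for free from the definition of \<open>measurable_on\<close>.\<close>

lemma L1_approx_continuous:
  fixes G :: "'a::euclidean_space => real"
  assumes G: "G \<in> borel_measurable borel" and B: "!!z. \<bar>G z\<bar> \<le> B" and R: "!!z. R < norm z ==> G z = 0"
    and e: "e > 0"
  obtains H where "continuous_on UNIV H" "!!z. R + 1 < norm z ==> H z = 0"
    "(LBINT z. \<bar>G z - H z\<bar>) < e"
proof -
  have "G \<in> borel_measurable lebesgue" using G by (intro measurable_completion) simp
  then have "G measurable_on UNIV" by (rule lebesgue_measurable_imp_measurable_on) simp
  then obtain N g where N: "negligible N" and g: "!!n. continuous_on UNIV (g n)"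
    and lim: "!!x. x \<notin> N ==> (%n. g n x) \<longlonglongrightarrow> G x"
    unfolding measurable_on_def by auto
  define c where "c = (%z::'a. max 0 (min 1 (R + 1 - norm z)))"
  define H where "H = (%n z. c z * max (- B) (min B (g n z)))"
  have B0: "0 \<le> B" using B[of 0] by linarith
  have cont: "continuous_on UNIV (H n)" for n
    unfolding H_def c_def by (intro continuous_intros g)
  have Hm: "H n \<in> borel_measurable borel" for n using cont by (rule borel_measurable_continuous_onI)
  have Hz: "H n z = 0" if "R + 1 < norm z" for n z using that by (simp add: H_def c_def)
  have HB: "\<bar>H n z\<bar> \<le> B" for n z
  proof -
    have "\<bar>H n z\<bar> = c z * \<bar>max (- B) (min B (g n z))\<bar>" by (simp add: H_def abs_mult c_def)
    also have "\<dots> \<le> 1 * B" using B0 by (intro mult_mono) (auto simp: c_def)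
    finally show ?thesis by simp
  qed
  have "(%n. LBINT z. \<bar>G z - H n z\<bar>) \<longlonglongrightarrow> (\<integral>z. (0::real) \<partial>(lborel::'a measure))"
  proof (rule integral_dominated_convergence[where w="%z. (2 * B) * indicator (cball (0::'a) (R + 1)) z"])
    show "integrable lborel (%z. (2 * B) * indicator (cball (0::'a) (R + 1)) z :: real)"
      using emeasure_compact_finite[of "cball (0::'a) (R + 1)"]
      by (intro integrable_mult_right integrable_real_indicator) auto
    have "AE z in lebesgue. z \<notin> N" using N by (simp add: negligible_iff_null_sets AE_not_in)
    then have "AE z in lborel. z \<notin> N" by (simp add: AE_completion_iff)
    then show "AE z in lborel. (%n. \<bar>G z - H n z\<bar>) \<longlonglongrightarrow> 0"
    proof eventually_elim
      case (elim z)
      then have "(%n. H n z) \<longlonglongrightarrow> c z * max (- B) (min B (G z))"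
        unfolding H_def by (intro tendsto_intros lim)
      moreover have "c z * max (- B) (min B (G z)) = G z"
      proof (cases "R < norm z")
        case True then show ?thesis using R B0 by simp
      next
        case False
        then have "c z = 1" by (simp add: c_def)
        then show ?thesis using B[of z] by (simp add: min_def max_def abs_le_iff)
      qed
      ultimately have "(%n. H n z) \<longlonglongrightarrow> G z" by simp
      then have "(%n. \<bar>G z - H n z\<bar>) \<longlonglongrightarrow> \<bar>G z - G z\<bar>" by (intro tendsto_intros)
      then show ?case by simp
    qed
    show "AE z in lborel. norm \<bar>G z - H n z\<bar> \<le> 2 * B * indicator (cball 0 (R + 1)) z" for n
    proof (rule AE_I2)
      fix z show "norm \<bar>G z - H n z\<bar> \<le> 2 * B * indicator (cball 0 (R + 1)) z"
      proof (cases "R + 1 < norm z")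
        case True then show ?thesis using R Hz by simp
      next
        case False then show ?thesis using B[of z] HB[of n z] by (simp add: indicator_def)
      qed
    qed
  qed (use G Hm in auto)
  then have "(%n. LBINT z. \<bar>G z - H n z\<bar>) \<longlonglongrightarrow> 0" by simp
  then have "\<forall>\<^sub>F n in sequentially. (LBINT z. \<bar>G z - H n z\<bar>) < e" using e by (rule order_tendstoD)
  then obtain n where "(LBINT z. \<bar>G z - H n z\<bar>) < e" by (auto simp: eventually_sequentially)
  with that[of "H n"] cont Hz show thesis by blast
qed

lemma conv_moll_support:
  assumes h: "h > 0" and R: "!!z. R < norm z ==> G z = 0" and z: "R + h < norm z"
  shows "conv G (moll h) z = 0"
proof -
  have "G y * moll h (z - y) = 0" for y
  proof (cases "R < norm y")
    case False
    then have "h \<le> norm (z - y)" using z norm_triangle_ineq2[of z y] by linarith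
    then show ?thesis using moll_zero[OF h] by simp
  qed (use R in simp)
  then have "(%y. G y * moll h (z - y)) = (%_. 0)" by blast
  then show ?thesis unfolding conv_def by (simp only: integral_zero)
qed

definition mo :: "nat => plane => real" where "mo n = moll (1 / real (Suc n))"

lemma mo_pos: "0 < 1 / real (Suc n)" by simp

text \<open>The density argument: split \<open>G\<close> into a continuous \<open>H\<close> and a
  remainder \<open>D\<close> that is small in L1. Mollification does not enlarge \<open>D\<close> in
  L1 and moves \<open>H\<close> uniformly little.\<close>

lemma conv_mo_L1:
  fixes G :: "plane => real"
  assumes G: "G \<in> borel_measurable borel" and B: "!!z. \<bar>G z\<bar> \<le> B" and R: "!!z. R < norm z ==> G z = 0"
  shows "(%n. LBINT z. \<bar>conv G (mo n) z - G z\<bar>) \<longlonglongrightarrow> 0"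
proof (rule LIMSEQ_I)
  fix e :: real assume e: "e > 0"
  have Gi: "integrable lborel G" using G B R by (rule integrable_bounded_support)
  have e3: "e / 3 > 0" using e by simp
  obtain H where H: "continuous_on UNIV H" "!!z. R + 1 < norm z ==> H z = 0"
    "(LBINT z. \<bar>G z - H z\<bar>) < e / 3" using L1_approx_continuous[OF G B R e3] by blast
  obtain CH where CH: "!!z. \<bar>H z\<bar> \<le> CH" using continuous_support_bounded[OF H(1,2)] by blast
  have Hm: "H \<in> borel_measurable borel" using H(1) by (rule borel_measurable_continuous_onI)
  have Hi: "integrable lborel H" using Hm CH H(2) by (rule integrable_bounded_support)
  define V where "V = measure lborel (cball (0::real\<times>real) (R + 2))"
  \<comment> \<open>\<open>V\<close> is the area of a ball containing the supports of
    \<open>H\<close> and of its mollifications with radius at most 1; a uniform error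
    \<open>eps\<close> there integrates to at most \<open>e / 3\<close>. The summand 1 avoids
    dividing by zero.\<close>
  define eps where "eps = e / (3 * (V + 1))"
  have V0: "0 \<le> V" by (simp add: V_def)
  have ep: "eps > 0" using e V0 by (simp add: eps_def)
  have "uniformly_continuous_on (cball 0 (R + 3)) H"
    by (rule compact_uniformly_continuous) (use H(1) in \<open>auto intro: continuous_on_subset\<close>)
  then have "\<exists>d>0. \<forall>x\<in>cball 0 (R + 3). \<forall>y\<in>cball 0 (R + 3). dist y x < d --> dist (H y) (H x) < eps"
    using ep unfolding uniformly_continuous_on_def by blast
  then obtain d where d: "d > 0" "!!x y. x \<in> cball 0 (R + 3) ==> y \<in> cball 0 (R + 3) ==> dist y x < d ==> dist (H y) (H x) < eps"
    by blast
  obtain N where N: "1 / real (Suc N) < d" using nat_approx_posE[OF d(1)] by blast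
  show "\<exists>no. \<forall>n\<ge>no. norm ((LBINT z. \<bar>conv G (mo n) z - G z\<bar>) - 0) < e"
  proof (intro exI allI impI)
    fix n assume n: "n \<ge> N"
    define h where "h = 1 / real (Suc n)"
    have h: "h > 0" "h \<le> 1" by (auto simp: h_def)
    have "h \<le> 1 / real (Suc N)" using n by (simp add: h_def frac_le)
    then have hd: "h < d" using N by simp
    define D where "D = (%z. G z - H z)"
    have Di: "integrable lborel D" unfolding D_def using Gi Hi by simp
    obtain C where C: "!!z. \<bar>moll h z\<bar> \<le> C" using bump_fun_bounded[OF moll_bump_fun[OF h(1)]] by blast
    have mm: "(%y. moll h (z - y)) \<in> borel_measurable lborel" for z
      using moll_measurable[OF h(1)] by measurable
    have cD: "conv G (moll h) z = conv D (moll h) z + conv H (moll h) z" for z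
    proof -
      have "integrable lborel (%y. D y * moll h (z - y))" "integrable lborel (%y. H y * moll h (z - y))"
        by (rule integrable_mult_bounded[OF Di mm C] integrable_mult_bounded[OF Hi mm C])+
      then have "conv D (moll h) z + conv H (moll h) z = (LBINT y. D y * moll h (z - y) + H y * moll h (z - y))"
        unfolding conv_def by simp
      then show ?thesis unfolding conv_def D_def by (simp add: algebra_simps)
    qed
    have Hd: "\<bar>conv H (moll h) z - H z\<bar> \<le> eps * indicator (cball 0 (R + 2)) z" for z
    proof (cases "norm z \<le> R + 2")
      case True
      have "\<bar>conv H (moll h) z - H z\<bar> \<le> eps"
      proof (rule conv_moll_diff_le[OF Hi h(1)])
        fix y :: "plane" assume y: "norm y < h"
        have "dist (H (z - y)) (H z) < eps"
        proof (rule d(2))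
          show "z \<in> cball 0 (R + 3)" using True by simp
          show "z - y \<in> cball 0 (R + 3)" using True y h norm_triangle_ineq4[of z y] by simp
          show "dist (z - y) z < d" using y hd by (simp add: dist_norm)
        qed
        then show "\<bar>H (z - y) - H z\<bar> \<le> eps" by (simp add: dist_real_def)
      qed
      then show ?thesis using True by simp
    next
      case False
      then have "conv H (moll h) z = 0" using h by (intro conv_moll_support[OF h(1), of "R + 1"] H(2)) auto
      then show ?thesis using False H(2)[of z] by simp
    qed
    have iV: "integrable lborel (%z. eps * indicator (cball (0::real\<times>real) (R + 2)) z)"
      using emeasure_compact_finite[of "cball (0::real\<times>real) (R + 2)"]
      by (intro integrable_mult_right integrable_real_indicator) auto
    note cc = conv_moll_contraction[OF _ h(1)]
    have i3: "integrable lborel (%z. \<bar>conv D (moll h) z\<bar>)" using cc(1)[OF Di] by simp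
    have i4: "integrable lborel (%z. \<bar>D z\<bar>)" using Di by simp
    have "(LBINT z. \<bar>conv G (moll h) z - G z\<bar>) \<le> (LBINT z. \<bar>conv D (moll h) z\<bar> + eps * indicator (cball 0 (R + 2)) z + \<bar>D z\<bar>)"
    proof (rule integral_mono)
      show "integrable lborel (%z. \<bar>conv G (moll h) z - G z\<bar>)" using cc(1)[OF Gi] Gi by simp
      show "integrable lborel (%z. \<bar>conv D (moll h) z\<bar> + eps * indicator (cball 0 (R + 2)) z + \<bar>D z\<bar>)"
        using i3 iV i4 by simp
      fix z show "\<bar>conv G (moll h) z - G z\<bar> \<le> \<bar>conv D (moll h) z\<bar> + eps * indicator (cball 0 (R + 2)) z + \<bar>D z\<bar>"
      proof -
        have "conv G (moll h) z - G z = conv D (moll h) z + (conv H (moll h) z - H z) - D z"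
          unfolding cD D_def by simp
        then show ?thesis using Hd[of z] by linarith
      qed
    qed
    also have "\<dots> = (LBINT z. \<bar>conv D (moll h) z\<bar>) + eps * V + (LBINT z. \<bar>D z\<bar>)"
      using i3 iV i4 by (simp add: V_def)
    also have "\<dots> < e"
    proof -
      have "eps * V \<le> eps * (V + 1)" using ep by simp
      also have "\<dots> = e / 3" using V0 by (simp add: eps_def field_simps)
      finally show ?thesis using cc(2)[OF Di] H(3) unfolding D_def[symmetric] by (simp add: D_def)
    qed
    finally have "(LBINT z. \<bar>conv G (mo n) z - G z\<bar>) < e" by (simp add: mo_def h_def)
    then show "norm ((LBINT z. \<bar>conv G (mo n) z - G z\<bar>) - 0) < e" by simp
  qed
qed

section \<open>Integration by parts for Lipschitz functions\<close>

lemma dq_lipschitz: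
  assumes "L-lipschitz_on UNIV g"
  shows "\<bar>dq e g n z\<bar> \<le> L * norm e"
proof -
  have "\<bar>g (z + (1 / real (Suc n)) *\<^sub>R e) - g z\<bar> \<le> L * (norm e / real (Suc n))"
    using lipschitz_onD[OF assms, of "z + (1 / real (Suc n)) *\<^sub>R e" z] by (simp add: dist_norm)
  then have "real (Suc n) * \<bar>g (z + (1 / real (Suc n)) *\<^sub>R e) - g z\<bar> \<le> real (Suc n) * (L * (norm e / real (Suc n)))"
    by (intro mult_left_mono) auto
  then show ?thesis by (simp add: dq_def abs_mult)
qed

lemma shift_tendsto: "(%n. z + (1 / real (Suc n)) *\<^sub>R e) \<longlonglongrightarrow> (z::'a::euclidean_space)"
proof -
  have "(%n. z + (1 / real (Suc n)) *\<^sub>R e) \<longlonglongrightarrow> z + 0 *\<^sub>R e"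
    using LIMSEQ_inverse_real_of_nat by (intro tendsto_intros) (simp add: inverse_eq_divide)
  then show ?thesis by simp
qed

lemma dq_locally_zero:
  fixes g :: "'a::euclidean_space => real"
  assumes "open V" "z \<in> V" "!!y. y \<in> V ==> g y = 0"
  shows "(%n. dq e g n z) \<longlonglongrightarrow> 0"
proof (rule tendsto_eventually)
  have "\<forall>\<^sub>F n in sequentially. z + (1 / real (Suc n)) *\<^sub>R e \<in> V"
    using topological_tendstoD[OF shift_tendsto assms(1,2)] .
  then show "\<forall>\<^sub>F n in sequentially. dq e g n z = 0"
    by eventually_elim (simp add: dq_def assms)
qed

lemma dq_mult:
  "dq e (%z. g z * psi z) n z = g (z + (1 / real (Suc n)) *\<^sub>R e) * dq e psi n z + psi z * dq e g n z"
  by (simp add: dq_def algebra_simps)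

lemma lipschitz_bounded_cball:
  fixes g :: "'a::euclidean_space => real"
  assumes "L-lipschitz_on UNIV g"
  obtains B where "B \<ge> 0" "!!z. norm z \<le> R ==> \<bar>g z\<bar> \<le> B"
proof
  have L0: "0 \<le> L" using assms by (rule lipschitz_on_nonneg)
  show "\<bar>g 0\<bar> + L * \<bar>R\<bar> \<ge> 0" using L0 by simp
  fix z :: 'a assume z: "norm z \<le> R"
  have "\<bar>g z - g 0\<bar> \<le> L * norm z" using lipschitz_onD[OF assms, of z 0] by (simp add: dist_norm)
  also have "\<dots> \<le> L * \<bar>R\<bar>" using z L0 by (intro mult_left_mono) auto
  finally show "\<bar>g z\<bar> \<le> \<bar>g 0\<bar> + L * \<bar>R\<bar>" by linarith
qed

lemma lipschitz_mult_support:
  fixes g psi :: "'a::euclidean_space => real"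
  assumes g: "L-lipschitz_on UNIV g" and p: "K-lipschitz_on UNIV psi" and R: "!!z. R < norm z ==> psi z = 0"
  obtains M where "M-lipschitz_on UNIV (%z. g z * psi z)"
proof -
  obtain Bg where Bg: "Bg \<ge> 0" "!!z. norm z \<le> R ==> \<bar>g z\<bar> \<le> Bg" using lipschitz_bounded_cball[OF g] by blast
  obtain Bp where Bp: "Bp \<ge> 0" "!!z. norm z \<le> R ==> \<bar>psi z\<bar> \<le> Bp" using lipschitz_bounded_cball[OF p] by blast
  have Bp': "\<bar>psi z\<bar> \<le> Bp" for z using Bp(1) Bp(2)[of z] R[of z] by (cases "norm z \<le> R") auto
  have L0: "0 \<le> L" "0 \<le> K" using g p by (auto dest: lipschitz_on_nonneg)
  have key: "\<bar>g z * psi z - g y * psi y\<bar> \<le> (Bp * L + Bg * K) * dist z y" if "norm y \<le> R" for z y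
  proof -
    have "g z * psi z - g y * psi y = psi z * (g z - g y) + g y * (psi z - psi y)" by (simp add: algebra_simps)
    then have "\<bar>g z * psi z - g y * psi y\<bar> \<le> \<bar>psi z\<bar> * \<bar>g z - g y\<bar> + \<bar>g y\<bar> * \<bar>psi z - psi y\<bar>"
      by (metis abs_mult abs_triangle_ineq)
    also have "\<dots> \<le> Bp * (L * dist z y) + Bg * (K * dist z y)"
      using Bp' Bg(2)[OF that] Bg(1) Bp(1) lipschitz_onD[OF g, of z y] lipschitz_onD[OF p, of z y]
      by (intro add_mono mult_mono) (auto simp: dist_real_def)
    also have "\<dots> = (Bp * L + Bg * K) * dist z y" by (simp add: algebra_simps)
    finally show ?thesis .
  qed
  have "(Bp * L + Bg * K)-lipschitz_on UNIV (%z. g z * psi z)"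
  proof (rule lipschitz_onI)
    fix z y :: 'a
    consider "norm y \<le> R" | "norm z \<le> R" | "R < norm y" "R < norm z" by linarith
    then show "dist (g z * psi z) (g y * psi y) \<le> (Bp * L + Bg * K) * dist z y"
    proof cases
      case 1 then show ?thesis using key[of y z] by (simp add: dist_real_def)
    next
      case 2 then show ?thesis using key[of z y] by (simp add: dist_real_def dist_commute abs_minus_commute)
    next
      case 3 then show ?thesis using R[of y] R[of z] L0 Bp(1) Bg(1) by simp
    qed
  qed (use L0 Bp(1) Bg(1) in simp)
  then show thesis using that by blast
qed

lemma lipschitz_borel:
  fixes g :: "'a::euclidean_space => real"
  shows "L-lipschitz_on UNIV g ==> g \<in> borel_measurable borel"
  by (intro borel_measurable_continuous_onI lipschitz_on_continuous_on)

text \<open>The product of \<open>g\<close> and \<open>psi\<close> is Lipschitz with bounded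
  support, so the integral of its derivative vanishes, and \<open>dq_mult\<close> is the product
  rule for quotients. The limit \<open>G\<close> matters only on \<open>U\<close>: off the closed
  set \<open>S\<close> the quotients of the product are eventually zero.\<close>

lemma integration_by_parts_dq:
  fixes g psi :: "'a::euclidean_space => real"
  assumes g: "L-lipschitz_on UNIV g" and p: "K-lipschitz_on UNIV psi" and R: "!!z. R < norm z ==> psi z = 0"
    and S: "closed S" "S \<subseteq> U" "!!z. z \<notin> S ==> psi z = 0"
    and gl: "AE z in lborel. z \<in> U --> (%n. dq e g n z) \<longlonglongrightarrow> G z" and Gm [measurable]: "G \<in> borel_measurable borel"
    and pl: "AE z in lborel. (%n. dq e psi n z) \<longlonglongrightarrow> \<Psi> z" and Pm [measurable]: "\<Psi> \<in> borel_measurable borel"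
  shows "integrable lborel (%z. g z * \<Psi> z)" "integrable lborel (%z. G z * psi z)"
    "(LBINT z. g z * \<Psi> z) = - (LBINT z. G z * psi z)"
proof -
  define k where "k = (%z. g z * psi z)"
  obtain M where M: "M-lipschitz_on UNIV k" unfolding k_def using lipschitz_mult_support[OF g p R] by blast
  obtain Bk where Bk: "Bk \<ge> 0" "!!z. norm z \<le> R ==> \<bar>k z\<bar> \<le> Bk" using lipschitz_bounded_cball[OF M] by blast
  have kR: "k z = 0" if "R < norm z" for z using R[OF that] by (simp add: k_def)
  have kB: "\<bar>k z\<bar> \<le> Bk" for z using Bk kR[of z] by (cases "norm z \<le> R") auto
  have [measurable]: "g \<in> borel_measurable borel" "psi \<in> borel_measurable borel" "k \<in> borel_measurable borel"
    using lipschitz_borel g p M by blast+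
  have P0: "AE z in lborel. \<bar>\<Psi> z\<bar> \<le> K * norm e \<and> (R < norm z --> \<Psi> z = 0) \<and> (z \<notin> S --> \<Psi> z = 0)"
    using pl
  proof eventually_elim
    case (elim z)
    note l = elim
    have "(%n. \<bar>dq e psi n z\<bar>) \<longlonglongrightarrow> \<bar>\<Psi> z\<bar>" using l by (intro tendsto_intros)
    then have 1: "\<bar>\<Psi> z\<bar> \<le> K * norm e"
      by (rule LIMSEQ_le_const2) (use dq_lipschitz[OF p] in auto)
    have 2: "\<Psi> z = 0" if "R < norm z"
    proof -
      have "open {z::'a. R < norm z}" by (intro open_Collect_less continuous_intros)
      from dq_locally_zero[OF this, of z psi e] that R have "(%n. dq e psi n z) \<longlonglongrightarrow> 0" by auto
      then show ?thesis using l LIMSEQ_unique by blast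
    qed
    have 3: "\<Psi> z = 0" if "z \<notin> S"
    proof -
      from dq_locally_zero[of "-S" z psi e] that S have "(%n. dq e psi n z) \<longlonglongrightarrow> 0" by auto
      then show ?thesis using l LIMSEQ_unique by blast
    qed
    show ?case using 1 2 3 by blast
  qed
  have lim: "AE z in lborel. (%n. dq e k n z) \<longlonglongrightarrow> g z * \<Psi> z + G z * psi z"
    using gl pl P0
  proof eventually_elim
    case (elim z)
    note a = elim(1-3)
    show ?case
    proof (cases "z \<in> S")
      case True
      have "isCont g z" using lipschitz_on_continuous_on[OF g] continuous_on_eq_continuous_at[OF open_UNIV] by blast
      then have "(%n. g (z + (1 / real (Suc n)) *\<^sub>R e)) \<longlonglongrightarrow> g z"
        by (rule isCont_tendsto_compose) (rule shift_tendsto)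
      then have "(%n. g (z + (1 / real (Suc n)) *\<^sub>R e) * dq e psi n z + psi z * dq e g n z) \<longlonglongrightarrow> g z * \<Psi> z + psi z * G z"
        using a True S(2) by (intro tendsto_intros) auto
      then show ?thesis unfolding k_def dq_mult by (simp add: mult.commute)
    next
      case False
      then have "(%n. dq e k n z) \<longlonglongrightarrow> 0"
        using S by (intro dq_locally_zero[of "- S"]) (auto simp: k_def)
      then show ?thesis using False a S(3)[of z] by simp
    qed
  qed
  have Z: "integrable lborel (%z. g z * \<Psi> z + G z * psi z)" "(LBINT z. g z * \<Psi> z + G z * psi z) = 0"
    by (rule integral_derivative_zero[OF _ kB _ dq_lipschitz[OF M] lim, of R]; use kR in auto)+
  obtain Bg where Bg: "Bg \<ge> 0" "!!z. norm z \<le> R ==> \<bar>g z\<bar> \<le> Bg" using lipschitz_bounded_cball[OF g] by blast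
  show i: "integrable lborel (%z. g z * \<Psi> z)"
  proof (rule Bochner_Integration.integrable_bound)
    show "integrable lborel (%z. (Bg * (K * norm e)) * indicator (cball (0::'a) R) z)"
      using emeasure_compact_finite[of "cball (0::'a) R"] by (intro integrable_mult_right integrable_real_indicator) auto
    show "AE z in lborel. norm (g z * \<Psi> z) \<le> norm (Bg * (K * norm e) * indicator (cball 0 R) z)"
      using P0
    proof eventually_elim
      case (elim z)
      note a = elim
      show ?case
      proof (cases "norm z \<le> R")
        case True
        have "\<bar>g z\<bar> * \<bar>\<Psi> z\<bar> \<le> Bg * (K * norm e)" using a Bg(1) Bg(2)[OF True] by (intro mult_mono) auto
        then show ?thesis using True Bg(1) lipschitz_on_nonneg[OF p] by (simp add: abs_mult)
      next
        case False then show ?thesis using a by simp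
      qed
    qed
  qed measurable
  show i2: "integrable lborel (%z. G z * psi z)"
    using Bochner_Integration.integrable_diff[OF Z(1) i] by simp
  show "(LBINT z. g z * \<Psi> z) = - (LBINT z. G z * psi z)"
    using Z(2) i i2 by simp
qed

abbreviation e_t :: "plane" where "e_t \<equiv> (1, 0)"

abbreviation e_x :: "plane" where "e_x \<equiv> (0, 1)"

lemma dq_e_t: "dq e_t phi n z = dq 1 (%s. phi (s, snd z)) n (fst z)"
  by (cases z) (simp add: dq_def)

lemma dq_e_x: "dq e_x phi n z = dq 1 (%s. phi (fst z, s)) n (snd z)"
  by (cases z) (simp add: dq_def)

lemma dq_partials:
  assumes "has_partials phi phit phix"
  shows "(%n. dq e_t phi n z) \<longlonglongrightarrow> phit z" "(%n. dq e_x phi n z) \<longlonglongrightarrow> phix z"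
  using assms dq_limit_real[of "%s. phi (s, snd z)" "phit z" "fst z"] dq_limit_real[of "%s. phi (fst z, s)" "phix z" "snd z"]
  by (cases z; simp add: dq_e_t dq_e_x has_partials_def)+

lemma bump_fun_lipschitz:
  assumes "bump_fun phi"
  obtains K where "K-lipschitz_on UNIV phi"
proof -
  obtain phit phix where p: "bump_fun phit" "bump_fun phix" "has_partials phi phit phix"
    using bump_fun_partials[OF assms] .
  obtain C1 where C1: "!!z. \<bar>phit z\<bar> \<le> C1" using bump_fun_bounded[OF p(1)] by blast
  obtain C2 where C2: "!!z. \<bar>phix z\<bar> \<le> C2" using bump_fun_bounded[OF p(2)] by blast
  define C where "C = max C1 C2"
  have l: "\<bar>phi z - phi z'\<bar> \<le> 2 * C * norm (z - z')" for z z'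
    by (rule has_partials_lipschitz[OF p(3)]) (use C1 C2 in \<open>auto simp: C_def le_max_iff_disj\<close>)
  have "0 \<le> C1" using C1[of 0] by linarith
  then have "0 \<le> C" by (simp add: C_def le_max_iff_disj)
  then have "(2 * C)-lipschitz_on UNIV phi" using l by (intro lipschitz_onI) (auto simp: dist_norm)
  then show thesis by (rule that)
qed

text \<open>The derivative of the kernel at \<open>z - y\<close> is moved onto \<open>g\<close>; the
  minus sign of the reflection cancels that of the integration by parts. As the kernel reaches only
  distance \<open>h\<close>, the derivative of \<open>g\<close> has to be known only around
  \<open>z\<close>.\<close>

lemma conv_moll_deriv:
  assumes g: "L-lipschitz_on UNIV g" and h: "h > 0" and p: "has_partials (moll h) phit phix" "bump_fun phit" "bump_fun phix"
    and z: "cball z h \<subseteq> U"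
  shows "AE y in lborel. y \<in> U --> (%n. dq e_t g n y) \<longlonglongrightarrow> G y ==> G \<in> borel_measurable borel ==>
       conv g phit z = conv G (moll h) z"
    "AE y in lborel. y \<in> U --> (%n. dq e_x g n y) \<longlonglongrightarrow> G y ==> G \<in> borel_measurable borel ==>
       conv g phix z = conv G (moll h) z"
proof -
  define psi where "psi = (%y. moll h (z - y))"
  have b: "bump_fun psi" unfolding psi_def by (rule bump_fun_reflect[OF moll_bump_fun[OF h]])
  obtain K where K: "K-lipschitz_on UNIV psi" using bump_fun_lipschitz[OF b] by blast
  obtain R where R: "!!y. R < norm y ==> psi y = 0" using b unfolding bump_fun_def by blast
  have S: "closed (cball z h)" "cball z h \<subseteq> U" "!!y. y \<notin> cball z h ==> psi y = 0"
    using z h by (auto simp: psi_def dist_norm intro!: moll_zero)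
  have hp: "has_partials psi (%y. - phit (z - y)) (%y. - phix (z - y))"
    unfolding psi_def by (rule has_partials_reflect[OF p(1)])
  note l = dq_partials[OF hp]
  have m: "(%y. - phit (z - y)) \<in> borel_measurable borel" "(%y. - phix (z - y)) \<in> borel_measurable borel"
    using bump_fun_continuous[OF p(2)] bump_fun_continuous[OF p(3)]
    by (auto intro!: borel_measurable_continuous_onI continuous_intros intro: continuous_on_compose2)
  {
    assume a: "AE y in lborel. y \<in> U --> (%n. dq e_t g n y) \<longlonglongrightarrow> G y" "G \<in> borel_measurable borel"
    have "AE y in lborel. (%n. dq e_t psi n y) \<longlonglongrightarrow> - phit (z - y)" using l(1) by simp
    from integration_by_parts_dq(3)[OF g K R S a this m(1)]
    show "conv g phit z = conv G (moll h) z" by (simp add: conv_def psi_def)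
  next
    assume a: "AE y in lborel. y \<in> U --> (%n. dq e_x g n y) \<longlonglongrightarrow> G y" "G \<in> borel_measurable borel"
    have "AE y in lborel. (%n. dq e_x psi n y) \<longlonglongrightarrow> - phix (z - y)" using l(2) by simp
    from integration_by_parts_dq(3)[OF g K R S a this m(2)]
    show "conv g phix z = conv G (moll h) z" by (simp add: conv_def psi_def)
  }
qed

section \<open>Test functions and the weak formulation\<close>

lemma conv_moll_zero_outside:
  assumes h: "h > 0" and g: "!!y. y \<notin> cball p s ==> g y = 0" and z: "s + h < dist p z"
  shows "conv g (moll h) z = 0"
proof -
  have "g y * moll h (z - y) = 0" for y
  proof (cases "y \<in> cball p s")
    case True
    then have "h \<le> norm (z - y)" using z dist_triangle[of p z y] by (simp add: dist_norm norm_minus_commute)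
    then show ?thesis using moll_zero[OF h] by simp
  qed (use g in simp)
  then have "(%y. g y * moll h (z - y)) = (%_. 0)" by blast
  then show ?thesis unfolding conv_def by (simp only: integral_zero)
qed

lemma conv_moll_test_function:
  assumes G: "integrable lborel g" and h: "h > 0" and g: "!!y. y \<notin> cball p s ==> g y = 0"
    and sub: "cball p (s + h) \<subseteq> \<Omega>"
  shows "conv g (moll h) \<in> test_functions \<Omega>"
proof -
  have "{z. conv g (moll h) z \<noteq> 0} \<subseteq> cball p (s + h)"
  proof
    fix z assume "z \<in> {z. conv g (moll h) z \<noteq> 0}"
    then show "z \<in> cball p (s + h)" using conv_moll_zero_outside[where g=g and h=h and p=p and s=s and z=z] h g by force
  qed
  then have c: "closure {z. conv g (moll h) z \<noteq> 0} \<subseteq> cball p (s + h)" by (rule closure_minimal) simp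
  then have "compact (closure {z. conv g (moll h) z \<noteq> 0})"
    using bounded_subset[OF bounded_cball] by (simp add: compact_eq_bounded_closed)
  then show ?thesis unfolding test_functions_def
    using conv_bump_smooth[OF G moll_bump_fun[OF h]] c sub by blast
qed

lemma bump_test_function:
  assumes b: "bump_fun phi" and g: "!!y. y \<notin> cball p s ==> phi y = 0" and sub: "cball p s \<subseteq> \<Omega>"
  shows "phi \<in> test_functions \<Omega>"
proof -
  have "{z. phi z \<noteq> 0} \<subseteq> cball p s" using g by blast
  then have c: "closure {z. phi z \<noteq> 0} \<subseteq> cball p s" by (rule closure_minimal) simp
  then have "compact (closure {z. phi z \<noteq> 0})"
    using bounded_subset[OF bounded_cball] by (simp add: compact_eq_bounded_closed)
  then show ?thesis unfolding test_functions_def using bump_smooth[OF b] c sub by blast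
qed

lemma has_partials_zero_outside:
  assumes p: "has_partials phi phit phix" and S: "closed S" "!!z. z \<notin> S ==> phi z = 0" and z: "z \<notin> S"
  shows "phit z = 0" "phix z = 0"
proof -
  have "open (- S)" "z \<in> - S" "!!y. y \<in> - S ==> phi y = 0" using S z by auto
  note l = dq_locally_zero[OF this]
  show "phit z = 0" "phix z = 0"
    using LIMSEQ_unique[OF dq_partials(1)[OF p] l] LIMSEQ_unique[OF dq_partials(2)[OF p] l] by auto
qed

text \<open>Bridge from the definition, which integrates over \<open>\<Omega>\<close> in the
  completed measure, to integrals of Borel functions over the plane. Equality with the Borel
  representatives is asked on \<open>S\<close> alone, because both partials of \<open>phi\<close>
  vanish elsewhere.\<close>

lemma weak_div_lborel:
  assumes Om: "\<Omega> \<in> sets lebesgue" and S: "closed S" "S \<subseteq> \<Omega>" "!!z. z \<notin> S ==> phi z = 0"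
    and p: "has_partials phi phit phix" and c: "continuous_on UNIV phit" "continuous_on UNIV phix"
    and m: "A \<in> borel_measurable (lebesgue_on \<Omega>)" "B \<in> borel_measurable (lebesgue_on \<Omega>)"
    and m': "A' \<in> borel_measurable borel" "B' \<in> borel_measurable borel"
    and ae: "AE z in lborel. z \<in> S --> A z = A' z \<and> B z = B' z"
  shows "weak_div \<Omega> A B phi = - (LBINT z. A' z * phit z + B' z * phix z)"
proof -
  have pm [measurable]: "phit \<in> borel_measurable borel" "phix \<in> borel_measurable borel"
    using c by (auto intro: borel_measurable_continuous_onI)
  note [measurable] = m'
  have pl [measurable]: "phit \<in> borel_measurable lebesgue" "phix \<in> borel_measurable lebesgue"
    using pm by (auto intro!: measurable_completion)
  have ml [measurable]: "(%z. if z \<in> \<Omega> then A z else 0) \<in> borel_measurable lebesgue"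
    "(%z. if z \<in> \<Omega> then B z else 0) \<in> borel_measurable lebesgue"
    using m Om by (auto simp: borel_measurable_if)
  have "(LINT z:\<Omega>|lebesgue. A z * d_t phi z + B z * d_x phi z)
     = (LINT z|lebesgue. (if z \<in> \<Omega> then A z else 0) * phit z + (if z \<in> \<Omega> then B z else 0) * phix z)"
    unfolding set_lebesgue_integral_def has_partials_d[OF p]
    by (rule Bochner_Integration.integral_cong) auto
  also have "\<dots> = (LINT z|lebesgue. A' z * phit z + B' z * phix z)"
  proof (rule integral_cong_AE)
    have "(%z. A' z * phit z + B' z * phix z) \<in> borel_measurable lborel" by measurable
    then show "(%z. A' z * phit z + B' z * phix z) \<in> borel_measurable lebesgue"
      by (rule measurable_completion)
    have "AE z in lebesgue. z \<in> S --> A z = A' z \<and> B z = B' z" using ae by (rule AE_completion)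
    then show "AE z in lebesgue. (if z \<in> \<Omega> then A z else 0) * phit z + (if z \<in> \<Omega> then B z else 0) * phix z = A' z * phit z + B' z * phix z"
    proof eventually_elim
      case (elim z)
      note a = elim
      show ?case
      proof (cases "z \<in> S")
        case True then show ?thesis using a S(2) by auto
      next
        case False then show ?thesis using has_partials_zero_outside[OF p S(1,3)] by simp
      qed
    qed
  qed measurable
  also have "\<dots> = (LBINT z. A' z * phit z + B' z * phix z)"
    by (rule integral_completion) measurable
  finally show ?thesis by (simp add: weak_div_def)
qed

text \<open>Truncating a Borel version at the essential bound turns the almost everywhere estimate
  into one valid everywhere, which the later domination arguments use.\<close>

lemma Linf_loc_borel:
  assumes u: "Linf_loc \<Omega> u" and Om: "\<Omega> \<in> sets lebesgue" and K: "compact K" "K \<subseteq> \<Omega>"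
  obtains v C where "v \<in> borel_measurable borel" "0 \<le> C" "!!z. \<bar>v z\<bar> \<le> C" "AE z in lborel. z \<in> K --> u z = v z"
proof -
  have "(%z. if z \<in> \<Omega> then u z else 0) \<in> borel_measurable lebesgue"
    using u Om by (simp add: Linf_loc_def borel_measurable_if)
  then obtain v where v: "v \<in> borel_measurable lborel" "AE z in lborel. (if z \<in> \<Omega> then u z else 0) = v z"
    using completion_ex_borel_measurable_real by blast
  obtain C where "AE z in lebesgue. z \<in> K --> \<bar>u z\<bar> \<le> C" using u K by (auto simp: Linf_loc_def)
  then have C: "AE z in lborel. z \<in> K --> \<bar>u z\<bar> \<le> C" by (simp add: AE_completion_iff)
  show thesis
  proof
    show "(%z. max (- \<bar>C\<bar>) (min \<bar>C\<bar> (v z))) \<in> borel_measurable borel" using v(1) by simp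
    show "\<bar>max (- \<bar>C\<bar>) (min \<bar>C\<bar> (v z))\<bar> \<le> \<bar>C\<bar>" for z by (simp add: abs_le_iff)
    show "AE z in lborel. z \<in> K --> u z = max (- \<bar>C\<bar>) (min \<bar>C\<bar> (v z))"
      using v(2) C
    proof eventually_elim
      case (elim z)
      note a = elim(1-2)
      show ?case
      proof
        assume "z \<in> K"
        then have "v z = u z" "\<bar>u z\<bar> \<le> C" using a K(2) by auto
        then show "u z = max (- \<bar>C\<bar>) (min \<bar>C\<bar> (v z))" by (simp add: max_def min_def abs_le_iff)
      qed
    qed
  qed simp
qed

lemma Lip_loc_compact_lipschitz:
  fixes g :: "'a::metric_space => real"
  assumes "Lip_loc S g" "compact K" "K \<subseteq> S"
  obtains L where "L-lipschitz_on K g"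
proof -
  \<comment> \<open>The compactness result is formulated for families with a parameter; here the
    parameter set is a single dummy point.\<close>
  have "local_lipschitz {0::real} K (%_. g)"
    unfolding local_lipschitz_def
  proof (intro ballI)
    fix x t assume "x \<in> K" "t \<in> {0::real}"
    then obtain r L where "r > 0" "L-lipschitz_on (cball x r \<inter> S) g"
      using assms unfolding Lip_loc_def by blast
    moreover have "cball x r \<inter> K \<subseteq> cball x r \<inter> S" using assms(3) by blast
    ultimately have "L-lipschitz_on (cball x r \<inter> K) g" using lipschitz_on_subset by blast
    then show "\<exists>u>0. \<exists>L. \<forall>t\<in>cball t u \<inter> {0}. L-lipschitz_on (cball x u \<inter> K) g"
      using \<open>r > 0\<close> by blast
  qed
  then obtain L where "!!t. t \<in> {0::real} ==> L-lipschitz_on K g"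
    by (rule local_lipschitz_compact_implies_lipschitz[OF _ assms(2), of "{0}"]) auto
  then show thesis using that by blast
qed

lemma Lip_loc_continuous:
  fixes f :: "real => real"
  assumes "Lip_loc UNIV f" shows "continuous_on UNIV f"
proof -
  have "isCont f x" for x
  proof -
    obtain r L where r: "r > 0" "L-lipschitz_on (cball x r \<inter> UNIV) f" using assms unfolding Lip_loc_def by blast
    then have "continuous_on (ball x r) f"
      using lipschitz_on_continuous_on continuous_on_subset[of "cball x r" f "ball x r"] by fastforce
    then show ?thesis using r(1) by (simp add: continuous_on_eq_continuous_at)
  qed
  then show ?thesis by (simp add: continuous_at_imp_continuous_on)
qed

lemma conv_moll_bounds:
  fixes g :: "plane => real"
  assumes g: "integrable lborel g" and h: "h > 0" and b: "!!z. 0 \<le> g z" "!!z. g z \<le> c"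
  shows "0 \<le> conv g (moll h) z" "conv g (moll h) z \<le> c"
proof -
  have [measurable]: "g \<in> borel_measurable borel" using g by auto
  note [measurable] = moll_measurable[OF h]
  show "0 \<le> conv g (moll h) z" unfolding conv_def
    by (rule integral_nonneg_AE) (use b moll_nonneg[OF h] in auto)
  have c0: "0 \<le> c" using b(1)[of 0] b(2)[of 0] by linarith
  have "(LBINT y. g (z - y) * moll h y) \<le> (LBINT y. c * moll h y)"
  proof (rule integral_mono')
    show "g (z - y) * moll h y \<le> c * moll h y" for y by (rule mult_right_mono[OF b(2) moll_nonneg[OF h]])
  qed (use moll_integrable[OF h] c0 moll_nonneg[OF h] in auto)
  then show "conv g (moll h) z \<le> c" using moll_integral[OF h] by (simp add: conv_flip)
qed

text \<open>The hypothesis speaks of smooth test functions, whereas the penalised functions are only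
  Lipschitz. Mollify \<open>g\<close>: its partials become the mollified \<open>Gt\<close> and
  \<open>Gx\<close>, which converge in L1 against the bounded \<open>A'\<close>, \<open>B'\<close>.
  On the right-hand side the mollified functions stay between 0 and \<open>c\<close>, and they
  vanish off \<open>ball p r\<close> once the mollification radius is below
  \<open>r - s\<close>.\<close>

lemma lipschitz_test_measure_ineq:
  assumes wd: "!!phi. phi \<in> test_functions \<Omega> ==> (\<forall>z. 0 \<le> phi z) ==> weak_div \<Omega> A B phi \<le> (LINT z|\<mu>. phi z)"
    and rad: "radon_measure_on \<Omega> \<mu>" and Om: "open \<Omega>"
    and m: "A \<in> borel_measurable (lebesgue_on \<Omega>)" "B \<in> borel_measurable (lebesgue_on \<Omega>)"
    and m': "A' \<in> borel_measurable borel" "B' \<in> borel_measurable borel"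
    and M: "!!z. \<bar>A' z\<bar> \<le> M" "!!z. \<bar>B' z\<bar> \<le> M"
    and ae: "AE z in lborel. z \<in> cball p r --> A z = A' z \<and> B z = B' z"
    and sr: "s < r" "cball p r \<subseteq> \<Omega>"
    and g: "K-lipschitz_on UNIV g" "!!z. 0 \<le> g z" "!!z. g z \<le> c" "!!z. z \<notin> cball p s ==> g z = 0"
    and lt: "AE z in lborel. (%n. dq e_t g n z) \<longlonglongrightarrow> Gt z" and Gt: "Gt \<in> borel_measurable borel" "!!z. \<bar>Gt z\<bar> \<le> D" "!!z. Q < norm z ==> Gt z = 0"
    and lx: "AE z in lborel. (%n. dq e_x g n z) \<longlonglongrightarrow> Gx z" and Gx: "Gx \<in> borel_measurable borel" "!!z. \<bar>Gx z\<bar> \<le> D" "!!z. Q < norm z ==> Gx z = 0"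
  shows "- (LBINT z. A' z * Gt z + B' z * Gx z) \<le> c * measure \<mu> (ball p r)"
proof -
  have OmL: "\<Omega> \<in> sets lebesgue" using Om by simp
  have c0: "0 \<le> c" using g(2,3)[of 0] by linarith
  have gi: "integrable lborel g"
  proof (rule integrable_bounded_support[where B=c and R="norm p + \<bar>s\<bar>"])
    show "g \<in> borel_measurable borel" using g(1) by (rule lipschitz_borel)
    show "\<bar>g z\<bar> \<le> c" for z using g(2,3) by (simp add: abs_of_nonneg)
    show "g z = 0" if "norm p + \<bar>s\<bar> < norm z" for z
    proof (rule g(4))
      show "z \<notin> cball p s" using that norm_triangle_ineq2[of z p] by (auto simp: dist_norm norm_minus_commute)
    qed
  qed
  have Gti: "integrable lborel Gt" and Gxi: "integrable lborel Gx"
    using integrable_bounded_support Gt Gx by blast+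
  define gn where "gn = (%n. conv g (mo n))"
  define I where "I = (%n. LBINT z. A' z * conv Gt (mo n) z + B' z * conv Gx (mo n) z)"
  have ci: "integrable lborel (conv Gt (mo n))" "integrable lborel (conv Gx (mo n))" for n
    unfolding mo_def using conv_moll_contraction(1) Gti Gxi mo_pos by blast+
  have prod: "integrable lborel (%z. A' z * X z)" "integrable lborel (%z. B' z * X z)"
    if "integrable lborel X" for X
    using integrable_mult_bounded[OF that, of A' M] integrable_mult_bounded[OF that, of B' M] m' M
    by (simp_all add: mult.commute)
  have lim: "I \<longlonglongrightarrow> (LBINT z. A' z * Gt z + B' z * Gx z)"
  proof -
    have one: "(%n. LBINT z. X z * conv G (mo n) z) \<longlonglongrightarrow> (LBINT z. X z * G z)"
      if X: "X \<in> borel_measurable borel" "!!z. \<bar>X z\<bar> \<le> M" and G: "G \<in> borel_measurable borel" "!!z. \<bar>G z\<bar> \<le> D" "!!z. Q < norm z ==> G z = 0" for X G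
    proof -
      have Gi: "integrable lborel G" using integrable_bounded_support G by blast
      have cG: "integrable lborel (conv G (mo n))" for n
        unfolding mo_def using conv_moll_contraction(1) Gi mo_pos by blast
      have XG: "integrable lborel (%z. X z * Y z)" if "integrable lborel Y" for Y
        using integrable_mult_bounded[OF that, of X M] X by (simp add: mult.commute)
      have bd: "\<bar>(LBINT z. X z * conv G (mo n) z) - (LBINT z. X z * G z)\<bar> \<le> M * (LBINT z. \<bar>conv G (mo n) z - G z\<bar>)" for n
      proof -
        have "(LBINT z. X z * conv G (mo n) z) - (LBINT z. X z * G z) = (LBINT z. X z * (conv G (mo n) z - G z))"
          using XG[OF cG] XG[OF Gi] by (simp add: right_diff_distrib)
        also have "\<bar>\<dots>\<bar> \<le> (LBINT z. \<bar>X z * (conv G (mo n) z - G z)\<bar>)" by (rule integral_abs_bound)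
        also have "\<dots> \<le> (LBINT z. M * \<bar>conv G (mo n) z - G z\<bar>)"
        proof (rule integral_mono)
          show "integrable lborel (%z. \<bar>X z * (conv G (mo n) z - G z)\<bar>)" using XG[of "%z. conv G (mo n) z - G z"] cG Gi by simp
          show "integrable lborel (%z. M * \<bar>conv G (mo n) z - G z\<bar>)" using cG Gi by simp
          show "\<bar>X z * (conv G (mo n) z - G z)\<bar> \<le> M * \<bar>conv G (mo n) z - G z\<bar>" for z
            unfolding abs_mult by (intro mult_right_mono X(2)) simp
        qed
        finally show ?thesis by simp
      qed
      have "(%n. M * (LBINT z. \<bar>conv G (mo n) z - G z\<bar>)) \<longlonglongrightarrow> M * 0"
        by (intro tendsto_intros conv_mo_L1[OF G])
      then have "(%n. M * (LBINT z. \<bar>conv G (mo n) z - G z\<bar>)) \<longlonglongrightarrow> 0" by simp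
      then have "(%n. (LBINT z. X z * conv G (mo n) z) - (LBINT z. X z * G z)) \<longlonglongrightarrow> 0"
        by (rule Lim_null_comparison[rotated]) (use bd in auto)
      then show ?thesis by (simp add: LIM_zero_iff)
    qed
    have "(%n. (LBINT z. A' z * conv Gt (mo n) z) + (LBINT z. B' z * conv Gx (mo n) z)) \<longlonglongrightarrow> (LBINT z. A' z * Gt z) + (LBINT z. B' z * Gx z)"
      by (intro tendsto_add one m' M Gt Gx)
    moreover have "I n = (LBINT z. A' z * conv Gt (mo n) z) + (LBINT z. B' z * conv Gx (mo n) z)" for n
      unfolding I_def using prod[OF ci(1)] prod[OF ci(2)] by simp
    moreover have "(LBINT z. A' z * Gt z + B' z * Gx z) = (LBINT z. A' z * Gt z) + (LBINT z. B' z * Gx z)"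
      using prod[OF Gti] prod[OF Gxi] by simp
    ultimately show ?thesis by presburger
  qed
  obtain N where N: "1 / real (Suc N) < r - s" using nat_approx_posE[of "r - s"] sr(1) by auto
  have bd: "- I n \<le> c * measure \<mu> (ball p r)" if n: "n \<ge> N" for n
  proof -
    define h where "h = 1 / real (Suc n)"
    have h: "h > 0" by (simp add: h_def)
    have "h \<le> 1 / real (Suc N)" using n by (simp add: h_def frac_le)
    then have hr: "s + h < r" using N by simp
    have mo: "mo n = moll h" by (simp add: mo_def h_def)
    have sub: "cball p (s + h) \<subseteq> \<Omega>" using hr sr(2) by (meson order.trans less_imp_le subset_cball)
    have tf: "gn n \<in> test_functions \<Omega>" unfolding gn_def mo by (rule conv_moll_test_function[OF gi h g(4) sub])
    note bds = conv_moll_bounds[OF gi h g(2,3)]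
    have pos: "\<forall>z. 0 \<le> gn n z" unfolding gn_def mo using bds by blast
    obtain phit phix where p: "bump_fun phit" "bump_fun phix" "has_partials (moll h) phit phix"
      "has_partials (conv g (moll h)) (conv g phit) (conv g phix)"
      using conv_bump_partials[OF gi moll_bump_fun[OF h]] .
    have lt': "AE y in lborel. y \<in> UNIV --> (%n. dq e_t g n y) \<longlonglongrightarrow> Gt y" using lt by simp
    have lx': "AE y in lborel. y \<in> UNIV --> (%n. dq e_x g n y) \<longlonglongrightarrow> Gx y" using lx by simp
    have et: "conv g phit = conv Gt (moll h)"
      using conv_moll_deriv(1)[OF g(1) h p(3,1,2) _ lt' Gt(1)] by (simp add: fun_eq_iff)
    have ex: "conv g phix = conv Gx (moll h)"
      using conv_moll_deriv(2)[OF g(1) h p(3,1,2) _ lx' Gx(1)] by (simp add: fun_eq_iff)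
    have zo: "gn n z = 0" if "z \<notin> cball p (s + h)" for z
      unfolding gn_def mo by (rule conv_moll_zero_outside[OF h g(4)]) (use that in auto)
    have "weak_div \<Omega> A B (gn n) = - I n"
      unfolding I_def mo
    proof (rule weak_div_lborel[OF OmL, of "cball p (s + h)"])
      show "has_partials (gn n) (conv Gt (moll h)) (conv Gx (moll h))" using p(4) unfolding gn_def mo et ex .
      show "continuous_on UNIV (conv Gt (moll h))" "continuous_on UNIV (conv Gx (moll h))"
        using conv_bump_continuous[OF Gti moll_bump_fun[OF h]] conv_bump_continuous[OF Gxi moll_bump_fun[OF h]] by auto
      have "cball p (s + h) \<subseteq> cball p r" using hr by (intro subset_cball) simp
      with ae show "AE z in lborel. z \<in> cball p (s + h) --> A z = A' z \<and> B z = B' z"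
        by (auto elim!: eventually_mono)
    qed (use sub zo m m' in auto)
    then have "- I n \<le> (LINT z|\<mu>. gn n z)" using wd[OF tf pos] by simp
    also have "\<dots> \<le> (LINT z|\<mu>. c * indicator (ball p r) z)"
    proof (rule integral_mono')
      have se: "sets \<mu> = sets (restrict_space borel \<Omega>)" using rad by (simp add: radon_measure_on_def)
      have cb: "cball p r \<in> sets \<mu>" "ball p r \<in> sets \<mu>"
        unfolding se using sr(2) Om ball_subset_cball[of p r] by (auto simp: sets_restrict_space_iff)
      have "emeasure \<mu> (ball p r) \<le> emeasure \<mu> (cball p r)" using cb by (intro emeasure_mono) auto
      also have "\<dots> < \<infinity>" using rad sr(2) by (simp add: radon_measure_on_def)
      finally show "integrable \<mu> (%z. c * indicator (ball p r) z)" using cb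
        by (intro integrable_mult_right integrable_real_indicator) auto
      show "gn n z \<le> c * indicator (ball p r) z" for z
      proof (cases "z \<in> ball p r")
        case True then show ?thesis using bds unfolding gn_def mo by simp
      next
        case False then have "z \<notin> cball p (s + h)" using hr by auto
        then show ?thesis using zo False by simp
      qed
    qed (use c0 in auto)
    also have "\<dots> = c * measure \<mu> (ball p r \<inter> space \<mu>)" by simp
    also have "ball p r \<inter> space \<mu> = ball p r"
    proof -
      have "space \<mu> = \<Omega>" using sets_eq_imp_space_eq[of \<mu> "restrict_space borel \<Omega>"] rad
        by (simp add: radon_measure_on_def space_restrict_space)
      then show ?thesis using sr(2) ball_subset_cball[of p r] by blast
    qed
    finally show ?thesis .
  qed
  have "(%n. - I n) \<longlonglongrightarrow> - (LBINT z. A' z * Gt z + B' z * Gx z)" using lim by (rule tendsto_minus)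
  then show ?thesis by (rule LIMSEQ_le_const2) (use bd in blast)
qed

section \<open>One-dimensional inequalities for convex functions\<close>

lemma strictly_convex_convex_on: "strictly_convex g ==> convex_on UNIV g"
proof (rule convex_onI)
  fix t x y :: real assume g: "strictly_convex g" and t: "0 < t" "t < 1"
  show "g ((1 - t) *\<^sub>R x + t *\<^sub>R y) \<le> (1 - t) * g x + t * g y"
  proof (cases "x = y")
    case True
    then have "(1 - t) *\<^sub>R x + t *\<^sub>R y = y" by (simp add: algebra_simps)
    then show ?thesis using True by (simp add: algebra_simps)
  next
    case False
    then have "y \<noteq> x" by simp
    then have "g (t * y + (1 - t) * x) < t * g y + (1 - t) * g x"
      using g t unfolding strictly_convex_def by blast
    then show ?thesis by (simp add: add.commute)
  qed
qed simp

lemma convex_subgradient: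
  fixes g :: "real => real"
  assumes "convex_on UNIV g"
  obtains c where "!!y. g b + c * (y - b) \<le> g y"
  using convex_le_Inf_differential[OF assms, of b] by auto

lemma convex_deriv_mono:
  fixes g :: "real => real"
  assumes g: "convex_on UNIV g" and d: "DERIV g s :> \<alpha>" "DERIV g r :> \<beta>"
    and "s \<le> r"
  shows "\<alpha> \<le> \<beta>"
proof (cases "s = r")
  case True then show ?thesis using d DERIV_unique by blast
next
  case False
  have "g r - g s \<ge> \<alpha> * (r - s)" "g s - g r \<ge> \<beta> * (s - r)"
    using convex_on_imp_above_tangent[OF g, of s r \<alpha>] convex_on_imp_above_tangent[OF g, of r s \<beta>] d by auto
  then have "\<alpha> * (r - s) \<le> \<beta> * (r - s)" by (simp add: algebra_simps)
  then show ?thesis using False \<open>s \<le> r\<close> by simp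
qed

lemma lipschitz_mult_interval:
  fixes f g :: "real => real"
  assumes f: "L-lipschitz_on {a..b} f" and g: "K-lipschitz_on {a..b} g"
  obtains M where "M-lipschitz_on {a..b} (%x. f x * g x)"
proof -
  have "bounded (f ` {a..b})" "bounded (g ` {a..b})"
    using lipschitz_on_continuous_on[OF f] lipschitz_on_continuous_on[OF g]
    by (auto intro!: compact_imp_bounded compact_continuous_image)
  then obtain B C where B: "!!x. x \<in> {a..b} ==> \<bar>f x\<bar> \<le> B" and C: "!!x. x \<in> {a..b} ==> \<bar>g x\<bar> \<le> C"
    unfolding bounded_iff by (metis imageI real_norm_def)
  have L0: "0 \<le> L" "0 \<le> K" using f g by (auto dest: lipschitz_on_nonneg)
  have "(\<bar>B\<bar> * K + \<bar>C\<bar> * L)-lipschitz_on {a..b} (%x. f x * g x)"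
  proof (rule lipschitz_onI)
    fix x y assume xy: "x \<in> {a..b}" "y \<in> {a..b}"
    have "f x * g x - f y * g y = f x * (g x - g y) + g y * (f x - f y)" by (simp add: algebra_simps)
    then have "\<bar>f x * g x - f y * g y\<bar> \<le> \<bar>f x\<bar> * \<bar>g x - g y\<bar> + \<bar>g y\<bar> * \<bar>f x - f y\<bar>"
      by (metis abs_mult abs_triangle_ineq)
    also have "\<dots> \<le> \<bar>B\<bar> * (K * dist x y) + \<bar>C\<bar> * (L * dist x y)"
      using B[OF xy(1)] C[OF xy(2)] lipschitz_onD[OF f xy] lipschitz_onD[OF g xy]
      by (intro add_mono mult_mono) (auto simp: dist_real_def)
    finally show "dist (f x * g x) (f y * g y) \<le> (\<bar>B\<bar> * K + \<bar>C\<bar> * L) * dist x y"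
      by (simp add: dist_real_def algebra_simps)
  qed (use L0 in simp)
  then show thesis by (rule that)
qed

lemma lipschitz_sub_const_interval:
  fixes f :: "real => real"
  assumes "L-lipschitz_on {a..b} f" shows "L-lipschitz_on {a..b} (%x. f x - c)"
  using assms unfolding lipschitz_on_def by (simp add: dist_real_def)

lemma Lip_loc_interval:
  fixes g :: "real => real"
  assumes "Lip_loc UNIV g" obtains L where "L-lipschitz_on {a..b} g"
  using Lip_loc_compact_lipschitz[OF assms, of "{a..b}"] by auto

text \<open>Chebyshev's inequality for the nondecreasing derivatives of \<open>\<eta>\<close> and
  \<open>f\<close>: the difference of the two sides is half the integral, over the square with side
  from \<open>b\<close> to \<open>v\<close>, of the product of the increments of both derivatives.
  Because these exist only almost everywhere, the proof differentiates in two stages and uses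
  monotonicity of Lipschitz functions.\<close>

lemma entropy_flux_chebyshev:
  assumes lip: "Lip_loc UNIV f" "Lip_loc UNIV \<eta>" "Lip_loc UNIV q"
    and cv: "convex_on UNIV f" "convex_on UNIV \<eta>" and fl: "entropy_flux f \<eta> q"
  shows "(\<eta> v - \<eta> b) * (f v - f b) \<le> (v - b) * (q v - q b)"
proof -
  have ae: "AE x in lborel. \<exists>\<alpha> \<beta>. DERIV \<eta> x :> \<alpha> \<and> DERIV f x :> \<beta> \<and>
        DERIV q x :> \<alpha> * \<beta>"
    using fl by (simp add: entropy_flux_def AE_completion_iff)
  \<comment> \<open>With \<open>\<alpha>\<close>, \<open>\<beta>\<close> the derivatives at one end
    point, \<open>T\<close> has derivative
    \<open>(\<alpha>' - \<alpha>) * (\<beta>' - \<beta>)\<close>, nonnegative because both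
    derivatives are monotone. The derivative of \<open>\<Phi>\<close> below is an increment of this
    \<open>T\<close>.\<close>
  define T where "T = (%\<alpha> \<beta> s. q s - \<beta> * \<eta> s - \<alpha> * f s + \<alpha> * \<beta> * s)"
  have Tmono: "T \<alpha> \<beta> s \<le> T \<alpha> \<beta> r" if sr: "s \<le> r" and x: "x = s \<or> x = r"
     and d: "DERIV \<eta> x :> \<alpha>" "DERIV f x :> \<beta>" for \<alpha> \<beta> s r x
  proof -
    obtain L1 L2 L3 where L: "L1-lipschitz_on {s..r} q" "L2-lipschitz_on {s..r} \<eta>" "L3-lipschitz_on {s..r} f"
      using Lip_loc_interval lip by metis
    obtain M where M: "M-lipschitz_on {s..r} (T \<alpha> \<beta>)"
    proof -
      have "(L1 + \<bar>\<beta>\<bar> * L2 + \<bar>\<alpha>\<bar> * L3 + \<bar>\<alpha> * \<beta>\<bar> * 1)-lipschitz_on {s..r} (%s. q s - \<beta> * \<eta> s - \<alpha> * f s + \<alpha> * \<beta> * s)"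
        by (intro lipschitz_on_add lipschitz_on_diff lipschitz_on_cmult_real L lipschitz_on_id[unfolded id_def])
      then show thesis using that unfolding T_def by blast
    qed
    show ?thesis
    proof (rule lipschitz_AE_deriv_nonneg_mono[OF sr M])
      show "AE y in lborel. y \<in> {s<..<r} --> (\<exists>d\<ge>0. DERIV (T \<alpha> \<beta>) y :> d)"
        using ae
      proof eventually_elim
        case (elim y)
        then obtain \<alpha>' \<beta>' where d': "DERIV \<eta> y :> \<alpha>'" "DERIV f y :> \<beta>'"
          "DERIV q y :> \<alpha>' * \<beta>'" by blast
        show ?case
        proof
          assume y: "y \<in> {s<..<r}"
          have "DERIV (T \<alpha> \<beta>) y :> (\<alpha>' * \<beta>' - \<beta> * \<alpha>' - \<alpha> * \<beta>' + \<alpha> * \<beta>)"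
            unfolding T_def by (auto intro!: derivative_eq_intros d')
          moreover have "\<alpha>' * \<beta>' - \<beta> * \<alpha>' - \<alpha> * \<beta>' + \<alpha> * \<beta> = (\<alpha>' - \<alpha>) * (\<beta>' - \<beta>)"
            by (simp add: algebra_simps)
          moreover have "(\<alpha>' - \<alpha>) * (\<beta>' - \<beta>) \<ge> 0"
          proof (cases "x = s")
            case True
            then have "\<alpha> \<le> \<alpha>'" "\<beta> \<le> \<beta>'" using convex_deriv_mono cv d d' y by (metis greaterThanLessThan_iff less_imp_le)+
            then show ?thesis by simp
          next
            case False
            then have "\<alpha>' \<le> \<alpha>" "\<beta>' \<le> \<beta>" using x convex_deriv_mono cv d d' y by (metis greaterThanLessThan_iff less_imp_le)+
            then show ?thesis by (simp add: mult_nonpos_nonpos)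
          qed
          ultimately show "\<exists>d\<ge>0. DERIV (T \<alpha> \<beta>) y :> d" by auto
        qed
      qed
    qed
  qed
  define \<Phi> where "\<Phi> = (%x. (x - b) * (q x - q b) - (\<eta> x - \<eta> b) * (f x - f b))"
  have lipP: "\<exists>M. M-lipschitz_on {s..r} \<Phi>" for s r
  proof -
    obtain L1 L2 L3 where L: "L1-lipschitz_on {s..r} q" "L2-lipschitz_on {s..r} \<eta>" "L3-lipschitz_on {s..r} f"
      using Lip_loc_interval lip by metis
    have "1-lipschitz_on {s..r} (%x. x)" by (rule lipschitz_onI) auto
    note L' = lipschitz_sub_const_interval[OF this] L[THEN lipschitz_sub_const_interval]
    obtain M1 where M1: "M1-lipschitz_on {s..r} (%x. (x - b) * (q x - q b))"
      using lipschitz_mult_interval[OF L'(1,2)] by blast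
    obtain M2 where M2: "M2-lipschitz_on {s..r} (%x. (\<eta> x - \<eta> b) * (f x - f b))"
      using lipschitz_mult_interval[OF L'(3,4)] by blast
    show ?thesis unfolding \<Phi>_def using lipschitz_on_diff[OF M1 M2] by blast
  qed
  have derP: "AE x in lborel. \<exists>d. DERIV \<Phi> x :> d \<and> (b \<le> x --> 0 \<le> d) \<and> (x \<le> b --> d \<le> 0)"
    using ae
  proof eventually_elim
    case (elim x)
    then obtain \<alpha> \<beta> where d: "DERIV \<eta> x :> \<alpha>" "DERIV f x :> \<beta>"
      "DERIV q x :> \<alpha> * \<beta>" by blast
    have "DERIV \<Phi> x :> ((q x - q b) + (x - b) * (\<alpha> * \<beta>) - (\<alpha> * (f x - f b) + \<beta> * (\<eta> x - \<eta> b)))"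
      unfolding \<Phi>_def by (auto intro!: derivative_eq_intros d)
    moreover have "(q x - q b) + (x - b) * (\<alpha> * \<beta>) - (\<alpha> * (f x - f b) + \<beta> * (\<eta> x - \<eta> b)) = T \<alpha> \<beta> x - T \<alpha> \<beta> b"
      by (simp add: T_def algebra_simps)
    ultimately have "DERIV \<Phi> x :> (T \<alpha> \<beta> x - T \<alpha> \<beta> b)" by simp
    then show ?case
      using Tmono[of b x x \<alpha> \<beta>] Tmono[of x b x \<alpha> \<beta>] d by force
  qed
  have "0 \<le> \<Phi> v"
  proof (cases "b \<le> v")
    case True
    obtain M where M: "M-lipschitz_on {b..v} \<Phi>" using lipP by blast
    have "\<Phi> b \<le> \<Phi> v"
      by (rule lipschitz_AE_deriv_nonneg_mono[OF True M]) (use derP in \<open>auto elim!: eventually_mono\<close>)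
    then show ?thesis by (simp add: \<Phi>_def)
  next
    case False
    then have vb: "v \<le> b" by simp
    obtain M where M: "M-lipschitz_on {v..b} \<Phi>" using lipP by blast
    then have M': "M-lipschitz_on {v..b} (%x. - \<Phi> x)" by (rule lipschitz_on_minus)
    have "- \<Phi> v \<le> - \<Phi> b"
    proof (rule lipschitz_AE_deriv_nonneg_mono[OF vb M'])
      show "AE x in lborel. x \<in> {v<..<b} --> (\<exists>d\<ge>0. DERIV (%x. - \<Phi> x) x :> d)"
        using derP
      proof eventually_elim
        case (elim x)
        then obtain d where d: "DERIV \<Phi> x :> d" "x \<le> b --> d \<le> 0" by blast
        have "DERIV (%x. - \<Phi> x) x :> - d" by (rule DERIV_minus[OF d(1)])
        moreover have "x \<in> {v<..<b} ==> 0 \<le> - d" using d(2) by auto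
        ultimately show ?case by blast
      qed
    qed
    then show ?thesis by (simp add: \<Phi>_def)
  qed
  then show ?thesis by (simp add: \<Phi>_def)
qed

text \<open>The excess \<open>E\<close> of \<open>\<eta>\<close> over a supporting line is convex,
  zero at \<open>b\<close> and positive elsewhere, so beyond distance \<open>\<kappa>\<close> it
  grows at least linearly; the slope \<open>k\<close> is read off at \<open>b + \<kappa>\<close> and
  \<open>b - \<kappa>\<close>. An average of \<open>E\<close> thus controls the average distance to
  \<open>b\<close> up to \<open>\<kappa>\<close>.\<close>

lemma strictly_convex_gap:
  assumes sc: "strictly_convex \<eta>" and c: "!!v. \<eta> b + c * (v - b) \<le> \<eta> v" and k: "\<kappa> > 0"
  obtains k where "k > 0" "!!v. \<bar>v - b\<bar> \<le> \<kappa> + (\<eta> v - \<eta> b - c * (v - b)) / k"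
proof -
  define E where "E = (%v. \<eta> v - \<eta> b - c * (v - b))"
  have E0: "0 \<le> E v" for v using c[of v] by (simp add: E_def)
  have Eb: "E b = 0" by (simp add: E_def)
  have Esc: "E (l * v + (1 - l) * b) < l * E v" if "v \<noteq> b" "0 < l" "l < 1" for l v
  proof -
    have "\<eta> (l * v + (1 - l) * b) < l * \<eta> v + (1 - l) * \<eta> b"
      using sc that unfolding strictly_convex_def by blast
    then show ?thesis by (simp add: E_def algebra_simps)
  qed
  have pos: "0 < E v" if "v \<noteq> b" for v
    using Esc[OF that, of "1/2"] E0[of "1/2 * v + (1 - 1/2) * b"] by simp
  define k where "k = min (E (b + \<kappa>)) (E (b - \<kappa>)) / \<kappa>"
  have kp: "k > 0" unfolding k_def using pos[of "b + \<kappa>"] pos[of "b - \<kappa>"] k by simp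
  have "\<bar>v - b\<bar> \<le> \<kappa> + E v / k" for v
  proof (cases "\<bar>v - b\<bar> \<le> \<kappa>")
    case True
    then show ?thesis using E0[of v] kp by (smt (verit) divide_nonneg_pos)
  next
    case False
    define l where "l = \<kappa> / \<bar>v - b\<bar>"
    have l: "0 < l" "l < 1" using False k by (auto simp: l_def)
    have vb: "v \<noteq> b" using False k by auto
    have "l * v + (1 - l) * b = b + l * (v - b)" by (simp add: algebra_simps)
    also have "l * (v - b) = (if v > b then \<kappa> else - \<kappa>)" using vb by (auto simp: l_def abs_if field_simps)
    finally have e: "l * v + (1 - l) * b = b + \<kappa> \<or> l * v + (1 - l) * b = b - \<kappa>" by auto
    have "k * \<kappa> \<le> E (l * v + (1 - l) * b)" using e k by (auto simp: k_def)
    also have "\<dots> < l * E v" by (rule Esc[OF vb l])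
    finally have "k * \<kappa> < \<kappa> / \<bar>v - b\<bar> * E v" by (simp add: l_def)
    then have "k * \<bar>v - b\<bar> < E v" using False k by (simp add: field_simps)
    then have "\<bar>v - b\<bar> < E v / k" using kp by (simp add: field_simps)
    then show ?thesis using k by simp
  qed
  then show thesis using kp that unfolding E_def by blast
qed

section \<open>A penalised local maximum\<close>

text \<open>As a penalty the l1 norm has partial derivatives that are just signs: explicit off the
  axes through the centre, and at most 1 in modulus.\<close>

definition norm1 :: "plane => real" where "norm1 z = \<bar>fst z\<bar> + \<bar>snd z\<bar>"

lemma norm_le_norm1: "norm z \<le> norm1 z"
  using norm_Pair_le[of "fst z" "snd z"] by (simp add: norm1_def)

lemma norm1_le: "norm1 z \<le> 2 * norm z"
  using norm_fst_le[of "fst z" "snd z"] norm_snd_le[of "snd z" "fst z"] by (simp add: norm1_def)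

lemma norm1_diff: "\<bar>norm1 (y - p) - norm1 (z - p)\<bar> \<le> 2 * norm (y - z)"
proof -
  have "\<bar>norm1 (y - p) - norm1 (z - p)\<bar> \<le> norm1 (y - z)" unfolding norm1_def fst_diff snd_diff by linarith
  then show ?thesis using norm1_le[of "y - z"] by linarith
qed

text \<open>The second entry of the minimum forces \<open>pen\<close> to vanish where
  \<open>norm1 (y - p) \<ge> \<delta> / eps\<close>, whatever \<open>v\<close> does far away. Where
  \<open>v y \<le> eps * norm (y - p)\<close>, the first entry is the smaller one, so near
  \<open>p\<close> nothing is cut off and \<open>pen\<close> is the positive part of the penalised
  function.\<close>

definition pen :: "(plane => real) => plane => real => real => plane => real" where
  "pen v p eps \<delta> y = max 0 (min (v y - 2 * eps * norm1 (y - p) + \<delta>) (\<delta> - eps * norm1 (y - p)))"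

lemma pen_lipschitz:
  assumes v: "L-lipschitz_on UNIV v" and e: "eps > 0"
  shows "(L + 4 * eps)-lipschitz_on UNIV (pen v p eps \<delta>)"
proof (rule lipschitz_onI)
  have L0: "0 \<le> L" using v by (rule lipschitz_on_nonneg)
  then show "0 \<le> L + 4 * eps" using e by simp
  fix y z :: "plane"
  define n where "n = norm (y - z)"
  have n0: "0 \<le> n" by (simp add: n_def)
  have a: "\<bar>v y - v z\<bar> \<le> L * n" using lipschitz_onD[OF v, of y z] by (simp add: dist_norm n_def)
  have "eps * \<bar>norm1 (y - p) - norm1 (z - p)\<bar> \<le> eps * (2 * n)"
    using norm1_diff[of y p z] e unfolding n_def by (intro mult_left_mono) auto
  then have b: "\<bar>eps * norm1 (y - p) - eps * norm1 (z - p)\<bar> \<le> 2 * eps * n"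
    using e by (simp add: right_diff_distrib[symmetric] abs_mult)
  define A B C D where "A = v y - 2 * eps * norm1 (y - p) + \<delta>" and "B = v z - 2 * eps * norm1 (z - p) + \<delta>"
    and "C = \<delta> - eps * norm1 (y - p)" and "D = \<delta> - eps * norm1 (z - p)"
  have AB: "\<bar>A - B\<bar> \<le> (L + 4 * eps) * n" using a b unfolding A_def B_def by (simp add: algebra_simps)
  have "\<bar>C - D\<bar> \<le> 2 * eps * n" using b unfolding C_def D_def by linarith
  also have "\<dots> \<le> (L + 4 * eps) * n" using n0 L0 e by (intro mult_right_mono) auto
  finally have CD: "\<bar>C - D\<bar> \<le> (L + 4 * eps) * n" .
  have "\<bar>max 0 (min A C) - max 0 (min B D)\<bar> \<le> (L + 4 * eps) * n"
  proof -
    define X where "X = (L + 4 * eps) * n"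
    have "\<bar>max 0 (min A C) - max 0 (min B D)\<bar> \<le> X" using AB CD unfolding X_def[symmetric] by linarith
    then show ?thesis by (simp add: X_def)
  qed
  then show "dist (pen v p eps \<delta> y) (pen v p eps \<delta> z) \<le> (L + 4 * eps) * dist y z"
    unfolding pen_def dist_real_def dist_norm n_def[symmetric] A_def B_def C_def D_def .
qed

lemma pen_bounds:
  assumes "eps > 0" "\<delta> > 0" shows "0 \<le> pen v p eps \<delta> y" "pen v p eps \<delta> y \<le> \<delta>"
proof -
  have "0 \<le> eps * norm1 (y - p)" using assms by (simp add: norm1_def)
  then show "0 \<le> pen v p eps \<delta> y" "pen v p eps \<delta> y \<le> \<delta>" using assms by (auto simp: pen_def)
qed

lemma pen_zero:
  assumes e: "eps > 0" and y: "\<delta> / eps \<le> norm1 (y - p)" shows "pen v p eps \<delta> y = 0"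
proof -
  have "\<delta> \<le> eps * norm1 (y - p)" using y e by (simp add: field_simps)
  then show ?thesis by (simp add: pen_def)
qed

lemma pen_at: "v p = 0 ==> \<delta> > 0 ==> pen v p eps \<delta> p = \<delta>"
  by (simp add: pen_def norm1_def)

text \<open>The square of the positive part is C1 with derivative \<open>2 * max 0 a\<close>, and
  the remainder is at most the square of the increment. This gives the chain rule for difference
  quotients at every point, including the zeros of the inner function.\<close>

lemma max_square_expand:
  fixes a b :: real
  shows "\<bar>(max 0 b)\<^sup>2 - (max 0 a)\<^sup>2 - 2 * max 0 a * (b - a)\<bar> \<le> (b - a)\<^sup>2"
proof -
  consider "a \<ge> 0" "b \<ge> 0" | "a \<ge> 0" "b < 0" | "a < 0" "b \<ge> 0" | "a < 0" "b < 0" by linarith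
  then show ?thesis
  proof cases
    case 1
    have "b\<^sup>2 - a\<^sup>2 - 2 * a * (b - a) = (b - a)\<^sup>2" by (simp add: power2_eq_square algebra_simps)
    then show ?thesis using 1 by simp
  next
    case 2
    have "- (a\<^sup>2) - 2 * a * (b - a) = a\<^sup>2 - 2 * a * b" by (simp add: power2_eq_square algebra_simps)
    moreover have "a * b \<le> 0" using 2 by (simp add: mult_nonneg_nonpos)
    moreover have "(b - a)\<^sup>2 = a\<^sup>2 - 2 * a * b + b\<^sup>2" by (simp add: power2_eq_square algebra_simps)
    moreover have "(max 0 b)\<^sup>2 - (max 0 a)\<^sup>2 - 2 * max 0 a * (b - a) = a\<^sup>2 - 2 * a * b"
      using 2 by (simp add: max_def power2_eq_square algebra_simps)
    moreover have "0 \<le> a\<^sup>2" "0 \<le> b\<^sup>2" by simp_all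
    ultimately show ?thesis by linarith
  next
    case 3
    have "b\<^sup>2 \<le> (b - a)\<^sup>2" using 3 by (intro power_mono) auto
    then show ?thesis using 3 by (simp add: max_def)
  qed (simp add: max_def)
qed

lemma dq_max_square:
  assumes d: "(%n. dq e psi n z) \<longlonglongrightarrow> d" and c: "isCont psi z"
  shows "(%n. dq e (%y. (max 0 (psi y))\<^sup>2) n z) \<longlonglongrightarrow> 2 * max 0 (psi z) * d"
proof -
  define b where "b = (%n. psi (z + (1 / real (Suc n)) *\<^sub>R e))"
  have bl: "b \<longlonglongrightarrow> psi z" unfolding b_def using c by (rule isCont_tendsto_compose) (rule shift_tendsto)
  have "(%n. dq e psi n z * (b n - psi z)) \<longlonglongrightarrow> d * (psi z - psi z)" by (intro tendsto_intros d bl)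
  then have z0: "(%n. dq e psi n z * (b n - psi z)) \<longlonglongrightarrow> 0" by simp
  have "(%n. dq e (%y. (max 0 (psi y))\<^sup>2) n z - 2 * max 0 (psi z) * dq e psi n z) \<longlonglongrightarrow> 0"
  proof (rule Lim_null_comparison[OF _ z0], rule always_eventually, rule allI)
    fix n
    have "dq e (%y. (max 0 (psi y))\<^sup>2) n z - 2 * max 0 (psi z) * dq e psi n z
      = real (Suc n) * ((max 0 (b n))\<^sup>2 - (max 0 (psi z))\<^sup>2 - 2 * max 0 (psi z) * (b n - psi z))"
      unfolding dq_def b_def by (simp only: algebra_simps)
    also have "\<bar>\<dots>\<bar> \<le> real (Suc n) * (b n - psi z)\<^sup>2"
      unfolding abs_mult using max_square_expand[of "b n" "psi z"] by (intro mult_mono) auto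
    also have "\<dots> = dq e psi n z * (b n - psi z)" by (simp add: dq_def b_def power2_eq_square)
    finally show "norm (dq e (%y. (max 0 (psi y))\<^sup>2) n z - 2 * max 0 (psi z) * dq e psi n z) \<le> dq e psi n z * (b n - psi z)"
      by simp
  qed
  from tendsto_add[OF this tendsto_mult_left[OF d, of "2 * max 0 (psi z)"]] show ?thesis by simp
qed

lemma dq_add: "dq e (%y. f y + g y) n z = dq e f n z + dq e g n z" by (simp add: dq_def algebra_simps)

lemma dq_diff: "dq e (%y. f y - g y) n z = dq e f n z - dq e g n z" by (simp add: dq_def algebra_simps)

lemma dq_cmult: "dq e (%y. c * g y) n z = c * dq e g n z" by (simp add: dq_def algebra_simps)

lemma dq_const: "dq e (%y. c) n z = 0" by (simp add: dq_def)

lemma abs_deriv_sgn: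
  fixes s c :: real
  assumes "s \<noteq> c" shows "DERIV (%s. \<bar>s - c\<bar>) s :> sgn (s - c)"
proof -
  show ?thesis
  proof (cases "c < s")
    case True
    have "DERIV (%s. s - c) s :> 1" by (auto intro!: derivative_eq_intros)
    moreover have "\<forall>\<^sub>F y in nhds s. \<bar>y - c\<bar> = y - c"
      using True by (intro eventually_nhds[THEN iffD2] exI[of _ "{c<..}"]) auto
    ultimately show ?thesis using True by (simp add: DERIV_transform_nhds)
  next
    case False
    have "DERIV (%s. c - s) s :> - 1" by (auto intro!: derivative_eq_intros)
    moreover have "\<forall>\<^sub>F y in nhds s. \<bar>y - c\<bar> = c - y"
      using False assms by (intro eventually_nhds[THEN iffD2] exI[of _ "{..<c}"]) auto
    ultimately show ?thesis using False assms by (simp add: DERIV_transform_nhds)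
  qed
qed

lemma dq_norm1:
  assumes "fst z \<noteq> fst p" "snd z \<noteq> snd p"
  shows "(%n. dq e_t (%y. norm1 (y - p)) n z) \<longlonglongrightarrow> sgn (fst z - fst p)"
    "(%n. dq e_x (%y. norm1 (y - p)) n z) \<longlonglongrightarrow> sgn (snd z - snd p)"
proof -
  have "DERIV (%s. norm1 ((s, snd z) - p)) (fst z) :> sgn (fst z - fst p)"
    unfolding norm1_def using assms by (auto intro!: derivative_eq_intros abs_deriv_sgn)
  then show "(%n. dq e_t (%y. norm1 (y - p)) n z) \<longlonglongrightarrow> sgn (fst z - fst p)"
    unfolding dq_e_t by (rule dq_limit_real)
  have "DERIV (%s. norm1 ((fst z, s) - p)) (snd z) :> sgn (snd z - snd p)"
    unfolding norm1_def using assms by (auto intro!: derivative_eq_intros abs_deriv_sgn)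
  then show "(%n. dq e_x (%y. norm1 (y - p)) n z) \<longlonglongrightarrow> sgn (snd z - snd p)"
    unfolding dq_e_x by (rule dq_limit_real)
qed

lemma AE_off_axes: "AE z in lborel. fst z \<noteq> fst p \<and> snd z \<noteq> (snd p :: real)" for p :: "plane"
proof -
  have b: "(1, 0) \<in> (Basis :: (plane) set)" "(0, 1) \<in> (Basis :: (plane) set)" by (auto simp: Basis_prod_def)
  have "negligible {z :: plane. z \<bullet> (1,0) = fst p}" "negligible {z :: plane. z \<bullet> (0,1) = snd p}"
    using negligible_standard_hyperplane b by blast+
  then have "AE z in lebesgue. z \<notin> {z :: plane. z \<bullet> (1,0) = fst p}" "AE z in lebesgue. z \<notin> {z :: plane. z \<bullet> (0,1) = snd p}"
    unfolding negligible_iff_null_sets by (blast intro: AE_not_in)+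
  then have "AE z in lborel. z \<notin> {z :: plane. z \<bullet> (1,0) = fst p}" "AE z in lborel. z \<notin> {z :: plane. z \<bullet> (0,1) = snd p}"
    by (simp_all add: AE_completion_iff)
  then show ?thesis by eventually_elim (auto simp: inner_prod_def)
qed

text \<open>Inside \<open>ball p r0\<close> this is the chain rule for the squared positive part.
  Outside, \<open>\<delta> / eps < r0\<close> puts the point beyond the support, and both sides are
  zero whatever value \<open>vd\<close> takes there.\<close>

lemma pen_dq:
  assumes v: "L-lipschitz_on UNIV v" and vle: "!!y. y \<in> ball p r0 ==> v y \<le> eps * norm (y - p)"
    and e: "eps > 0" and d: "\<delta> > 0" "\<delta> / eps < r0"
    and lim: "AE z in lborel. z \<in> ball p r0 --> (%n. dq e v n z) \<longlonglongrightarrow> vd z"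
    and N: "!!z. fst z \<noteq> fst p ==> snd z \<noteq> snd p ==> (%n. dq e (%y. norm1 (y - p)) n z) \<longlonglongrightarrow> sg z"
  shows "AE z in lborel. (%n. dq e (%y. (pen v p eps \<delta> y)\<^sup>2) n z) \<longlonglongrightarrow> 2 * pen v p eps \<delta> z * (vd z - 2 * eps * sg z)"
  using lim AE_off_axes[of p]
proof eventually_elim
  case (elim z)
  note l = elim(1) and o = elim(2)
  define psi where "psi = (%y. v y - 2 * eps * norm1 (y - p) + \<delta>)"
  have pm: "pen v p eps \<delta> y = max 0 (psi y)" if "y \<in> ball p r0" for y
  proof -
    have "v y \<le> eps * norm (y - p)" by (rule vle[OF that])
    also have "\<dots> \<le> eps * norm1 (y - p)" using e norm_le_norm1 by (intro mult_left_mono) auto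
    finally show ?thesis by (simp add: pen_def psi_def)
  qed
  show ?case
  proof (cases "z \<in> ball p r0")
    case True
    have cN: "continuous_on UNIV (%y. norm1 (y - p))" unfolding norm1_def by (intro continuous_intros)
    have "continuous_on UNIV psi" unfolding psi_def by (intro continuous_intros lipschitz_on_continuous_on[OF v] cN)
    then have c: "isCont psi z" using continuous_on_eq_continuous_at[OF open_UNIV] by blast
    have "(%n. dq e v n z - 2 * eps * dq e (%y. norm1 (y - p)) n z + 0) \<longlonglongrightarrow> vd z - 2 * eps * sg z + 0"
      using l True N o by (intro tendsto_intros) auto
    then have dl: "(%n. dq e psi n z) \<longlonglongrightarrow> vd z - 2 * eps * sg z"
      unfolding psi_def dq_add dq_diff dq_cmult dq_const by simp
    have m: "(%n. dq e (%y. (max 0 (psi y))\<^sup>2) n z) \<longlonglongrightarrow> 2 * max 0 (psi z) * (vd z - 2 * eps * sg z)"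
      by (rule dq_max_square[OF dl c])
    have ev: "\<forall>\<^sub>F n in sequentially. z + (1 / real (Suc n)) *\<^sub>R e \<in> ball p r0"
      using topological_tendstoD[OF shift_tendsto open_ball True] .
    have "\<forall>\<^sub>F n in sequentially. dq e (%y. (max 0 (psi y))\<^sup>2) n z = dq e (%y. (pen v p eps \<delta> y)\<^sup>2) n z"
      using ev by eventually_elim (simp only: dq_def pm pm[OF True])
    then show ?thesis using m tendsto_cong[of "%n. dq e (%y. (max 0 (psi y))\<^sup>2) n z" "%n. dq e (%y. (pen v p eps \<delta> y)\<^sup>2) n z"]
      by (simp add: pm[OF True])
  next
    case False
    have zero: "pen v p eps \<delta> y = 0" if "y \<notin> cball p (\<delta> / eps)" for y
      using that norm_le_norm1[of "y - p"] by (intro pen_zero[OF e]) (simp add: dist_norm norm_minus_commute)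
    have zn: "z \<in> - cball p (\<delta> / eps)" using False d by auto
    have "(%n. dq e (%y. (pen v p eps \<delta> y)\<^sup>2) n z) \<longlonglongrightarrow> 0"
      by (rule dq_locally_zero[of "- cball p (\<delta> / eps)"]) (use zero zn in auto)
    then show ?thesis using zero zn by simp
  qed
qed

text \<open>\<open>pen\<close> equals \<open>\<delta>\<close> at \<open>p\<close> and is Lipschitz
  with constant at most \<open>L + 4\<close>, so it stays above \<open>\<delta> / 2\<close> on the
  ball of radius \<open>\<delta> / (2 * (L + 4))\<close>; the area of that ball gives the constant.
  What matters is that it does not depend on \<open>eps\<close>.\<close>

lemma pen_integral_lower:
  assumes v: "L-lipschitz_on UNIV v" "v p = 0" and e: "eps > 0" "eps \<le> 1" and d: "\<delta> > 0"
  shows "integrable lborel (pen v p eps \<delta>)"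
    "unit_ball_vol 2 / (8 * (L + 4)\<^sup>2) * \<delta> ^ 3 \<le> (LBINT z. pen v p eps \<delta> z)"
proof -
  note lip = pen_lipschitz[OF v(1) e(1), of p \<delta>]
  have L0: "0 \<le> L" using v(1) by (rule lipschitz_on_nonneg)
  have zero: "pen v p eps \<delta> y = 0" if "\<delta> / eps < norm (y - p)" for y
    using that norm_le_norm1[of "y - p"] by (intro pen_zero[OF e(1)]) simp
  show i: "integrable lborel (pen v p eps \<delta>)"
  proof (rule integrable_bounded_support[where B=\<delta> and R="norm p + \<delta> / eps"])
    show "pen v p eps \<delta> \<in> borel_measurable borel" using lip by (rule lipschitz_borel)
    show "\<bar>pen v p eps \<delta> z\<bar> \<le> \<delta>" for z using pen_bounds[OF e(1) d, of v p z] by simp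
    show "pen v p eps \<delta> z = 0" if "norm p + \<delta> / eps < norm z" for z
      using that norm_triangle_ineq2[of z p] by (intro zero) simp
  qed
  define \<rho> where "\<rho> = \<delta> / (2 * (L + 4))"
  have "\<delta> / 2 * measure lborel (ball p \<rho>) \<le> (LBINT z. pen v p eps \<delta> z)"
  proof (rule integral_ge_on_ball[OF i])
    show "0 \<le> pen v p eps \<delta> z" for z using pen_bounds[OF e(1) d] by blast
    fix z assume z: "z \<in> ball p \<rho>"
    have "\<bar>pen v p eps \<delta> p - pen v p eps \<delta> z\<bar> \<le> (L + 4 * eps) * dist p z"
      using lipschitz_onD[OF lip, of p z] by (simp add: dist_real_def)
    also have "\<dots> \<le> (L + 4) * \<rho>" using z e L0 by (intro mult_mono) auto
    also have "\<dots> = \<delta> / 2" using L0 by (simp add: \<rho>_def field_simps)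
    finally show "\<delta> / 2 \<le> pen v p eps \<delta> z" using pen_at[of v p \<delta> eps, OF v(2) d] by linarith
  qed
  moreover have "measure lborel (ball p \<rho>) = unit_ball_vol 2 * \<rho>\<^sup>2"
  proof -
    have "0 \<le> \<rho>" using L0 d by (simp add: \<rho>_def)
    from content_ball[OF this, of p] show ?thesis by (simp add: power2_eq_square)
  qed
  moreover have "\<delta> / 2 * (unit_ball_vol 2 * \<rho>\<^sup>2) = unit_ball_vol 2 / (8 * (L + 4)\<^sup>2) * \<delta> ^ 3"
    by (simp add: \<rho>_def power2_eq_square power3_eq_cube field_simps)
  ultimately show "unit_ball_vol 2 / (8 * (L + 4)\<^sup>2) * \<delta> ^ 3 \<le> (LBINT z. pen v p eps \<delta> z)" by simp
qed

lemma pen_square_lipschitz: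
  assumes v: "L-lipschitz_on UNIV v" and e: "eps > 0"
  obtains K where "K-lipschitz_on UNIV (%y. (pen v p eps \<delta> y)\<^sup>2)"
proof -
  note lip = pen_lipschitz[OF v e, of p \<delta>]
  have "pen v p eps \<delta> z = 0" if "norm p + \<delta> / eps < norm z" for z
    using that norm_triangle_ineq2[of z p] norm_le_norm1[of "z - p"] by (intro pen_zero[OF e]) simp
  from lipschitz_mult_support[OF lip lip this]
  show thesis using that by (auto simp: power2_eq_square)
qed

text \<open>The derivative of the squared weight, \<open>2 * pen * (vd - 2 * eps * sg)\<close>,
  integrates to zero. So the weighted mean of \<open>vd\<close> is \<open>2 * eps\<close> times that
  of \<open>sg\<close>, which is at most 1 in modulus.\<close>

lemma pen_deriv_average:
  assumes v: "L-lipschitz_on UNIV v" and vle: "!!y. y \<in> ball p r0 ==> v y \<le> eps * norm (y - p)"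
    and e: "eps > 0" and d: "\<delta> > 0" "\<delta> / eps < r0"
    and lim: "AE z in lborel. z \<in> ball p r0 --> (%n. dq e v n z) \<longlonglongrightarrow> vd z"
    and N: "!!z. fst z \<noteq> fst p ==> snd z \<noteq> snd p ==> (%n. dq e (%y. norm1 (y - p)) n z) \<longlonglongrightarrow> sg z"
    and m: "vd \<in> borel_measurable borel" "sg \<in> borel_measurable borel" and sb: "!!z. \<bar>sg z\<bar> \<le> 1"
    and vb: "!!z. \<bar>vd z\<bar> \<le> D" and i: "integrable lborel (pen v p eps \<delta>)"
  shows "\<bar>LBINT z. pen v p eps \<delta> z * vd z\<bar> \<le> 2 * eps * (LBINT z. pen v p eps \<delta> z)"
proof -
  let ?m = "pen v p eps \<delta>"
  obtain K where K: "K-lipschitz_on UNIV (%y. (?m y)\<^sup>2)" using pen_square_lipschitz[OF v e] by blast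
  have zero: "?m z = 0" if "norm p + \<delta> / eps < norm z" for z
    using that norm_triangle_ineq2[of z p] norm_le_norm1[of "z - p"] by (intro pen_zero[OF e]) simp
  note mb = pen_bounds[OF e d(1), of v p]
  have mm [measurable]: "?m \<in> borel_measurable borel" using i by auto
  note [measurable] = m
  have l: "AE z in lborel. (%n. dq e (%y. (?m y)\<^sup>2) n z) \<longlonglongrightarrow> 2 * ?m z * (vd z - 2 * eps * sg z)"
    by (rule pen_dq[OF v vle e d lim N])
  have Z: "(LBINT z. 2 * ?m z * (vd z - 2 * eps * sg z)) = 0"
  proof (rule integral_derivative_zero(2)[OF _ _ _ dq_lipschitz[OF K] l, of "\<delta>\<^sup>2" "norm p + \<delta> / eps"])
    show "\<bar>(?m z)\<^sup>2\<bar> \<le> \<delta>\<^sup>2" for z using mb[of z] by (simp add: power_mono)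
    show "norm p + \<delta> / eps < norm z ==> (?m z)\<^sup>2 = 0" for z using zero by simp
  qed measurable
  have i1: "integrable lborel (%z. ?m z * vd z)" by (rule integrable_mult_bounded[OF i _ vb]) measurable
  have i2: "integrable lborel (%z. ?m z * sg z)" by (rule integrable_mult_bounded[OF i _ sb]) measurable
  have "(LBINT z. 2 * ?m z * (vd z - 2 * eps * sg z)) = (LBINT z. 2 * (?m z * vd z) - 4 * eps * (?m z * sg z))"
    by (rule Bochner_Integration.integral_cong) (auto simp: algebra_simps)
  also have "\<dots> = 2 * (LBINT z. ?m z * vd z) - 4 * eps * (LBINT z. ?m z * sg z)"
    using i1 i2 by simp
  finally have eq: "(LBINT z. ?m z * vd z) = 2 * eps * (LBINT z. ?m z * sg z)" using Z by simp
  have "\<bar>LBINT z. ?m z * sg z\<bar> \<le> (LBINT z. ?m z)"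
  proof (rule order_trans[OF integral_abs_bound], rule integral_mono)
    show "\<bar>?m z * sg z\<bar> \<le> ?m z" for z using mb[of z] sb[of z] mult_left_mono[of "\<bar>sg z\<bar>" 1 "?m z"] by (simp add: abs_mult)
  qed (use i i2 in auto)
  then show ?thesis unfolding eq using e by (simp add: abs_mult)
qed

lemma continuous_bounded_comp:
  fixes X :: "real => real" and U :: "'a => real"
  assumes "continuous_on UNIV X" "!!z. \<bar>U z\<bar> \<le> C"
  shows "\<exists>B\<ge>0. \<forall>z. \<bar>X (U z)\<bar> \<le> B"
proof -
  have "compact (X ` {-C..C})" using assms(1) by (intro compact_continuous_image) (auto intro: continuous_on_subset)
  then have "bounded (X ` {-C..C})" by (rule compact_imp_bounded)
  then obtain B where B: "!!y. y \<in> X ` {-C..C} ==> norm y \<le> B" by (auto simp: bounded_iff)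
  have "U z \<in> {-C..C}" for z using assms(2)[of z] by (simp add: abs_le_iff)
  then have b: "\<bar>X (U z)\<bar> \<le> B" for z using B[of "X (U z)"] by (metis imageI real_norm_def)
  have "\<bar>X (U z)\<bar> \<le> \<bar>B\<bar>" for z using b[of z] by linarith
  then show ?thesis by (intro exI[of _ "\<bar>B\<bar>"]) simp
qed

lemma integrable_weight_comp:
  fixes X :: "real => real"
  assumes m: "integrable M m" and U: "U \<in> borel_measurable M" "!!z. \<bar>U z\<bar> \<le> C" and X: "continuous_on UNIV X"
  shows "integrable M (%z. m z * X (U z))"
proof -
  obtain B where "!!z. \<bar>X (U z)\<bar> \<le> B" using continuous_bounded_comp[where U=U, OF X U(2)] by blast
  moreover have "(%z. X (U z)) \<in> borel_measurable M"
    using measurable_compose[OF U(1) borel_measurable_continuous_onI[OF X]] .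
  ultimately show ?thesis using m by (intro integrable_mult_bounded)
qed

lemma mult_le_abs_mult:
  fixes c x y :: real
  assumes "\<bar>x\<bar> \<le> y" shows "c * x \<le> \<bar>c\<bar> * y"
proof -
  have "c * x \<le> \<bar>c\<bar> * \<bar>x\<bar>" using abs_ge_self[of "c * x"] by (simp add: abs_mult)
  also have "\<dots> \<le> \<bar>c\<bar> * y" using assms by (intro mult_left_mono) auto
  finally show ?thesis .
qed

lemma sgn_borel: "(sgn :: real => real) \<in> borel_measurable borel"
proof -
  have "(%x::real. if x = 0 then 0 else if 0 < x then 1 else - 1 :: real) \<in> borel_measurable borel"
    by measurable
  then show ?thesis by (simp add: sgn_if[abs_def])
qed

lemma sgn_fst_measurable: "(%z::plane. sgn (fst z - c)) \<in> borel_measurable borel"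
  by (rule measurable_compose[OF _ sgn_borel]) (intro borel_measurable_continuous_onI continuous_intros)

lemma sgn_snd_measurable: "(%z::plane. sgn (snd z - c)) \<in> borel_measurable borel"
  by (rule measurable_compose[OF _ sgn_borel]) (intro borel_measurable_continuous_onI continuous_intros)

text \<open>The weights \<open>m\<close> have averages of \<open>U\<close> and \<open>f U\<close> close to \<open>b\<close> and \<open>- a\<close>. If \<open>- a > f b\<close>, then \<open>U\<close> is
  far from constant, and the strict convexity of \<open>\<eta>\<close> is incompatible with the last inequality.\<close>

lemma averaged_entropy_contradiction:
  assumes lip: "Lip_loc UNIV f" "Lip_loc UNIV \<eta>" "Lip_loc UNIV q"
    and cv: "convex_on UNIV f" "strictly_convex \<eta>" and fl: "entropy_flux f \<eta> q"
    and U: "U \<in> borel_measurable M" "!!z. \<bar>U z\<bar> \<le> C"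
    and H: "!!eps. 0 < eps ==> eps \<le> 1 ==> \<exists>m. integrable M m \<and> (\<forall>z. 0 \<le> m z) \<and> 0 < (\<integral>z. m z \<partial>M) \<and>
        \<bar>\<integral>z. m z * (a + f (U z)) \<partial>M\<bar> \<le> 2 * eps * (\<integral>z. m z \<partial>M) \<and>
        \<bar>\<integral>z. m z * (b - U z) \<partial>M\<bar> \<le> 2 * eps * (\<integral>z. m z \<partial>M) \<and>
        - (K * eps * (\<integral>z. m z \<partial>M)) \<le> (\<integral>z. m z * (\<eta> (U z) * (a + f (U z)) + q (U z) * (b - U z)) \<partial>M)"
  shows "0 \<le> a + f b"
proof (rule ccontr)
  assume "\<not> 0 \<le> a + f b"
  define h where "h = - (a + f b)"
  have h: "h > 0" using \<open>\<not> 0 \<le> a + f b\<close> by (simp add: h_def)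
  have ecv: "convex_on UNIV \<eta>" by (rule strictly_convex_convex_on[OF cv(2)])
  obtain c where c: "!!y. \<eta> b + c * (y - b) \<le> \<eta> y" using convex_subgradient[OF ecv] by blast
  define E where "E = (%v. \<eta> v - \<eta> b - c * (v - b))"
  have E0: "0 \<le> E v" for v using c[of v] by (simp add: E_def)
  define C' where "C' = \<bar>C\<bar> + \<bar>b\<bar>"
  obtain Lf where Lf: "Lf-lipschitz_on {-C'..C'} f" using Lip_loc_interval[OF lip(1)] by blast
  have Lf0: "0 \<le> Lf" using Lf by (rule lipschitz_on_nonneg)
  \<comment> \<open>This threshold costs \<open>Lf * \<kappa> \<le> h / 2\<close> and so leaves half
    of the gap \<open>h\<close> for the contradiction.\<close>
  define \<kappa> where "\<kappa> = h / (2 * (Lf + 1))"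
  have kap: "\<kappa> > 0" using h Lf0 by (simp add: \<kappa>_def)
  obtain k where k: "k > 0" "!!v. \<bar>v - b\<bar> \<le> \<kappa> + E v / k"
    using strictly_convex_gap[OF cv(2) c kap] unfolding E_def by blast
  have cf: "continuous_on UNIV f" and ce: "continuous_on UNIV \<eta>" and cq: "continuous_on UNIV q"
    using Lip_loc_continuous lip by blast+
  define C1 where "C1 = \<bar>K\<bar> + 2 * \<bar>\<eta> b\<bar> + 2 * \<bar>q b + c * h\<bar>"
  define Q where "Q = 2 + Lf * C1 / (h * k)"
  have C10: "0 \<le> C1" by (simp add: C1_def)
  have Q: "Q \<ge> 2" unfolding Q_def using Lf0 C10 h k(1) by simp
  \<comment> \<open>\<open>Q\<close> gathers the coefficients of \<open>eps\<close> in the final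
    estimate \<open>h \<le> Q * eps + h / 2\<close>, which is absurd once
    \<open>Q * eps \<le> h / 4\<close>.\<close>
  define eps where "eps = min 1 (h / (4 * Q))"
  have ep: "0 < eps" "eps \<le> 1" using h Q by (auto simp: eps_def)
  obtain m where m: "integrable M m" "!!z. 0 \<le> m z" "0 < (\<integral>z. m z \<partial>M)"
    and I1: "\<bar>\<integral>z. m z * (a + f (U z)) \<partial>M\<bar> \<le> 2 * eps * (\<integral>z. m z \<partial>M)"
    and I2: "\<bar>\<integral>z. m z * (b - U z) \<partial>M\<bar> \<le> 2 * eps * (\<integral>z. m z \<partial>M)"
    and I3: "- (K * eps * (\<integral>z. m z \<partial>M)) \<le> (\<integral>z. m z * (\<eta> (U z) * (a + f (U z)) + q (U z) * (b - U z)) \<partial>M)"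
    using H[OF ep] by blast
  define S where "S = (\<integral>z. m z \<partial>M)"
  define J where "J = (\<integral>z. m z * E (U z) \<partial>M)"
  note int = integrable_weight_comp[OF m(1) U]
  have cE: "continuous_on UNIV E" unfolding E_def by (intro continuous_intros ce)
  have i1: "integrable M (%z. m z * (a + f (U z)))" by (rule int) (intro continuous_intros cf)
  have i2: "integrable M (%z. m z * (b - U z))" by (rule int) (intro continuous_intros)
  have i3: "integrable M (%z. m z * (\<eta> (U z) * (a + f (U z)) + q (U z) * (b - U z)))"
    by (rule int) (intro continuous_intros cf ce cq)
  have iJ: "integrable M (%z. m z * E (U z))" by (rule int[OF cE])
  have J0: "0 \<le> J" unfolding J_def by (rule integral_nonneg_AE) (use m(2) E0 in auto)
  have S0: "S > 0" using m(3) by (simp add: S_def)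
  \<comment> \<open>With \<open>a = - h - f b\<close> the pointwise difference of the two sides is
    exactly that of the two sides of Chebyshev's inequality; the coefficient
    \<open>q b + c * h\<close> is the one that makes this happen. After averaging, the term
    \<open>- h * J\<close> measures the spread of \<open>U\<close> around \<open>b\<close>.\<close>
  have A: "(\<integral>z. m z * (\<eta> (U z) * (a + f (U z)) + q (U z) * (b - U z)) \<partial>M)
     \<le> - h * J + \<eta> b * (\<integral>z. m z * (a + f (U z)) \<partial>M) + (q b + c * h) * (\<integral>z. m z * (b - U z) \<partial>M)"
  proof -
    have pt: "m z * (\<eta> v * (a + f v) + q v * (b - v))
      \<le> - h * (m z * E v) + \<eta> b * (m z * (a + f v)) + (q b + c * h) * (m z * (b - v))" for z v
    proof -
      have ch: "(\<eta> v - \<eta> b) * (f v - f b) \<le> (v - b) * (q v - q b)"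
        by (rule entropy_flux_chebyshev[OF lip cv(1) ecv fl])
      have "\<eta> v * (a + f v) + q v * (b - v) - (- h * E v + \<eta> b * (a + f v) + (q b + c * h) * (b - v))
         = (\<eta> v - \<eta> b) * (f v - f b) - (v - b) * (q v - q b)"
        unfolding h_def E_def by (simp add: algebra_simps)
      then have "\<eta> v * (a + f v) + q v * (b - v) \<le> - h * E v + \<eta> b * (a + f v) + (q b + c * h) * (b - v)"
        using ch by linarith
      from mult_left_mono[OF this m(2)[of z]] show ?thesis by (simp add: algebra_simps)
    qed
    have "(\<integral>z. m z * (\<eta> (U z) * (a + f (U z)) + q (U z) * (b - U z)) \<partial>M)
      \<le> (\<integral>z. - h * (m z * E (U z)) + \<eta> b * (m z * (a + f (U z))) + (q b + c * h) * (m z * (b - U z)) \<partial>M)"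
      by (rule integral_mono[OF i3 _ pt]) (use i1 i2 iJ in simp)
    also have "\<dots> = - h * J + \<eta> b * (\<integral>z. m z * (a + f (U z)) \<partial>M) + (q b + c * h) * (\<integral>z. m z * (b - U z) \<partial>M)"
      using i1 i2 iJ unfolding J_def by simp
    finally show ?thesis .
  qed
  \<comment> \<open>The average of \<open>f (U z) - f b\<close> is close to \<open>h\<close>, so
    \<open>U\<close> must deviate from \<open>b\<close>; the Lipschitz bound of \<open>f\<close> and
    the strict convexity gap turn this into a lower bound for \<open>J\<close>.\<close>
  have B: "(\<integral>z. m z * (a + f (U z)) \<partial>M) + h * S \<le> Lf * (\<kappa> * S + J / k)"
  proof -
    have pt: "m z * (a + f (U z)) + h * m z \<le> Lf * (\<kappa> * m z + m z * E (U z) / k)" for z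
    proof -
      have "U z \<in> {-C'..C'}" "b \<in> {-C'..C'}" using U(2)[of z] by (auto simp: C'_def)
      then have "\<bar>f (U z) - f b\<bar> \<le> Lf * \<bar>U z - b\<bar>" using lipschitz_onD[OF Lf] by (simp add: dist_real_def)
      also have "\<dots> \<le> Lf * (\<kappa> + E (U z) / k)" using k(2)[of "U z"] Lf0 by (intro mult_left_mono)
      finally have "f (U z) - f b \<le> Lf * (\<kappa> + E (U z) / k)" by linarith
      from mult_left_mono[OF this m(2)[of z]] show ?thesis by (simp add: h_def algebra_simps)
    qed
    have "(\<integral>z. m z * (a + f (U z)) + h * m z \<partial>M) \<le> (\<integral>z. Lf * (\<kappa> * m z + m z * E (U z) / k) \<partial>M)"
      by (rule integral_mono[OF _ _ pt]) (use i1 iJ m(1) in simp_all)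
    then show ?thesis using i1 iJ m(1) unfolding J_def S_def by simp
  qed
  have hJ: "h * J \<le> C1 * eps * S"
  proof -
    have "\<eta> b * (\<integral>z. m z * (a + f (U z)) \<partial>M) \<le> \<bar>\<eta> b\<bar> * (2 * eps * S)"
      using I1 unfolding S_def[symmetric] by (rule mult_le_abs_mult)
    moreover have "(q b + c * h) * (\<integral>z. m z * (b - U z) \<partial>M) \<le> \<bar>q b + c * h\<bar> * (2 * eps * S)"
      using I2 unfolding S_def[symmetric] by (rule mult_le_abs_mult)
    moreover have "K * eps * S \<le> \<bar>K\<bar> * eps * S" using ep S0 by (intro mult_right_mono) auto
    ultimately have "h * J \<le> \<bar>K\<bar> * eps * S + \<bar>\<eta> b\<bar> * (2 * eps * S) + \<bar>q b + c * h\<bar> * (2 * eps * S)"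
      using A I3 unfolding S_def[symmetric] by linarith
    also have "\<dots> = C1 * eps * S" by (simp add: C1_def algebra_simps)
    finally show ?thesis .
  qed
  have "J / k \<le> C1 * eps * S / (h * k)" using hJ h k(1) by (simp add: field_simps)
  then have "Lf * (J / k) \<le> Lf * (C1 * eps * S / (h * k))" using Lf0 by (rule mult_left_mono)
  moreover have "Lf * \<kappa> \<le> h / 2" using h Lf0 by (simp add: \<kappa>_def field_simps)
  then have "Lf * \<kappa> * S \<le> h / 2 * S" using S0 by (intro mult_right_mono) auto
  ultimately have "h * S \<le> 2 * eps * S + h / 2 * S + Lf * (C1 * eps * S / (h * k))"
    using B I1 unfolding S_def[symmetric] distrib_left by (simp add: algebra_simps)
  also have "\<dots> = (Q * eps + h / 2) * S" by (simp add: Q_def algebra_simps)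
  finally have "h \<le> Q * eps + h / 2" using S0 by (simp add: mult_le_cancel_right)
  moreover have "Q * eps \<le> Q * (h / (4 * Q))" using Q by (intro mult_left_mono) (auto simp: eps_def)
  moreover have "Q * (h / (4 * Q)) = h / 4" using Q by simp
  ultimately show False using h by linarith
qed

lemma le_zero_from_eps:
  fixes x C :: real
  assumes "!!eps. 0 < eps ==> eps \<le> 1 ==> x \<le> C * eps" shows "x \<le> 0"
proof (rule ccontr)
  assume "\<not> x \<le> 0"
  define eps where "eps = min 1 (x / (2 * (\<bar>C\<bar> + 1)))"
  have e: "0 < eps" "eps \<le> 1" using \<open>\<not> x \<le> 0\<close> by (auto simp: eps_def)
  have "x \<le> C * eps" by (rule assms[OF e])
  also have "\<dots> \<le> (\<bar>C\<bar> + 1) * eps" using e by (intro mult_right_mono) auto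
  also have "\<dots> \<le> (\<bar>C\<bar> + 1) * (x / (2 * (\<bar>C\<bar> + 1)))" by (intro mult_left_mono) (auto simp: eps_def)
  also have "\<dots> = x / 2" by (simp add: field_simps)
  finally show False using \<open>\<not> x \<le> 0\<close> by simp
qed

section \<open>Slopes of semidifferentials satisfy the Hamilton-Jacobi equation\<close>

abbreviation lin :: "plane => real => real => plane => real" where
  "lin p a b y \<equiv> a * (fst y - fst p) + b * (snd y - snd p)"

lemma lin_lipschitz: "(\<bar>a\<bar> + \<bar>b\<bar>)-lipschitz_on UNIV (lin p a b)"
proof (rule lipschitz_onI)
  fix x y :: "plane"
  have n: "\<bar>fst x - fst y\<bar> \<le> dist x y" "\<bar>snd x - snd y\<bar> \<le> dist x y"
    using dist_fst_le[of x y] dist_snd_le[of x y] by (auto simp: dist_real_def)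
  have "lin p a b x - lin p a b y = a * (fst x - fst y) + b * (snd x - snd y)" by (simp add: algebra_simps)
  then have "\<bar>lin p a b x - lin p a b y\<bar> \<le> \<bar>a\<bar> * \<bar>fst x - fst y\<bar> + \<bar>b\<bar> * \<bar>snd x - snd y\<bar>"
    by (metis abs_mult abs_triangle_ineq)
  also have "\<dots> \<le> \<bar>a\<bar> * dist x y + \<bar>b\<bar> * dist x y" using n by (intro add_mono mult_left_mono) auto
  finally show "dist (lin p a b x) (lin p a b y) \<le> (\<bar>a\<bar> + \<bar>b\<bar>) * dist x y"
    by (simp add: dist_real_def algebra_simps)
qed simp

lemma dq_lin: "dq e_t (lin p a b) n z = a" "dq e_x (lin p a b) n z = b"
proof -
  have "lin p a b (z + (1 / real (Suc n)) *\<^sub>R e_t) - lin p a b z = a / real (Suc n)"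
    "lin p a b (z + (1 / real (Suc n)) *\<^sub>R e_x) - lin p a b z = b / real (Suc n)"
    by (simp_all add: algebra_simps del: of_nat_Suc)
  then show "dq e_t (lin p a b) n z = a" "dq e_x (lin p a b) n z = b"
    unfolding dq_def by simp_all
qed

definition grad_on ::
  "(plane) set => (plane => real) => (plane => real) => (plane => real) => bool" where
  "grad_on V w wt wx \<longleftrightarrow> (AE z in lborel. z \<in> V --> (%n. dq e_t w n z) \<longlonglongrightarrow> wt z \<and> (%n. dq e_x w n z) \<longlonglongrightarrow> wx z)"

definition superdiff :: "(plane => real) => plane => real => real => bool" where
  "superdiff w p a b \<longleftrightarrow> (\<forall>eps>0. \<exists>r>0. \<forall>y\<in>ball p r. w y \<le> w p + lin p a b y + eps * norm (y - p))"

definition subdiff :: "(plane => real) => plane => real => real => bool" where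
  "subdiff w p a b \<longleftrightarrow> (\<forall>eps>0. \<exists>r>0. \<forall>y\<in>ball p r. w p + lin p a b y - eps * norm (y - p) \<le> w y)"

text \<open>\<open>\<sigma>\<close> is 1 for superdifferentials and -1 for subdifferentials.
  Jensen's inequality needs only that the averages of \<open>U\<close> and \<open>f U\<close> are
  close to \<open>b\<close> and \<open>- a\<close> in modulus, so the sign of the penalised function
  drops out and both kinds of slope satisfy the same inequality. Jensen itself is the supporting
  line of \<open>f\<close> at \<open>b\<close>, integrated.\<close>

lemma semidiff_le:
  assumes f: "Lip_loc UNIV f" "convex_on UNIV f"
    and w: "L-lipschitz_on UNIV w" and r1: "r1 > 0"
    and U: "U \<in> borel_measurable borel" "!!z. \<bar>U z\<bar> \<le> C"
    and gr: "grad_on (ball p r1) w (%z. - f (U z)) U" and sd: "superdiff w p a b \<or> subdiff w p a b"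
  shows "a + f b \<le> 0"
proof -
  obtain c where c: "!!y. f b + c * (y - b) \<le> f y" using convex_subgradient[OF f(2)] by blast
  have cf: "continuous_on UNIV f" by (rule Lip_loc_continuous[OF f(1)])
  have fU [measurable]: "(%z. f (U z)) \<in> borel_measurable borel"
    using measurable_compose[OF U(1) borel_measurable_continuous_onI[OF cf]] .
  note [measurable] = U(1)
  obtain F where F: "!!z. \<bar>f (U z)\<bar> \<le> F" using continuous_bounded_comp[where U=U, OF cf U(2)] by blast
  obtain \<sigma> :: real where \<sigma>: "\<bar>\<sigma>\<bar> = 1" "\<sigma> * \<sigma> = 1"
    and sd': "!!eps. eps > 0 ==> \<exists>r>0. \<forall>y\<in>ball p r. \<sigma> * (w y - w p - lin p a b y) \<le> eps * norm (y - p)"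
  proof (cases "superdiff w p a b")
    case True
    show thesis
    proof (rule that[of 1])
      fix eps :: real assume e: "eps > 0"
      obtain r where "r > 0" "!!y. y \<in> ball p r ==> w y \<le> w p + lin p a b y + eps * norm (y - p)"
        using True[unfolded superdiff_def, THEN spec, THEN mp, OF e] by blast
      then show "\<exists>r>0. \<forall>y\<in>ball p r. 1 * (w y - w p - lin p a b y) \<le> eps * norm (y - p)"
        by (intro exI[of _ r] conjI ballI) (auto simp: algebra_simps)
    qed auto
  next
    case False
    then have sub: "subdiff w p a b" using sd by blast
    show thesis
    proof (rule that[of "-1"])
      fix eps :: real assume e: "eps > 0"
      obtain r where "r > 0" "!!y. y \<in> ball p r ==> w p + lin p a b y - eps * norm (y - p) \<le> w y"
        using sub[unfolded subdiff_def, THEN spec, THEN mp, OF e] by blast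
      then show "\<exists>r>0. \<forall>y\<in>ball p r. - 1 * (w y - w p - lin p a b y) \<le> eps * norm (y - p)"
        by (intro exI[of _ r] conjI ballI) (auto simp: algebra_simps)
    qed auto
  qed
  define v where "v = (%y. \<sigma> * (w y - w p - lin p a b y))"
  have vl: "(L + (\<bar>a\<bar> + \<bar>b\<bar>))-lipschitz_on UNIV v"
  proof -
    have "L-lipschitz_on UNIV (%y. w y - w p)" using w unfolding lipschitz_on_def by (simp add: dist_real_def)
    then have "(L + (\<bar>a\<bar> + \<bar>b\<bar>))-lipschitz_on UNIV (%y. w y - w p - lin p a b y)" by (rule lipschitz_on_diff[OF _ lin_lipschitz])
    then have "(\<bar>\<sigma>\<bar> * (L + (\<bar>a\<bar> + \<bar>b\<bar>)))-lipschitz_on UNIV v" unfolding v_def by (rule lipschitz_on_cmult_real)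
    then show ?thesis by (simp only: \<sigma> mult_1)
  qed
  have vp: "v p = 0" by (simp add: v_def)
  show ?thesis
  proof (rule le_zero_from_eps[where C="2 + 2 * \<bar>c\<bar>"])
    fix eps :: real assume e: "0 < eps" "eps \<le> 1"
    obtain r where r: "r > 0" "!!y. y \<in> ball p r ==> \<sigma> * (w y - w p - lin p a b y) \<le> eps * norm (y - p)"
      using sd'[OF e(1)] by blast
    define r0 where "r0 = min r r1"
    have r0: "r0 > 0" using r r1 by (simp add: r0_def)
    define \<delta> where "\<delta> = eps * r0 / 2"
    have d: "\<delta> > 0" "\<delta> / eps < r0" using r0 e by (auto simp: \<delta>_def)
    have vle: "v y \<le> eps * norm (y - p)" if "y \<in> ball p r0" for y
      using r(2)[of y] that by (simp add: v_def r0_def)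
    have dv: "dq e v n z = \<sigma> * (dq e w n z - dq e (lin p a b) n z)" for e n z
      unfolding v_def dq_def by (simp add: algebra_simps)
    have lims: "AE z in lborel. z \<in> ball p r0 --> (%n. dq e_t v n z) \<longlonglongrightarrow> \<sigma> * (- f (U z) - a)"
       "AE z in lborel. z \<in> ball p r0 --> (%n. dq e_x v n z) \<longlonglongrightarrow> \<sigma> * (U z - b)"
    proof -
      note g = gr[unfolded grad_on_def]
      show "AE z in lborel. z \<in> ball p r0 --> (%n. dq e_t v n z) \<longlonglongrightarrow> \<sigma> * (- f (U z) - a)"
        using g
      proof eventually_elim
        case (elim z)
        moreover have "z \<in> ball p r1" if "z \<in> ball p r0" using that by (simp add: r0_def)
        ultimately show ?case
          unfolding dv dq_lin by (intro impI tendsto_mult[OF tendsto_const] tendsto_diff[OF _ tendsto_const]) blast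
      qed
      show "AE z in lborel. z \<in> ball p r0 --> (%n. dq e_x v n z) \<longlonglongrightarrow> \<sigma> * (U z - b)"
        using g
      proof eventually_elim
        case (elim z)
        moreover have "z \<in> ball p r1" if "z \<in> ball p r0" using that by (simp add: r0_def)
        ultimately show ?case
          unfolding dv dq_lin by (intro impI tendsto_mult[OF tendsto_const] tendsto_diff[OF _ tendsto_const]) blast
      qed
    qed
    define m where "m = pen v p eps \<delta>"
    define S where "S = (LBINT z. m z)"
    note pl = pen_integral_lower[OF vl vp e d(1)]
    have mi: "integrable lborel m" using pl(1) by (simp add: m_def)
    have L0: "0 \<le> L" using w by (rule lipschitz_on_nonneg)
    have "0 < unit_ball_vol 2 / (8 * ((L + (\<bar>a\<bar> + \<bar>b\<bar>)) + 4)\<^sup>2) * \<delta> ^ 3"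
      using d L0 by (intro mult_pos_pos divide_pos_pos) auto
    then have S0: "S > 0" using pl(2) unfolding S_def m_def by linarith
    have m0: "0 \<le> m z" for z using pen_bounds[OF e(1) d(1)] by (simp add: m_def)
    have sig: "\<bar>LBINT z. m z * k z\<bar> = \<bar>LBINT z. m z * (\<sigma> * k z)\<bar>" for k
    proof -
      have "(LBINT z. m z * (\<sigma> * k z)) = \<sigma> * (LBINT z. m z * k z)"
        by (simp add: mult.left_commute)
      then show ?thesis by (simp add: abs_mult \<sigma>)
    qed
    have I1: "\<bar>LBINT z. m z * (- f (U z) - a)\<bar> \<le> 2 * eps * S" unfolding sig[of "%z. - f (U z) - a"] unfolding m_def S_def
    proof (rule pen_deriv_average[OF vl vle e(1) d lims(1) dq_norm1(1) _ _ _ _ pl(1)])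
      show "\<bar>\<sigma> * (- f (U z) - a)\<bar> \<le> F + \<bar>a\<bar>" for z unfolding abs_mult \<sigma> mult_1 using F[of z] by linarith
    qed (auto simp: abs_sgn_eq sgn_fst_measurable sgn_snd_measurable)
    have I2: "\<bar>LBINT z. m z * (U z - b)\<bar> \<le> 2 * eps * S" unfolding sig[of "%z. U z - b"] unfolding m_def S_def
    proof (rule pen_deriv_average[OF vl vle e(1) d lims(2) dq_norm1(2) _ _ _ _ pl(1)])
      show "\<bar>\<sigma> * (U z - b)\<bar> \<le> C + \<bar>b\<bar>" for z unfolding abs_mult \<sigma> mult_1 using U(2)[of z] by linarith
    qed (auto simp: abs_sgn_eq sgn_fst_measurable sgn_snd_measurable)
    have U': "U \<in> borel_measurable lborel" by simp
    note int = integrable_weight_comp[OF mi U' U(2)]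
    have i1: "integrable lborel (%z. m z * (- f (U z) - a))" by (rule int) (intro continuous_intros cf)
    have i2: "integrable lborel (%z. m z * (U z - b))" by (rule int) (intro continuous_intros)
    have "(LBINT z. (a + f b) * m z + c * (m z * (U z - b)) + m z * (- f (U z) - a)) \<le> (\<integral>z. (0::real) \<partial>(lborel :: (plane) measure))"
    proof (rule integral_mono)
      fix z
      have "f b + c * (U z - b) - f (U z) \<le> 0" using c[of "U z"] by simp
      from mult_left_mono[OF this m0[of z]]
      show "(a + f b) * m z + c * (m z * (U z - b)) + m z * (- f (U z) - a) \<le> 0" by (simp add: algebra_simps)
    qed (use i1 i2 mi in auto)
    then have "(a + f b) * S + c * (LBINT z. m z * (U z - b)) + (LBINT z. m z * (- f (U z) - a)) \<le> 0"
      using i1 i2 mi unfolding S_def by simp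
    moreover have "\<bar>c * (LBINT z. m z * (U z - b))\<bar> \<le> \<bar>c\<bar> * (2 * eps * S)"
      unfolding abs_mult using I2 by (intro mult_left_mono) auto
    ultimately have "(a + f b) * S \<le> \<bar>c\<bar> * (2 * eps * S) + 2 * eps * S" using I1 by linarith
    also have "\<dots> = ((2 + 2 * \<bar>c\<bar>) * eps) * S" by (simp add: algebra_simps)
    finally show "a + f b \<le> (2 + 2 * \<bar>c\<bar>) * eps" using S0 by (simp add: mult_le_cancel_right)
  qed
qed

text \<open>A lower limit equal to zero means that small ratios occur frequently, hence at some
  radius below any prescribed one.\<close>

lemma liminf_zero_small_ball:
  assumes li: "Liminf (at_right 0) (%r. ennreal (1 / r) * emeasure \<mu> (ball p r)) = 0"
    and k: "\<kappa> > 0" and r1: "r1 > 0"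
  obtains r where "0 < r" "r < r1" "emeasure \<mu> (ball p r) < ennreal (\<kappa> * r)"
proof -
  have "\<not> (\<forall>\<^sub>F r in at_right 0. ennreal \<kappa> \<le> ennreal (1 / r) * emeasure \<mu> (ball p r))"
  proof
    assume "\<forall>\<^sub>F r in at_right 0. ennreal \<kappa> \<le> ennreal (1 / r) * emeasure \<mu> (ball p r)"
    then have "ennreal \<kappa> \<le> Liminf (at_right 0) (%r. ennreal (1 / r) * emeasure \<mu> (ball p r))"
      by (rule Liminf_bounded)
    then show False using k unfolding li by (simp add: ennreal_eq_0_iff)
  qed
  then have "\<exists>\<^sub>F r in at_right 0. ennreal (1 / r) * emeasure \<mu> (ball p r) < ennreal \<kappa>"
    by (simp add: frequently_def not_less)
  moreover have "\<forall>\<^sub>F r in at_right 0. 0 < r \<and> r < r1"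
    using r1 by (intro eventually_at_right[THEN iffD2]) (auto intro!: exI[of _ r1])
  ultimately have "\<exists>\<^sub>F r in at_right 0. ennreal (1 / r) * emeasure \<mu> (ball p r) < ennreal \<kappa> \<and> (0 < r \<and> r < r1)"
    by (rule frequently_eventually_frequently)
  then obtain r where r: "ennreal (1 / r) * emeasure \<mu> (ball p r) < ennreal \<kappa>" "0 < r" "r < r1"
    using frequently_ex by blast
  have "ennreal r * (ennreal (1 / r) * emeasure \<mu> (ball p r)) < ennreal r * ennreal \<kappa>"
    using r by (intro ennreal_mult_strict_left_mono) auto
  moreover have "ennreal r * (ennreal (1 / r) * emeasure \<mu> (ball p r)) = emeasure \<mu> (ball p r)"
    using r by (simp add: mult.assoc[symmetric] ennreal_mult[symmetric])
  moreover have "ennreal r * ennreal \<kappa> = ennreal (\<kappa> * r)"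
    using r k by (simp add: ennreal_mult[symmetric] mult.commute)
  ultimately show thesis using r that by metis
qed

text \<open>Here the side matters: the weight comes from tangent minus \<open>w\<close>, so the
  entropy inequality tested with its square bounds the averaged expression in
  \<open>averaged_entropy_contradiction\<close> from below. In the constant
  \<open>1 + 4 * M\<close>, the 1 pays for \<open>\<mu>\<close> and \<open>4 * M\<close> for the
  derivatives of the penalty, as \<open>\<eta> U\<close> and \<open>q U\<close> are at most
  \<open>M\<close> in modulus.\<close>

lemma subdiff_ge:
  assumes lip: "Lip_loc UNIV f" "Lip_loc UNIV \<eta>" "Lip_loc UNIV q"
    and cv: "convex_on UNIV f" "strictly_convex \<eta>" and fl: "entropy_flux f \<eta> q"
    and Om: "open \<Omega>" and rad: "radon_measure_on \<Omega> \<mu>"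
    and li: "Liminf (at_right 0) (%r. ennreal (1 / r) * emeasure \<mu> (ball p r)) = 0"
    and mu: "u \<in> borel_measurable (lebesgue_on \<Omega>)"
    and wd: "weak_div_le_measure \<Omega> (%z. \<eta> (u z)) (%z. q (u z)) \<mu>"
    and w: "L-lipschitz_on UNIV w" and r1: "r1 > 0" "cball p r1 \<subseteq> \<Omega>"
    and U: "U \<in> borel_measurable borel" "!!z. \<bar>U z\<bar> \<le> C" and uU: "AE z in lborel. z \<in> cball p r1 --> u z = U z"
    and gr: "grad_on (ball p r1) w (%z. - f (U z)) U" and sd: "subdiff w p a b"
  shows "0 \<le> a + f b"
proof -
  have cf: "continuous_on UNIV f" and ce: "continuous_on UNIV \<eta>" and cq: "continuous_on UNIV q"
    using Lip_loc_continuous lip by blast+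
  note [measurable] = U(1)
  have comp: "(%z. X (U z)) \<in> borel_measurable borel" if "continuous_on UNIV X" for X :: "real => real"
    using measurable_compose[OF U(1) borel_measurable_continuous_onI[OF that]] .
  note [measurable] = comp[OF cf] comp[OF ce] comp[OF cq]
  obtain F where F: "!!z. \<bar>f (U z)\<bar> \<le> F" using continuous_bounded_comp[where U=U, OF cf U(2)] by blast
  obtain M1 where M1: "!!z. \<bar>\<eta> (U z)\<bar> \<le> M1" using continuous_bounded_comp[where U=U, OF ce U(2)] by blast
  obtain M2 where M2: "!!z. \<bar>q (U z)\<bar> \<le> M2" using continuous_bounded_comp[where U=U, OF cq U(2)] by blast
  define M where "M = max M1 M2"
  have M: "\<bar>\<eta> (U z)\<bar> \<le> M" "\<bar>q (U z)\<bar> \<le> M" for z using M1[of z] M2[of z] by (auto simp: M_def)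
  have M0: "0 \<le> M" using M(1)[of 0] by linarith
  define v where "v = (%y. w p + lin p a b y - w y)"
  define \<Lambda> where "\<Lambda> = \<bar>a\<bar> + \<bar>b\<bar> + L"
  have vl: "\<Lambda>-lipschitz_on UNIV v"
  proof -
    have "(\<bar>a\<bar> + \<bar>b\<bar>)-lipschitz_on UNIV (%y. w p + lin p a b y)"
      using lin_lipschitz[of a b p] unfolding lipschitz_on_def by (simp add: dist_real_def)
    then show ?thesis unfolding v_def \<Lambda>_def by (rule lipschitz_on_diff[OF _ w])
  qed
  have L0: "0 \<le> \<Lambda>" using vl by (rule lipschitz_on_nonneg)
  have vp: "v p = 0" by (simp add: v_def)
  define K0 where "K0 = unit_ball_vol 2 / (8 * (\<Lambda> + 4)\<^sup>2)"
  have K0: "K0 > 0" unfolding K0_def using L0 by (intro divide_pos_pos) auto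
  have mU: "(%z. X (u z)) \<in> borel_measurable (lebesgue_on \<Omega>)" if "continuous_on UNIV X" for X :: "real => real"
    using measurable_compose[OF mu borel_measurable_continuous_onI[OF that]] .
  show ?thesis
  proof (rule averaged_entropy_contradiction[OF lip cv fl, where M=lborel and U=U and C=C and K="1 + 4 * M"])
    show "U \<in> borel_measurable lborel" by simp
    show "\<bar>U z\<bar> \<le> C" for z by (rule U(2))
    fix eps :: real assume e: "0 < eps" "eps \<le> 1"
    obtain r where r: "r > 0" "!!y. y \<in> ball p r ==> w p + lin p a b y - eps * norm (y - p) \<le> w y"
      using sd[unfolded subdiff_def, THEN spec, THEN mp, OF e(1)] by blast
    define r0 where "r0 = min r r1"
    have r0: "r0 > 0" using r r1 by (simp add: r0_def)
    \<comment> \<open>The threshold is tuned so that, with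
      \<open>\<delta> = eps * \<rho> / 2\<close>, the measure term
      \<open>\<delta>\<^sup>2 * (eps\<^sup>2 * K0 * \<rho>)\<close> equals
      \<open>2 * eps * (K0 * \<delta> ^ 3)\<close>, which is at most
      \<open>2 * eps * S\<close>.\<close>
    have kap: "eps\<^sup>2 * K0 > 0" using e K0 by simp
    obtain \<rho> where rho: "0 < \<rho>" "\<rho> < r0" "emeasure \<mu> (ball p \<rho>) < ennreal (eps\<^sup>2 * K0 * \<rho>)"
      using liminf_zero_small_ball[OF li kap r0] by blast
    \<comment> \<open>The support then has radius \<open>\<rho> / 2\<close>, leaving room to mollify
      inside \<open>ball p \<rho>\<close>.\<close>
    define \<delta> where "\<delta> = eps * \<rho> / 2"
    have de: "\<delta> / eps = \<rho> / 2" using e by (simp add: \<delta>_def)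
    have d: "\<delta> > 0" "\<delta> / eps < r0" using rho e unfolding de by (auto simp: \<delta>_def)
    have mur: "measure \<mu> (ball p \<rho>) \<le> eps\<^sup>2 * K0 * \<rho>"
      unfolding measure_def using rho(3) kap rho(1)
      by (metis enn2real_leI ennreal_less_top less_imp_le mult_nonneg_nonneg)
    have vle: "v y \<le> eps * norm (y - p)" if "y \<in> ball p r0" for y
      using r(2)[of y] that by (auto simp: v_def r0_def)
    have dv: "dq e v n z = dq e (lin p a b) n z - dq e w n z" for e n z
      by (simp add: v_def dq_def algebra_simps)
    have lims: "AE z in lborel. z \<in> ball p r0 --> (%n. dq e_t v n z) \<longlonglongrightarrow> a + f (U z)"
       "AE z in lborel. z \<in> ball p r0 --> (%n. dq e_x v n z) \<longlonglongrightarrow> b - U z"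
    proof -
      note g = gr[unfolded grad_on_def]
      show "AE z in lborel. z \<in> ball p r0 --> (%n. dq e_t v n z) \<longlonglongrightarrow> a + f (U z)"
        using g
      proof eventually_elim
        case (elim z)
        then show ?case
          unfolding dv dq_lin r0_def using tendsto_diff[OF tendsto_const, of "%n. dq e_t w n z" "- f (U z)" sequentially a] by auto
      qed
      show "AE z in lborel. z \<in> ball p r0 --> (%n. dq e_x v n z) \<longlonglongrightarrow> b - U z"
        using g
      proof eventually_elim
        case (elim z)
        then show ?case
          unfolding dv dq_lin r0_def by (auto intro: tendsto_diff[OF tendsto_const])
      qed
    qed
    define m where "m = pen v p eps \<delta>"
    define S where "S = (LBINT z. m z)"
    note pl = pen_integral_lower[OF vl vp e d(1)]
    have mi: "integrable lborel m" using pl(1) by (simp add: m_def)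
    have mm [measurable]: "m \<in> borel_measurable borel" using mi by auto
    have SK: "K0 * \<delta> ^ 3 \<le> S" using pl(2) unfolding S_def m_def K0_def .
    have "0 < K0 * \<delta> ^ 3" using d(1) K0 by simp
    then have S0: "S > 0" using SK by linarith
    note mb = pen_bounds[OF e(1) d(1), of v p, folded m_def]
    have I1: "\<bar>LBINT z. m z * (a + f (U z))\<bar> \<le> 2 * eps * S" unfolding m_def S_def
    proof (rule pen_deriv_average[OF vl vle e(1) d lims(1) dq_norm1(1) _ _ _ _ pl(1)])
      show "\<bar>a + f (U z)\<bar> \<le> \<bar>a\<bar> + F" for z using F[of z] by linarith
    qed (auto simp: abs_sgn_eq sgn_fst_measurable)
    have I2: "\<bar>LBINT z. m z * (b - U z)\<bar> \<le> 2 * eps * S" unfolding m_def S_def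
    proof (rule pen_deriv_average[OF vl vle e(1) d lims(2) dq_norm1(2) _ _ _ _ pl(1)])
      show "\<bar>b - U z\<bar> \<le> \<bar>b\<bar> + C" for z using U(2)[of z] by linarith
    qed (auto simp: abs_sgn_eq sgn_snd_measurable)
    define st sx :: "plane => real" where "st = (%z. sgn (fst z - fst p))" and "sx = (%z. sgn (snd z - snd p))"
    have sm [measurable]: "st \<in> borel_measurable borel" "sx \<in> borel_measurable borel"
      unfolding st_def sx_def by (rule sgn_fst_measurable sgn_snd_measurable)+
    have sb: "\<bar>st z\<bar> \<le> 1" "\<bar>sx z\<bar> \<le> 1" for z by (auto simp: st_def sx_def abs_sgn_eq)
    define Gt Gx where "Gt = (%z. 2 * m z * ((a + f (U z)) - 2 * eps * st z))"
      and "Gx = (%z. 2 * m z * ((b - U z) - 2 * eps * sx z))"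
    have lt: "AE z in lborel. (%n. dq e_t (%y. (m y)\<^sup>2) n z) \<longlonglongrightarrow> Gt z" unfolding m_def Gt_def st_def
      by (rule pen_dq[OF vl vle e(1) d lims(1) dq_norm1(1)])
    have lx: "AE z in lborel. (%n. dq e_x (%y. (m y)\<^sup>2) n z) \<longlonglongrightarrow> Gx z" unfolding m_def Gx_def sx_def
      by (rule pen_dq[OF vl vle e(1) d lims(2) dq_norm1(2)])
    obtain K where K: "K-lipschitz_on UNIV (%y. (m y)\<^sup>2)" using pen_square_lipschitz[OF vl e(1)] unfolding m_def by blast
    have zero: "m z = 0" if "z \<notin> cball p (\<rho> / 2)" for z
      using that norm_le_norm1[of "z - p"] unfolding m_def de[symmetric]
      by (intro pen_zero[OF e(1)]) (simp add: dist_norm norm_minus_commute)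
    have zero': "m z = 0" if "norm p + \<rho> < norm z" for z
      using that norm_triangle_ineq2[of z p] rho(1) by (intro zero) (simp add: dist_norm norm_minus_commute)
    define D where "D = 2 * \<delta> * (\<bar>a\<bar> + \<bar>b\<bar> + F + C + 2)"
    have D0: "0 \<le> F" "0 \<le> C" using F[of 0] U(2)[of 0] by linarith+
    have Db: "\<bar>2 * m z * (x - 2 * eps * s)\<bar> \<le> D" if "\<bar>x\<bar> \<le> \<bar>a\<bar> + \<bar>b\<bar> + F + C" "\<bar>s\<bar> \<le> 1" for z x s
    proof -
      have "\<bar>2 * eps * s\<bar> \<le> 2 * 1 * 1" unfolding abs_mult using that e by (intro mult_mono) auto
      then have "\<bar>x - 2 * eps * s\<bar> \<le> \<bar>a\<bar> + \<bar>b\<bar> + F + C + 2" using that by linarith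
      then have "\<bar>2 * m z\<bar> * \<bar>x - 2 * eps * s\<bar> \<le> (2 * \<delta>) * (\<bar>a\<bar> + \<bar>b\<bar> + F + C + 2)"
        using mb[of z] d(1) by (intro mult_mono) auto
      then show ?thesis by (simp add: D_def abs_mult)
    qed
    have ineq: "- (LBINT z. \<eta> (U z) * Gt z + q (U z) * Gx z) \<le> \<delta>\<^sup>2 * measure \<mu> (ball p \<rho>)"
    proof (rule lipschitz_test_measure_ineq[where A="%z. \<eta> (u z)" and B="%z. q (u z)" and \<Omega>=\<Omega> and s="\<rho>/2" and M=M and D=D and Q="norm p + \<rho>", OF _ rad Om _ _ _ _ _ _ _ _ _ K _ _ _ lt _ _ _ lx])
      show "weak_div \<Omega> (%z. \<eta> (u z)) (%z. q (u z)) phi \<le> integral\<^sup>L \<mu> phi"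
        if "phi \<in> test_functions \<Omega>" "\<forall>z. 0 \<le> phi z" for phi
        using wd that unfolding weak_div_le_measure_def by blast
      show "AE z in lborel. z \<in> cball p \<rho> --> \<eta> (u z) = \<eta> (U z) \<and> q (u z) = q (U z)"
        using uU by eventually_elim (use rho in \<open>auto simp: r0_def\<close>)
      show "\<rho> / 2 < \<rho>" using rho by simp
      show "cball p \<rho> \<subseteq> \<Omega>" using rho r1(2) by (auto simp: r0_def)
      show "(m z)\<^sup>2 \<le> \<delta>\<^sup>2" for z using mb[of z] by (simp add: power_mono)
      show "\<bar>Gt z\<bar> \<le> D" for z unfolding Gt_def using F[of z] D0 sb by (intro Db) auto
      show "\<bar>Gx z\<bar> \<le> D" for z unfolding Gx_def using U(2)[of z] D0 sb by (intro Db) auto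
      show "norm p + \<rho> < norm z ==> Gt z = 0" "norm p + \<rho> < norm z ==> Gx z = 0" for z
        using zero' by (simp_all add: Gt_def Gx_def)
      show "z \<notin> cball p (\<rho> / 2) ==> (m z)\<^sup>2 = 0" for z using zero by simp
      show "Gt \<in> borel_measurable borel" "Gx \<in> borel_measurable borel" unfolding Gt_def Gx_def by measurable
    qed (use M mU[OF ce] mU[OF cq] comp[OF ce] comp[OF cq] in auto)
    have U': "U \<in> borel_measurable lborel" by simp
    note int = integrable_weight_comp[OF mi U' U(2)]
    have i3: "integrable lborel (%z. m z * (\<eta> (U z) * (a + f (U z)) + q (U z) * (b - U z)))"
      by (rule int) (intro continuous_intros cf ce cq)
    define R where "R = (%z. \<eta> (U z) * st z + q (U z) * sx z)"
    have Rm [measurable]: "R \<in> borel_measurable borel" unfolding R_def by measurable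
    have Rb: "\<bar>R z\<bar> \<le> 2 * M" for z
    proof -
      have "\<bar>\<eta> (U z) * st z\<bar> \<le> M * 1" "\<bar>q (U z) * sx z\<bar> \<le> M * 1"
        unfolding abs_mult by (rule mult_mono[OF M(1) sb(1) M0 abs_ge_zero] mult_mono[OF M(2) sb(2) M0 abs_ge_zero])+
      then show ?thesis unfolding R_def by linarith
    qed
    have i4: "integrable lborel (%z. m z * R z)" by (rule integrable_mult_bounded[OF mi _ Rb]) simp
    have "(LBINT z. \<eta> (U z) * Gt z + q (U z) * Gx z)
      = (LBINT z. 2 * (m z * (\<eta> (U z) * (a + f (U z)) + q (U z) * (b - U z))) - 4 * eps * (m z * R z))"
      by (rule Bochner_Integration.integral_cong) (auto simp: Gt_def Gx_def R_def algebra_simps)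
    also have "\<dots> = 2 * (LBINT z. m z * (\<eta> (U z) * (a + f (U z)) + q (U z) * (b - U z))) - 4 * eps * (LBINT z. m z * R z)"
      using i3 i4 by simp
    finally have eq: "(LBINT z. \<eta> (U z) * Gt z + q (U z) * Gx z) = \<dots>" .
    have RS: "\<bar>LBINT z. m z * R z\<bar> \<le> 2 * M * S"
    proof -
      have "\<bar>LBINT z. m z * R z\<bar> \<le> (LBINT z. 2 * M * m z)"
      proof (rule order_trans[OF integral_abs_bound], rule integral_mono)
        show "\<bar>m z * R z\<bar> \<le> 2 * M * m z" for z using mb[of z] mult_left_mono[OF Rb[of z], of "m z"] by (simp add: abs_mult mult.commute)
      qed (use mi i4 in auto)
      then show ?thesis by (simp add: S_def)
    qed
    then have "\<bar>4 * eps * (LBINT z. m z * R z)\<bar> \<le> 4 * eps * (2 * M * S)"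
      unfolding abs_mult using e by (intro mult_mono) auto
    moreover have "\<delta>\<^sup>2 * measure \<mu> (ball p \<rho>) \<le> 2 * eps * S"
    proof -
      have "\<delta>\<^sup>2 * measure \<mu> (ball p \<rho>) \<le> \<delta>\<^sup>2 * (eps\<^sup>2 * K0 * \<rho>)" using mur by (intro mult_left_mono) auto
      also have "\<dots> = 2 * eps * (K0 * \<delta> ^ 3)" by (simp add: \<delta>_def power2_eq_square power3_eq_cube field_simps)
      also have "\<dots> \<le> 2 * eps * S" using SK e by (intro mult_left_mono) auto
      finally show ?thesis .
    qed
    ultimately have "- (eps * S + 4 * M * eps * S) \<le> (LBINT z. m z * (\<eta> (U z) * (a + f (U z)) + q (U z) * (b - U z)))"
      using ineq unfolding eq by (simp add: algebra_simps)
    then have I3: "- ((1 + 4 * M) * eps * S) \<le> (LBINT z. m z * (\<eta> (U z) * (a + f (U z)) + q (U z) * (b - U z)))"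
      by (simp add: algebra_simps)
    show "\<exists>m. integrable lborel m \<and> (\<forall>z. 0 \<le> m z) \<and> 0 < (LBINT z. m z) \<and>
        \<bar>LBINT z. m z * (a + f (U z))\<bar> \<le> 2 * eps * (LBINT z. m z) \<and>
        \<bar>LBINT z. m z * (b - U z)\<bar> \<le> 2 * eps * (LBINT z. m z) \<and>
        - ((1 + 4 * M) * eps * (LBINT z. m z)) \<le> (LBINT z. m z * (\<eta> (U z) * (a + f (U z)) + q (U z) * (b - U z)))"
      by (intro exI[of _ m] conjI allI mi mb(1) S0[unfolded S_def] I1[unfolded S_def] I2[unfolded S_def] I3[unfolded S_def])
  qed
qed

section \<open>Localising a potential\<close>

lemma lipschitz_extension_cball:
  fixes w :: "'a::euclidean_space => real"
  assumes w: "L-lipschitz_on (cball p r) w" and r: "r > 0"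
  obtains W where "L-lipschitz_on UNIV W" "!!z. z \<in> cball p r ==> W z = w z"
proof
  \<comment> \<open>The nearest-point projection onto a closed ball is 1-Lipschitz, so the constant
    \<open>L\<close> is kept.\<close>
  let ?c = "closest_point (cball p r)"
  have ne: "cball p r \<noteq> {}" using r by simp
  show "L-lipschitz_on UNIV (%z. w (?c z))"
  proof (rule lipschitz_onI)
    fix x y :: 'a
    have "dist (w (?c x)) (w (?c y)) \<le> L * dist (?c x) (?c y)"
      by (rule lipschitz_onD[OF w]) (use closest_point_in_set[OF closed_cball ne] in auto)
    also have "\<dots> \<le> L * dist x y"
      using closest_point_lipschitz[OF convex_cball closed_cball ne] lipschitz_on_nonneg[OF w] by (intro mult_left_mono)
    finally show "dist (w (?c x)) (w (?c y)) \<le> L * dist x y" .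
  qed (rule lipschitz_on_nonneg[OF w])
  show "w (?c z) = w z" if "z \<in> cball p r" for z using closest_point_self[OF that] by simp
qed

text \<open>Replaces a potential on \<open>V\<close> by a function that is Lipschitz on the plane,
  and \<open>u\<close> by its Borel representative. At points of the open ball the difference
  quotients of \<open>W\<close> and \<open>w\<close> eventually coincide, so the almost everywhere
  derivatives survive as \<open>grad_on\<close>.\<close>

lemma potential_local_grad:
  assumes w: "potential f V u w" and V: "open V" "p \<in> V"
    and sub: "cball p r1 \<subseteq> V" "r1 > 0" and uU: "AE z in lborel. z \<in> cball p r1 --> u z = U z"
  obtains W L where "L-lipschitz_on UNIV W" "!!z. z \<in> cball p r1 ==> W z = w z"
    "grad_on (ball p r1) W (%z. - f (U z)) U"
proof -
  obtain L where L: "L-lipschitz_on (cball p r1) w"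
    using Lip_loc_compact_lipschitz[OF _ compact_cball sub(1)] w unfolding potential_def by blast
  obtain W where W: "L-lipschitz_on UNIV W" "!!z. z \<in> cball p r1 ==> W z = w z"
    using lipschitz_extension_cball[OF L sub(2)] by blast
  have ae: "AE z in lborel. z \<in> V --> DERIV (%y. w (fst z, y)) (snd z) :> u z \<and>
     DERIV (%s. w (s, snd z)) (fst z) :> - f (u z)"
    using w unfolding potential_def AE_completion_iff by blast
  have "grad_on (ball p r1) W (%z. - f (U z)) U"
    unfolding grad_on_def using ae uU
  proof eventually_elim
    case (elim z)
    note a = elim(1) and b = elim(2)
    show ?case
    proof
      assume z: "z \<in> ball p r1"
      then have zc: "z \<in> cball p r1" by auto
      have d: "DERIV (%y. w (fst z, y)) (snd z) :> U z"
         "DERIV (%s. w (s, snd z)) (fst z) :> - f (U z)"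
        using a b zc sub(1) by auto
      have l: "(%n. dq e_t w n z) \<longlonglongrightarrow> - f (U z)" "(%n. dq e_x w n z) \<longlonglongrightarrow> U z"
        unfolding dq_e_t dq_e_x by (rule dq_limit_real, rule d)+
      have ev: "\<forall>\<^sub>F n in sequentially. dq e w n z = dq e W n z" for e
        using topological_tendstoD[OF shift_tendsto[of z e] open_ball z]
      proof eventually_elim
        case (elim n)
        then have "z + (1 / real (Suc n)) *\<^sub>R e \<in> cball p r1" by auto
        then show ?case unfolding dq_def using W(2) zc by simp
      qed
      show "(%n. dq e_t W n z) \<longlonglongrightarrow> - f (U z) \<and> (%n. dq e_x W n z) \<longlonglongrightarrow> U z"
        using tendsto_cong[OF ev, THEN iffD1, OF l(1)] tendsto_cong[OF ev, THEN iffD1, OF l(2)] by (rule conjI)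
    qed
  qed
  with W show thesis by (rule that)
qed

section \<open>Local existence of the potential\<close>

text \<open>For continuous \<open>g\<close> rational increments suffice: a non-strict estimate that
  fails does so on an open set of increments. The condition becomes a countable combination, so the
  set of points with a given section derivative is Borel, as Fubini's theorem requires.\<close>

lemma continuous_deriv_rational_criterion:
  fixes g :: "real => real"
  assumes c: "continuous_on UNIV g"
  shows "DERIV g x :> d \<longleftrightarrow>
    (\<forall>k::nat. \<exists>n::nat. \<forall>q::rat. \<bar>real_of_rat q\<bar> < 1 / real (Suc n) -->
        \<bar>g (x + real_of_rat q) - g x - real_of_rat q * d\<bar> \<le> \<bar>real_of_rat q\<bar> / real (Suc k))" (is "_ \<longleftrightarrow> ?R")
proof
  assume "DERIV g x :> d"
  then have L: "((%h. (g (x + h) - g x) / h) \<longlongrightarrow> d) (at 0)" by (simp add: DERIV_def)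
  show ?R
  proof
    fix k :: nat
    have "1 / real (Suc k) > 0" by simp
    then obtain \<delta> where d: "\<delta> > 0" "!!h. h \<noteq> 0 ==> norm (h - 0) < \<delta> ==> norm ((g (x + h) - g x) / h - d) < 1 / real (Suc k)"
      using L unfolding LIM_eq by blast
    obtain n where n: "1 / real (Suc n) < \<delta>" using nat_approx_posE[OF d(1)] by blast
    show "\<exists>n::nat. \<forall>q::rat. \<bar>real_of_rat q\<bar> < 1 / real (Suc n) -->
        \<bar>g (x + real_of_rat q) - g x - real_of_rat q * d\<bar> \<le> \<bar>real_of_rat q\<bar> / real (Suc k)"
    proof (intro exI allI impI)
      fix q :: rat assume q: "\<bar>real_of_rat q\<bar> < 1 / real (Suc n)"
      define h where "h = real_of_rat q"
      show "\<bar>g (x + real_of_rat q) - g x - real_of_rat q * d\<bar> \<le> \<bar>real_of_rat q\<bar> / real (Suc k)"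
      proof (cases "h = 0")
        case True then show ?thesis by (simp add: h_def)
      next
        case False
        have b: "\<bar>(g (x + h) - g x) / h - d\<bar> \<le> 1 / real (Suc k)" using d(2)[OF False] q n by (simp add: h_def)
        have e: "g (x + h) - g x - h * d = h * ((g (x + h) - g x) / h - d)" using False by (simp add: field_simps)
        have "\<bar>g (x + h) - g x - h * d\<bar> \<le> \<bar>h\<bar> * (1 / real (Suc k))"
          unfolding e abs_mult using b by (intro mult_left_mono) auto
        then show ?thesis by (simp add: h_def)
      qed
    qed
  qed
next
  assume R: ?R
  have "((%h. (g (x + h) - g x) / h) \<longlongrightarrow> d) (at 0)"
    unfolding LIM_eq
  proof (intro allI impI)
    fix e :: real assume "e > 0"
    then obtain k where k: "1 / real (Suc k) < e" using nat_approx_posE by blast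
    obtain n where n: "!!q::rat. \<bar>real_of_rat q\<bar> < 1 / real (Suc n) ==>
        \<bar>g (x + real_of_rat q) - g x - real_of_rat q * d\<bar> \<le> \<bar>real_of_rat q\<bar> / real (Suc k)" using R by blast
    have all: "\<bar>g (x + h) - g x - h * d\<bar> \<le> \<bar>h\<bar> / real (Suc k)" if h: "\<bar>h\<bar> < 1 / real (Suc n)" for h
    proof (rule ccontr)
      assume neg: "\<not> \<bar>g (x + h) - g x - h * d\<bar> \<le> \<bar>h\<bar> / real (Suc k)"
      define G where "G = (%h. \<bar>g (x + h) - g x - h * d\<bar> - \<bar>h\<bar> / real (Suc k))"
      have cG: "continuous_on UNIV G" unfolding G_def
        by (intro continuous_intros continuous_on_compose2[OF c]) auto
      have "open (G -` {0<..} \<inter> {y. \<bar>y\<bar> < 1 / real (Suc n)})"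
        by (intro open_Int open_vimage cG open_greaterThan open_Collect_less continuous_intros)
      moreover have "h \<in> G -` {0<..} \<inter> {y. \<bar>y\<bar> < 1 / real (Suc n)}" using neg h by (simp add: G_def)
      ultimately obtain r where r: "r > 0" "ball h r \<subseteq> G -` {0<..} \<inter> {y. \<bar>y\<bar> < 1 / real (Suc n)}"
        by (rule openE)
      obtain q where q: "h < real_of_rat q" "real_of_rat q < h + r" using of_rat_dense[of h "h + r"] r(1) by auto
      then have "real_of_rat q \<in> ball h r" by (simp add: dist_real_def)
      then have "G (real_of_rat q) > 0" "\<bar>real_of_rat q\<bar> < 1 / real (Suc n)" using r(2) by auto
      then show False using n[of q] by (simp add: G_def)
    qed
    show "\<exists>s>0. \<forall>h. h \<noteq> 0 \<and> norm (h - 0) < s --> norm ((g (x + h) - g x) / h - d) < e"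
    proof (intro exI[of _ "1 / real (Suc n)"] conjI allI impI)
      fix h :: real assume h: "h \<noteq> 0 \<and> norm (h - 0) < 1 / real (Suc n)"
      have e: "g (x + h) - g x - h * d = h * ((g (x + h) - g x) / h - d)" using h by (simp add: field_simps)
      have "\<bar>h\<bar> * \<bar>(g (x + h) - g x) / h - d\<bar> \<le> \<bar>h\<bar> * (1 / real (Suc k))"
        using all[of h] h unfolding e abs_mult by simp
      then have "\<bar>(g (x + h) - g x) / h - d\<bar> \<le> 1 / real (Suc k)" by (rule mult_left_le_imp_le) (use h in simp)
      then show "norm ((g (x + h) - g x) / h - d) < e" using k by simp
    qed simp
  qed
  then show "DERIV g x :> d" by (simp add: DERIV_def)
qed

lemma section_deriv_measurable:
  fixes w U :: "plane => real"
  assumes c: "continuous_on UNIV w" and U [measurable]: "U \<in> borel_measurable borel"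
  shows "{z. DERIV (%y. w (fst z, y)) (snd z) :> U z} \<in> sets borel"
proof -
  have [measurable]: "w \<in> borel_measurable borel" using c by (rule borel_measurable_continuous_onI)
  have e: "DERIV (%y. w (fst z, y)) (snd z) :> U z \<longleftrightarrow>
    (\<forall>k::nat. \<exists>n::nat. \<forall>q::rat. \<bar>real_of_rat q\<bar> < 1 / real (Suc n) -->
        \<bar>w (z + (0, real_of_rat q)) - w z - real_of_rat q * U z\<bar> \<le> \<bar>real_of_rat q\<bar> / real (Suc k))" for z
  proof -
    have "continuous_on UNIV (%y. w (fst z, y))" by (intro continuous_on_compose2[OF c] continuous_intros) auto
    from continuous_deriv_rational_criterion[OF this, of "U z" "snd z"] show ?thesis
      by (cases z) simp
  qed
  have "Measurable.pred borel (%z. \<forall>k::nat. \<exists>n::nat. \<forall>q::rat. \<bar>real_of_rat q\<bar> < 1 / real (Suc n) -->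
        \<bar>w (z + (0, real_of_rat q)) - w z - real_of_rat q * U z\<bar> \<le> \<bar>real_of_rat q\<bar> / real (Suc k))"
    by measurable
  then show ?thesis unfolding e by (simp add: pred_def)
qed

lemma interval_integral_bounded_borel:
  fixes g :: "real => real"
  assumes g: "g \<in> borel_measurable borel" "!!y. \<bar>g y\<bar> \<le> C"
  shows "set_integrable lborel {a..b} g" "g integrable_on {a..b}" "(LINT y:{a..b}|lborel. g y) = integral {a..b} g"
proof -
  show i: "set_integrable lborel {a..b} g"
    unfolding set_integrable_def
    by (rule integrable_bounded_support[where B=C and R="\<bar>a\<bar> + \<bar>b\<bar>"])
       (use g order_trans[OF abs_ge_zero g(2)[of 0]] in \<open>auto simp: indicator_def\<close>)
  show "g integrable_on {a..b}" "(LINT y:{a..b}|lborel. g y) = integral {a..b} g"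
    using set_borel_integral_eq_integral[OF i] by auto
qed

text \<open>L1 convergence on the plane gives, along a subsequence, L1 convergence on almost every
  line of fixed first coordinate. There the increments of \<open>w\<close> are integrals of
  \<open>U\<close>, and Lebesgue differentiation applies. The exceptional set is measurable, so its
  null sections make it null.\<close>

lemma section_derivative_AE:
  fixes v :: "nat => plane => real"
  assumes vc: "!!n. continuous_on UNIV (v n)" and vi: "!!n. integrable lborel (v n)" and vb: "!!n z. \<bar>v n z\<bar> \<le> C"
    and U: "U \<in> borel_measurable borel" "integrable lborel U" "!!z. \<bar>U z\<bar> \<le> C"
    and L1: "(%n. LBINT z. \<bar>v n z - U z\<bar>) \<longlonglongrightarrow> 0"
    and W: "!!n t x x'. t \<in> {t1..t2} ==> x1 \<le> x ==> x \<le> x' ==> x' \<le> x2 ==>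
           W n (t, x') - W n (t, x) = integral {x..x'} (%y. v n (t, y))"
    and lim: "!!z. z \<in> {t1..t2} \<times> {x1..x2} ==> (%n. W n z) \<longlonglongrightarrow> w z"
    and wc: "continuous_on ({t1..t2} \<times> {x1..x2}) w" and le: "t1 < t2" "x1 < x2"
  shows "AE z in lborel. z \<in> {t1<..<t2} \<times> {x1<..<x2} --> DERIV (%y. w (fst z, y)) (snd z) :> U z"
proof -
  \<comment> \<open>Clamping to the rectangle gives a continuous function on the whole plane, as the
    measurability lemma expects.\<close>
  define cl where "cl = (%z::real\<times>real. (max t1 (min t2 (fst z)), max x1 (min x2 (snd z))))"
  define w' where "w' = (%z. w (cl z))"
  have clK: "cl z \<in> {t1..t2} \<times> {x1..x2}" for z using le by (auto simp: cl_def)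
  have cle: "cl z = z" if "z \<in> {t1..t2} \<times> {x1..x2}" for z using that by (cases z) (auto simp: cl_def)
  have "continuous_on UNIV cl" unfolding cl_def by (intro continuous_intros)
  then have w'c: "continuous_on UNIV w'" unfolding w'_def by (rule continuous_on_compose2[OF wc]) (use clK in blast)
  note [measurable] = U(1)
  have [measurable]: "v n \<in> borel_measurable borel" for n using vc by (rule borel_measurable_continuous_onI)
  define H where "H = (%n z. v n z - U z)"
  have Hi: "integrable (lborel \<Otimes>\<^sub>M lborel) (%z. \<bar>H n z\<bar>)" for n
    using vi U(2) unfolding lborel_prod H_def by (intro integrable_abs) simp
  define g where "g = (%n s. LBINT y. \<bar>H n (s, y)\<bar>)"
  have gi: "integrable lborel (g n)" for n unfolding g_def by (rule lborel_pair.integrable_fst'[OF Hi])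
  have gI: "(LBINT s. g n s) = (LBINT z. \<bar>v n z - U z\<bar>)" for n
    using lborel_pair.integral_fst'[OF Hi[of n]] unfolding g_def lborel_prod by (simp add: H_def)
  have g0: "0 \<le> g n s" for n s unfolding g_def by simp
  have "(%n. LBINT s. norm (g n s)) \<longlonglongrightarrow> 0" using L1 g0 by (simp add: gI)
  then obtain r where r: "strict_mono r" "AE s in lborel. (%n. g (r n) s) \<longlonglongrightarrow> 0"
    using tendsto_L1_AE_subseq[of lborel g] gi by blast
  have "AE s in lborel. \<forall>n. integrable lborel (%y. \<bar>H n (s, y)\<bar>)"
    unfolding AE_all_countable using lborel_pair.AE_integrable_fst'[OF Hi] by blast
  with r(2) have sec: "AE s in lborel. s \<in> {t1<..<t2} -->
     (AE y in lborel. y \<in> {x1<..<x2} --> DERIV (%y. w' (s, y)) y :> U (s, y))"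
  proof eventually_elim
    case (elim s)
    note gl = elim(1) and Hs = elim(2)
    show ?case
    proof
      assume s: "s \<in> {t1<..<t2}"
      have Us: "(%y. U (s, y)) \<in> borel_measurable borel" by measurable
      have vs: "(%y. v n (s, y)) \<in> borel_measurable borel" for n by measurable
      note IU = interval_integral_bounded_borel[OF Us U(3)]
      note Iv = interval_integral_bounded_borel[OF vs vb]
      have eq: "w (s, x') - w (s, x) = integral {x..x'} (%y. U (s, y))" if x: "x1 \<le> x" "x \<le> x'" "x' \<le> x2" for x x'
      proof (rule LIMSEQ_unique)
        have K: "(s, x) \<in> {t1..t2} \<times> {x1..x2}" "(s, x') \<in> {t1..t2} \<times> {x1..x2}" using s x by auto
        have "(%n. W n (s, x') - W n (s, x)) \<longlonglongrightarrow> w (s, x') - w (s, x)" by (intro tendsto_diff lim K)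
        then show "(%n. W (r n) (s, x') - W (r n) (s, x)) \<longlonglongrightarrow> w (s, x') - w (s, x)"
          using LIMSEQ_subseq_LIMSEQ[OF _ r(1)] by (auto simp: o_def)
        have "\<bar>(W n (s, x') - W n (s, x)) - integral {x..x'} (%y. U (s, y))\<bar> \<le> g n s" for n
        proof -
          have "W n (s, x') - W n (s, x) = integral {x..x'} (%y. v n (s, y))" using s x by (intro W) auto
          then have "(W n (s, x') - W n (s, x)) - integral {x..x'} (%y. U (s, y))
             = (LINT y:{x..x'}|lborel. v n (s, y)) - (LINT y:{x..x'}|lborel. U (s, y))"
            by (simp add: IU(3) Iv(3))
          also have "\<dots> = (LINT y:{x..x'}|lborel. H n (s, y))" unfolding H_def
            using set_integral_diff(2)[OF Iv(1) IU(1), of x x'] by simp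
          also have "\<bar>\<dots>\<bar> \<le> (LBINT y. \<bar>indicator {x..x'} y *\<^sub>R H n (s, y)\<bar>)"
            unfolding set_lebesgue_integral_def by (rule integral_abs_bound)
          also have "\<dots> \<le> g n s" unfolding g_def
            by (rule integral_mono') (use Hs in \<open>auto simp: indicator_def\<close>)
          finally show ?thesis .
        qed
        then have "(%n. (W (r n) (s, x') - W (r n) (s, x)) - integral {x..x'} (%y. U (s, y))) \<longlonglongrightarrow> 0"
          by (intro Lim_null_comparison[OF _ gl]) auto
        then show "(%n. W (r n) (s, x') - W (r n) (s, x)) \<longlonglongrightarrow> integral {x..x'} (%y. U (s, y))"
          by (simp add: LIM_zero_iff)
      qed
      have "negligible {y \<in> {x1<..<x2}. \<not> DERIV (%y. integral {x1..y} (%y. U (s, y))) y :> U (s, y)}"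
        by (rule lebesgue_differentiation_real[OF IU(2)])
      then have "AE y in lebesgue. y \<notin> {y \<in> {x1<..<x2}. \<not> DERIV (%y. integral {x1..y} (%y. U (s, y))) y :> U (s, y)}"
        unfolding negligible_iff_null_sets by (rule AE_not_in)
      then have "AE y in lborel. y \<notin> {y \<in> {x1<..<x2}. \<not> DERIV (%y. integral {x1..y} (%y. U (s, y))) y :> U (s, y)}"
        by (simp only: AE_completion_iff)
      then show "AE y in lborel. y \<in> {x1<..<x2} --> DERIV (%y. w' (s, y)) y :> U (s, y)"
      proof eventually_elim
        case (elim y)
        note a = elim
        show ?case
        proof
          assume y: "y \<in> {x1<..<x2}"
          then have "DERIV (%y. integral {x1..y} (%y. U (s, y))) y :> U (s, y)" using a by blast
          then have d: "DERIV (%y. w (s, x1) + integral {x1..y} (%y. U (s, y))) y :> U (s, y)"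
            by (auto intro!: derivative_eq_intros)
          have "\<forall>\<^sub>F y' in nhds y. w' (s, y') = w (s, x1) + integral {x1..y'} (%y. U (s, y))"
            unfolding eventually_nhds
          proof (intro exI[of _ "{x1<..<x2}"] conjI ballI)
            fix y' assume "y' \<in> {x1<..<x2}"
            then show "w' (s, y') = w (s, x1) + integral {x1..y'} (%y. U (s, y))"
              using eq[of x1 y'] s by (simp add: w'_def cle)
          qed (use y in auto)
          with d show "DERIV (%y. w' (s, y)) y :> U (s, y)" by (rule DERIV_transform_nhds)
        qed
      qed
    qed
  qed
  define P where "P = (%z. z \<in> {t1<..<t2} \<times> {x1<..<x2} --> DERIV (%y. w' (fst z, y)) (snd z) :> U z)"
  have "{z. P z} = - ({t1<..<t2} \<times> {x1<..<x2}) \<union> {z. DERIV (%y. w' (fst z, y)) (snd z) :> U z}"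
    by (auto simp: P_def)
  moreover have "- ({t1<..<t2} \<times> {x1<..<x2}) \<in> sets borel" by (intro borel_closed) (simp add: closed_def open_Times)
  ultimately have Pm: "{z. P z} \<in> sets borel" using section_deriv_measurable[OF w'c U(1)] by auto
  have "AE z in lborel \<Otimes>\<^sub>M lborel. P z"
  proof (rule lborel_pair.AE_pair_measure)
    show "{z \<in> space (lborel \<Otimes>\<^sub>M lborel). P z} \<in> sets (lborel \<Otimes>\<^sub>M lborel)" using Pm unfolding lborel_prod by simp
    show "AE s in lborel. AE y in lborel. P (s, y)"
      using sec by eventually_elim (auto simp: P_def)
  qed
  then have "AE z in lborel. P z" unfolding lborel_prod .
  then show ?thesis
  proof eventually_elim
    case (elim z)
    note Pz = elim
    show ?case
    proof
      assume z: "z \<in> {t1<..<t2} \<times> {x1<..<x2}"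
      then have "DERIV (%y. w' (fst z, y)) (snd z) :> U z" using Pz by (simp add: P_def)
      moreover have "\<forall>\<^sub>F y in nhds (snd z). w (fst z, y) = w' (fst z, y)"
        unfolding eventually_nhds
        by (intro exI[of _ "{x1<..<x2}"] conjI ballI) (use z in \<open>auto simp: w'_def cle\<close>)
      ultimately show "DERIV (%y. w (fst z, y)) (snd z) :> U z" by (rule DERIV_transform_nhds)
    qed
  qed
qed

lemma lborel_swap: "distr lborel borel prod.swap = (lborel :: (plane) measure)"
proof -
  have "distr (lborel \<Otimes>\<^sub>M lborel) (lborel \<Otimes>\<^sub>M lborel) (%(x, y). (y, x)) = (lborel \<Otimes>\<^sub>M lborel :: (plane) measure)"
    using lborel_pair.distr_pair_swap[where ?'a=real and ?'b=real] by simp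
  then have "distr lborel lborel (%(x, y). (y, x)) = (lborel :: (plane) measure)" by (simp add: lborel_prod)
  moreover have "prod.swap = (%(x::real, y::real). (y, x))" by (auto simp: fun_eq_iff)
  moreover have "distr lborel borel (%(x, y). (y, x)) = distr (lborel :: (plane) measure) lborel (%(x, y). (y, x))"
    by (intro distr_cong) auto
  ultimately show ?thesis by simp
qed

lemma swap_measurable [measurable]: "prod.swap \<in> borel_measurable (borel :: (plane) measure)"
  by (intro borel_measurable_continuous_onI) (simp add: prod.swap_def continuous_intros)

lemma lborel_swap_integral:
  fixes g :: "plane => real"
  assumes [measurable]: "g \<in> borel_measurable borel"
  shows "(LBINT z. g (prod.swap z)) = (LBINT z. g z)" "integrable lborel (%z. g (prod.swap z)) \<longleftrightarrow> integrable lborel g"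
proof -
  have "(\<integral>z. g z \<partial>distr lborel borel prod.swap) = (LBINT z. g (prod.swap z))"
    by (subst integral_distr) auto
  then show "(LBINT z. g (prod.swap z)) = (LBINT z. g z)" by (simp add: lborel_swap)
  have "integrable (distr lborel borel prod.swap) g \<longleftrightarrow> integrable lborel (%z. g (prod.swap z))"
    by (subst integrable_distr_eq) auto
  then show "integrable lborel (%z. g (prod.swap z)) \<longleftrightarrow> integrable lborel g" by (simp add: lborel_swap)
qed

lemma AE_lborel_swap:
  assumes "AE z in lborel. P (z :: plane)"
  shows "AE z in lborel. P (prod.swap z)"
proof -
  obtain N where N: "{z. \<not> P z} \<subseteq> N" "N \<in> null_sets lborel" using assms by (auto elim!: AE_E simp: null_sets_def)
  have "AE z in distr lborel borel prod.swap. z \<notin> N" unfolding lborel_swap using N(2) by (rule AE_not_in)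
  then have "AE z in lborel. prod.swap z \<notin> N" by (rule AE_distrD[rotated]) simp
  then show ?thesis by eventually_elim (use N(1) in auto)
qed

text \<open>The test function is the mollifier seen from \<open>z\<close>, that is
  \<open>moll h (z - y)\<close> as a function of \<open>y\<close>; its partials are the reflected
  ones with a minus sign. This makes the mollified pair satisfy the law pointwise.\<close>

lemma mollified_conservation_law:
  assumes h: "h > 0" and p: "has_partials (moll h) phit phix" "bump_fun phit" "bump_fun phix"
    and wd: "!!phi phit phix. bump_fun phi ==> bump_fun phit ==> bump_fun phix ==> has_partials phi phit phix ==> (!!z. z \<notin> cball p0 R ==> phi z = 0) ==>
          (LBINT z. U z * phit z + F z * phix z) = 0"
    and i: "integrable lborel U" "integrable lborel F" and z: "cball z h \<subseteq> cball p0 R"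
  shows "conv U phit z + conv F phix z = 0"
proof -
  have "z' \<notin> cball p0 R ==> moll h (z - z') = 0" for z'
  proof (rule moll_zero[OF h])
    assume "z' \<notin> cball p0 R"
    then have "z' \<notin> cball z h" using z by blast
    then show "h \<le> norm (z - z')" by (simp add: dist_norm)
  qed
  moreover have nb: "bump_fun (%y. - phi (z - y))" if b: "bump_fun phi" for phi
  proof -
    obtain f g R where fg: "smooth1 f" "smooth1 g" "(%y. phi (z - y)) = (%z. f (fst z) * g (snd z))"
      and R: "!!y. R < norm y ==> phi (z - y) = 0"
      using bump_fun_reflect[OF b, of z] unfolding bump_fun_def by blast
    have "smooth1 (%s. (-1) * f s)" by (intro smooth1.intros fg)
    moreover have "(%y. - phi (z - y)) = (%y. ((-1) * f (fst y)) * g (snd y))" using fg(3) by (simp add: fun_eq_iff)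
    moreover have "\<forall>y. R < norm y --> - phi (z - y) = 0" using R by simp
    ultimately show ?thesis unfolding bump_fun_def using fg(2) by blast
  qed
  ultimately have "(LBINT y. U y * (- phit (z - y)) + F y * (- phix (z - y))) = 0"
    by (intro wd[OF bump_fun_reflect[OF moll_bump_fun[OF h]] nb nb has_partials_reflect[OF p(1)]] p(2,3))
  moreover have "(LBINT y. U y * (- phit (z - y)) + F y * (- phix (z - y))) = - (conv U phit z + conv F phix z)"
  proof -
    have prod: "integrable lborel (%y. G y * phi (z - y))" if "integrable lborel G" "bump_fun phi" for G phi
    proof -
      have b: "bump_fun (%y. phi (z - y))" by (rule bump_fun_reflect[OF that(2)])
      obtain C where C: "!!y. \<bar>phi (z - y)\<bar> \<le> C" using bump_fun_bounded[OF b] by blast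
      have "(%y. phi (z - y)) \<in> borel_measurable lborel" using borel_measurable_continuous_onI[OF bump_fun_continuous[OF b]] by simp
      then show ?thesis using that(1) C by (intro integrable_mult_bounded)
    qed
    show ?thesis unfolding conv_def using prod[OF i(1) p(2)] prod[OF i(2) p(3)] by simp
  qed
  ultimately show ?thesis by simp
qed

text \<open>The line integral of \<open>V dx - G dt\<close> from \<open>(t1, x1)\<close>: first in
  time along the edge \<open>x = x1\<close>, then in space at the final time. The minus sign
  anticipates that the time derivative is \<open>- f(u)\<close>.\<close>

definition rect_potential :: "real => real => (plane => real) => (plane => real) => plane => real" where
  "rect_potential t1 x1 V G z = integral {x1..snd z} (%y. V (fst z, y)) - integral {t1..fst z} (%s. G (s, x1))"

text \<open>Space increments are immediate from the path. For time increments differentiate under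
  the integral and replace \<open>Vt\<close> by \<open>- Gx\<close>: the space integral reduces to
  boundary values, and the one at \<open>x1\<close> cancels against the edge integral.\<close>

lemma rect_potential_diff:
  assumes V: "has_partials V Vt Vx" "continuous_on UNIV V" "continuous_on UNIV Vt"
    and G: "has_partials G Gt Gx" "continuous_on UNIV G" "continuous_on UNIV Gx"
    and eq: "!!t x. t \<in> {t1..t2} ==> x \<in> {x1..x2} ==> Vt (t, x) + Gx (t, x) = 0"
  shows "x1 \<le> x ==> x \<le> x' ==> rect_potential t1 x1 V G (t, x') - rect_potential t1 x1 V G (t, x) = integral {x..x'} (%y. V (t, y))"
    "x \<in> {x1..x2} ==> t1 \<le> t ==> t \<le> t' ==> t' \<le> t2 ==>
      rect_potential t1 x1 V G (t', x) - rect_potential t1 x1 V G (t, x) = integral {t..t'} (%s. - G (s, x))"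
proof -
  have secx: "continuous_on S (%y. X (t, y))" and sect: "continuous_on S (%s. X (s, x))"
    if "continuous_on UNIV X" for X :: "plane => real" and t x S
    by (auto intro!: continuous_on_compose2[OF that] continuous_intros)
  show "rect_potential t1 x1 V G (t, x') - rect_potential t1 x1 V G (t, x) = integral {x..x'} (%y. V (t, y))"
    if "x1 \<le> x" "x \<le> x'" for x x'
  proof -
    have "(%y. V (t, y)) integrable_on {x1..x'}" by (rule integrable_continuous_real[OF secx[OF V(2)]])
    from Henstock_Kurzweil_Integration.integral_combine[OF that this] show ?thesis by (simp add: rect_potential_def)
  qed
  show "rect_potential t1 x1 V G (t', x) - rect_potential t1 x1 V G (t, x) = integral {t..t'} (%s. - G (s, x))"
    if x: "x \<in> {x1..x2}" and t: "t1 \<le> t" "t \<le> t'" "t' \<le> t2"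
  proof -
    define phi where "phi = (%s. integral {x1..x} (%y. V (s, y)))"
    have der: "(phi has_vector_derivative (- G (s, x) + G (s, x1))) (at s within {t..t'})" if s: "s \<in> {t..t'}" for s
    proof -
      have "((%s. integral (cbox x1 x) (%y. V (s, y))) has_field_derivative integral (cbox x1 x) (%y. Vt (s, y))) (at s within {t..t'})"
      proof (rule leibniz_rule_field_derivative)
        show "((%s. V (s, y)) has_real_derivative Vt (s, y)) (at s within {t..t'})" for s y
          using V(1) by (simp add: has_partials_def has_field_derivative_at_within)
        show "(%y. V (s, y)) integrable_on cbox x1 x" for s
          using integrable_continuous_real[OF secx[OF V(2)]] by simp
        show "continuous_on ({t..t'} \<times> cbox x1 x) (%(s, y). Vt (s, y))"
          using continuous_on_subset[OF V(3)] by (simp add: case_prod_beta)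
      qed (use s in auto)
      moreover have "integral (cbox x1 x) (%y. Vt (s, y)) = - G (s, x) + G (s, x1)"
      proof -
        have "((%y. Gx (s, y)) has_integral (G (s, x) - G (s, x1))) {x1..x}"
        proof (rule fundamental_theorem_of_calculus)
          show "((%y. G (s, y)) has_vector_derivative Gx (s, y)) (at y within {x1..x})" for y
            using G(1) unfolding has_partials_def has_real_derivative_iff_has_vector_derivative[symmetric]
            by (simp add: has_field_derivative_at_within)
        qed (use x in auto)
        then have "integral {x1..x} (%y. Gx (s, y)) = G (s, x) - G (s, x1)" by (rule integral_unique)
        moreover have "integral {x1..x} (%y. Vt (s, y)) = integral {x1..x} (%y. - Gx (s, y))"
        proof (rule Henstock_Kurzweil_Integration.integral_cong)
          fix y assume "y \<in> {x1..x}"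
          then show "Vt (s, y) = - Gx (s, y)" using eq[of s y] s t x by auto
        qed
        ultimately show ?thesis by simp
      qed
      ultimately show ?thesis unfolding phi_def has_real_derivative_iff_has_vector_derivative[symmetric] by simp
    qed
    have "((%s. - G (s, x) + G (s, x1)) has_integral (phi t' - phi t)) {t..t'}"
      using der by (intro fundamental_theorem_of_calculus t(2))
    then have 1: "integral {t..t'} (%s. - G (s, x) + G (s, x1)) = phi t' - phi t" by (rule integral_unique)
    have i: "(%s. - G (s, x)) integrable_on {t..t'}" "(%s. G (s, x1)) integrable_on {t..t'}"
      by (intro integrable_continuous_real continuous_intros sect[OF G(2)])+
    have 2: "integral {t..t'} (%s. - G (s, x)) + integral {t..t'} (%s. G (s, x1)) = phi t' - phi t"
      using 1 Henstock_Kurzweil_Integration.integral_add[OF i] by simp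
    have "(%s. G (s, x1)) integrable_on {t1..t'}" by (rule integrable_continuous_real[OF sect[OF G(2)]])
    from Henstock_Kurzweil_Integration.integral_combine[OF t(1,2) this] 2
    show ?thesis by (simp add: rect_potential_def phi_def)
  qed
qed

lemma conv_moll_abs_bound:
  fixes g :: "plane => real"
  assumes g: "integrable lborel g" and h: "h > 0" and b: "!!z. \<bar>g z\<bar> \<le> c"
  shows "\<bar>conv g (moll h) z\<bar> \<le> c"
proof -
  have [measurable]: "g \<in> borel_measurable borel" using g by auto
  note [measurable] = moll_measurable[OF h]
  have "\<bar>LBINT y. g (z - y) * moll h y\<bar> \<le> (LBINT y. \<bar>g (z - y) * moll h y\<bar>)" by (rule integral_abs_bound)
  also have "\<dots> \<le> (LBINT y. c * moll h y)"
  proof (rule integral_mono')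
    show "\<bar>g (z - y) * moll h y\<bar> \<le> c * moll h y" for y
      using mult_right_mono[OF b moll_nonneg[OF h]] moll_nonneg[OF h, of y] by (simp add: abs_mult)
  qed (use moll_integrable[OF h] order_trans[OF abs_ge_zero b[of 0]] moll_nonneg[OF h] in auto)
  finally show ?thesis using moll_integral[OF h] by (simp add: conv_flip)
qed

lemma rectangle_lipschitz:
  fixes W :: "plane => real"
  assumes x: "!!t x x'. t \<in> {t1..t2} ==> x1 \<le> x ==> x \<le> x' ==> x' \<le> x2 ==> \<bar>W (t, x') - W (t, x)\<bar> \<le> D * (x' - x)"
    and t: "!!t t' x. x \<in> {x1..x2} ==> t1 \<le> t ==> t \<le> t' ==> t' \<le> t2 ==> \<bar>W (t', x) - W (t, x)\<bar> \<le> D * (t' - t)"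
    and D: "0 \<le> D"
  shows "(2 * D)-lipschitz_on ({t1..t2} \<times> {x1..x2}) W"
proof (rule lipschitz_onI)
  fix z z' assume "z \<in> {t1..t2} \<times> {x1..x2}" "z' \<in> {t1..t2} \<times> {x1..x2}"
  then obtain a b a' b' where z: "z = (a, b)" "z' = (a', b')" "a \<in> {t1..t2}" "a' \<in> {t1..t2}" "b \<in> {x1..x2}" "b' \<in> {x1..x2}" by auto
  have 1: "\<bar>W (a, b) - W (a, b')\<bar> \<le> D * \<bar>b - b'\<bar>"
    using x[of a b b'] x[of a b' b] z by (cases "b \<le> b'") (auto simp: abs_minus_commute)
  have 2: "\<bar>W (a, b') - W (a', b')\<bar> \<le> D * \<bar>a - a'\<bar>"
    using t[of b' a a'] t[of b' a' a] z by (cases "a \<le> a'") (auto simp: abs_minus_commute)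
  have n: "\<bar>a - a'\<bar> \<le> dist z z'" "\<bar>b - b'\<bar> \<le> dist z z'"
    using dist_fst_le[of z z'] dist_snd_le[of z z'] by (auto simp: z dist_real_def)
  have "D * \<bar>b - b'\<bar> \<le> D * dist z z'" "D * \<bar>a - a'\<bar> \<le> D * dist z z'" using n D by (auto intro: mult_left_mono)
  then show "dist (W z) (W z') \<le> 2 * D * dist z z'" using 1 2 by (simp add: dist_real_def z)
qed (use D in simp)

lemma box_ball:
  fixes p z :: "plane"
  assumes "z \<in> {fst p - r..fst p + r} \<times> {snd p - r..snd p + r}" shows "dist p z \<le> 2 * r"
proof -
  have "\<bar>fst (z - p)\<bar> \<le> r" "\<bar>snd (z - p)\<bar> \<le> r" using assms by auto
  then show ?thesis using norm_le_norm1[of "z - p"] by (simp add: norm1_def dist_norm norm_minus_commute)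
qed

lemma ball_box:
  fixes p z :: "plane"
  assumes "dist p z < r" shows "z \<in> {fst p - r<..<fst p + r} \<times> {snd p - r<..<snd p + r}"
  using assms dist_fst_le[of p z] dist_snd_le[of p z] by (cases z) (auto simp: dist_real_def)

lemma mo_tail_L1:
  fixes G :: "plane => real"
  assumes "G \<in> borel_measurable borel" "!!z. \<bar>G z\<bar> \<le> B" "!!z. R < norm z ==> G z = 0" and k: "strict_mono k"
  shows "(%n. LBINT z. \<bar>conv G (mo (k n + n0)) z - G z\<bar>) \<longlonglongrightarrow> 0"
proof -
  have "strict_mono (%n. k n + n0)" using k by (auto simp: strict_mono_def)
  from LIMSEQ_subseq_LIMSEQ[OF conv_mo_L1[OF assms(1-3)] this] show ?thesis by (simp add: o_def)
qed

text \<open>\<open>u\<close> and \<open>f u\<close> are mollified separately, so the linear relation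
  between their derivatives holds exactly and the mollified form is closed. Its line integrals are
  Lipschitz with a uniform constant, hence a subsequence converges uniformly, and the limit has the
  right derivatives by L1 convergence of the mollifications.\<close>

lemma local_potential:
  assumes f: "Lip_loc UNIV f" and Om: "open \<Omega>" and u: "Linf_loc \<Omega> u"
    and wd: "weak_div_eq_0 \<Omega> u (%p. f (u p))" and p0: "p0 \<in> \<Omega>"
  shows "\<exists>r w. r > 0 \<and> ball p0 r \<subseteq> \<Omega> \<and> potential f (ball p0 r) u w"
proof -
  have cf: "continuous_on UNIV f" by (rule Lip_loc_continuous[OF f])
  have OmL: "\<Omega> \<in> sets lebesgue" using Om by simp
  obtain R where R: "R > 0" "cball p0 R \<subseteq> \<Omega>" using Om p0 open_contains_cball by blast
  \<comment> \<open>Points of the rectangle with half-side \<open>r\<close> are within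
    \<open>2 * r\<close> of \<open>p0\<close>; one more \<open>r\<close> bounds the mollification
    radius, and \<open>3 * r < R\<close>.\<close>
  define r where "r = R / 4"
  have r: "r > 0" using R by (simp add: r_def)
  obtain v C where v: "v \<in> borel_measurable borel" "0 \<le> C" "!!z. \<bar>v z\<bar> \<le> C" "AE z in lborel. z \<in> cball p0 R --> u z = v z"
    using Linf_loc_borel[OF u OmL compact_cball R(2)] by metis
  obtain CF where CF: "0 \<le> CF" "!!z. \<bar>f (v z)\<bar> \<le> CF" using continuous_bounded_comp[where U=v, OF cf v(3)] by blast
  define U F where "U = (%z. if z \<in> cball p0 R then v z else 0)" and "F = (%z. if z \<in> cball p0 R then f (v z) else 0)"
  define D where "D = max C CF"
  have D0: "0 \<le> D" using v(2) by (simp add: D_def)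
  note [measurable] = v(1)
  have [measurable]: "(%z. f (v z)) \<in> borel_measurable borel"
    using measurable_compose[OF v(1) borel_measurable_continuous_onI[OF cf]] .
  have Um [measurable]: "U \<in> borel_measurable borel" and Fm [measurable]: "F \<in> borel_measurable borel"
    unfolding U_def F_def by (intro measurable_If_set; simp)+
  have Ub: "\<bar>U z\<bar> \<le> D" and Fb: "\<bar>F z\<bar> \<le> D" for z
    using v(2) v(3)[of z] CF(1) CF(2)[of z] by (auto simp: U_def F_def D_def)
  have out: "z \<notin> cball p0 R" if "norm p0 + R < norm z" for z
    using that norm_triangle_ineq2[of z p0] by (auto simp: dist_norm norm_minus_commute)
  have Us: "norm p0 + R < norm z ==> U z = 0" and Fs: "norm p0 + R < norm z ==> F z = 0" for z
    using out[of z] by (auto simp: U_def F_def)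
  have Ui: "integrable lborel U" and Fi: "integrable lborel F"
    using integrable_bounded_support[OF Um Ub Us] integrable_bounded_support[OF Fm Fb Fs] by auto
  have mu: "u \<in> borel_measurable (lebesgue_on \<Omega>)" using u by (simp add: Linf_loc_def)
  have mfu: "(%z. f (u z)) \<in> borel_measurable (lebesgue_on \<Omega>)"
    using measurable_compose[OF mu borel_measurable_continuous_onI[OF cf]] .
  have wz: "(LBINT z. U z * phit z + F z * phix z) = 0"
    if b: "bump_fun phi" "bump_fun phit" "bump_fun phix" "has_partials phi phit phix" and z: "!!z. z \<notin> cball p0 R ==> phi z = 0" for phi phit phix
  proof -
    have "phi \<in> test_functions \<Omega>" by (rule bump_test_function[OF b(1) z R(2)])
    then have "weak_div \<Omega> u (%p. f (u p)) phi = 0" using wd unfolding weak_div_eq_0_def by blast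
    moreover have "weak_div \<Omega> u (%p. f (u p)) phi = - (LBINT z. U z * phit z + F z * phix z)"
    proof (rule weak_div_lborel[OF OmL closed_cball R(2) z b(4) _ _ mu mfu Um Fm])
      show "AE z in lborel. z \<in> cball p0 R --> u z = U z \<and> f (u z) = F z"
        using v(4) by eventually_elim (auto simp: U_def F_def)
    qed (use bump_fun_continuous b in auto)
    ultimately show ?thesis by simp
  qed
  define t1 t2 x1 x2 where "t1 = fst p0 - r" and "t2 = fst p0 + r" and "x1 = snd p0 - r" and "x2 = snd p0 + r"
  define K where "K = {t1..t2} \<times> {x1..x2}"
  have le: "t1 < t2" "x1 < x2" using r by (auto simp: t1_def t2_def x1_def x2_def)
  obtain n0 where n0: "1 / real (Suc n0) < r" using nat_approx_posE[OF r] by blast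
  define Vn Fn where "Vn = (%n. conv U (mo (n + n0)))" and "Fn = (%n. conv F (mo (n + n0)))"
  define W where "W = (%n. rect_potential t1 x1 (Vn n) (Fn n))"
  have main: "continuous_on UNIV (Vn n) \<and> continuous_on UNIV (Fn n) \<and> integrable lborel (Vn n) \<and> integrable lborel (Fn n) \<and>
     (\<forall>z. \<bar>Vn n z\<bar> \<le> D) \<and> (\<forall>z. \<bar>Fn n z\<bar> \<le> D) \<and>
     (\<forall>t x x'. t \<in> {t1..t2} --> x1 \<le> x --> x \<le> x' --> x' \<le> x2 --> W n (t, x') - W n (t, x) = integral {x..x'} (%y. Vn n (t, y))) \<and>
     (\<forall>t t' x. x \<in> {x1..x2} --> t1 \<le> t --> t \<le> t' --> t' \<le> t2 --> W n (t', x) - W n (t, x) = integral {t..t'} (%s. - Fn n (s, x)))" for n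
  proof -
    define h where "h = 1 / real (Suc (n + n0))"
    have h: "h > 0" by (simp add: h_def)
    have "h \<le> 1 / real (Suc n0)" by (simp add: h_def frac_le)
    then have hr: "h < r" using n0 by simp
    have mo: "mo (n + n0) = moll h" by (simp add: mo_def h_def)
    obtain phit phix where p: "bump_fun phit" "bump_fun phix" "has_partials (moll h) phit phix"
      "has_partials (conv U (moll h)) (conv U phit) (conv U phix)"
      using conv_bump_partials[OF Ui moll_bump_fun[OF h]] .
    obtain phit' phix' where p': "bump_fun phit'" "bump_fun phix'" "has_partials (moll h) phit' phix'"
      "has_partials (conv F (moll h)) (conv F phit') (conv F phix')"
      using conv_bump_partials[OF Fi moll_bump_fun[OF h]] .
    \<comment> \<open>Both lists are the partials of the same mollifier, so they coincide; without
      this the two convolutions could not be combined.\<close>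
    have same: "phit' = phit" "phix' = phix" using has_partials_d[OF p(3)] has_partials_d[OF p'(3)] by auto
    have eq: "conv U phit (t, x) + conv F phix (t, x) = 0" if tx: "t \<in> {t1..t2}" "x \<in> {x1..x2}" for t x
    proof (rule mollified_conservation_law[OF h p(3,1,2) wz Ui Fi])
      have d: "dist p0 (t, x) \<le> 2 * r" using tx by (intro box_ball) (auto simp: t1_def t2_def x1_def x2_def)
      show "cball (t, x) h \<subseteq> cball p0 R"
      proof
        fix y assume "y \<in> cball (t, x) h"
        then show "y \<in> cball p0 R" using d hr r dist_triangle[of p0 y "(t, x)"] by (simp add: r_def)
      qed
    qed
    note cb = conv_bump_continuous
    note rp = rect_potential_diff[where ?t1.0=t1 and ?t2.0=t2 and ?x1.0=x1 and ?x2.0=x2, OF p(4) cb[OF Ui moll_bump_fun[OF h]] cb[OF Ui p(1)] p'(4)[unfolded same] cb[OF Fi moll_bump_fun[OF h]] cb[OF Fi p(2)] eq]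
    show ?thesis unfolding Vn_def Fn_def W_def mo
    proof (intro conjI allI impI)
      show "continuous_on UNIV (conv U (moll h))" "continuous_on UNIV (conv F (moll h))"
        by (rule cb[OF Ui moll_bump_fun[OF h]], rule cb[OF Fi moll_bump_fun[OF h]])
      show "integrable lborel (conv U (moll h))" "integrable lborel (conv F (moll h))"
        by (rule conv_moll_contraction(1)[OF Ui h], rule conv_moll_contraction(1)[OF Fi h])
      show "\<bar>conv U (moll h) z\<bar> \<le> D" "\<bar>conv F (moll h) z\<bar> \<le> D" for z
        by (rule conv_moll_abs_bound[OF Ui h Ub], rule conv_moll_abs_bound[OF Fi h Fb])
    qed (rule rp; assumption)+
  qed
  have Vc: "continuous_on UNIV (Vn n)" and Fc: "continuous_on UNIV (Fn n)" and Vi: "integrable lborel (Vn n)"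
    and Fni: "integrable lborel (Fn n)" for n using main[of n] by blast+
  have Vb: "\<bar>Vn n z\<bar> \<le> D" and Fnb: "\<bar>Fn n z\<bar> \<le> D" for n z using main[of n] by blast+
  have Wx: "W n (t, x') - W n (t, x) = integral {x..x'} (%y. Vn n (t, y))"
    if "t \<in> {t1..t2}" "x1 \<le> x" "x \<le> x'" "x' \<le> x2" for n t x x' using main[of n] that by blast
  have Wt: "W n (t', x) - W n (t, x) = integral {t..t'} (%s. - Fn n (s, x))"
    if "x \<in> {x1..x2}" "t1 \<le> t" "t \<le> t'" "t' \<le> t2" for n t t' x using main[of n] that by blast
  have ib: "\<bar>integral {a..b} g\<bar> \<le> D * (b - a)" if "a \<le> b" "continuous_on {a..b} g" "!!s. \<bar>g s\<bar> \<le> D" for a b and g :: "real => real"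
    using integral_bound[OF that(1,2), of D] that(3) by simp
  have sec: "continuous_on S (%y. X (t, y))" "continuous_on S (%s. X (s, x))"
    if "continuous_on UNIV X" for X :: "plane => real" and t x S
    by (rule continuous_on_compose2[OF that], intro continuous_intros, simp)+
  have Wlip: "(2 * D)-lipschitz_on K (W n)" for n
    unfolding K_def
  proof (rule rectangle_lipschitz[OF _ _ D0])
    fix t x x' assume a: "t \<in> {t1..t2}" "x1 \<le> x" "x \<le> x'" "x' \<le> x2"
    show "\<bar>W n (t, x') - W n (t, x)\<bar> \<le> D * (x' - x)" unfolding Wx[OF a] by (rule ib[OF a(3) sec(1)[OF Vc] Vb])
  next
    fix t t' x assume a: "x \<in> {x1..x2}" "t1 \<le> t" "t \<le> t'" "t' \<le> t2"
    have c: "continuous_on {t..t'} (%s. - Fn n (s, x))" by (intro continuous_intros sec(2) Fc)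
    show "\<bar>W n (t', x) - W n (t, x)\<bar> \<le> D * (t' - t)" unfolding Wt[OF a] by (rule ib[OF a(3) c]) (use Fnb in simp)
  qed
  have Kc: "compact K" unfolding K_def by (intro compact_Times compact_Icc)
  have W0: "W n (t1, x1) = 0" for n by (simp add: W_def rect_potential_def)
  have c0: "(t1, x1) \<in> K" using le by (simp add: K_def)
  obtain B where B0: "\<forall>y\<in>K. dist (t1, x1) y \<le> B"
    using compact_imp_bounded[OF Kc] bounded_any_center[of K "(t1, x1)"] by blast
  then have B: "dist z (t1, x1) \<le> B" if "z \<in> K" for z using that by (simp add: dist_commute)
  obtain w k where wk: "continuous_on K w" "strict_mono (k :: nat => nat)"
     "!!e. 0 < e ==> \<exists>N. \<forall>n z. n \<ge> N \<and> z \<in> K --> norm (W (k n) z - w z) < e"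
  proof (rule Arzela_Ascoli[OF Kc, of W "2 * D * B"])
    fix n z assume z: "z \<in> K"
    have "norm (W n z) \<le> 2 * D * dist z (t1, x1)" using lipschitz_onD[OF Wlip[of n] z c0] W0 by (simp add: dist_real_def)
    also have "\<dots> \<le> 2 * D * B" using B[OF z] D0 by (intro mult_left_mono) auto
    finally show "norm (W n z) \<le> 2 * D * B" .
  next
    fix z and e :: real assume z: "z \<in> K" and e: "0 < e"
    show "\<exists>d>0. \<forall>n y. y \<in> K \<and> norm (z - y) < d --> norm (W n z - W n y) < e"
    proof (intro exI[of _ "e / (2 * D + 1)"] conjI allI impI)
      show "0 < e / (2 * D + 1)" using e D0 by simp
      fix n y assume y: "y \<in> K \<and> norm (z - y) < e / (2 * D + 1)"
      have "norm (W n z - W n y) \<le> 2 * D * norm (z - y)" using lipschitz_onD[OF Wlip[of n] z] y by (simp add: dist_norm)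
      also have "\<dots> \<le> (2 * D + 1) * norm (z - y)" by (intro mult_right_mono) auto
      also have "\<dots> < e" using y D0 by (simp add: field_simps)
      finally show "norm (W n z - W n y) < e" .
    qed
  qed (rule that)
  have lim: "(%n. W (k n) z) \<longlonglongrightarrow> w z" if "z \<in> K" for z
  proof (rule LIMSEQ_I)
    fix e :: real assume "0 < e"
    from wk(3)[OF this] obtain N where "\<forall>n z. n \<ge> N \<and> z \<in> K --> norm (W (k n) z - w z) < e" by (rule exE)
    then show "\<exists>N. \<forall>n\<ge>N. norm (W (k n) z - w z) < e" using that by blast
  qed
  have wlip: "(2 * D)-lipschitz_on K w"
  proof (rule lipschitz_onI)
    fix z y assume zy: "z \<in> K" "y \<in> K"
    have "(%n. dist (W (k n) z) (W (k n) y)) \<longlonglongrightarrow> dist (w z) (w y)" using lim zy by (intro tendsto_dist)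
    then show "dist (w z) (w y) \<le> 2 * D * dist z y"
      by (rule LIMSEQ_le_const2) (intro exI[of _ 0] allI impI lipschitz_onD[OF Wlip zy])
  qed (use D0 in simp)
  have dx: "AE z in lborel. z \<in> {t1<..<t2} \<times> {x1<..<x2} --> DERIV (%y. w (fst z, y)) (snd z) :> U z"
  proof (rule section_derivative_AE[where v="%n. Vn (k n)" and W="%n. W (k n)" and C=D, OF Vc Vi Vb Um Ui Ub _ Wx lim[unfolded K_def] wk(1)[unfolded K_def] le])
    show "(%n. LBINT z. \<bar>Vn (k n) z - U z\<bar>) \<longlonglongrightarrow> 0"
      unfolding Vn_def by (rule mo_tail_L1[OF Um Ub Us wk(2)])
  qed
  have dt: "AE z in lborel. z \<in> {t1<..<t2} \<times> {x1<..<x2} --> DERIV (%s. w (s, snd z)) (fst z) :> - F z"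
  proof -
    have cs: "continuous_on UNIV (%z. X (prod.swap z))" if "continuous_on UNIV X" for X :: "plane => real"
      by (rule continuous_on_compose2[OF that]) (auto simp: prod.swap_def intro!: continuous_intros)
    \<comment> \<open>The time derivative is the same statement with the coordinates exchanged and
      with \<open>- F\<close> in the role of \<open>U\<close>.\<close>
    have "AE z in lborel. z \<in> {x1<..<x2} \<times> {t1<..<t2} --> DERIV (%y. w (prod.swap (fst z, y))) (snd z) :> (- F (prod.swap z))"
    proof (rule section_derivative_AE[where v="%n z. - Fn (k n) (prod.swap z)" and W="%n z. W (k n) (prod.swap z)" and C=D and U="%z. - F (prod.swap z)"])
      show "continuous_on UNIV (%z. - Fn (k n) (prod.swap z))" for n by (intro continuous_intros cs Fc)
      show "integrable lborel (%z. - Fn (k n) (prod.swap z))" for n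
        using Fni lborel_swap_integral(2)[OF borel_measurable_continuous_onI[OF Fc]] by simp
      show "\<bar>- Fn (k n) (prod.swap z)\<bar> \<le> D" for n z using Fnb[of "k n" "prod.swap z"] by simp
      show "(%z. - F (prod.swap z)) \<in> borel_measurable borel" by measurable
      show "integrable lborel (%z. - F (prod.swap z))" using lborel_swap_integral(2)[OF Fm] Fi by simp
      show "\<bar>- F (prod.swap z)\<bar> \<le> D" for z using Fb by simp
      have "(%n. LBINT z. \<bar>Fn (k n) z - F z\<bar>) \<longlonglongrightarrow> 0"
        unfolding Fn_def by (rule mo_tail_L1[OF Fm Fb Fs wk(2)])
      moreover have "(LBINT z. \<bar>- Fn (k n) (prod.swap z) - - F (prod.swap z)\<bar>) = (LBINT z. \<bar>Fn (k n) z - F z\<bar>)" for n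
      proof -
        have m: "(%z. \<bar>Fn (k n) z - F z\<bar>) \<in> borel_measurable borel"
          using borel_measurable_continuous_onI[OF Fc[of "k n"]] by measurable
        have "(LBINT z. \<bar>- Fn (k n) (prod.swap z) - - F (prod.swap z)\<bar>) = (LBINT z. \<bar>Fn (k n) (prod.swap z) - F (prod.swap z)\<bar>)"
          by (rule Bochner_Integration.integral_cong) auto
        then show ?thesis using lborel_swap_integral(1)[OF m] by simp
      qed
      ultimately show "(%n. LBINT z. \<bar>- Fn (k n) (prod.swap z) - - F (prod.swap z)\<bar>) \<longlonglongrightarrow> 0" by simp
      show "continuous_on ({x1..x2} \<times> {t1..t2}) (%z. w (prod.swap z))"
        by (rule continuous_on_compose2[OF wk(1)]) (auto simp: prod.swap_def K_def intro!: continuous_intros)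
      show "W (k n) (prod.swap (t, x')) - W (k n) (prod.swap (t, x)) = integral {x..x'} (%y. - Fn (k n) (prod.swap (t, y)))"
        if "t \<in> {x1..x2}" "t1 \<le> x" "x \<le> x'" "x' \<le> t2" for n t x x'
        using Wt[OF that] by simp
      show "(%n. W (k n) (prod.swap z)) \<longlonglongrightarrow> w (prod.swap z)" if "z \<in> {x1..x2} \<times> {t1..t2}" for z
        by (rule lim) (use that in \<open>auto simp: K_def\<close>)
    qed (rule le)+
    from AE_lborel_swap[OF this] show ?thesis by eventually_elim auto
  qed
  have "potential f (ball p0 r) u w"
    unfolding potential_def
  proof
    have bK: "ball p0 r \<subseteq> K"
    proof
      fix z assume "z \<in> ball p0 r"
      then have "dist p0 z < r" by simp
      from ball_box[OF this] show "z \<in> K" by (auto simp: K_def t1_def t2_def x1_def x2_def)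
    qed
    show "Lip_loc (ball p0 r) w"
      unfolding Lip_loc_def
    proof
      fix z assume "z \<in> ball p0 r"
      have "(2 * D)-lipschitz_on (cball z 1 \<inter> ball p0 r) w"
        using wlip by (rule lipschitz_on_subset) (use bK in blast)
      then show "\<exists>s>0. \<exists>L. L-lipschitz_on (cball z s \<inter> ball p0 r) w" using zero_less_one by blast
    qed
    have "AE z in lborel. z \<in> ball p0 r --> DERIV (%y. w (fst z, y)) (snd z) :> u z \<and>
        DERIV (%s. w (s, snd z)) (fst z) :> - f (u z)"
      using dx dt v(4)
    proof eventually_elim
      case (elim z)
      note a = elim(1-3)
      show ?case
      proof
        assume "z \<in> ball p0 r"
        then have d: "dist p0 z < r" by simp
        then have "z \<in> cball p0 R" using R(1) by (simp add: r_def)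
        then have "U z = u z" "F z = f (u z)" using a(3) by (auto simp: U_def F_def)
        then show "DERIV (%y. w (fst z, y)) (snd z) :> u z \<and>
          DERIV (%s. w (s, snd z)) (fst z) :> - f (u z)"
          using a(1,2) ball_box[OF d] unfolding t1_def t2_def x1_def x2_def by auto
      qed
    qed
    then show "AE p in lebesgue. p \<in> ball p0 r -->
        DERIV (%y. w (fst p, y)) (snd p) :> u p \<and>
        DERIV (%s. w (s, snd p)) (fst p) :> - f (u p)" by (rule AE_completion)
  qed
  moreover have "ball p0 r \<subseteq> \<Omega>" using R by (auto simp: r_def)
  ultimately show ?thesis using r by blast
qed

section \<open>Gluing local potentials\<close>

lemma continuous_AE_zero:
  fixes h :: "real => real"
  assumes c: "continuous_on {a<..<b} h" and ae: "AE s in lborel. s \<in> {a<..<b} --> h s = 0" and s: "s \<in> {a<..<b}"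
  shows "h s = 0"
proof (rule ccontr)
  assume n: "h s \<noteq> 0"
  have "open ({a<..<b} \<inter> h -` (- {0}))" by (rule continuous_open_preimage[OF c]) auto
  then obtain r where r: "r > 0" "ball s r \<subseteq> {a<..<b} \<inter> h -` (- {0})" using n s by (auto elim: openE)
  obtain N where N: "{s. \<not> (s \<in> {a<..<b} --> h s = 0)} \<subseteq> N" "N \<in> null_sets lborel"
    using ae by (auto elim!: AE_E simp: null_sets_def)
  have "ball s r \<subseteq> N" using r(2) N(1) by blast
  then have "emeasure lborel (ball s r) \<le> emeasure lborel N" using N(2) by (intro emeasure_mono) auto
  then have "emeasure lborel (ball s r) = 0" using N(2) by auto
  then have "measure lborel (ball s r) = 0" by (simp add: measure_def)
  then show False using content_ball_pos[OF r(1), of s] by simp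
qed

text \<open>Fubini's theorem yields constancy on almost every section only; continuity of the
  difference in \<open>s\<close> extends it to every \<open>s\<close> in the open interval.\<close>

lemma section_constant:
  fixes d :: "plane => real"
  assumes l: "L-lipschitz_on ({t1..t2} \<times> {x1..x2}) d"
    and ae: "AE z in lborel. z \<in> {t1<..<t2} \<times> {x1<..<x2} --> DERIV (%y. d (fst z, y)) (snd z) :> 0"
    and s: "s \<in> {t1<..<t2}" and x: "x \<in> {x1..x2}" "x' \<in> {x1..x2}"
  shows "d (s, x) = d (s, x')"
proof -
  have main: "d (s, x) = d (s, x')" if x: "x1 \<le> x" "x \<le> x'" "x' \<le> x2" for x x'
  proof -
    have "AE z in lborel \<Otimes>\<^sub>M lborel. z \<in> {t1<..<t2} \<times> {x1<..<x2} --> DERIV (%y. d (fst z, y)) (snd z) :> 0"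
      unfolding lborel_prod by (rule ae)
    from lborel_pair.AE_pair[OF this]
    have "AE s in lborel. AE y in lborel. (s, y) \<in> {t1<..<t2} \<times> {x1<..<x2} --> DERIV (%v. d (s, v)) y :> 0"
      unfolding fst_conv snd_conv .
    then have "AE s in lborel. s \<in> {t1<..<t2} --> d (s, x) - d (s, x') = 0"
    proof eventually_elim
      case (elim s)
      note a = elim
      show ?case
      proof
        assume s: "s \<in> {t1<..<t2}"
        have ls: "L-lipschitz_on {x..x'} (%y. d (s, y))"
        proof (rule lipschitz_onI)
          fix y y' assume "y \<in> {x..x'}" "y' \<in> {x..x'}"
          then have "dist (d (s, y)) (d (s, y')) \<le> L * dist (s, y) (s, y')" using s x by (intro lipschitz_onD[OF l]) auto
          then show "dist (d (s, y)) (d (s, y')) \<le> L * dist y y'" by (simp add: dist_Pair_Pair)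
        qed (rule lipschitz_on_nonneg[OF l])
        \<comment> \<open>Used with \<open>\<sigma>\<close> equal to 1 and to -1: monotone in both
          directions means constant.\<close>
        have le: "\<sigma> * d (s, x) \<le> \<sigma> * d (s, x')" for \<sigma>
        proof (rule lipschitz_AE_deriv_nonneg_mono[OF x(2) lipschitz_on_cmult_real[OF ls]])
          show "AE y in lborel. y \<in> {x<..<x'} --> (\<exists>e\<ge>0. DERIV (%y. \<sigma> * d (s, y)) y :> e)"
            using a
          proof eventually_elim
            case (elim y)
            note b = elim
            show ?case
            proof
              assume "y \<in> {x<..<x'}"
              then have "(s, y) \<in> {t1<..<t2} \<times> {x1<..<x2}" using s x by simp
              then have "DERIV (%y. d (s, y)) y :> 0" using b by blast
              from DERIV_cmult[OF this, of \<sigma>] have "DERIV (%y. \<sigma> * d (s, y)) y :> 0" unfolding mult_zero_right .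
              then have "(0::real) \<le> 0 \<and> DERIV (%y. \<sigma> * d (s, y)) y :> 0" by (rule conjI[OF order_refl])
              then show "\<exists>e\<ge>0. DERIV (%y. \<sigma> * d (s, y)) y :> e" by (rule exI)
            qed
          qed
        qed
        show "d (s, x) - d (s, x') = 0" using le[of 1] le[of "-1"] by simp
      qed
    qed
    note z = this
    have c: "continuous_on {t1<..<t2} (%s. d (s, x) - d (s, x'))"
    proof (rule continuous_on_diff)
      have *: "continuous_on {t1<..<t2} (%s. d (s, y))" if "y \<in> {x1..x2}" for y
      proof (rule continuous_on_compose2[OF lipschitz_on_continuous_on[OF l]])
        show "continuous_on {t1<..<t2} (%s. (s, y))" by (intro continuous_intros)
        show "(%s. (s, y)) ` {t1<..<t2} \<subseteq> {t1..t2} \<times> {x1..x2}" using that by auto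
      qed
      show "continuous_on {t1<..<t2} (%s. d (s, x))" "continuous_on {t1<..<t2} (%s. d (s, x'))"
        using x by (auto intro: *)
    qed
    show ?thesis using continuous_AE_zero[OF c z s] by simp
  qed
  show ?thesis
  proof (cases "x \<le> x'")
    case True then show ?thesis using main x by auto
  next
    case False
    have "d (s, x') = d (s, x)" using False x by (intro main) auto
    then show ?thesis by (rule sym)
  qed
qed

lemma potential_AE:
  "potential f V u w ==> AE z in lborel. z \<in> V --> DERIV (%y. w (fst z, y)) (snd z) :> u z \<and>
     DERIV (%s. w (s, snd z)) (fst z) :> - f (u z)"
  unfolding potential_def AE_completion_iff by blast

text \<open>The difference of two potentials has vanishing partials almost everywhere. It is
  constant on space sections and, after exchanging coordinates, on time sections of a small
  rectangle, and two such segments join \<open>z\<close> to \<open>p\<close>.\<close>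

lemma potential_unique_local:
  assumes w1: "potential f V1 u w1" and w2: "potential f V2 u w2" and V: "open V1" "open V2" "p \<in> V1" "p \<in> V2"
  shows "\<exists>s>0. \<forall>z\<in>ball p s. w1 z - w2 z = w1 p - w2 p"
proof -
  have "open (V1 \<inter> V2)" "p \<in> V1 \<inter> V2" using V by auto
  then obtain R where R: "R > 0" "cball p R \<subseteq> V1 \<inter> V2" using open_contains_cball by blast
  define r where "r = R / 2"
  define t1 t2 x1 x2 where "t1 = fst p - r" and "t2 = fst p + r" and "x1 = snd p - r" and "x2 = snd p + r"
  have r: "r > 0" using R by (simp add: r_def)
  have sub: "{t1..t2} \<times> {x1..x2} \<subseteq> V1 \<inter> V2"
  proof
    fix z assume "z \<in> {t1..t2} \<times> {x1..x2}"
    then have "dist p z \<le> 2 * r" unfolding t1_def t2_def x1_def x2_def by (rule box_ball)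
    then show "z \<in> V1 \<inter> V2" using R(2) by (auto simp: r_def)
  qed
  define d where "d = (%z. w1 z - w2 z)"
  have Kc: "compact ({t1..t2} \<times> {x1..x2})" by (intro compact_Times compact_Icc)
  obtain L1 where L1: "L1-lipschitz_on ({t1..t2} \<times> {x1..x2}) w1"
    using Lip_loc_compact_lipschitz[OF _ Kc] w1 sub unfolding potential_def by blast
  obtain L2 where L2: "L2-lipschitz_on ({t1..t2} \<times> {x1..x2}) w2"
    using Lip_loc_compact_lipschitz[OF _ Kc] w2 sub unfolding potential_def by blast
  have l: "(L1 + L2)-lipschitz_on ({t1..t2} \<times> {x1..x2}) d" unfolding d_def by (rule lipschitz_on_diff[OF L1 L2])
  have both: "AE z in lborel. z \<in> {t1<..<t2} \<times> {x1<..<x2} --> DERIV (%y. d (fst z, y)) (snd z) :> 0 \<and>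
     DERIV (%s. d (s, snd z)) (fst z) :> 0"
    using potential_AE[OF w1] potential_AE[OF w2]
  proof eventually_elim
    case (elim z)
    note a = elim(1) and b = elim(2)
    show ?case
    proof
      assume "z \<in> {t1<..<t2} \<times> {x1<..<x2}"
      then have "z \<in> {t1..t2} \<times> {x1..x2}" by (cases z) auto
      then have "z \<in> V1" "z \<in> V2" using sub by auto
      with a b have e: "DERIV (%y. w1 (fst z, y)) (snd z) :> u z" "DERIV (%s. w1 (s, snd z)) (fst z) :> - f (u z)"
        "DERIV (%y. w2 (fst z, y)) (snd z) :> u z" "DERIV (%s. w2 (s, snd z)) (fst z) :> - f (u z)" by auto
      show "DERIV (%y. d (fst z, y)) (snd z) :> 0 \<and> DERIV (%s. d (s, snd z)) (fst z) :> 0"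
        unfolding d_def using DERIV_diff[OF e(1,3)] DERIV_diff[OF e(2,4)] by simp
    qed
  qed
  have bx: "AE z in lborel. z \<in> {t1<..<t2} \<times> {x1<..<x2} --> DERIV (%y. d (fst z, y)) (snd z) :> 0"
    using both by eventually_elim simp
  have secx: "d (s, x) = d (s, x')" if "s \<in> {t1<..<t2}" "x \<in> {x1..x2}" "x' \<in> {x1..x2}" for s x x'
    by (rule section_constant[where d=d, OF l bx that])
  have l': "(L1 + L2)-lipschitz_on ({x1..x2} \<times> {t1..t2}) (%z. d (prod.swap z))"
  proof (rule lipschitz_onI)
    fix z y assume "z \<in> {x1..x2} \<times> {t1..t2}" "y \<in> {x1..x2} \<times> {t1..t2}"
    then have "dist (d (prod.swap z)) (d (prod.swap y)) \<le> (L1 + L2) * dist (prod.swap z) (prod.swap y)"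
      by (intro lipschitz_onD[OF l]) auto
    moreover have "dist (prod.swap z) (prod.swap y) = dist z y" by (cases z; cases y) (simp add: dist_Pair_Pair add.commute)
    ultimately show "dist (d (prod.swap z)) (d (prod.swap y)) \<le> (L1 + L2) * dist z y" by simp
  qed (rule lipschitz_on_nonneg[OF l])
  have sect: "d (s, x) = d (s', x)" if "x \<in> {x1<..<x2}" "s \<in> {t1..t2}" "s' \<in> {t1..t2}" for s s' x
  proof -
    have "AE z in lborel. z \<in> {x1<..<x2} \<times> {t1<..<t2} --> DERIV (%y. d (prod.swap (fst z, y))) (snd z) :> 0"
      using AE_lborel_swap[OF both] by eventually_elim auto
    from section_constant[where d="%z. d (prod.swap z)", OF l' this that] show ?thesis by simp
  qed
  have "d z = d p" if z: "z \<in> ball p r" for z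
  proof -
    have b: "z \<in> {t1<..<t2} \<times> {x1<..<x2}" using ball_box[of p z r] z by (simp add: t1_def t2_def x1_def x2_def)
    have "d (fst z, snd z) = d (fst z, snd p)" using b r by (intro secx) (auto simp: x1_def x2_def)
    also have "\<dots> = d (fst p, snd p)" using b r by (intro sect) (auto simp: t1_def t2_def x1_def x2_def)
    finally show ?thesis by simp
  qed
  then show ?thesis using r unfolding d_def by blast
qed

text \<open>Countably many of the balls already cover \<open>V\<close> by Lindelof's theorem, so the
  null sets of the local potentials have a null union.\<close>

lemma potential_local_to_global:
  assumes V: "open V"
    and loc: "!!p. p \<in> V ==> \<exists>\<sigma>>0. \<exists>w' c. ball p \<sigma> \<subseteq> V \<and> potential f (ball p \<sigma>) u w' \<and> (\<forall>z\<in>ball p \<sigma>. w z = w' z + c)"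
  shows "potential f V u w"
proof -
  obtain \<sigma> w' c where s: "!!p. p \<in> V ==> \<sigma> p > 0" "!!p. p \<in> V ==> ball p (\<sigma> p) \<subseteq> V"
     "!!p. p \<in> V ==> potential f (ball p (\<sigma> p)) u (w' p)"
     "!!p z. p \<in> V ==> z \<in> ball p (\<sigma> p) ==> w z = w' p z + c p"
    using loc by metis
  have lip: "Lip_loc V w" unfolding Lip_loc_def
  proof
    fix p assume p: "p \<in> V"
    then have "p \<in> ball p (\<sigma> p)" using s(1) by simp
    then obtain r L where r: "r > 0" "L-lipschitz_on (cball p r \<inter> ball p (\<sigma> p)) (w' p)"
      using s(3)[OF p] unfolding potential_def Lip_loc_def by blast
    define q where "q = min r (\<sigma> p / 2)"
    have q: "q > 0" "cball p q \<subseteq> cball p r \<inter> ball p (\<sigma> p)" using r s(1)[OF p] by (auto simp: q_def)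
    have "L-lipschitz_on (cball p q \<inter> V) w"
    proof (rule lipschitz_onI)
      fix x y assume "x \<in> cball p q \<inter> V" "y \<in> cball p q \<inter> V"
      then have xy: "x \<in> cball p r \<inter> ball p (\<sigma> p)" "y \<in> cball p r \<inter> ball p (\<sigma> p)" using q(2) by auto
      then have "w x = w' p x + c p" "w y = w' p y + c p" using s(4)[OF p] by auto
      then show "dist (w x) (w y) \<le> L * dist x y" using lipschitz_onD[OF r(2) xy] by (simp add: dist_real_def)
    qed (rule lipschitz_on_nonneg[OF r(2)])
    then show "\<exists>r>0. \<exists>L. L-lipschitz_on (cball p r \<inter> V) w" using q(1) by blast
  qed
  define BB where "BB = (%p. ball p (\<sigma> p)) ` V"
  obtain F' where F': "F' \<subseteq> BB" "countable F'" "\<Union> F' = \<Union> BB"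
    by (rule Lindelof[of BB]) (auto simp: BB_def)
  obtain A where A: "A \<subseteq> V" "countable A" "F' = (%p. ball p (\<sigma> p)) ` A"
    using F'(1,2) countable_subset_image[of F' "%p. ball p (\<sigma> p)" V] unfolding BB_def by blast
  have cov: "\<exists>p\<in>A. z \<in> ball p (\<sigma> p)" if "z \<in> V" for z
  proof -
    have "z \<in> \<Union> BB" using that s(1)[OF that] by (auto simp: BB_def intro!: bexI[of _ z])
    then obtain X where "X \<in> F'" "z \<in> X" using F'(3) by blast
    then show ?thesis using A(3) by blast
  qed
  have "AE z in lborel. \<forall>p\<in>A. z \<in> ball p (\<sigma> p) --> DERIV (%y. w' p (fst z, y)) (snd z) :> u z \<and>
     DERIV (%s. w' p (s, snd z)) (fst z) :> - f (u z)"
    using potential_AE[OF s(3)] A(1,2) by (subst AE_ball_countable) auto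
  then have "AE z in lborel. z \<in> V --> DERIV (%y. w (fst z, y)) (snd z) :> u z \<and>
     DERIV (%s. w (s, snd z)) (fst z) :> - f (u z)"
  proof eventually_elim
    case (elim z)
    note a = elim
    show ?case
    proof
      assume "z \<in> V"
      then obtain p where p: "p \<in> A" "z \<in> ball p (\<sigma> p)" using cov by blast
      have pV: "p \<in> V" using p A by blast
      have d: "DERIV (%y. w' p (fst z, y) + c p) (snd z) :> u z"
        "DERIV (%s. w' p (s, snd z) + c p) (fst z) :> - f (u z)"
        using a p by (auto intro!: derivative_eq_intros)
      have op: "open ((%y. (fst z, y)) -` ball p (\<sigma> p))" "open ((%s. (s, snd z)) -` ball p (\<sigma> p))"
        by (rule open_vimage[OF open_ball], intro continuous_intros)+
      have ev1: "\<forall>\<^sub>F y in nhds (snd z). w (fst z, y) = w' p (fst z, y) + c p"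
        unfolding eventually_nhds using op(1) p(2) s(4)[OF pV] by (intro exI[of _ "(%y. (fst z, y)) -` ball p (\<sigma> p)"] conjI ballI) simp_all
      have ev2: "\<forall>\<^sub>F s in nhds (fst z). w (s, snd z) = w' p (s, snd z) + c p"
        unfolding eventually_nhds using op(2) p(2) s(4)[OF pV] by (intro exI[of _ "(%s. (s, snd z)) -` ball p (\<sigma> p)"] conjI ballI) simp_all
      show "DERIV (%y. w (fst z, y)) (snd z) :> u z \<and> DERIV (%s. w (s, snd z)) (fst z) :> - f (u z)"
        by (rule conjI[OF DERIV_transform_nhds[OF d(1) ev1] DERIV_transform_nhds[OF d(2) ev2]])
    qed
  qed
  from AE_completion[OF this] lip show ?thesis unfolding potential_def by (rule conjI[rotated])
qed

text \<open>A locally defined additive cocycle on the unit ball is a coboundary: sum it along a fine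
  subdivision of the ray from the centre. On a smaller closed ball the mesh can be chosen uniformly.\<close>

lemma glue_on_unit_ball:
  fixes g :: "'a::euclidean_space => 'a => real" and r :: "'a => real"
  assumes r: "!!x. x \<in> ball 0 1 ==> 0 < r x"
    and comp: "!!x y. x \<in> ball 0 1 ==> y \<in> ball 0 1 ==> \<exists>c. \<forall>z\<in>ball x (r x) \<inter> ball y (r y). g x z = g y z + c"
  obtains W where "!!x. x \<in> ball 0 1 ==> \<exists>c. \<exists>s>0. \<forall>z\<in>ball x s. W z = g x z + c"
proof -
  \<comment> \<open>The increment of a local function from \<open>a\<close> to \<open>b\<close>. By
    \<open>dl\<close> the choice of the ball does not matter, since any two local functions differ
    by a constant on their overlap; for pairs in no common ball the value is arbitrary.\<close>
  define \<delta> where "\<delta> = (%a b. SOME v. \<exists>z\<in>ball 0 1. a \<in> ball z (r z) \<and> b \<in> ball z (r z) \<and> v = g z b - g z a)"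
  have dl: "\<delta> a b = g z b - g z a" if z: "z \<in> ball 0 1" "a \<in> ball z (r z)" "b \<in> ball z (r z)" for a b z
  proof -
    have "\<exists>z\<in>ball 0 1. a \<in> ball z (r z) \<and> b \<in> ball z (r z) \<and> \<delta> a b = g z b - g z a"
      unfolding \<delta>_def by (rule someI_ex) (use that in blast)
    then obtain z' where z': "z' \<in> ball 0 1" "a \<in> ball z' (r z')" "b \<in> ball z' (r z')" "\<delta> a b = g z' b - g z' a" by blast
    obtain c where "\<forall>y\<in>ball z' (r z') \<inter> ball z (r z). g z' y = g z y + c" using comp[OF z'(1) z(1)] by blast
    then have "g z' a = g z a + c" "g z' b = g z b + c" using z z' by auto
    then show ?thesis using z'(4) by simp
  qed
  \<comment> \<open>Lebesgue numbers are available on smaller closed balls only: the radii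
    \<open>r x\<close> may shrink towards the unit sphere.\<close>
  have leb: "\<exists>e>0. \<forall>x\<in>cball 0 R. \<exists>z\<in>ball 0 1. ball x e \<subseteq> ball z (r z)" if R: "R < 1" for R
  proof -
    have "cball 0 R \<subseteq> \<Union> ((%z. ball z (r z)) ` ball 0 1)"
    proof
      fix x :: 'a assume "x \<in> cball 0 R"
      then have "x \<in> ball 0 1" using R by auto
      then show "x \<in> \<Union> ((%z. ball z (r z)) ` ball 0 1)" using r[of x] by (auto intro!: bexI[of _ x])
    qed
    then obtain e where e: "0 < e" "!!x. x \<in> cball 0 R ==> \<exists>G \<in> (%z. ball z (r z)) ` ball 0 1. ball x e \<subseteq> G"
      by (rule Heine_Borel_lemma[OF compact_cball]) auto
    then have "\<forall>x\<in>cball 0 R. \<exists>z\<in>ball 0 1. ball x e \<subseteq> ball z (r z)" by blast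
    with e(1) show ?thesis by blast
  qed
  define S where "S = (%n p. \<Sum>k<n. \<delta> ((real k / real n) *\<^sub>R p) ((real (Suc k) / real n) *\<^sub>R p))"
  define good where "good = (%R F. F 0 = 0 \<and> (\<exists>e>0. \<forall>p\<in>cball 0 R. \<forall>p'\<in>cball 0 R. norm (p - p') < e --> F p' - F p = \<delta> p p'))"
  have ex: "\<exists>F. good R F" if R: "0 \<le> R" "R < 1" for R
  proof -
    obtain e where e: "e > 0" "!!x. x \<in> cball 0 R ==> \<exists>z\<in>ball 0 1. ball x e \<subseteq> ball z (r z)" using leb[OF R(2)] by blast
    have "e / 2 > 0" using e by simp
    then obtain m where m: "1 / real (Suc m) < e / 2" using nat_approx_posE by blast
    define n where "n = Suc m"
    have n: "n > 0" "1 / real n < e / 2" using m by (auto simp: n_def)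
    have dself: "\<delta> a a = 0" if a: "a \<in> cball 0 R" for a
    proof -
      obtain z where z: "z \<in> ball 0 1" "ball a e \<subseteq> ball z (r z)" using e(2)[OF a] by blast
      have "a \<in> ball z (r z)" using z(2) e(1) by (meson centre_in_ball subsetD)
      then show ?thesis using dl[OF z(1)] by simp
    qed
    have "S n p' - S n p = \<delta> p p'" if p: "p \<in> cball 0 R" "p' \<in> cball 0 R" "norm (p - p') < e / 2" for p p'
    proof -
      \<comment> \<open>A discrete homotopy: the four points \<open>a\<close>, \<open>b\<close>,
        \<open>a'\<close>, \<open>b'\<close> of one cell lie in a single ball
        \<open>ball z (r z)\<close>, where the increments around the cell cancel. Mesh and
        displacement below \<open>e / 2\<close> place all of them within \<open>e\<close> of
        \<open>a\<close>.\<close>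
      have ind: "(\<Sum>k<j. \<delta> ((real k / real n) *\<^sub>R p') ((real (Suc k) / real n) *\<^sub>R p')) - (\<Sum>k<j. \<delta> ((real k / real n) *\<^sub>R p) ((real (Suc k) / real n) *\<^sub>R p))
         = \<delta> ((real j / real n) *\<^sub>R p) ((real j / real n) *\<^sub>R p')" if "j \<le> n" for j
        using that
      proof (induction j)
        case 0
        show ?case using dself[of 0] R by simp
      next
        case (Suc j)
        define a b a' b' where "a = (real j / real n) *\<^sub>R p" and "b = (real (Suc j) / real n) *\<^sub>R p"
          and "a' = (real j / real n) *\<^sub>R p'" and "b' = (real (Suc j) / real n) *\<^sub>R p'"
        have jn: "real j / real n \<le> 1" using Suc.prems by simp
        have sm: "norm ((real j / real n) *\<^sub>R x) \<le> norm x" for x :: 'a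
          using mult_right_mono[OF jn, of "norm x"] by simp
        have aK: "a \<in> cball 0 R" using sm[of p] p(1) by (simp add: a_def)
        obtain z where z: "z \<in> ball 0 1" "ball a e \<subseteq> ball z (r z)" using e(2)[OF aK] by blast
        have step: "norm ((real (Suc j) / real n) *\<^sub>R x - (real j / real n) *\<^sub>R x) < e / 2" if "x \<in> cball 0 R" for x :: 'a
        proof -
          have "(real (Suc j) / real n) *\<^sub>R x - (real j / real n) *\<^sub>R x = (1 / real n) *\<^sub>R x"
            by (simp add: scaleR_left_diff_distrib[symmetric] diff_divide_distrib[symmetric])
          then have "norm ((real (Suc j) / real n) *\<^sub>R x - (real j / real n) *\<^sub>R x) = (1 / real n) * norm x" by simp
          also have "\<dots> \<le> (1 / real n) * 1" using that R by (intro mult_left_mono) auto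
          finally show ?thesis using n by simp
        qed
        have ab: "norm (b - a) < e / 2" "norm (b' - a') < e / 2" unfolding a_def b_def a'_def b'_def using step p by auto
        have "norm (a - a') \<le> norm (p - p')" using sm[of "p - p'"] by (simp add: a_def a'_def scaleR_right_diff_distrib)
        then have aa: "norm (a' - a) < e / 2" using p(3) by (simp add: norm_minus_commute)
        have "norm (b' - a) \<le> norm (b' - a') + norm (a' - a)" using norm_triangle_ineq[of "b' - a'" "a' - a"] by simp
        then have "norm (b' - a) < e" using ab aa by simp
        then have "a \<in> ball z (r z)" "b \<in> ball z (r z)" "a' \<in> ball z (r z)" "b' \<in> ball z (r z)"
          using z(2) e(1) ab aa by (auto simp: dist_norm norm_minus_commute subset_iff)
        note D = dl[OF z(1) this(1,2)] dl[OF z(1) this(3,4)] dl[OF z(1) this(1,3)] dl[OF z(1) this(2,4)]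
        have "(\<Sum>k<j. \<delta> ((real k / real n) *\<^sub>R p') ((real (Suc k) / real n) *\<^sub>R p')) - (\<Sum>k<j. \<delta> ((real k / real n) *\<^sub>R p) ((real (Suc k) / real n) *\<^sub>R p)) = \<delta> a a'"
          using Suc by (simp add: a_def a'_def)
        then show ?case using D unfolding sum.lessThan_Suc a_def[symmetric] b_def[symmetric] a'_def[symmetric] b'_def[symmetric] by linarith
      qed
      from ind[of n] show ?thesis using n(1) by (simp add: S_def)
    qed
    moreover have "S n 0 = 0" using dself[of 0] R by (simp add: S_def)
    ultimately have "good R (S n)" unfolding good_def using \<open>e / 2 > 0\<close> by blast
    then show ?thesis by blast
  qed
  \<comment> \<open>Both functions vanish at 0 and have the same increments over short steps, so
    they agree along the ray. This is why \<open>W\<close> below may use a radius that depends on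
    the point.\<close>
  have uniq: "F p = F' p" if F: "good R F" "good R' F'" and p: "norm p \<le> R" "norm p \<le> R'" for F F' R R' p
  proof -
    obtain e where e: "e > 0" "!!p p'. p \<in> cball 0 R ==> p' \<in> cball 0 R ==> norm (p - p') < e ==> F p' - F p = \<delta> p p'"
      using F(1) unfolding good_def by blast
    obtain e' where e': "e' > 0" "!!p p'. p \<in> cball 0 R' ==> p' \<in> cball 0 R' ==> norm (p - p') < e' ==> F' p' - F' p = \<delta> p p'"
      using F(2) unfolding good_def by blast
    have "min e e' / (norm p + 1) > 0" using e(1) e'(1) by (simp add: add_nonneg_pos)
    then obtain m where m: "1 / real (Suc m) < min e e' / (norm p + 1)" using nat_approx_posE by blast
    define n where "n = Suc m"
    have n0: "n > 0" by (simp add: n_def)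
    have np: "(1 / real n) * norm p < min e e'"
    proof -
      have "(1 / real n) * norm p \<le> (1 / real n) * (norm p + 1)" by (intro mult_left_mono) auto
      also have "\<dots> < min e e' / (norm p + 1) * (norm p + 1)" using m unfolding n_def by (intro mult_strict_right_mono) (auto simp: add_nonneg_pos)
      also have "\<dots> = min e e'" using add_nonneg_pos[OF norm_ge_zero[of p] zero_less_one] by simp
      finally show ?thesis .
    qed
    have "F ((real j / real n) *\<^sub>R p) = F' ((real j / real n) *\<^sub>R p)" if "j \<le> n" for j
      using that
    proof (induction j)
      case 0 then show ?case using F unfolding good_def by simp
    next
      case (Suc j)
      define a b where "a = (real j / real n) *\<^sub>R p" and "b = (real (Suc j) / real n) *\<^sub>R p"
      have na: "norm a \<le> norm p" "norm b \<le> norm p"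
        using mult_right_mono[of "real j / real n" 1 "norm p"] mult_right_mono[of "real (Suc j) / real n" 1 "norm p"] Suc.prems
        by (auto simp: a_def b_def simp del: of_nat_Suc)
      have "b - a = (1 / real n) *\<^sub>R p" unfolding a_def b_def
        by (simp add: scaleR_left_diff_distrib[symmetric] diff_divide_distrib[symmetric])
      then have "norm (a - b) = (1 / real n) * norm p" by (metis norm_minus_commute norm_scaleR abs_of_nonneg zero_le_divide_1_iff of_nat_0_le_iff)
      then have "norm (a - b) < e" "norm (a - b) < e'" using np by auto
      then have "F b - F a = \<delta> a b" "F' b - F' a = \<delta> a b" using e(2)[of a b] e'(2)[of a b] na p by auto
      then show ?case using Suc unfolding a_def b_def by simp
    qed
    from this[of n] show ?thesis using n0 by simp
  qed
  define FF where "FF = (%R. SOME F. good R F)"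
  have FF: "good R (FF R)" if "0 \<le> R" "R < 1" for R unfolding FF_def using ex[OF that] by (rule someI_ex)
  define W where "W = (%p. FF (norm p) p)"
  have WF: "W p = FF R p" if "norm p \<le> R" "R < 1" for p R
    unfolding W_def by (rule uniq[OF FF FF, of "norm p" R]) (use that order_trans[OF norm_ge_zero that(1)] in auto)
  show thesis
  proof (rule that[of W])
    fix x :: 'a assume x: "x \<in> ball 0 1"
    define R where "R = (1 + norm x) / 2"
    have R: "0 \<le> R" "R < 1" "norm x < R" using x by (auto simp: R_def field_simps add_nonneg_nonneg)
    obtain e where e: "e > 0" "!!p p'. p \<in> cball 0 R ==> p' \<in> cball 0 R ==> norm (p - p') < e ==> FF R p' - FF R p = \<delta> p p'"
      using FF[OF R(1,2)] unfolding good_def by blast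
    define s where "s = min e (min (r x) (R - norm x))"
    have s: "s > 0" using e(1) r[OF x] R(3) by (simp add: s_def)
    have "W z = g x z + (W x - g x x)" if z: "z \<in> ball x s" for z
    proof -
      have d: "norm (x - z) < e" "norm (x - z) < r x" "norm (x - z) < R - norm x" using z by (auto simp: s_def dist_norm)
      have nz: "norm z < R" using d(3) norm_triangle_ineq2[of z x] by (simp add: norm_minus_commute)
      have "FF R z - FF R x = \<delta> x z" using nz R(3) d(1) by (intro e(2)) auto
      also have "\<dots> = g x z - g x x" using d(2) r[OF x] by (intro dl[OF x]) (auto simp: dist_norm)
      finally show ?thesis using WF[of z R] WF[of x R] nz R by simp
    qed
    then show "\<exists>c. \<exists>s>0. \<forall>z\<in>ball x s. W z = g x z + c" using s by blast
  qed
qed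

text \<open>The Riemann map serves only as a homeomorphism from the unit disc, where rays and convex
  balls are at hand, onto \<open>V\<close>. No derivative passes through it: local potentials are
  composed with it to match their additive constants, and the result is read off in \<open>V\<close>
  again.\<close>

lemma simply_connected_potential:
  assumes f: "Lip_loc UNIV f" and Om: "open \<Omega>" and u: "Linf_loc \<Omega> u"
    and wd: "weak_div_eq_0 \<Omega> u (%p. f (u p))"
    and V: "V \<subseteq> \<Omega>" "open V" "simply_connected V"
  shows "\<exists>w. potential f V u w"
proof (cases "V = {}")
  case True
  then show ?thesis by (intro exI[of _ "%_. 0"]) (simp add: potential_def Lip_loc_def)
next
  case False
  define T where "T = (%z::plane. Complex (fst z) (snd z))"
  have cT: "continuous_on A T" for A
    unfolding T_def by (simp add: Complex_eq) (intro continuous_intros)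
  have hT: "homeomorphism V (T ` V) T (%c. (Re c, Im c))"
  proof (rule homeomorphismI)
    show "continuous_on V T" by (rule cT)
    show "continuous_on (T ` V) (%c. (Re c, Im c))" by (intro continuous_intros)
  qed (auto simp: T_def)
  have "open (T ` V)"
  proof -
    have "T ` V = (%c. (Re c, Im c)) -` V"
    proof (intro equalityI subsetI)
      fix c assume "c \<in> (%c. (Re c, Im c)) -` V"
      then have "(Re c, Im c) \<in> V" by simp
      moreover have "c = T (Re c, Im c)" by (simp add: T_def complex_eq_iff)
      ultimately show "c \<in> T ` V" by (intro image_eqI)
    qed (auto simp: T_def)
    moreover have "open ((%c. (Re c, Im c)) -` V)" by (intro open_vimage V continuous_intros)
    ultimately show ?thesis by simp
  qed
  moreover have "simply_connected (T ` V)"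
    using V(3) hT homeomorphic_simply_connected_eq unfolding homeomorphic_def by blast
  ultimately have "(T ` V) homeomorphic ball (0::complex) 1"
    using simply_connected_eq_homeomorphic_to_disc False by blast
  moreover have "V homeomorphic T ` V" using hT unfolding homeomorphic_def by blast
  ultimately have "ball (0::complex) 1 homeomorphic V" using homeomorphic_trans homeomorphic_sym by blast
  then obtain h k where hk: "homeomorphism (ball (0::complex) 1) V h k" unfolding homeomorphic_def by blast
  have hV: "h x \<in> V" if "x \<in> ball 0 1" for x using hk that unfolding homeomorphism_def by blast
  have kD: "k p \<in> ball 0 1" "h (k p) = p" if "p \<in> V" for p using hk that unfolding homeomorphism_def by auto
  have ch: "continuous_on (ball 0 1) h" and ck: "continuous_on V k" using hk unfolding homeomorphism_def by auto
  have "\<exists>\<rho> w. \<rho> > 0 \<and> ball (h x) \<rho> \<subseteq> \<Omega> \<and> potential f (ball (h x) \<rho>) u w" if "x \<in> ball 0 1" for x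
    using local_potential[OF f Om u wd] hV[OF that] V(1) by blast
  then obtain \<rho> w where w: "!!x. x \<in> ball 0 1 ==> \<rho> x > 0" "!!x. x \<in> ball 0 1 ==> potential f (ball (h x) (\<rho> x)) u (w x)"
    by metis
  have ex: "\<exists>r>0. ball x r \<subseteq> ball 0 1 \<and> h ` ball x r \<subseteq> ball (h x) (\<rho> x)" if x: "x \<in> ball 0 1" for x
  proof -
    have op: "open (ball 0 1 \<inter> h -` ball (h x) (\<rho> x))" by (rule continuous_open_preimage[OF ch]) auto
    have xin: "x \<in> ball 0 1 \<inter> h -` ball (h x) (\<rho> x)" using x w(1)[OF x] by simp
    obtain r where "r > 0" "ball x r \<subseteq> ball 0 1 \<inter> h -` ball (h x) (\<rho> x)" using openE[OF op xin] by blast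
    then show ?thesis by blast
  qed
  define r where "r = (%x. SOME r. r > 0 \<and> ball x r \<subseteq> ball 0 1 \<and> h ` ball x r \<subseteq> ball (h x) (\<rho> x))"
  have r: "r x > 0" "ball x (r x) \<subseteq> ball 0 1" "h ` ball x (r x) \<subseteq> ball (h x) (\<rho> x)" if "x \<in> ball 0 1" for x
    using someI_ex[OF ex[OF that]] unfolding r_def by blast+
  define g where "g = (%x z. w x (h z))"
  obtain W where W: "!!x. x \<in> ball 0 1 ==> \<exists>c. \<exists>s>0. \<forall>z\<in>ball x s. W z = g x z + c"
  proof (rule glue_on_unit_ball[of r g])
    fix x y :: complex assume xy: "x \<in> ball 0 1" "y \<in> ball 0 1"
    define A where "A = ball x (r x) \<inter> ball y (r y)"
    \<comment> \<open>Intersections of discs are convex, hence connected, so a locally constant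
      difference is constant on them. In \<open>V\<close> itself the overlaps carry no such
      structure.\<close>
    have cA: "connected A" unfolding A_def by (intro convex_connected convex_Int convex_ball)
    have oA: "open A" unfolding A_def by auto
    have loc: "\<forall>\<^sub>F b in at a within A. g x a - g y a = g x b - g y b" if a: "a \<in> A" for a
    proof -
      have "h a \<in> ball (h x) (\<rho> x)" "h a \<in> ball (h y) (\<rho> y)" using a r(3)[OF xy(1)] r(3)[OF xy(2)] unfolding A_def by blast+
      from potential_unique_local[OF w(2)[OF xy(1)] w(2)[OF xy(2)] open_ball open_ball this]
      obtain s where s: "s > 0" "!!z. z \<in> ball (h a) s ==> w x z - w y z = w x (h a) - w y (h a)" by blast
      have aD: "a \<in> ball 0 1" using a r(2)[OF xy(1)] by (auto simp: A_def)
      have "open (ball 0 1 \<inter> h -` ball (h a) s)" by (rule continuous_open_preimage[OF ch]) auto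
      moreover have "a \<in> ball 0 1 \<inter> h -` ball (h a) s" using aD s(1) by simp
      ultimately have "\<forall>\<^sub>F b in nhds a. b \<in> ball 0 1 \<inter> h -` ball (h a) s" by (rule eventually_nhds_in_open)
      then have "\<forall>\<^sub>F b in nhds a. g x a - g y a = g x b - g y b"
        by eventually_elim (use s(2) in \<open>auto simp: g_def\<close>)
      then show ?thesis by (auto simp: eventually_at_filter elim: eventually_mono)
    qed
    show "\<exists>c. \<forall>z\<in>ball x (r x) \<inter> ball y (r y). g x z = g y z + c"
    proof (cases "A = {}")
      case True then show ?thesis by (simp add: A_def)
    next
      case False
      then obtain a where a: "a \<in> A" by blast
      have "g x a - g y a = g x z - g y z" if "z \<in> A" for z
        by (rule connected_local_const[OF cA a that]) (use loc in blast)
      then have "\<forall>z\<in>A. g x z = g y z + (g x a - g y a)" by force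
      then show ?thesis unfolding A_def by blast
    qed
  qed (use r in auto)
  have "potential f V u (%p. W (k p))"
  proof (rule potential_local_to_global[OF V(2)])
    fix p assume p: "p \<in> V"
    define x where "x = k p"
    have x: "x \<in> ball 0 1" "h x = p" using kD[OF p] by (auto simp: x_def)
    obtain c s where cs: "s > 0" "!!z. z \<in> ball x s ==> W z = g x z + c" using W[OF x(1)] by blast
    have "open (V \<inter> k -` ball x s)" by (rule continuous_open_preimage[OF ck V(2)]) auto
    then have "open (V \<inter> k -` ball x s \<inter> ball p (\<rho> x))" by auto
    moreover have "p \<in> V \<inter> k -` ball x s \<inter> ball p (\<rho> x)" using p cs(1) w(1)[OF x(1)] by (simp add: x_def)
    ultimately obtain \<sigma> where sg: "\<sigma> > 0" "ball p \<sigma> \<subseteq> V \<inter> k -` ball x s \<inter> ball p (\<rho> x)" by (rule openE)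
    have "potential f (ball p \<sigma>) u (w x)"
    proof -
      have pp: "potential f (ball p (\<rho> x)) u (w x)" using w(2)[OF x(1)] x(2) by simp
      have "Lip_loc (ball p \<sigma>) (w x)" unfolding Lip_loc_def
      proof
        fix z assume "z \<in> ball p \<sigma>"
        then have "z \<in> ball p (\<rho> x)" using sg(2) by blast
        then obtain r L where "r > 0" "L-lipschitz_on (cball z r \<inter> ball p (\<rho> x)) (w x)"
          using pp unfolding potential_def Lip_loc_def by blast
        moreover have "cball z r \<inter> ball p \<sigma> \<subseteq> cball z r \<inter> ball p (\<rho> x)" using sg(2) by blast
        ultimately show "\<exists>r>0. \<exists>L. L-lipschitz_on (cball z r \<inter> ball p \<sigma>) (w x)" using lipschitz_on_subset by blast
      qed
      moreover have "AE z in lebesgue. z \<in> ball p \<sigma> --> DERIV (%y. w x (fst z, y)) (snd z) :> u z \<and>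
        DERIV (%s. w x (s, snd z)) (fst z) :> - f (u z)"
      proof -
        have "AE z in lebesgue. z \<in> ball p (\<rho> x) --> DERIV (%y. w x (fst z, y)) (snd z) :> u z \<and>
          DERIV (%s. w x (s, snd z)) (fst z) :> - f (u z)" using pp unfolding potential_def by blast
        then show ?thesis by eventually_elim (use sg(2) in blast)
      qed
      ultimately show ?thesis unfolding potential_def by blast
    qed
    moreover have "\<forall>z\<in>ball p \<sigma>. W (k z) = w x z + c"
    proof
      fix z assume z: "z \<in> ball p \<sigma>"
      then have zz: "z \<in> V" "k z \<in> ball x s" using sg(2) by auto
      show "W (k z) = w x z + c" using cs(2)[OF zz(2)] kD(2)[OF zz(1)] by (simp add: g_def)
    qed
    ultimately show "\<exists>\<sigma>>0. \<exists>w' c. ball p \<sigma> \<subseteq> V \<and> potential f (ball p \<sigma>) u w' \<and> (\<forall>z\<in>ball p \<sigma>. W (k z) = w' z + c)"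
      using sg by blast
  qed
  then show ?thesis by blast
qed

section \<open>Semiconcave functions\<close>

text \<open>\<open>p\<close> selects at each point the slope of a parabola touching from above along
  the line in direction \<open>e\<close>, for all \<open>s\<close> and not just small ones. For the
  inf-convolution the selection comes from a minimiser, and it serves \<open>e\<close> and
  \<open>- e\<close> with opposite signs.\<close>

definition semiconc :: "('a::euclidean_space => real) => 'a => real => ('a => real) => bool" where
  "semiconc W e \<kappa> p \<longleftrightarrow> (\<forall>z s. W (z + s *\<^sub>R e) \<le> W z + p z * s + \<kappa> * s\<^sup>2 / 2)"

text \<open>Subtracting the parabola leaves a function with a supporting line above its graph at
  every point, that is, a concave one. Its chord slopes grow as the step shrinks, and the Lipschitz
  bound limits them.\<close>

lemma semiconc_dq_convergent:
  assumes sc: "semiconc W e \<kappa> p" and lip: "L-lipschitz_on UNIV W"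
  shows "convergent (%n. dq e W n z)"
proof -
  define h where "h = (%n. 1 / real (Suc n))"
  define phi where "phi = (%s. W (z + s *\<^sub>R e) - \<kappa> * s\<^sup>2 / 2)"
  define a where "a = (%n. (phi (h n) - phi 0) / h n)"
  have hp: "h n > 0" for n by (simp add: h_def)
  have aff: "\<exists>q. \<forall>s. phi s \<le> phi s0 + q * (s - s0)" for s0
  proof (intro exI allI)
    fix s
    have e: "(z + s0 *\<^sub>R e) + (s - s0) *\<^sub>R e = z + s *\<^sub>R e" by (simp add: algebra_simps)
    have "W ((z + s0 *\<^sub>R e) + (s - s0) *\<^sub>R e) \<le> W (z + s0 *\<^sub>R e) + p (z + s0 *\<^sub>R e) * (s - s0) + \<kappa> * (s - s0)\<^sup>2 / 2"
      using sc unfolding semiconc_def by blast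
    then have "W (z + s *\<^sub>R e) \<le> W (z + s0 *\<^sub>R e) + p (z + s0 *\<^sub>R e) * (s - s0) + \<kappa> * (s - s0)\<^sup>2 / 2"
      unfolding e .
    moreover have "\<kappa> * (s - s0)\<^sup>2 / 2 = \<kappa> * s\<^sup>2 / 2 - \<kappa> * s0\<^sup>2 / 2 - \<kappa> * s0 * (s - s0)"
      by (simp add: power2_eq_square field_simps)
    ultimately show "phi s \<le> phi s0 + (p (z + s0 *\<^sub>R e) - \<kappa> * s0) * (s - s0)"
      unfolding phi_def by (simp add: algebra_simps)
  qed
  have slope: "(phi t - phi 0) / t \<le> (phi s - phi 0) / s" if st: "0 < s" "s \<le> t" for s t
  proof -
    obtain q where q: "!!r. phi r \<le> phi s + q * (r - s)" using aff[of s] by blast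
    have 1: "q * s \<le> phi s - phi 0" using q[of 0] by simp
    have 2: "phi t - phi 0 \<le> (phi s - phi 0) + q * (t - s)" using q[of t] by simp
    have "s * (phi t - phi 0) \<le> s * ((phi s - phi 0) + q * (t - s))" using 2 st by (intro mult_left_mono) auto
    also have "\<dots> = s * (phi s - phi 0) + (q * s) * (t - s)" by (simp add: algebra_simps)
    also have "\<dots> \<le> s * (phi s - phi 0) + (phi s - phi 0) * (t - s)" using 1 st by (intro add_left_mono mult_right_mono) auto
    also have "\<dots> = t * (phi s - phi 0)" by (simp add: algebra_simps)
    finally show ?thesis using st by (simp add: field_simps)
  qed
  have inc: "incseq a"
  proof (rule incseq_SucI)
    fix n show "a n \<le> a (Suc n)" unfolding a_def by (rule slope) (auto simp: h_def frac_le)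
  qed
  have aeq: "a n = dq e W n z - \<kappa> * h n / 2" for n
  proof -
    have "a n = (W (z + h n *\<^sub>R e) - W z) / h n - \<kappa> * h n / 2"
      unfolding a_def phi_def using hp[of n] by (simp add: field_simps power2_eq_square)
    then show ?thesis by (simp add: dq_def h_def mult.commute)
  qed
  have bd: "a n \<le> L * norm e + \<bar>\<kappa>\<bar>" for n
  proof -
    have "h n \<le> 1" by (simp add: h_def)
    then have "\<bar>\<kappa> * h n / 2\<bar> \<le> \<bar>\<kappa>\<bar>" using hp[of n] mult_left_mono[of "h n" 1 "\<bar>\<kappa>\<bar>"] by (simp add: abs_mult)
    then show ?thesis unfolding aeq using dq_lipschitz[OF lip, of e n z] by linarith
  qed
  obtain a0 where a0: "a \<longlonglongrightarrow> a0" using incseq_convergent[OF inc, of "L * norm e + \<bar>\<kappa>\<bar>"] bd by blast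
  have "(%n. \<kappa> * h n / 2) \<longlonglongrightarrow> \<kappa> * 0 / 2"
    unfolding h_def using LIMSEQ_inverse_real_of_nat by (intro tendsto_intros) (simp_all add: inverse_eq_divide)
  then have "convergent (%n. a n + \<kappa> * h n / 2)" by (rule convergentI[OF tendsto_add[OF a0]])
  then show ?thesis by (simp add: aeq)
qed

definition dlim :: "'a::euclidean_space => ('a => real) => 'a => real" where
  "dlim e W z = lim (%n. dq e W n z)"

lemma semiconc_dlim:
  assumes sc: "semiconc W e \<kappa> p" and lip: "L-lipschitz_on UNIV W"
  shows "(%n. dq e W n z) \<longlonglongrightarrow> dlim e W z" "dlim e W z \<le> p z" "\<bar>dlim e W z\<bar> \<le> L * norm e"
    "dlim e W \<in> borel_measurable borel"
proof -
  show l: "(%n. dq e W n z) \<longlonglongrightarrow> dlim e W z"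
    using semiconc_dq_convergent[OF sc lip] unfolding dlim_def by (simp add: convergent_LIMSEQ_iff)
  have "(%n. \<bar>dq e W n z\<bar>) \<longlonglongrightarrow> \<bar>dlim e W z\<bar>" by (intro tendsto_rabs l)
  then show "\<bar>dlim e W z\<bar> \<le> L * norm e" by (rule LIMSEQ_le_const2) (intro exI[of _ 0] allI impI dq_lipschitz[OF lip])
  have b: "dq e W n z \<le> p z + \<kappa> * (1 / real (Suc n)) / 2" for n
  proof -
    define h where "h = 1 / real (Suc n)"
    have h: "h > 0" "real (Suc n) = 1 / h" by (simp_all add: h_def)
    have "W (z + h *\<^sub>R e) \<le> W z + p z * h + \<kappa> * h\<^sup>2 / 2" using sc unfolding semiconc_def by blast
    then have "(W (z + h *\<^sub>R e) - W z) / h \<le> (p z * h + \<kappa> * h\<^sup>2 / 2) / h" using h(1) by (intro divide_right_mono) auto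
    also have "\<dots> = p z + \<kappa> * h / 2" using h(1) by (simp add: field_simps power2_eq_square)
    finally show ?thesis unfolding dq_def h_def[symmetric] using h(2) by simp
  qed
  have "(%n. p z + \<kappa> * (1 / real (Suc n)) / 2) \<longlonglongrightarrow> p z + \<kappa> * 0 / 2"
    using LIMSEQ_inverse_real_of_nat by (intro tendsto_intros) (simp_all add: inverse_eq_divide)
  then have "(%n. p z + \<kappa> * (1 / real (Suc n)) / 2) \<longlonglongrightarrow> p z" by simp
  with l show "dlim e W z \<le> p z" by (rule LIMSEQ_le) (intro exI[of _ 0] allI impI b)
  have "(%z. lim (%n. dq e W n z)) \<in> borel_measurable borel"
    by (rule borel_measurable_lim_metric) (rule dq_measurable[OF lipschitz_borel[OF lip]])
  then show "dlim e W \<in> borel_measurable borel" by (simp add: dlim_def[abs_def])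
qed

lemma bump2_pos:
  assumes "h > 0" "\<bar>fst z\<bar> < h / 2" "\<bar>snd z\<bar> < h / 2" shows "0 < bump2 h z"
proof -
  have p: "0 < bump0 s" if "\<bar>s\<bar> < 1/2" for s using that by (auto simp: bump0_def flat_exp_def abs_less_iff)
  have "\<bar>fst z / h\<bar> < 1/2" "\<bar>snd z / h\<bar> < 1/2" using assms by (auto simp: field_simps)
  then show ?thesis unfolding bump2_def by (intro mult_pos_pos p)
qed

text \<open>The two one-sided derivatives have the same distributional limit and are ordered, hence agree
  almost everywhere.\<close>

lemma semiconc_deriv_AE:
  fixes W :: "plane => real"
  assumes s1: "semiconc W e \<kappa> p" and s2: "semiconc W (- e) \<kappa> (%z. - p z)" and lip: "L-lipschitz_on UNIV W"
    and e: "e = e_t \<or> e = e_x"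
  shows "AE z in lborel. dlim e W z = p z"
proof -
  note d1 = semiconc_dlim[OF s1 lip] and d2 = semiconc_dlim[OF s2 lip]
  \<comment> \<open>The left derivative minus the right one; it is nonnegative because
    \<open>p\<close> lies between them. Integration by parts in both directions shows that it has
    integral zero against every bump.\<close>
  define D where "D = (%z. - (dlim e W z + dlim (- e) W z))"
  have D0: "0 \<le> D z" for z using d1(2)[of z] d2(2)[of z] by (simp add: D_def)
  have Dm: "D \<in> borel_measurable borel" unfolding D_def using d1(4) d2(4) by measurable
  have "AE z in lborel. bump2 (real (Suc k)) z * D z = 0" for k
  proof -
    define psi where "psi = bump2 (real (Suc k))"
    have b: "bump_fun psi" unfolding psi_def by (rule bump2_bump_fun) simp
    obtain psit psix where p: "bump_fun psit" "bump_fun psix" "has_partials psi psit psix" using bump_fun_partials[OF b] .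
    obtain K where K: "K-lipschitz_on UNIV psi" using bump_fun_lipschitz[OF b] by blast
    obtain R where R: "!!y. R < norm y ==> psi y = 0" using b unfolding bump_fun_def by blast
    define psie where "psie = (if e = e_t then psit else psix)"
    have em: "psie \<in> borel_measurable borel" unfolding psie_def
      using bump_fun_continuous[OF p(1)] bump_fun_continuous[OF p(2)] by (simp add: borel_measurable_continuous_onI)
    have l1: "(%n. dq e psi n z) \<longlonglongrightarrow> psie z" for z
      using e dq_partials[OF p(3), of z] by (auto simp: psie_def)
    have l2: "(%n. dq (- e) psi n z) \<longlonglongrightarrow> - psie z" for z
    proof -
      have hpm: "has_partials (%y. psi (0 - y)) (%y. - psit (0 - y)) (%y. - psix (0 - y))" by (rule has_partials_reflect[OF p(3)])
      have "dq (- e) psi n z = dq e (%y. psi (0 - y)) n (- z)" for n by (simp add: dq_def)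
      then show ?thesis using e dq_partials[OF hpm, of "- z"] by (auto simp: psie_def)
    qed
    have ip: "integrable lborel (%z. dlim e' W z * psi z) \<and> (LBINT z. W z * d z) = - (LBINT z. dlim e' W z * psi z)"
      if dm: "d \<in> borel_measurable borel" and Dm: "dlim e' W \<in> borel_measurable borel"
        and Dl: "!!z. (%n. dq e' W n z) \<longlonglongrightarrow> dlim e' W z" and dl: "!!z. (%n. dq e' psi n z) \<longlonglongrightarrow> d z" for e' d
      using integration_by_parts_dq(2,3)[where e=e' and U=UNIV and S=UNIV, OF lip K R closed_UNIV subset_UNIV _ _ Dm _ dm] Dl dl
      by simp
    note i1 = ip[OF em d1(4) d1(1) l1] and i2 = ip[OF borel_measurable_uminus[OF em] d2(4) d2(1) l2]
    have "integrable lborel (%z. - (dlim e W z * psi z + dlim (- e) W z * psi z))"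
      using i1 i2 by (intro Bochner_Integration.integrable_minus Bochner_Integration.integrable_add) auto
    then have Di: "integrable lborel (%z. psi z * D z)" unfolding D_def by (simp add: algebra_simps)
    have "(LBINT z. psi z * D z) = (LBINT z. - (dlim e W z * psi z + dlim (- e) W z * psi z))"
      by (rule Bochner_Integration.integral_cong) (auto simp: D_def algebra_simps)
    also have "\<dots> = 0" using i1 i2 by simp
    finally have "(LBINT z. psi z * D z) = 0" .
    moreover have "AE z in lborel. 0 \<le> psi z * D z" using D0 bump2_nonneg by (simp add: psi_def)
    ultimately have "AE z in lborel. psi z * D z = 0" using integral_nonneg_eq_0_iff_AE[OF Di] by blast
    then show ?thesis by (simp add: psi_def)
  qed
  then have "AE z in lborel. \<forall>k. bump2 (real (Suc k)) z * D z = 0" unfolding AE_all_countable by blast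
  then show ?thesis
  proof eventually_elim
    case (elim z)
    note a = elim
    \<comment> \<open>Every point lies where a sufficiently wide bump is strictly positive.\<close>
    obtain k :: nat where k: "2 * (\<bar>fst z\<bar> + \<bar>snd z\<bar>) < real k" using reals_Archimedean2 by blast
    have "0 < bump2 (real (Suc k)) z" by (rule bump2_pos) (use k in auto)
    then have "D z = 0" using a by (metis mult_eq_0_iff less_irrefl)
    then show ?case using d1(2)[of z] d2(2)[of z] by (simp add: D_def)
  qed
qed

section \<open>Inf-convolution\<close>

definition pnl :: "real => plane => real" where
  "pnl eps k = (fst k)\<^sup>2 / (2 * eps\<^sup>2) + (snd k)\<^sup>2 / (2 * eps)"

definition minpt :: "(plane => real) => real => plane => plane" where
  "minpt w eps z = (SOME y. \<forall>y'. w y + pnl eps (z - y) \<le> w y' + pnl eps (z - y'))"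

definition infc :: "(plane => real) => real => plane => real" where
  "infc w eps z = w (minpt w eps z) + pnl eps (z - minpt w eps z)"

lemma pnl_lower:
  assumes "0 < eps" "eps \<le> 1" shows "(norm k)\<^sup>2 / (2 * eps) \<le> pnl eps k"
proof -
  have n: "(norm k)\<^sup>2 = (fst k)\<^sup>2 + (snd k)\<^sup>2" by (cases k) (simp add: norm_Pair)
  have "eps\<^sup>2 \<le> eps" using assms by (simp add: power2_eq_square mult_left_le)
  then have "(fst k)\<^sup>2 / (2 * eps) \<le> (fst k)\<^sup>2 / (2 * eps\<^sup>2)" using assms by (intro divide_left_mono) auto
  then show ?thesis unfolding n pnl_def by (simp add: add_divide_distrib)
qed

text \<open>Beyond distance \<open>2 * L * eps\<close> the quadratic penalty outweighs what
  \<open>w\<close> can gain by its Lipschitz bound, so a minimiser over that closed ball is a global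
  one.\<close>

lemma minpt_min:
  assumes w: "L-lipschitz_on UNIV w" and e: "0 < eps" "eps \<le> 1"
  shows "w (minpt w eps z) + pnl eps (z - minpt w eps z) \<le> w y' + pnl eps (z - y')"
proof -
  have L0: "0 \<le> L" using w by (rule lipschitz_on_nonneg)
  define F where "F = (%y. w y + pnl eps (z - y))"
  have wc: "continuous_on UNIV w" using w by (rule lipschitz_on_continuous_on)
  have Fc: "continuous_on (cball z (2 * L * eps)) F" unfolding F_def pnl_def
    by (intro continuous_intros continuous_on_subset[OF wc]) (use e in auto)
  have "0 \<le> 2 * L * eps" using L0 e by simp
  then have ne: "cball z (2 * L * eps) \<noteq> {}" by (metis centre_in_cball empty_iff)
  obtain y where y: "y \<in> cball z (2 * L * eps)" "!!x. x \<in> cball z (2 * L * eps) ==> F y \<le> F x"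
    using continuous_attains_inf[OF compact_cball ne Fc] by blast
  have Fz: "F z = w z" by (simp add: F_def pnl_def)
  have yz: "F y \<le> F z" using y(2)[of z] L0 e by simp
  have "F y \<le> F x" for x
  proof (cases "x \<in> cball z (2 * L * eps)")
    case True then show ?thesis by (rule y(2))
  next
    case False
    define n where "n = norm (z - x)"
    have n: "2 * L * eps < n" using False by (simp add: n_def dist_norm)
    have n0: "0 < n" using n L0 e by (meson le_less_trans mult_nonneg_nonneg less_imp_le zero_le_numeral)
    have "(2 * L * eps) * n \<le> n * n" using n n0 by (intro mult_right_mono) auto
    then have "L * n \<le> n\<^sup>2 / (2 * eps)" using e by (simp add: power2_eq_square field_simps)
    also have "\<dots> \<le> pnl eps (z - x)" using pnl_lower[OF e, of "z - x"] by (simp add: n_def)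
    finally have "L * n \<le> pnl eps (z - x)" .
    moreover have "\<bar>w z - w x\<bar> \<le> L * n" using lipschitz_onD[OF w, of z x] by (simp add: dist_norm n_def)
    ultimately show ?thesis using yz Fz unfolding F_def by linarith
  qed
  then have "\<exists>y. \<forall>y'. w y + pnl eps (z - y) \<le> w y' + pnl eps (z - y')" unfolding F_def by blast
  from someI_ex[OF this] show ?thesis unfolding minpt_def by blast
qed

lemma infc_le:
  assumes "L-lipschitz_on UNIV w" "0 < eps" "eps \<le> 1"
  shows "infc w eps z \<le> w y + pnl eps (z - y)"
  unfolding infc_def by (rule minpt_min[OF assms])

text \<open>Translate the minimiser of one point by the displacement: the penalty is unchanged, and
  \<open>w\<close> changes by at most \<open>L\<close> times the displacement.\<close>

lemma infc_lipschitz: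
  assumes w: "L-lipschitz_on UNIV w" and e: "0 < eps" "eps \<le> 1"
  shows "L-lipschitz_on UNIV (infc w eps)"
proof (rule lipschitz_onI)
  have one: "infc w eps z - infc w eps z' \<le> L * norm (z - z')" for z z'
  proof -
    let ?m = "minpt w eps z'"
    have "infc w eps z \<le> w (?m + (z - z')) + pnl eps (z - (?m + (z - z')))" by (rule infc_le[OF w e])
    also have "z - (?m + (z - z')) = z' - ?m" by simp
    finally have "infc w eps z - infc w eps z' \<le> w (?m + (z - z')) - w ?m" by (simp add: infc_def)
    also have "\<dots> \<le> L * norm (z - z')" using lipschitz_onD[OF w, of "?m + (z - z')" ?m] by (simp add: dist_norm)
    finally show ?thesis .
  qed
  fix x y :: "plane"
  show "dist (infc w eps x) (infc w eps y) \<le> L * dist x y"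
    using one[of x y] one[of y x] by (simp add: dist_real_def dist_norm norm_minus_commute)
qed (rule lipschitz_on_nonneg[OF w])

lemma minpt_near:
  assumes w: "L-lipschitz_on UNIV w" and e: "0 < eps" "eps \<le> 1"
  shows "norm (z - minpt w eps z) \<le> 2 * L * eps" "\<bar>fst z - fst (minpt w eps z)\<bar> \<le> 2 * L * eps\<^sup>2" "\<bar>snd z - snd (minpt w eps z)\<bar> \<le> 2 * L * eps"
proof -
  have L0: "0 \<le> L" using w by (rule lipschitz_on_nonneg)
  let ?m = "minpt w eps z"
  have bd: "n \<le> 2 * L * c" if "n\<^sup>2 / (2 * c) \<le> L * n" "0 \<le> n" "0 < c" for n c :: real
  proof (cases "n = 0")
    case True then show ?thesis using L0 that by simp
  next
    case False
    have "n * n \<le> (2 * L * c) * n" using that by (simp add: power2_eq_square field_simps)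
    then show ?thesis using False that(2) by (simp add: mult_le_cancel_right)
  qed
  have "w ?m + pnl eps (z - ?m) \<le> w z + pnl eps (z - z)" by (rule minpt_min[OF w e])
  then have "pnl eps (z - ?m) \<le> L * norm (z - ?m)" using lipschitz_onD[OF w, of z ?m] by (simp add: pnl_def dist_norm)
  then have "(norm (z - ?m))\<^sup>2 / (2 * eps) \<le> L * norm (z - ?m)" using pnl_lower[OF e, of "z - ?m"] by linarith
  then show n: "norm (z - ?m) \<le> 2 * L * eps" by (rule bd) (use e in auto)
  have "\<bar>snd (z - ?m)\<bar> \<le> norm (z - ?m)" by (cases "z - ?m") (simp add: norm_Pair real_le_rsqrt)
  then show "\<bar>snd z - snd ?m\<bar> \<le> 2 * L * eps" using n by simp
  \<comment> \<open>A competitor with the time coordinate of \<open>z\<close> and the space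
    coordinate of the minimiser isolates the time penalty, which gives the better bound of order
    \<open>eps\<^sup>2\<close>.\<close>
  define y where "y = (fst z, snd ?m)"
  have "w ?m + pnl eps (z - ?m) \<le> w y + pnl eps (z - y)" by (rule minpt_min[OF w e])
  moreover have "\<bar>w y - w ?m\<bar> \<le> L * \<bar>fst z - fst ?m\<bar>"
    using lipschitz_onD[OF w, of y ?m] by (cases ?m) (simp add: y_def dist_Pair_Pair dist_real_def)
  ultimately have "(\<bar>fst z - fst ?m\<bar>)\<^sup>2 / (2 * eps\<^sup>2) \<le> L * \<bar>fst z - fst ?m\<bar>"
    by (simp add: pnl_def y_def)
  then show "\<bar>fst z - fst ?m\<bar> \<le> 2 * L * eps\<^sup>2" by (rule bd) (use e in auto)
qed

lemma pnl_expand: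
  assumes "eps > 0"
  shows "pnl eps (k + s *\<^sub>R e_t) = pnl eps k + fst k / eps\<^sup>2 * s + (1 / eps\<^sup>2) * s\<^sup>2 / 2"
    "pnl eps (k + s *\<^sub>R e_x) = pnl eps k + snd k / eps * s + (1 / eps) * s\<^sup>2 / 2"
  using assms by (simp_all add: pnl_def power2_eq_square field_simps)

text \<open>Keeping the minimiser of \<open>z\<close> fixed while moving the point bounds the
  infimum from above by a quadratic that touches at \<open>z\<close>; \<open>pnl_expand\<close>
  reads off its slope and curvature.\<close>

lemma infc_semiconc:
  assumes w: "L-lipschitz_on UNIV w" and e: "0 < eps" "eps \<le> 1"
  shows "semiconc (infc w eps) e_t (1 / eps\<^sup>2) (%z. fst (z - minpt w eps z) / eps\<^sup>2)"
    "semiconc (infc w eps) (- e_t) (1 / eps\<^sup>2) (%z. - (fst (z - minpt w eps z) / eps\<^sup>2))"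
    "semiconc (infc w eps) e_x (1 / eps) (%z. snd (z - minpt w eps z) / eps)"
    "semiconc (infc w eps) (- e_x) (1 / eps) (%z. - (snd (z - minpt w eps z) / eps))"
proof -
  have b: "infc w eps (z + k) \<le> w (minpt w eps z) + pnl eps ((z - minpt w eps z) + k)" for z k
    using infc_le[OF w e, of "z + k" "minpt w eps z"] by (simp add: algebra_simps)
  have t: "infc w eps (z + s *\<^sub>R e_t) \<le> infc w eps z + fst (z - minpt w eps z) / eps\<^sup>2 * s + (1 / eps\<^sup>2) * s\<^sup>2 / 2" for z s
    using b[of z "s *\<^sub>R e_t"] unfolding pnl_expand[OF e(1)] by (simp add: infc_def)
  have x: "infc w eps (z + s *\<^sub>R e_x) \<le> infc w eps z + snd (z - minpt w eps z) / eps * s + (1 / eps) * s\<^sup>2 / 2" for z s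
    using b[of z "s *\<^sub>R e_x"] unfolding pnl_expand[OF e(1)] by (simp add: infc_def)
  show "semiconc (infc w eps) e_t (1 / eps\<^sup>2) (%z. fst (z - minpt w eps z) / eps\<^sup>2)"
    "semiconc (infc w eps) e_x (1 / eps) (%z. snd (z - minpt w eps z) / eps)"
    unfolding semiconc_def using t x by blast+
  show "semiconc (infc w eps) (- e_t) (1 / eps\<^sup>2) (%z. - (fst (z - minpt w eps z) / eps\<^sup>2))"
    unfolding semiconc_def
  proof (intro allI)
    fix z :: "plane" and s :: real
    show "infc w eps (z + s *\<^sub>R - e_t) \<le> infc w eps z + - (fst (z - minpt w eps z) / eps\<^sup>2) * s + 1 / eps\<^sup>2 * s\<^sup>2 / 2"
      using t[of z "- s"] by simp
  qed
  show "semiconc (infc w eps) (- e_x) (1 / eps) (%z. - (snd (z - minpt w eps z) / eps))"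
    unfolding semiconc_def
  proof (intro allI)
    fix z :: "plane" and s :: real
    show "infc w eps (z + s *\<^sub>R - e_x) \<le> infc w eps z + - (snd (z - minpt w eps z) / eps) * s + 1 / eps * s\<^sup>2 / 2"
      using x[of z "- s"] by simp
  qed
qed

text \<open>At the minimiser the penalty, seen as a function of the other argument, touches
  \<open>w\<close> from below. The slope is the one that \<open>infc_semiconc\<close> assigns to
  \<open>z\<close>, so inequalities for subdifferentials of \<open>w\<close> transfer to the
  inf-convolution at every point, not just almost everywhere.\<close>

lemma infc_subdiff:
  assumes w: "L-lipschitz_on UNIV w" and e: "0 < eps" "eps \<le> 1"
  shows "subdiff w (minpt w eps z) (fst (z - minpt w eps z) / eps\<^sup>2) (snd (z - minpt w eps z) / eps)"
  unfolding subdiff_def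
proof (intro allI impI)
  fix eps' :: real assume e': "0 < eps'"
  let ?m = "minpt w eps z"
  have e2: "0 < eps\<^sup>2" "eps\<^sup>2 \<le> eps" using e by (simp_all add: power2_eq_square mult_left_le)
  show "\<exists>r>0. \<forall>y\<in>ball ?m r. w ?m + lin ?m (fst (z - ?m) / eps\<^sup>2) (snd (z - ?m) / eps) y - eps' * norm (y - ?m) \<le> w y"
  proof (intro exI[of _ "2 * eps\<^sup>2 * eps'"] conjI ballI)
    show "0 < 2 * eps\<^sup>2 * eps'" using e2 e' by simp
    fix y assume "y \<in> ball ?m (2 * eps\<^sup>2 * eps')"
    then have n: "norm (y - ?m) < 2 * eps\<^sup>2 * eps'" by (simp add: dist_norm norm_minus_commute)
    define k where "k = y - ?m"
    have "w ?m + pnl eps (z - ?m) \<le> w y + pnl eps (z - y)" by (rule minpt_min[OF w e])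
    moreover have "pnl eps (z - y) = pnl eps (z - ?m) - (fst (z - ?m) / eps\<^sup>2 * fst k + snd (z - ?m) / eps * snd k) + pnl eps k"
      using e unfolding pnl_def k_def by (simp add: power2_eq_square field_simps)
    moreover have "pnl eps k \<le> eps' * norm k"
    proof -
      have "(snd k)\<^sup>2 / (2 * eps) \<le> (snd k)\<^sup>2 / (2 * eps\<^sup>2)" 
      proof (rule divide_left_mono)
        show "0 < (2 * eps) * (2 * eps\<^sup>2)" by (intro mult_pos_pos e(1) e2(1) zero_less_numeral)
      qed (use e2 in simp_all)
      then have "pnl eps k \<le> (norm k)\<^sup>2 / (2 * eps\<^sup>2)" unfolding pnl_def by (cases k) (simp add: norm_Pair add_divide_distrib)
      also have "\<dots> = norm k * norm k / (2 * eps\<^sup>2)" by (simp add: power2_eq_square)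
      also have "\<dots> \<le> (2 * eps\<^sup>2 * eps') * norm k / (2 * eps\<^sup>2)" using n e2 unfolding k_def by (intro divide_right_mono mult_right_mono) auto
      also have "\<dots> = eps' * norm k" using e2(1) by simp
      finally show ?thesis .
    qed
    ultimately show "w ?m + lin ?m (fst (z - ?m) / eps\<^sup>2) (snd (z - ?m) / eps) y - eps' * norm (y - ?m) \<le> w y"
      unfolding k_def by simp
  qed
qed

text \<open>The temporal penalty is of higher order than the spatial one, so that differentiability of the
  spatial section alone controls the minimiser.\<close>

lemma infc_slope_tendsto:
  assumes w: "L-lipschitz_on UNIV w" and d: "DERIV (%y. w (fst z, y)) (snd z) :> u"
  shows "(%n. snd (z - minpt w (1 / real (Suc n)) z) / (1 / real (Suc n))) \<longlonglongrightarrow> u"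
proof (rule LIMSEQ_I)
  fix \<rho> :: real assume rho: "\<rho> > 0"
  have L0: "0 \<le> L" using w by (rule lipschitz_on_nonneg)
  define M where "M = 2 * L + \<bar>u\<bar> + 1"
  have M: "M \<ge> 1" using L0 by (simp add: M_def)
  \<comment> \<open>The two linearisation errors together give
    \<open>2 * \<eta> * M = \<rho>\<^sup>2 / 8\<close>, and \<open>eps0\<close> below bounds the
    effect of the time displacement by as much, so \<open>(v - u)\<^sup>2\<close> is at most
    \<open>\<rho>\<^sup>2 / 2\<close>.\<close>
  define \<eta> where "\<eta> = \<rho>\<^sup>2 / (16 * M)"
  have eta: "\<eta> > 0" using rho M by (simp add: \<eta>_def)
  obtain s where s: "s > 0" "!!k. \<bar>k\<bar> < s ==> \<bar>w (fst z, snd z + k) - w z - u * k\<bar> \<le> \<eta> * \<bar>k\<bar>"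
  proof -
    have "((%h. (w (fst z, snd z + h) - w (fst z, snd z)) / h) \<longlongrightarrow> u) (at 0)" using d by (simp add: DERIV_def)
    then obtain s where s: "s > 0" "!!h. h \<noteq> 0 ==> norm (h - 0) < s ==> norm ((w (fst z, snd z + h) - w (fst z, snd z)) / h - u) < \<eta>"
      using eta unfolding LIM_eq by blast
    show thesis
    proof (rule that[OF s(1)])
      fix k :: real assume k: "\<bar>k\<bar> < s"
      show "\<bar>w (fst z, snd z + k) - w z - u * k\<bar> \<le> \<eta> * \<bar>k\<bar>"
      proof (cases "k = 0")
        case True then show ?thesis by simp
      next
        case False
        have e: "w (fst z, snd z + k) - w z - u * k = ((w (fst z, snd z + k) - w (fst z, snd z)) / k - u) * k"
          using False by (simp add: field_simps)
        show ?thesis unfolding e abs_mult using s(2)[OF False] k by (intro mult_right_mono) auto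
      qed
    qed
  qed
  define eps0 where "eps0 = min (s / (M + 1)) (\<rho>\<^sup>2 / (16 * (L\<^sup>2 + 1)))"
  have e0: "eps0 > 0" using s(1) M rho by (simp add: eps0_def add_nonneg_pos)
  obtain N where N: "1 / real (Suc N) < eps0" using nat_approx_posE[OF e0] by blast
  show "\<exists>no. \<forall>n\<ge>no. norm (snd (z - minpt w (1 / real (Suc n)) z) / (1 / real (Suc n)) - u) < \<rho>"
  proof (intro exI allI impI)
    fix n assume n: "n \<ge> N"
    define eps where "eps = 1 / real (Suc n)"
    have e: "0 < eps" "eps \<le> 1" by (simp_all add: eps_def)
    have "eps \<le> 1 / real (Suc N)" using n by (simp add: eps_def frac_le)
    then have ee: "eps < s / (M + 1)" "eps < \<rho>\<^sup>2 / (16 * (L\<^sup>2 + 1))" using N by (simp_all add: eps0_def)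
    have es: "eps * M < s"
    proof -
      have "eps * M \<le> eps * (M + 1)" using e by simp
      also have "\<dots> < s" using ee(1) M by (simp add: field_simps)
      finally show ?thesis .
    qed
    let ?m = "minpt w eps z"
    define v where "v = (snd z - snd ?m) / eps"
    have vm: "snd ?m = snd z + (- eps * v)" using e by (simp add: v_def)
    note nr = minpt_near[OF w e, of z]
    have vb: "\<bar>v\<bar> \<le> 2 * L" using nr(3) e by (simp add: v_def field_simps)
    \<comment> \<open>The competitor displaced by exactly \<open>- eps * u\<close> in space is
      optimal for the linear approximation of \<open>w\<close>; comparing with it completes the
      square to \<open>eps * ((v - u)\<^sup>2 / 2)\<close>.\<close>
    have "w ?m + pnl eps (z - ?m) \<le> w (fst z, snd z + (- eps * u)) + pnl eps (z - (fst z, snd z + (- eps * u)))"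
      by (rule minpt_min[OF w e])
    moreover have "pnl eps (z - (fst z, snd z + (- eps * u))) = eps * u\<^sup>2 / 2" using e by (simp add: pnl_def power2_eq_square)
    moreover have "eps * v\<^sup>2 / 2 \<le> pnl eps (z - ?m)"
    proof -
      have "eps * v\<^sup>2 / 2 = (snd (z - ?m))\<^sup>2 / (2 * eps)" using e by (simp add: v_def power2_eq_square)
      then show ?thesis unfolding pnl_def by (metis le_add_same_cancel2 divide_nonneg_nonneg zero_le_power2 mult_nonneg_nonneg zero_le_numeral)
    qed
    \<comment> \<open>Moving the minimiser back to the time of \<open>z\<close> costs only order
      \<open>eps\<^sup>2\<close>, negligible against the terms of order \<open>eps\<close>; from
      here on only the space section through \<open>z\<close> is involved.\<close>
    moreover have "w (fst z, snd z + (- eps * v)) - 2 * L\<^sup>2 * eps\<^sup>2 \<le> w ?m"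
    proof -
      have "\<bar>w (fst z, snd ?m) - w ?m\<bar> \<le> L * \<bar>fst z - fst ?m\<bar>"
        using lipschitz_onD[OF w, of "(fst z, snd ?m)" ?m] by (cases ?m) (simp add: dist_Pair_Pair dist_real_def)
      also have "\<dots> \<le> L * (2 * L * eps\<^sup>2)" using nr(2) L0 by (intro mult_left_mono)
      finally show ?thesis using vm by (simp add: power2_eq_square algebra_simps)
    qed
    moreover have "\<bar>w (fst z, snd z + (- eps * x)) - w z - u * (- eps * x)\<bar> \<le> \<eta> * (eps * M)" if "\<bar>x\<bar> \<le> M" for x
    proof -
      have ab: "\<bar>- eps * x\<bar> \<le> eps * M" using that e by (simp add: abs_mult)
      have "\<bar>w (fst z, snd z + (- eps * x)) - w z - u * (- eps * x)\<bar> \<le> \<eta> * \<bar>- eps * x\<bar>" using ab es by (intro s(2)) simp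
      also have "\<dots> \<le> \<eta> * (eps * M)" using ab eta by (intro mult_left_mono) auto
      finally show ?thesis .
    qed
    moreover have "\<bar>u\<bar> \<le> M" "\<bar>v\<bar> \<le> M" using vb L0 by (auto simp: M_def)
    ultimately have A: "\<bar>w (fst z, snd z + (- eps * u)) - w z - u * (- eps * u)\<bar> \<le> \<eta> * (eps * M)"
      "\<bar>w (fst z, snd z + (- eps * v)) - w z - u * (- eps * v)\<bar> \<le> \<eta> * (eps * M)"
      "w (fst z, snd z + (- eps * v)) - 2 * L\<^sup>2 * eps\<^sup>2 + eps * v\<^sup>2 / 2 \<le> w (fst z, snd z + (- eps * u)) + eps * u\<^sup>2 / 2"
      by (blast, blast, linarith)
    have "u * (- eps * v) + eps * v\<^sup>2 / 2 - (u * (- eps * u) + eps * u\<^sup>2 / 2) = eps * ((v - u)\<^sup>2 / 2)"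
      by (simp add: power2_eq_square algebra_simps)
    then have "eps * ((v - u)\<^sup>2 / 2) \<le> 2 * (\<eta> * (eps * M)) + 2 * L\<^sup>2 * eps\<^sup>2" using A by linarith
    also have "\<dots> = eps * (2 * \<eta> * M + 2 * L\<^sup>2 * eps)" by (simp add: power2_eq_square algebra_simps)
    finally have "(v - u)\<^sup>2 / 2 \<le> 2 * \<eta> * M + 2 * L\<^sup>2 * eps" using e(1) by (simp only: mult_le_cancel_left_pos)
    moreover have "2 * \<eta> * M = \<rho>\<^sup>2 / 8" using M by (simp add: \<eta>_def)
    moreover have "2 * L\<^sup>2 * eps \<le> \<rho>\<^sup>2 / 8"
    proof -
      have "2 * L\<^sup>2 * eps \<le> 2 * (L\<^sup>2 + 1) * (\<rho>\<^sup>2 / (16 * (L\<^sup>2 + 1)))" using ee(2) e by (intro mult_mono) auto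
      also have "\<dots> = \<rho>\<^sup>2 / 8" by (simp add: field_simps add_nonneg_eq_0_iff)
      finally show ?thesis .
    qed
    ultimately have "(v - u)\<^sup>2 \<le> \<rho>\<^sup>2 / 2" by linarith
    also have "\<dots> < \<rho>\<^sup>2" using rho by simp
    finally have "\<bar>v - u\<bar> < \<rho>" using rho by (metis abs_le_square_iff abs_of_pos not_less)
    then show "norm (snd (z - minpt w (1 / real (Suc n)) z) / (1 / real (Suc n)) - u) < \<rho>"
      by (simp add: v_def eps_def)
  qed
qed

section \<open>The entropy inequality\<close>

lemma has_partials_comp:
  assumes "!!s. DERIV g s :> g' s" "has_partials u ut ux"
  shows "has_partials (%z. g (u z)) (%z. g' (u z) * ut z) (%z. g' (u z) * ux z)"
  using assms(2) unfolding has_partials_def by (auto intro!: DERIV_chain2[OF assms(1)])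

lemma has_partials_mult:
  assumes "has_partials a a\<^sub>t a\<^sub>x" "has_partials b b\<^sub>t b\<^sub>x"
  shows "has_partials (%z. a z * b z) (%z. a z * b\<^sub>t z + a\<^sub>t z * b z) (%z. a z * b\<^sub>x z + a\<^sub>x z * b z)"
  using assms unfolding has_partials_def by (auto intro!: derivative_eq_intros)

lemma compact_partials_integral_zero:
  assumes p: "has_partials X Xt Xx" and c: "continuous_on UNIV X" "continuous_on UNIV Xt" "continuous_on UNIV Xx"
    and R: "!!z. R < norm z ==> X z = 0"
  shows "integrable lborel Xt" "(LBINT z. Xt z) = 0" "integrable lborel Xx" "(LBINT z. Xx z) = 0"
proof -
  have z: "Xt z = 0" "Xx z = 0" if "R < norm z" for z
    using has_partials_zero_outside[OF p closed_cball, of 0 R z] R that by (auto simp: dist_norm)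
  obtain B0 B1 B2 where B: "!!z. \<bar>X z\<bar> \<le> B0" "!!z. \<bar>Xt z\<bar> \<le> B1" "!!z. \<bar>Xx z\<bar> \<le> B2"
    using continuous_support_bounded[OF c(1) R] continuous_support_bounded[OF c(2) z(1)] continuous_support_bounded[OF c(3) z(2)] by metis
  have "B0 \<ge> 0" "B1 \<ge> 0" "B2 \<ge> 0" using B[of 0] by linarith+
  then have "(2 * (B1 + B2))-lipschitz_on UNIV X"
  proof (intro lipschitz_onI)
    have b: "\<bar>Xt z\<bar> \<le> B1 + B2" "\<bar>Xx z\<bar> \<le> B1 + B2" for z using B(2,3)[of z] \<open>B1 \<ge> 0\<close> \<open>B2 \<ge> 0\<close> by linarith+
    show "dist (X y) (X z) \<le> 2 * (B1 + B2) * dist y z" for y z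
      using has_partials_lipschitz[OF p b, of y z] by (simp add: dist_norm)
  qed auto
  note l = dq_lipschitz[OF this]
  have m: "X \<in> borel_measurable borel" "Xt \<in> borel_measurable borel" "Xx \<in> borel_measurable borel"
    using c by (auto intro: borel_measurable_continuous_onI)
  note d = dq_partials[OF p]
  show "integrable lborel Xt" "(LBINT z. Xt z) = 0"
    using integral_derivative_zero[OF m(1) B(1) R l, of _ e_t Xt] d(1) m(2) by auto
  show "integrable lborel Xx" "(LBINT z. Xx z) = 0"
    using integral_derivative_zero[OF m(1) B(1) R l, of _ e_x Xx] d(2) m(3) by auto
qed

lemma entropy_identity:
  assumes u: "has_partials u ut ux" "continuous_on UNIV u" "continuous_on UNIV ut" "continuous_on UNIV ux"
    and N: "has_partials N Nt Nx" "continuous_on UNIV N" "continuous_on UNIV Nt" "continuous_on UNIV Nx"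
    and mixed: "!!z. ut z = Nx z"
    and phi: "has_partials phi phit phix" "continuous_on UNIV phi" "continuous_on UNIV phit" "continuous_on UNIV phix" "!!z. R < norm z ==> phi z = 0"
    and d: "!!s. DERIV \<eta> s :> \<eta>1 s" "!!s. DERIV \<eta>1 s :> \<eta>2 s" "continuous_on UNIV \<eta>2"
      "!!s. DERIV Q s :> \<eta>2 s * f s" and f: "continuous_on UNIV f"
  shows "integrable lborel (%z. \<eta> (u z) * phit z + (\<eta>1 (u z) * f (u z) - Q (u z)) * phix z
            - (f (u z) + N z) * (phix z * \<eta>1 (u z) + phi z * \<eta>2 (u z) * ux z))"
    "(LBINT z. \<eta> (u z) * phit z + (\<eta>1 (u z) * f (u z) - Q (u z)) * phix z
            - (f (u z) + N z) * (phix z * \<eta>1 (u z) + phi z * \<eta>2 (u z) * ux z)) = 0"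
proof -
  have ce: "continuous_on UNIV \<eta>" "continuous_on UNIV \<eta>1" "continuous_on UNIV Q"
    using DERIV_isCont[OF d(1)] DERIV_isCont[OF d(2)] DERIV_isCont[OF d(4)] by (simp_all add: continuous_at_imp_continuous_on)
  have comp: "continuous_on UNIV (%z. g (u z))" if "continuous_on UNIV g" for g :: "real => real"
    using continuous_on_compose2[OF that u(2)] by simp
  note cs = comp[OF ce(1)] comp[OF ce(2)] comp[OF ce(3)] comp[OF d(3)] comp[OF f] u(2-4) N(2-4) phi(2-4)
  note X1 = has_partials_mult[OF has_partials_comp[OF d(1) u(1)] phi(1)]
    and X2 = has_partials_mult[OF has_partials_mult[OF has_partials_comp[OF d(2) u(1)] N(1)] phi(1)]
    and X3 = has_partials_mult[OF has_partials_comp[OF d(4) u(1)] phi(1)]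
  have z1: "!!z. R < norm z ==> \<eta> (u z) * phi z = 0" and z2: "!!z. R < norm z ==> \<eta>1 (u z) * N z * phi z = 0"
    and z3: "!!z. R < norm z ==> Q (u z) * phi z = 0" using phi(5) by simp_all
  have Y1: "integrable lborel (%z. \<eta> (u z) * phit z + \<eta>1 (u z) * ut z * phi z) \<and>
    (LBINT z. \<eta> (u z) * phit z + \<eta>1 (u z) * ut z * phi z) = 0"
    by (rule conjI[OF compact_partials_integral_zero(1)[OF X1, where R=R] compact_partials_integral_zero(2)[OF X1, where R=R]]; (intro continuous_on_add continuous_on_mult cs | erule z1))
  have Y2: "integrable lborel (%z. \<eta>1 (u z) * N z * phix z + (\<eta>1 (u z) * Nx z + \<eta>2 (u z) * ux z * N z) * phi z) \<and>
    (LBINT z. \<eta>1 (u z) * N z * phix z + (\<eta>1 (u z) * Nx z + \<eta>2 (u z) * ux z * N z) * phi z) = 0"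
    by (rule conjI[OF compact_partials_integral_zero(3)[OF X2, where R=R] compact_partials_integral_zero(4)[OF X2, where R=R]]; (intro continuous_on_add continuous_on_mult cs | erule z2))
  have Y3: "integrable lborel (%z. Q (u z) * phix z + \<eta>2 (u z) * f (u z) * ux z * phi z) \<and>
    (LBINT z. Q (u z) * phix z + \<eta>2 (u z) * f (u z) * ux z * phi z) = 0"
    by (rule conjI[OF compact_partials_integral_zero(3)[OF X3, where R=R] compact_partials_integral_zero(4)[OF X3, where R=R]]; (intro continuous_on_add continuous_on_mult cs | erule z3))
  have eq: "\<eta> (u z) * phit z + (\<eta>1 (u z) * f (u z) - Q (u z)) * phix z
            - (f (u z) + N z) * (phix z * \<eta>1 (u z) + phi z * \<eta>2 (u z) * ux z)
      = (\<eta> (u z) * phit z + \<eta>1 (u z) * ut z * phi z)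
        - (\<eta>1 (u z) * N z * phix z + (\<eta>1 (u z) * Nx z + \<eta>2 (u z) * ux z * N z) * phi z)
        - (Q (u z) * phix z + \<eta>2 (u z) * f (u z) * ux z * phi z)" for z
    unfolding mixed by (simp add: algebra_simps)
  show "integrable lborel (%z. \<eta> (u z) * phit z + (\<eta>1 (u z) * f (u z) - Q (u z)) * phix z
            - (f (u z) + N z) * (phix z * \<eta>1 (u z) + phi z * \<eta>2 (u z) * ux z))"
    unfolding eq by (intro Bochner_Integration.integrable_diff Y1[THEN conjunct1] Y2[THEN conjunct1] Y3[THEN conjunct1])
  show "(LBINT z. \<eta> (u z) * phit z + (\<eta>1 (u z) * f (u z) - Q (u z)) * phix z
            - (f (u z) + N z) * (phix z * \<eta>1 (u z) + phi z * \<eta>2 (u z) * ux z)) = 0"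
    unfolding eq using Y1 Y2 Y3 by simp
qed

lemma tendsto_integral_comp:
  fixes H :: "plane => real"
  assumes H: "continuous_on UNIV H" and b: "!!n z. \<bar>v n z\<bar> \<le> C" "!!n z. \<bar>m n z\<bar> \<le> C"
    and lim: "AE z in M. psi z \<noteq> 0 --> (%n. v n z) \<longlonglongrightarrow> v0 z" "AE z in M. psi z \<noteq> 0 --> (%n. m n z) \<longlonglongrightarrow> m0 z"
    and ms [measurable]: "!!n. v n \<in> borel_measurable M" "!!n. m n \<in> borel_measurable M" "v0 \<in> borel_measurable M" "m0 \<in> borel_measurable M"
    and i: "integrable M psi"
  shows "(%n. \<integral>z. H (v n z, m n z) * psi z \<partial>M) \<longlonglongrightarrow> (\<integral>z. H (v0 z, m0 z) * psi z \<partial>M)"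
    "integrable M (%z. H (v n z, m n z) * psi z)"
proof -
  have [measurable]: "H \<in> borel_measurable borel" "psi \<in> borel_measurable M" using H i by (auto intro: borel_measurable_continuous_onI)
  have "compact (H ` ({-C..C} \<times> {-C..C}))"
    by (intro compact_continuous_image continuous_on_subset[OF H] compact_Times) auto
  then have "bounded (H ` ({-C..C} \<times> {-C..C}))" by (rule compact_imp_bounded)
  then obtain B where "\<forall>y\<in>H ` ({-C..C} \<times> {-C..C}). norm y \<le> B" unfolding bounded_iff by blast
  moreover have "(v n z, m n z) \<in> {-C..C} \<times> {-C..C}" for n z using b[of n z] by (simp add: abs_le_iff)
  ultimately have B: "\<bar>H (v n z, m n z)\<bar> \<le> B" for n z by (metis image_eqI real_norm_def)
  have d: "norm (H (v n z, m n z) * psi z) \<le> B * \<bar>psi z\<bar>" for n z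
    unfolding real_norm_def abs_mult using B[of n z] by (intro mult_right_mono) auto
  have iB: "integrable M (%z. B * \<bar>psi z\<bar>)" using i by auto
  show "(%n. \<integral>z. H (v n z, m n z) * psi z \<partial>M) \<longlonglongrightarrow> (\<integral>z. H (v0 z, m0 z) * psi z \<partial>M)"
  proof (rule integral_dominated_convergence[OF _ _ iB])
    show "AE z in M. (%n. H (v n z, m n z) * psi z) \<longlonglongrightarrow> H (v0 z, m0 z) * psi z"
      using lim
    proof eventually_elim
      case (elim z)
      note a = elim(1-2)
      show ?case
      proof (cases "psi z = 0")
        case False
        then have "(%n. (v n z, m n z)) \<longlonglongrightarrow> (v0 z, m0 z)" using a by (intro tendsto_Pair) auto
        then have "(%n. H (v n z, m n z)) \<longlonglongrightarrow> H (v0 z, m0 z)" by (rule continuous_on_tendsto_compose[OF H]) auto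
        then show ?thesis by (rule tendsto_mult[OF _ tendsto_const])
      qed simp
    qed
  qed (use d in auto)
  show "integrable M (%z. H (v n z, m n z) * psi z)"
    by (rule Bochner_Integration.integrable_bound[OF iB]) (use d order_trans[OF d abs_ge_self] in auto)
qed

text \<open>The product form makes the two mixed derivatives one function \<open>phitx\<close>;
  convolution turns this into the relation \<open>mixed\<close> of
  \<open>entropy_identity\<close>.\<close>

lemma bump_fun_second_partials:
  assumes b: "bump_fun phi"
  obtains phit phix phitt phitx phixx where "has_partials phi phit phix" "has_partials phit phitt phitx" "has_partials phix phitx phixx"
    "bump_fun phit" "bump_fun phix" "bump_fun phitt" "bump_fun phitx" "bump_fun phixx"
proof -
  obtain phit phix where 1: "bump_fun phit" "bump_fun phix" "has_partials phi phit phix" using bump_fun_partials[OF b] .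
  obtain phitt phitx where 2: "bump_fun phitt" "bump_fun phitx" "has_partials phit phitt phitx" using bump_fun_partials[OF 1(1)] .
  obtain phixt phixx where 3: "bump_fun phixt" "bump_fun phixx" "has_partials phix phixt phixx" using bump_fun_partials[OF 1(2)] .
  obtain f g where fg: "smooth1 f" "smooth1 g" "phi = (%z. f (fst z) * g (snd z))" using b unfolding bump_fun_def by blast
  obtain f' g' where *: "!!s. DERIV f s :> f' s" "!!s. DERIV g s :> g' s"
    using smooth1_deriv fg by metis
  have e: "has_partials phi (%z. f' (fst z) * g (snd z)) (%z. f (fst z) * g' (snd z))"
    unfolding has_partials_def fg(3) by (auto intro!: derivative_eq_intros *)
  have "phit = (%z. f' (fst z) * g (snd z))" "phix = (%z. f (fst z) * g' (snd z))"
    using has_partials_d[OF e] has_partials_d[OF 1(3)] by simp_all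
  then have "d_x phit = (%z. f' (fst z) * g' (snd z))" "d_t phix = (%z. f' (fst z) * g' (snd z))"
    unfolding d_x_def d_t_def by (auto intro!: DERIV_imp_deriv derivative_eq_intros *)
  then have "phitx = phixt" using has_partials_d[OF 2(3)] has_partials_d[OF 3(3)] by simp
  then show thesis using that[OF 1(3) 2(3) _ 1(1,2) 2(1,2) 3(2)] 3(3) by simp
qed

lemma conv_has_partials:
  assumes "integrable lborel G" "bump_fun phi" "has_partials phi phit phix"
  shows "has_partials (conv G phi) (conv G phit) (conv G phix)"
proof -
  obtain a b where "has_partials phi a b" "has_partials (conv G phi) (conv G a) (conv G b)"
    using conv_bump_partials[OF assms(1,2)] .
  then show ?thesis using has_partials_d[of phi a b] has_partials_d[OF assms(3)] by simp
qed

text \<open>A one-sided estimate of Oleinik type, valid at every point. Comparing the parabolas at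
  both ends bounds the increase of \<open>p\<close>; since \<open>p\<close> is only an upper bound
  for \<open>dlim\<close>, the quotients at \<open>z\<close> are compared with \<open>p\<close> at
  the nearby points \<open>z + h *\<^sub>R e\<close>.\<close>

lemma semiconc_dlim_mono:
  assumes sc: "semiconc W e \<kappa> p" and sc': "semiconc W (- e) \<kappa> (%z. - p z)" and lip: "L-lipschitz_on UNIV W" and k: "0 < k"
  shows "dlim e W (z + k *\<^sub>R e) \<le> dlim e W z + \<kappa> * k"
proof -
  note d = semiconc_dlim[OF sc lip]
  have m: "p (y + s *\<^sub>R e) \<le> p y + \<kappa> * s" if "0 < s" for y s
  proof -
    have "W (y + s *\<^sub>R e) \<le> W y + p y * s + \<kappa> * s\<^sup>2 / 2" using sc unfolding semiconc_def by blast
    moreover have "W ((y + s *\<^sub>R e) + (- s) *\<^sub>R e) \<le> W (y + s *\<^sub>R e) + p (y + s *\<^sub>R e) * (- s) + \<kappa> * (- s)\<^sup>2 / 2"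
      using sc unfolding semiconc_def by blast
    ultimately have "p (y + s *\<^sub>R e) * s \<le> (p y + \<kappa> * s) * s" by (simp add: power2_eq_square algebra_simps)
    then show ?thesis using that by simp
  qed
  have ev: "\<forall>\<^sub>F n in sequentially. p (z + k *\<^sub>R e) - \<kappa> * k + \<kappa> * (1 / real (Suc n)) / 2 \<le> dq e W n z"
  proof -
    obtain N where N: "1 / real (Suc N) < k" using nat_approx_posE[OF k] by blast
    show ?thesis
    proof (intro eventually_sequentiallyI)
      fix n assume n: "N \<le> n"
      define h where "h = 1 / real (Suc n)"
      have h: "h > 0" "real (Suc n) = 1 / h" by (simp_all add: h_def)
      have "h \<le> 1 / real (Suc N)" using n by (simp add: h_def frac_le)
      then have hk: "h < k" using N by simp
      have "W ((z + h *\<^sub>R e) + (- h) *\<^sub>R e) \<le> W (z + h *\<^sub>R e) + p (z + h *\<^sub>R e) * (- h) + \<kappa> * (- h)\<^sup>2 / 2"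
        using sc unfolding semiconc_def by blast
      then have "(p (z + h *\<^sub>R e) - \<kappa> * h / 2) * h \<le> W (z + h *\<^sub>R e) - W z" by (simp add: power2_eq_square algebra_simps)
      then have "p (z + h *\<^sub>R e) - \<kappa> * h / 2 \<le> dq e W n z" unfolding dq_def h_def[symmetric] h(2) using h(1) by (simp add: field_simps)
      moreover have "p ((z + h *\<^sub>R e) + (k - h) *\<^sub>R e) \<le> p (z + h *\<^sub>R e) + \<kappa> * (k - h)" using hk by (intro m) simp
      moreover have "(z + h *\<^sub>R e) + (k - h) *\<^sub>R e = z + k *\<^sub>R e" by (simp add: algebra_simps)
      ultimately show "p (z + k *\<^sub>R e) - \<kappa> * k + \<kappa> * (1 / real (Suc n)) / 2 \<le> dq e W n z"
        unfolding h_def[symmetric] by (simp add: algebra_simps)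
    qed
  qed
  have "(%n. p (z + k *\<^sub>R e) - \<kappa> * k + \<kappa> * (1 / real (Suc n)) / 2) \<longlonglongrightarrow> p (z + k *\<^sub>R e) - \<kappa> * k + \<kappa> * 0 / 2"
    using LIMSEQ_inverse_real_of_nat by (intro tendsto_intros) (simp_all add: inverse_eq_divide)
  from tendsto_le[OF sequentially_bot d(1) this ev]
  have "p (z + k *\<^sub>R e) - \<kappa> * k \<le> dlim e W z" by simp
  then show ?thesis using d(2)[of "z + k *\<^sub>R e"] by linarith
qed

lemma lipschitz_cutoff:
  "1-lipschitz_on UNIV (%z::'a::real_normed_vector. max 0 (min 1 (r - norm z)))"
proof (rule lipschitz_onI)
  fix y z :: 'a
  have "\<bar>max 0 (min 1 a) - max 0 (min 1 b)\<bar> \<le> \<bar>a - b\<bar>" for a b :: real by (auto simp: max_def min_def abs_if)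
  from this[of "r - norm y" "r - norm z"]
  show "dist (max 0 (min 1 (r - norm y))) (max 0 (min 1 (r - norm z))) \<le> 1 * dist y z"
    using norm_triangle_ineq3[of z y] by (simp add: dist_real_def dist_norm norm_minus_commute)
qed simp

text \<open>Jensen's inequality with the mollifier as probability density, carried out through the
  supporting line of \<open>f\<close> at the mollified value.\<close>

lemma conv_jensen:
  assumes f: "convex_on UNIV f" and h: "h > 0" and G: "integrable lborel G" "integrable lborel H"
    and le: "AE y in lborel. norm (z - y) < h --> f (G y) + H y \<le> 0"
  shows "f (conv G (moll h) z) + conv H (moll h) z \<le> 0"
proof -
  define b where "b = conv G (moll h) z"
  obtain c where c: "!!y. f b + c * (y - b) \<le> f y" using convex_subgradient[OF f] by blast
  obtain B where B: "!!y. \<bar>moll h y\<bar> \<le> B" using bump_fun_bounded[OF moll_bump_fun[OF h]] by blast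
  have m: "(%y. moll h (z - y)) \<in> borel_measurable borel" using moll_measurable[OF h] by measurable
  have mb: "\<bar>moll h (z - y)\<bar> \<le> B" for y by (rule B)
  have i: "integrable lborel (%y. G y * moll h (z - y))" "integrable lborel (%y. H y * moll h (z - y))"
    using m by (auto intro!: integrable_mult_bounded[OF _ _ mb] G)
  have im: "integrable lborel (%y. moll h (z - y))" by (rule bump_fun_integrable[OF bump_fun_reflect[OF moll_bump_fun[OF h]]])
  have m1: "(LBINT y. moll h (z - y)) = 1" unfolding lborel_integral_reflect[OF moll_measurable[OF h]] by (rule moll_integral[OF h])
  have "(LBINT y. (f b - c * b) * moll h (z - y) + c * (G y * moll h (z - y)) + H y * moll h (z - y)) \<le> (\<integral>y. 0 \<partial>(lborel :: (plane) measure))"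
  proof (rule integral_mono_AE)
    show "AE y in lborel. (f b - c * b) * moll h (z - y) + c * (G y * moll h (z - y)) + H y * moll h (z - y) \<le> 0"
      using le
    proof eventually_elim
      case (elim y)
      note a = elim
      show ?case
      proof (cases "norm (z - y) < h")
        case True
        then have "f b + c * (G y - b) + H y \<le> 0" using a c[of "G y"] by linarith
        from mult_right_mono[OF this moll_nonneg[OF h, of "z - y"]] show ?thesis by (simp add: algebra_simps)
      next
        case False then show ?thesis using moll_zero[OF h, of "z - y"] by simp
      qed
    qed
  qed (use i im in auto)
  then have "(f b - c * b) + c * b + conv H (moll h) z \<le> 0" using i im m1 unfolding b_def conv_def by simp
  then show ?thesis unfolding b_def by simp
qed

lemma conv_moll_mono_shift:
  assumes h: "h > 0" and G: "G \<in> borel_measurable borel" "!!z. \<bar>G z\<bar> \<le> B"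
    and le: "!!y. norm y < h ==> G (z + e - y) \<le> G (z - y) + d"
  shows "conv G (moll h) (z + e) \<le> conv G (moll h) z + d"
proof -
  have i: "integrable lborel (%y. G (a - y) * moll h y)" for a
  proof -
    have "(%y. G (a - y)) \<in> borel_measurable lborel" using G(1) by measurable
    from integrable_mult_bounded[OF moll_integrable[OF h] this G(2)] show ?thesis by (simp add: mult.commute)
  qed
  have "(LBINT y. G (z + e - y) * moll h y) \<le> (LBINT y. G (z - y) * moll h y + d * moll h y)"
  proof (rule integral_mono)
    fix y
    show "G (z + e - y) * moll h y \<le> G (z - y) * moll h y + d * moll h y"
    proof (cases "norm y < h")
      case True
      from mult_right_mono[OF le[OF this] moll_nonneg[OF h, of y]] show ?thesis by (simp add: algebra_simps)
    next
      case False then show ?thesis using moll_zero[OF h, of y] by simp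
    qed
  qed (use i moll_integrable[OF h] in auto)
  also have "\<dots> = (LBINT y. G (z - y) * moll h y) + d" using i moll_integrable[OF h] moll_integral[OF h] by simp
  finally show ?thesis unfolding conv_flip[OF G(1) moll_measurable[OF h]] .
qed

text \<open>For the mollified slopes the residual \<open>f v + m\<close> is at most 0 and the space
  derivative of \<open>v\<close> is at most \<open>\<kappa>\<close>. As \<open>phi\<close> and
  \<open>\<eta>2\<close> are nonnegative, replacing that derivative by \<open>\<kappa>\<close> in
  \<open>entropy_identity\<close> gives an inequality without derivatives of \<open>v\<close>. It
  passes to the limit, and there the residual vanishes by \<open>eq\<close>.\<close>

lemma semiconc_entropy:
  assumes f: "Lip_loc UNIV f" "convex_on UNIV f" and W: "L-lipschitz_on UNIV W"
    and st: "semiconc W e_t \<kappa>t pt" "semiconc W (- e_t) \<kappa>t (%z. - pt z)"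
    and sx: "semiconc W e_x \<kappa> px" "semiconc W (- e_x) \<kappa> (%z. - px z)"
    and eq: "!!z. z \<in> ball p R ==> pt z + f (px z) = 0"
    and phi: "has_partials phi phit phix" "continuous_on UNIV phi" "continuous_on UNIV phit" "continuous_on UNIV phix"
      "!!z. z \<notin> cball p s ==> phi z = 0" "!!z. 0 \<le> phi z" and s: "s < R"
    and d: "!!s. DERIV \<eta> s :> \<eta>1 s" "!!s. DERIV \<eta>1 s :> \<eta>2 s" "continuous_on UNIV \<eta>2"
      "!!s. DERIV Q s :> \<eta>2 s * f s" "!!s. 0 \<le> \<eta>2 s"
  shows "0 \<le> (LBINT z. \<eta> (dlim e_x W z) * phit z + (\<eta>1 (dlim e_x W z) * f (dlim e_x W z) - Q (dlim e_x W z)) * phix z)"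
proof -
  have ce: "continuous_on UNIV \<eta>" "continuous_on UNIV \<eta>1" "continuous_on UNIV Q" "continuous_on UNIV f"
    using DERIV_isCont[OF d(1)] DERIV_isCont[OF d(2)] DERIV_isCont[OF d(4)] Lip_loc_continuous[OF f(1)]
    by (simp_all add: continuous_at_imp_continuous_on)
  note dx = semiconc_dlim[OF sx(1) W] and dt = semiconc_dlim[OF st(1) W]
  have aeq: "AE z in lborel. z \<in> ball p R --> f (dlim e_x W z) + dlim e_t W z = 0"
    using semiconc_deriv_AE[OF sx W disjI2[OF refl]] semiconc_deriv_AE[OF st W disjI1[OF refl]]
  proof eventually_elim
    case (elim z)
    then show ?case using eq[of z] by (simp add: add.commute)
  qed
  define G where "G = (%e z. indicator (ball p R) z * dlim e W z)"
  have Gm: "G e_x \<in> borel_measurable borel" "G e_t \<in> borel_measurable borel"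
    unfolding G_def by (auto intro!: borel_measurable_times borel_measurable_indicator dx(4) dt(4))
  have L0: "0 \<le> L" using W by (rule lipschitz_on_nonneg)
  have Gb: "\<bar>G e_x z\<bar> \<le> L" "\<bar>G e_t z\<bar> \<le> L" for z
    using dx(3)[of z] dt(3)[of z] L0 by (auto simp: G_def indicator_def norm_Pair)
  define R2 where "R2 = norm p + R"
  have inR: "norm z < R2" if "z \<in> ball p R" for z
    using that norm_triangle_ineq[of p "z - p"] by (simp add: R2_def dist_norm norm_minus_commute)
  have Gz: "G e z = 0" if "R2 < norm z" for e z
    using that inR[of z] unfolding G_def indicator_def by auto
  have Gi: "integrable lborel (G e_x)" "integrable lborel (G e_t)"
  proof -
    show "integrable lborel (G e_x)" by (rule integrable_bounded_support[OF Gm(1) Gb(1) Gz])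
    show "integrable lborel (G e_t)" by (rule integrable_bounded_support[OF Gm(2) Gb(2) Gz])
  qed
  \<comment> \<open>Convolution is set up for integrable functions; the cutoff is 1 on
    \<open>ball p R\<close>, so there the derivatives of \<open>g\<close> are those of
    \<open>W\<close>.\<close>
  define cut where "cut = (%z::plane. max 0 (min 1 ((R2 + 1) - norm z)))"
  have cut: "1-lipschitz_on UNIV cut" unfolding cut_def by (rule lipschitz_cutoff)
  have cut0: "cut z = 0" if "R2 + 1 < norm z" for z using that by (simp add: cut_def)
  have cut1: "cut z = 1" if "z \<in> ball p R" for z using inR[OF that] by (simp add: cut_def)
  define g where "g = (%z. W z * cut z)"
  obtain M where "M-lipschitz_on UNIV (%z. W z * cut z)"
    by (rule lipschitz_mult_support[OF W cut cut0]) (assumption, rule that)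
  then have M: "M-lipschitz_on UNIV g" unfolding g_def .
  have gi: "integrable lborel g"
  proof -
    obtain B where B: "B \<ge> 0" "!!z. norm z \<le> R2 + 1 ==> \<bar>g z\<bar> \<le> B" using lipschitz_bounded_cball[OF M] by blast
    have g0: "g z = 0" if "R2 + 1 < norm z" for z using cut0[OF that] by (simp add: g_def)
    have "\<bar>g z\<bar> \<le> B" for z using B g0[of z] by (cases "norm z \<le> R2 + 1") auto
    then show ?thesis by (rule integrable_bounded_support[OF lipschitz_borel[OF M] _ g0])
  qed
  have gd: "AE z in lborel. z \<in> ball p R --> (%n. dq e g n z) \<longlonglongrightarrow> G e z"
    if l: "!!z. (%n. dq e W n z) \<longlonglongrightarrow> dlim e W z" for e
  proof (intro AE_I2 impI)
    fix z assume z: "z \<in> ball p R"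
    have "(%n. dq e (%y. g y - W y) n z) \<longlonglongrightarrow> 0"
      by (rule dq_locally_zero[OF open_ball z]) (simp add: g_def cut1)
    from tendsto_add[OF this l[of z]] show "(%n. dq e g n z) \<longlonglongrightarrow> G e z"
      using z by (simp add: dq_diff G_def)
  qed
  define v where "v = (%n. conv (G e_x) (mo n))"
  define m where "m = (%n. conv (G e_t) (mo n))"
  have vb: "\<bar>v n z\<bar> \<le> L" "\<bar>m n z\<bar> \<le> L" for n z
    unfolding v_def m_def mo_def by (rule conv_moll_abs_bound[OF Gi(1) mo_pos Gb(1)], rule conv_moll_abs_bound[OF Gi(2) mo_pos Gb(2)])
  have vi: "integrable lborel (v n)" "integrable lborel (m n)" for n
    unfolding v_def m_def mo_def by (rule conv_moll_contraction(1)[OF Gi(1) mo_pos], rule conv_moll_contraction(1)[OF Gi(2) mo_pos])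
  have vm: "v n \<in> borel_measurable lborel" "m n \<in> borel_measurable lborel" for n
    by (rule borel_measurable_integrable[OF vi(1)], rule borel_measurable_integrable[OF vi(2)])
  \<comment> \<open>With \<open>\<kappa>\<close> in place of the derivative, each term is a
    continuous function of \<open>(v, m)\<close> times a fixed integrable factor, the form that
    \<open>tendsto_integral_comp\<close> handles.\<close>
  define H1 where "H1 = (%k::plane. \<eta> (fst k))"
  define H2 where "H2 = (%k::plane. \<eta>1 (fst k) * f (fst k) - Q (fst k) - (f (fst k) + snd k) * \<eta>1 (fst k))"
  define H3 where "H3 = (%k::plane. - (f (fst k) + snd k) * \<eta>2 (fst k) * \<kappa>)"
  have cf: "continuous_on UNIV (%k::plane. X (fst k))" if "continuous_on UNIV X" for X :: "real => real"
    by (rule continuous_on_compose2[OF that]) (intro continuous_intros subset_UNIV)+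
  have Hc: "continuous_on UNIV H1" "continuous_on UNIV H2" "continuous_on UNIV H3"
    unfolding H1_def H2_def H3_def
    by (intro continuous_on_diff continuous_on_mult continuous_on_add continuous_on_minus continuous_on_const cf ce d(3) continuous_on_snd continuous_on_id)+
  have phiz: "phit z = 0" "phix z = 0" if "z \<notin> cball p s" for z using has_partials_zero_outside[OF phi(1) closed_cball, of p s z] phi(5) that by blast+
  have out: "z \<notin> cball p s" if "R2 < norm z" for z 
  proof
    assume "z \<in> cball p s"
    then have "z \<in> ball p R" using s by simp
    from inR[OF this] show False using that by simp
  qed
  have phi0: "phi z = 0" "phit z = 0" "phix z = 0" if "R2 < norm z" for z using phi(5) phiz out[OF that] by auto
  have ci: "integrable lborel X" if c: "continuous_on UNIV X" and z: "!!z. R2 < norm z ==> X z = 0" for X :: "plane => real"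
  proof -
    obtain B where "!!z. \<bar>X z\<bar> \<le> B" using continuous_support_bounded[OF c z] by blast
    then show ?thesis by (rule integrable_bounded_support[OF borel_measurable_continuous_onI[OF c] _ z])
  qed
  have phii: "integrable lborel phi" "integrable lborel phit" "integrable lborel phix"
  proof -
    show "integrable lborel phi" by (rule ci[OF phi(2) phi0(1)])
    show "integrable lborel phit" by (rule ci[OF phi(3) phi0(2)])
    show "integrable lborel phix" by (rule ci[OF phi(4) phi0(3)])
  qed
  define J where "J = (%v m. (LBINT z. H1 (v z, m z) * phit z) + (LBINT z. H2 (v z, m z) * phix z) + (LBINT z. H3 (v z, m z) * phi z))"
  have Jint: "integrable lborel (%z. H1 (v z, m z) * phit z)" "integrable lborel (%z. H2 (v z, m z) * phix z)" "integrable lborel (%z. H3 (v z, m z) * phi z)"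
    if "!!z. \<bar>v z\<bar> \<le> L" "!!z. \<bar>m z\<bar> \<le> L" "v \<in> borel_measurable lborel" "m \<in> borel_measurable lborel" for v m :: "plane => real"
    using tendsto_integral_comp(2)[OF Hc(1), where v="%_. v" and m="%_. m" and ?v0.0=v and ?m0.0=m and C=L and M=lborel, OF _ _ _ _ _ _ _ _ phii(2)]
      tendsto_integral_comp(2)[OF Hc(2), where v="%_. v" and m="%_. m" and ?v0.0=v and ?m0.0=m and C=L and M=lborel, OF _ _ _ _ _ _ _ _ phii(3)]
      tendsto_integral_comp(2)[OF Hc(3), where v="%_. v" and m="%_. m" and ?v0.0=v and ?m0.0=m and C=L and M=lborel, OF _ _ _ _ _ _ _ _ phii(1)] that
    by simp_all
  have key: "0 \<le> J (v n) (m n)" if n: "1 / real (Suc n) < (R - s) / 2" for n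
  proof -
    define h where "h = 1 / real (Suc n)"
    have h: "h > 0" "h < (R - s) / 2" using n by (simp_all add: h_def)
    have bm: "bump_fun (moll h)" by (rule moll_bump_fun[OF h(1)])
    obtain mt mx mtt mtx mxx where mp: "has_partials (moll h) mt mx" "has_partials mt mtt mtx" "has_partials mx mtx mxx"
      "bump_fun mt" "bump_fun mx" "bump_fun mtt" "bump_fun mtx" "bump_fun mxx" using bump_fun_second_partials[OF bm] .
    define u where "u = conv g mx"
    define N where "N = conv g mt"
    have up: "has_partials u (conv g mtx) (conv g mxx)" "has_partials N (conv g mtt) (conv g mtx)"
      unfolding u_def N_def using conv_has_partials[OF gi] mp by blast+
    have cc: "continuous_on UNIV u" "continuous_on UNIV N" "continuous_on UNIV (conv g mtt)" "continuous_on UNIV (conv g mtx)" "continuous_on UNIV (conv g mxx)"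
      unfolding u_def N_def using conv_bump_continuous[OF gi] mp by blast+
    have uv: "u z = v n z" "N z = m n z" if z: "cball z h \<subseteq> ball p R" for z
      unfolding u_def N_def v_def m_def mo_def h_def[symmetric]
      using conv_moll_deriv(2)[OF M h(1) mp(1,4,5) z gd[OF dx(1)] Gm(1)] conv_moll_deriv(1)[OF M h(1) mp(1,4,5) z gd[OF dt(1)] Gm(2)] by simp_all
    have cb: "cball y h \<subseteq> ball p R" if "z \<in> cball p s" "norm (y - z) < (R - s) / 2" for y z
    proof
      fix a assume "a \<in> cball y h"
      then have "dist y a \<le> h" by simp
      moreover have "dist p a \<le> dist p z + dist z y + dist y a" using dist_triangle[of p a z] dist_triangle[of z a y] by linarith
      ultimately show "a \<in> ball p R" using that h by (simp add: dist_norm norm_minus_commute)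
    qed
    have rle: "f (v n z) + m n z \<le> 0" if z: "z \<in> cball p s" for z
      unfolding v_def m_def mo_def h_def[symmetric]
    proof (rule conv_jensen[OF f(2) h(1) Gi])
      have sub: "cball z h \<subseteq> ball p R" by (rule cb[OF z]) (use s in simp)
      show "AE y in lborel. norm (z - y) < h --> f (G e_x y) + G e_t y \<le> 0"
        using aeq
      proof eventually_elim
        case (elim y)
        note a = elim
        show ?case
        proof
          assume "norm (z - y) < h"
          then have "y \<in> cball z h" by (simp add: dist_norm)
          then have "y \<in> ball p R" using sub by blast
          then show "f (G e_x y) + G e_t y \<le> 0" using a by (simp add: G_def)
        qed
      qed
    qed
    have uxle: "conv g mxx z \<le> \<kappa>" if z: "z \<in> cball p s" for z
    proof (rule LIMSEQ_le_const2[OF dq_partials(2)[OF up(1)]])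
      obtain j0 where j0: "1 / real (Suc j0) < (R - s) / 2" using nat_approx_posE[of "(R - s) / 2"] s by auto
      show "\<exists>N. \<forall>j\<ge>N. dq e_x u j z \<le> \<kappa>"
      proof (intro exI allI impI)
        fix j assume j: "j0 \<le> j"
        define k where "k = 1 / real (Suc j)"
        have k: "k > 0" "real (Suc j) = 1 / k" by (simp_all add: k_def)
        have "k \<le> 1 / real (Suc j0)" using j by (simp add: k_def frac_le)
        then have kl: "norm ((z + k *\<^sub>R e_x) - z) < (R - s) / 2" using j0 k by (simp add: norm_Pair)
        have sub: "cball z h \<subseteq> ball p R" "cball (z + k *\<^sub>R e_x) h \<subseteq> ball p R" using cb[OF z, of z] cb[OF z kl] s by auto
        have "conv (G e_x) (moll h) (z + k *\<^sub>R e_x) \<le> conv (G e_x) (moll h) z + \<kappa> * k"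
        proof (rule conv_moll_mono_shift[OF h(1) Gm(1) Gb(1)])
          fix y :: "plane" assume y: "norm y < h"
          have "z - y \<in> cball z h" "z + k *\<^sub>R e_x - y \<in> cball (z + k *\<^sub>R e_x) h" using y by (simp_all add: dist_norm)
          then have i: "z - y \<in> ball p R" "z + k *\<^sub>R e_x - y \<in> ball p R" using sub by blast+
          have "dlim e_x W ((z - y) + k *\<^sub>R e_x) \<le> dlim e_x W (z - y) + \<kappa> * k" by (rule semiconc_dlim_mono[OF sx W k(1)])
          moreover have "(z - y) + k *\<^sub>R e_x = z + k *\<^sub>R e_x - y" by simp
          ultimately show "G e_x (z + k *\<^sub>R e_x - y) \<le> G e_x (z - y) + \<kappa> * k" using i by (simp only: G_def indicator_simps mult_1)
        qed
        then have "u (z + k *\<^sub>R e_x) - u z \<le> \<kappa> * k" unfolding uv(1)[OF sub(1)] uv(1)[OF sub(2)] v_def mo_def h_def[symmetric] by linarith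
        then have "(u (z + k *\<^sub>R e_x) - u z) / k \<le> \<kappa>" using k by (simp add: pos_divide_le_eq)
        then show "dq e_x u j z \<le> \<kappa>" unfolding dq_def k_def[symmetric] k(2) by simp
      qed
    qed
    let ?I = "%z. \<eta> (u z) * phit z + (\<eta>1 (u z) * f (u z) - Q (u z)) * phix z
            - (f (u z) + N z) * (phix z * \<eta>1 (u z) + phi z * \<eta>2 (u z) * conv g mxx z)"
    have id: "integrable lborel ?I \<and> (LBINT z. ?I z) = 0"
    proof
      show "integrable lborel ?I"
        by (rule entropy_identity(1)[OF up(1) cc(1,4,5) up(2) cc(2,3,4) refl phi(1-4) phi0(1) d(1-4) ce(4)])
      show "(LBINT z. ?I z) = 0"
        by (rule entropy_identity(2)[OF up(1) cc(1,4,5) up(2) cc(2,3,4) refl phi(1-4) phi0(1) d(1-4) ce(4)])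
    qed
    note ji = Jint[OF vb(1) vb(2) vm(1) vm(2), of n n]
    have "(LBINT z. ?I z) \<le> (LBINT z. H1 (v n z, m n z) * phit z + H2 (v n z, m n z) * phix z + H3 (v n z, m n z) * phi z)"
    proof (rule integral_mono[OF id[THEN conjunct1]])
      show "integrable lborel (%z. H1 (v n z, m n z) * phit z + H2 (v n z, m n z) * phix z + H3 (v n z, m n z) * phi z)"
        by (intro Bochner_Integration.integrable_add ji)
      show "?I z \<le> H1 (v n z, m n z) * phit z + H2 (v n z, m n z) * phix z + H3 (v n z, m n z) * phi z" for z
      proof (cases "z \<in> cball p s")
        case True
        have e: "u z = v n z" "N z = m n z" by (rule uv[OF cb[OF True]], use s in simp)+
        \<comment> \<open>The factor in front of the derivative is nonnegative since the residual is
          nonpositive, so an upper bound on the derivative suffices.\<close>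
        have "- (f (v n z) + m n z) * (phi z * \<eta>2 (v n z)) * conv g mxx z \<le> - (f (v n z) + m n z) * (phi z * \<eta>2 (v n z)) * \<kappa>"
          using rle[OF True] phi(6) d(5) by (intro mult_left_mono uxle[OF True] mult_nonneg_nonneg) auto
        then show ?thesis unfolding e H1_def H2_def H3_def fst_conv snd_conv by (simp add: algebra_simps)
      next
        case False then show ?thesis using phi(5) phiz by simp
      qed
    qed
    then show "0 \<le> J (v n) (m n)" unfolding id[THEN conjunct2] J_def using ji by simp
  qed
  have L1: "(%n. LBINT z. \<bar>v n z - G e_x z\<bar>) \<longlonglongrightarrow> 0" "(%n. LBINT z. \<bar>m n z - G e_t z\<bar>) \<longlonglongrightarrow> 0"
  proof -
    show "(%n. LBINT z. \<bar>v n z - G e_x z\<bar>) \<longlonglongrightarrow> 0" unfolding v_def by (rule conv_mo_L1[OF Gm(1) Gb(1) Gz])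
    show "(%n. LBINT z. \<bar>m n z - G e_t z\<bar>) \<longlonglongrightarrow> 0" unfolding m_def by (rule conv_mo_L1[OF Gm(2) Gb(2) Gz])
  qed
  obtain k1 where k1: "strict_mono k1" "AE z in lborel. (%n. v (k1 n) z - G e_x z) \<longlonglongrightarrow> 0"
    using tendsto_L1_AE_subseq[of lborel "%n z. v n z - G e_x z"] L1(1) vi(1) Gi(1) by auto
  obtain k2 where k2: "strict_mono k2" "AE z in lborel. (%n. m (k1 (k2 n)) z - G e_t z) \<longlonglongrightarrow> 0"
  proof -
    have "(%n. LBINT z. norm (m (k1 n) z - G e_t z)) \<longlonglongrightarrow> 0"
      using LIMSEQ_subseq_LIMSEQ[OF L1(2) k1(1)] by (simp add: comp_def)
    then show thesis using tendsto_L1_AE_subseq[of lborel "%n z. m (k1 n) z - G e_t z"] vi(2) Gi(2) that by auto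
  qed
  define k where "k = (%n. k1 (k2 n))"
  have kge: "n \<le> k n" for n using seq_suble[OF k2(1), of n] seq_suble[OF k1(1), of "k2 n"] unfolding k_def by linarith
  have lv: "AE z in lborel. (%n. v (k n) z) \<longlonglongrightarrow> G e_x z" "AE z in lborel. (%n. m (k n) z) \<longlonglongrightarrow> G e_t z"
  proof -
    show "AE z in lborel. (%n. v (k n) z) \<longlonglongrightarrow> G e_x z" using k1(2)
    proof eventually_elim
      case (elim z)
      from LIMSEQ_subseq_LIMSEQ[OF this k2(1)] show ?case
        unfolding k_def comp_def by (rule LIM_zero_cancel)
    qed
    show "AE z in lborel. (%n. m (k n) z) \<longlonglongrightarrow> G e_t z" using k2(2)
    proof eventually_elim
      case (elim z)
      then show ?case unfolding k_def by (rule LIM_zero_cancel)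
    qed
  qed
  have lv': "AE z in lborel. psi z \<noteq> 0 --> (%n. v (k n) z) \<longlonglongrightarrow> G e_x z" "AE z in lborel. psi z \<noteq> 0 --> (%n. m (k n) z) \<longlonglongrightarrow> G e_t z"
    for psi :: "plane => real"
    by (rule eventually_mono[OF lv(1)], simp, rule eventually_mono[OF lv(2)], simp)
  have Gm': "G e_x \<in> borel_measurable lborel" "G e_t \<in> borel_measurable lborel" using Gm by simp_all
  have lJ: "(%n. J (v (k n)) (m (k n))) \<longlonglongrightarrow> J (G e_x) (G e_t)"
    unfolding J_def
    by (intro tendsto_add tendsto_integral_comp(1)[OF Hc(1) vb lv' vm Gm' phii(2)] tendsto_integral_comp(1)[OF Hc(2) vb lv' vm Gm' phii(3)]
        tendsto_integral_comp(1)[OF Hc(3) vb lv' vm Gm' phii(1)])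
  have "0 \<le> J (G e_x) (G e_t)"
  proof (rule LIMSEQ_le_const[OF lJ])
    obtain j0 where j0: "1 / real (Suc j0) < (R - s) / 2" using nat_approx_posE[of "(R - s) / 2"] s by auto
    show "\<exists>N. \<forall>n\<ge>N. 0 \<le> J (v (k n)) (m (k n))"
    proof (intro exI allI impI key)
      fix n assume "j0 \<le> n"
      from order_trans[OF this kge[of n]] have "j0 \<le> k n" .
      then have "1 / real (Suc (k n)) \<le> 1 / real (Suc j0)" by (simp add: frac_le)
      then show "1 / real (Suc (k n)) < (R - s) / 2" using j0 by (rule le_less_trans)
    qed
  qed
  also have "J (G e_x) (G e_t) = (LBINT z. H1 (G e_x z, G e_t z) * phit z + H2 (G e_x z, G e_t z) * phix z + H3 (G e_x z, G e_t z) * phi z)"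
    unfolding J_def using Jint[OF Gb Gm'] by simp
  also have "\<dots> = (LBINT z. \<eta> (dlim e_x W z) * phit z + (\<eta>1 (dlim e_x W z) * f (dlim e_x W z) - Q (dlim e_x W z)) * phix z)"
  proof (rule integral_cong_AE)
    show "(%z. H1 (G e_x z, G e_t z) * phit z + H2 (G e_x z, G e_t z) * phix z + H3 (G e_x z, G e_t z) * phi z) \<in> borel_measurable lborel"
      using Jint[OF Gb Gm'] by (intro borel_measurable_add borel_measurable_integrable)
    have mX: "(%z. X (dlim e_x W z)) \<in> borel_measurable borel" if "continuous_on UNIV X" for X :: "real => real"
      by (rule measurable_compose[OF dx(4) borel_measurable_continuous_onI[OF that]])
    show "(%z. \<eta> (dlim e_x W z) * phit z + (\<eta>1 (dlim e_x W z) * f (dlim e_x W z) - Q (dlim e_x W z)) * phix z) \<in> borel_measurable lborel"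
      unfolding measurable_lborel1 measurable_lborel2
      by (intro borel_measurable_add borel_measurable_diff borel_measurable_times mX[OF ce(1)] mX[OF ce(2)] mX[OF ce(3)] mX[OF ce(4)]
          borel_measurable_continuous_onI[OF phi(3)] borel_measurable_continuous_onI[OF phi(4)])
    show "AE z in lborel. H1 (G e_x z, G e_t z) * phit z + H2 (G e_x z, G e_t z) * phix z + H3 (G e_x z, G e_t z) * phi z
        = \<eta> (dlim e_x W z) * phit z + (\<eta>1 (dlim e_x W z) * f (dlim e_x W z) - Q (dlim e_x W z)) * phix z"
      using aeq
    proof eventually_elim
      case (elim z)
      note a = elim
      show ?case
      proof (cases "z \<in> cball p s")
        case True
        then have "z \<in> ball p R" using s by simp
        then have "G e_x z = dlim e_x W z" "G e_t z = dlim e_t W z" "f (dlim e_x W z) + dlim e_t W z = 0" using a by (simp_all add: G_def)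
        then show ?thesis by (simp add: H1_def H2_def H3_def)
      next
        case False then show ?thesis using phi(5) phiz by simp
      qed
    qed
  qed
  finally show ?thesis .
qed

text \<open>The slopes of the inf-convolution at \<open>z\<close> form a subdifferential of
  \<open>w\<close> at the minimiser, so \<open>semidiff_le\<close> and \<open>ge\<close> together
  give the equation for them. The semiconcavity constant grows like \<open>1 / eps\<close>, but
  \<open>semiconc_entropy\<close> has no error term for fixed \<open>eps\<close>; only afterwards
  does \<open>eps\<close> tend to zero, where the space slopes converge to \<open>U\<close>.\<close>

lemma local_entropy:
  assumes f: "Lip_loc UNIV f" "convex_on UNIV f" and w: "L-lipschitz_on UNIV w"
    and U: "U \<in> borel_measurable borel" "!!z. \<bar>U z\<bar> \<le> C"
    and gr: "grad_on (ball p R) w (%z. - f (U z)) U"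
    and dw: "AE z in lborel. z \<in> ball p R --> DERIV (%y. w (fst z, y)) (snd z) :> U z"
    and ge: "!!y a b. y \<in> ball p R ==> subdiff w y a b ==> 0 \<le> a + f b"
    and phi: "has_partials phi phit phix" "continuous_on UNIV phi" "continuous_on UNIV phit" "continuous_on UNIV phix"
      "!!z. z \<notin> cball p s ==> phi z = 0" "!!z. 0 \<le> phi z" and s: "s < R"
    and d: "!!s. DERIV \<eta> s :> \<eta>1 s" "!!s. DERIV \<eta>1 s :> \<eta>2 s" "continuous_on UNIV \<eta>2"
      "!!s. DERIV Q s :> \<eta>2 s * f s" "!!s. 0 \<le> \<eta>2 s"
  shows "0 \<le> (LBINT z. \<eta> (U z) * phit z + (\<eta>1 (U z) * f (U z) - Q (U z)) * phix z)"
proof -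
  have ce: "continuous_on UNIV \<eta>" "continuous_on UNIV (%v. \<eta>1 v * f v - Q v)"
    using DERIV_isCont[OF d(1)] DERIV_isCont[OF d(2)] DERIV_isCont[OF d(4)] Lip_loc_continuous[OF f(1)]
    by (auto simp: continuous_at_imp_continuous_on intro!: continuous_on_diff continuous_on_mult)
  define H1 where "H1 = (%k::plane. \<eta> (fst k))"
  define H2 where "H2 = (%k::plane. \<eta>1 (fst k) * f (fst k) - Q (fst k))"
  have Hc: "continuous_on UNIV H1" "continuous_on UNIV H2"
    unfolding H1_def H2_def using continuous_on_compose2[OF ce(1) continuous_on_fst[OF continuous_on_id]] continuous_on_compose2[OF ce(2) continuous_on_fst[OF continuous_on_id]] by auto
  define eps where "eps = (%n. 1 / real (Suc n))"
  have e: "0 < eps n" "eps n \<le> 1" for n by (simp_all add: eps_def)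
  define W where "W = (%n. infc w (eps n))"
  define v where "v = (%n. dlim e_x (W n))"
  have Wl: "L-lipschitz_on UNIV (W n)" for n unfolding W_def by (rule infc_lipschitz[OF w e])
  have Wn: "infc w (eps n) = W n" for n by (simp add: W_def)
  note sc = infc_semiconc[OF w e, unfolded Wn]
  have vb: "\<bar>v n z\<bar> \<le> L" for n z using semiconc_dlim(3)[OF sc(3) Wl, of n z] by (simp add: v_def norm_Pair)
  have vm: "v n \<in> borel_measurable lborel" for n using semiconc_dlim(4)[OF sc(3) Wl, of n] by (simp add: v_def)
  have L0: "0 \<le> L" using w by (rule lipschitz_on_nonneg)
  have phiz: "phit z = 0" "phix z = 0" if "z \<notin> cball p s" for z using has_partials_zero_outside[OF phi(1) closed_cball, of p s z] phi(5) that by blast+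
  have ci: "integrable lborel X" if c: "continuous_on UNIV X" and z: "!!z. z \<notin> cball p s ==> X z = 0" for X :: "plane => real"
  proof -
    have z': "X z = 0" if "norm p + s < norm z" for z
      using that norm_triangle_ineq[of p "z - p"] by (intro z) (simp add: dist_norm norm_minus_commute)
    obtain B where "!!z. \<bar>X z\<bar> \<le> B" using continuous_support_bounded[OF c z'] by blast
    then show ?thesis by (rule integrable_bounded_support[OF borel_measurable_continuous_onI[OF c] _ z'])
  qed
  have phii: "integrable lborel phit" "integrable lborel phix" using phiz by (auto intro: ci phi(3,4))
  have "AE z in lborel. \<forall>n. v n z = snd (z - minpt w (eps n) z) / eps n"
    unfolding AE_all_countable v_def using semiconc_deriv_AE[OF sc(3,4) Wl disjI2[OF refl]] by blast
  then have lim: "AE z in lborel. z \<in> ball p R --> (%n. v n z) \<longlonglongrightarrow> U z" using dw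
  proof eventually_elim
    case (elim z)
    note a = elim(1) and b = elim(2)
    have "(%n. v n z) = (%n. snd (z - minpt w (1 / real (Suc n)) z) / (1 / real (Suc n)))" using a by (simp add: eps_def fun_eq_iff)
    then show ?case using infc_slope_tendsto[OF w, of z "U z"] b by simp
  qed
  have lim': "AE z in lborel. psi z \<noteq> 0 --> (%n. v n z) \<longlonglongrightarrow> U z" if "!!z. z \<notin> cball p s ==> psi z = 0" for psi :: "plane => real"
    using lim
  proof eventually_elim
    case (elim z)
    note a = elim
    show ?case using a that[of z] s by (cases "z \<in> cball p s") auto
  qed
  have Um: "U \<in> borel_measurable lborel" using U(1) by simp
  define J where "J = (%v. LBINT z. \<eta> (v z) * phit z + (\<eta>1 (v z) * f (v z) - Q (v z)) * phix z)"
  have Jeq: "J v = (LBINT z. H1 (v z, 0) * phit z) + (LBINT z. H2 (v z, 0) * phix z)"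
    if v: "!!z. \<bar>v z\<bar> \<le> B" "v \<in> borel_measurable lborel" for v :: "plane => real" and B
  proof -
    have B0: "0 \<le> B" using v(1)[of 0] by linarith
    have i: "integrable lborel (%z. H1 (v z, 0) * phit z)" "integrable lborel (%z. H2 (v z, 0) * phix z)"
      using tendsto_integral_comp(2)[OF Hc(1), where v="%_. v" and m="%_ _. 0" and ?v0.0=v and ?m0.0="%_. 0" and C=B and M=lborel, OF _ _ _ _ _ _ _ _ phii(1)]
        tendsto_integral_comp(2)[OF Hc(2), where v="%_. v" and m="%_ _. 0" and ?v0.0=v and ?m0.0="%_. 0" and C=B and M=lborel, OF _ _ _ _ _ _ _ _ phii(2)] v B0
      by simp_all
    show ?thesis unfolding J_def using Bochner_Integration.integral_add[OF i] by (simp add: H1_def H2_def)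
  qed
  have "(%n. J (v n)) \<longlonglongrightarrow> J U"
    unfolding Jeq[OF vb vm] Jeq[OF U(2) Um]
    by (intro tendsto_add tendsto_integral_comp(1)[OF Hc(1), where m="%_ _. 0" and ?m0.0="%_. 0" and C=L] tendsto_integral_comp(1)[OF Hc(2), where m="%_ _. 0" and ?m0.0="%_. 0" and C=L]
        vb vm Um phii lim' phiz) (simp_all add: L0)
  moreover have "\<exists>N. \<forall>n\<ge>N. 0 \<le> J (v n)"
  proof -
    \<comment> \<open>Half of the room between \<open>s\<close> and \<open>R\<close> is reserved for
      the displacement of the minimiser, which is at most \<open>2 * L * eps n\<close>.\<close>
    define \<rho> where "\<rho> = (R - s) / 2"
    have rho: "\<rho> > 0" using s by (simp add: \<rho>_def)
    obtain j where j: "1 / real (Suc j) < \<rho> / (2 * L + 1)" using nat_approx_posE[of "\<rho> / (2 * L + 1)"] rho L0 by auto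
    show ?thesis
    proof (intro exI allI impI)
      fix n assume n: "j \<le> n"
      have "eps n \<le> 1 / real (Suc j)" using n by (simp add: eps_def frac_le)
      then have "eps n < \<rho> / (2 * L + 1)" using j by linarith
      then have en: "2 * L * eps n < \<rho>" using L0 e(1)[of n] by (simp add: field_simps)
      show "0 \<le> J (v n)" unfolding J_def v_def
      proof (rule semiconc_entropy[OF f Wl sc _ phi _ d, where p=p and R="R - \<rho>" and s=s])
        show "s < R - \<rho>" using s by (simp add: \<rho>_def field_simps)
        fix z assume z: "z \<in> ball p (R - \<rho>)"
        let ?m = "minpt w (eps n) z"
        have "dist p ?m \<le> dist p z + norm (z - ?m)" using dist_triangle[of p ?m z] by (simp add: dist_norm)
        then have m: "?m \<in> ball p R" using z minpt_near(1)[OF w e, of z n] en by simp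
        have sd: "subdiff w ?m (fst (z - ?m) / (eps n)\<^sup>2) (snd (z - ?m) / eps n)" by (rule infc_subdiff[OF w e])
        have "ball ?m (R - dist p ?m) \<subseteq> ball p R"
        proof
          fix a assume "a \<in> ball ?m (R - dist p ?m)"
          then show "a \<in> ball p R" using dist_triangle[of p a ?m] by simp
        qed
        then have "grad_on (ball ?m (R - dist p ?m)) w (%z. - f (U z)) U"
          using gr unfolding grad_on_def by (auto elim!: eventually_mono)
        from semidiff_le[OF f w _ U this disjI2[OF sd]] m
        have "fst (z - ?m) / (eps n)\<^sup>2 + f (snd (z - ?m) / eps n) \<le> 0" by simp
        then show "fst (z - ?m) / (eps n)\<^sup>2 + f (snd (z - ?m) / eps n) = 0" using ge[OF m sd] by linarith
      qed
    qed
  qed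
  ultimately have "0 \<le> J U" by (rule LIMSEQ_le_const)
  then show ?thesis unfolding J_def .
qed

section \<open>Approximation of convex entropy pairs by smooth ones\<close>

lemma real_antiderivative:
  fixes g :: "real => real"
  assumes "continuous_on UNIV g"
  obtains G where "!!s. DERIV G s :> g s"
proof -
  have "isCont g x" for x using assms by (simp add: continuous_on_eq_continuous_at)
  then obtain G where "\<forall>x. -\<infinity> < ereal x --> ereal x < \<infinity> --> (G has_vector_derivative g x) (at x)"
    using einterval_antiderivative[of "-\<infinity>" "\<infinity>" g] by auto
  then show thesis by (intro that[of G]) (simp add: has_real_derivative_iff_has_vector_derivative)
qed

lemma second_difference_mean_value:
  fixes G :: "real => real"
  assumes G: "!!s. DERIV G s :> g s" and h: "h > 0"
  obtains \<xi> where "0 < \<xi>" "\<xi> < h" "G (v + 2 * h) - 2 * G (v + h) + G v = h * (g (v + h + \<xi>) - g (v + \<xi>))"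
proof -
  have "DERIV (%s. G (v + h + s) - G (v + s)) s :> g (v + h + s) - g (v + s)" for s
    by (auto intro!: derivative_eq_intros DERIV_chain2[OF G])
  then obtain \<xi> where "0 < \<xi>" "\<xi> < h" "(G (v + h + h) - G (v + h)) - (G (v + h + 0) - G (v + 0)) = (h - 0) * (g (v + h + \<xi>) - g (v + \<xi>))"
    using MVT2[OF h, of "%s. G (v + h + s) - G (v + s)" "%s. g (v + h + s) - g (v + s)"] by blast
  moreover have "v + h + h = v + 2 * h" by simp
  ultimately show thesis using that[of \<xi>] by simp
qed

lemma continuous_Icc_bounded:
  fixes g :: "real => real"
  assumes "continuous_on UNIV g"
  obtains E where "!!s. s \<in> {l..r} ==> \<bar>g s\<bar> \<le> E"
proof -
  have "bounded (g ` {l..r})"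
    by (rule compact_imp_bounded[OF compact_continuous_image[OF continuous_on_subset[OF assms subset_UNIV] compact_Icc]])
  then obtain E where "\<forall>y\<in>g ` {l..r}. norm y \<le> E" unfolding bounded_iff by blast
  then show thesis by (intro that[of E]) simp
qed

text \<open>Formally the derivative is \<open>a\<close> times that of \<open>f\<close>, but
  \<open>f\<close> is only Lipschitz. Freezing \<open>f\<close> at \<open>x\<close> makes the mean
  value theorem applicable to \<open>a s * f x - Q s\<close>, and what remains is
  \<open>a y * (f y - f x)\<close>.\<close>

lemma product_minus_antiderivative_lipschitz:
  fixes a a' Q f :: "real => real"
  assumes a: "!!s. DERIV a s :> a' s" "continuous_on UNIV a'"
    and Q: "!!s. DERIV Q s :> a' s * f s" and f: "Lf-lipschitz_on {l..r} f"
  obtains M where "M-lipschitz_on {l..r} (%s. a s * f s - Q s)"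
proof -
  have ca: "continuous_on UNIV a" using DERIV_isCont[OF a(1)] by (simp add: continuous_at_imp_continuous_on)
  obtain E1 where E1: "!!s. s \<in> {l..r} ==> \<bar>a s\<bar> \<le> E1"
    by (rule continuous_Icc_bounded[OF ca]) (rule that)
  obtain E2 where E2: "!!s. s \<in> {l..r} ==> \<bar>a' s\<bar> \<le> E2"
    by (rule continuous_Icc_bounded[OF a(2)]) (rule that)
  have L0: "0 \<le> Lf" using f by (rule lipschitz_on_nonneg)
  define M where "M = (\<bar>E1\<bar> + \<bar>E2\<bar> * \<bar>r - l\<bar>) * Lf"
  have M0: "0 \<le> M" using L0 by (simp add: M_def)
  have fl: "\<bar>f x - f y\<bar> \<le> Lf * \<bar>x - y\<bar>" if "x \<in> {l..r}" "y \<in> {l..r}" for x y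
    using lipschitz_onD[OF f that] by (simp add: dist_real_def)
  have key: "\<bar>(a y * f y - Q y) - (a x * f x - Q x)\<bar> \<le> M * \<bar>y - x\<bar>" if xy: "x \<in> {l..r}" "y \<in> {l..r}" "x < y" for x y
  proof -
    have "DERIV (%s. a s * f x - Q s) s :> a' s * (f x - f s)" for s
      by (auto intro!: derivative_eq_intros a Q simp: algebra_simps)
    then obtain \<xi> where xi: "x < \<xi>" "\<xi> < y" "(a y * f x - Q y) - (a x * f x - Q x) = (y - x) * (a' \<xi> * (f x - f \<xi>))"
      using MVT2[OF xy(3), of "%s. a s * f x - Q s" "%s. a' s * (f x - f s)"] by blast
    then have xim: "\<xi> \<in> {l..r}" using xy by simp
    have eq: "(a y * f y - Q y) - (a x * f x - Q x) = a y * (f y - f x) + (y - x) * (a' \<xi> * (f x - f \<xi>))"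
      using xi(3) by (simp add: algebra_simps)
    have "\<bar>a y * (f y - f x)\<bar> \<le> \<bar>E1\<bar> * (Lf * \<bar>y - x\<bar>)" unfolding abs_mult
      using E1[OF xy(2)] fl[OF xy(2,1)] by (intro mult_mono) auto
    moreover have "\<bar>(y - x) * (a' \<xi> * (f x - f \<xi>))\<bar> \<le> \<bar>y - x\<bar> * (\<bar>E2\<bar> * (Lf * \<bar>r - l\<bar>))"
    proof -
      have "\<bar>f x - f \<xi>\<bar> \<le> Lf * \<bar>x - \<xi>\<bar>" by (rule fl[OF xy(1) xim])
      also have "\<dots> \<le> Lf * \<bar>r - l\<bar>" using xi xy L0 by (intro mult_left_mono) auto
      finally have "\<bar>f x - f \<xi>\<bar> \<le> Lf * \<bar>r - l\<bar>" .
      then show ?thesis unfolding abs_mult using E2[OF xim] by (intro mult_mono mult_nonneg_nonneg) auto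
    qed
    ultimately have "\<bar>a y * (f y - f x) + (y - x) * (a' \<xi> * (f x - f \<xi>))\<bar>
        \<le> \<bar>E1\<bar> * (Lf * \<bar>y - x\<bar>) + \<bar>y - x\<bar> * (\<bar>E2\<bar> * (Lf * \<bar>r - l\<bar>))"
      by (rule order_trans[OF abs_triangle_ineq add_mono])
    also have "\<dots> = M * \<bar>y - x\<bar>" by (simp add: M_def algebra_simps)
    finally show ?thesis unfolding eq .
  qed
  have "M-lipschitz_on {l..r} (%s. a s * f s - Q s)"
  proof (rule lipschitz_onI[OF _ M0])
    fix x y assume xy: "x \<in> {l..r}" "y \<in> {l..r}"
    consider "x < y" | "x = y" | "y < x" by linarith
    then show "dist (a x * f x - Q x) (a y * f y - Q y) \<le> M * dist x y"
    proof cases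
      case 1 then show ?thesis using key[OF xy 1] by (simp add: dist_real_def abs_minus_commute)
    next
      case 3 then show ?thesis using key[OF xy(2,1) 3] by (simp add: dist_real_def)
    qed (simp add: M0)
  qed
  then show thesis by (rule that)
qed

lemma second_difference_quotient_tendsto:
  fixes G :: "real => real"
  assumes G: "!!s. DERIV G s :> g s" and d: "DERIV g v :> d"
  shows "(%n. (G (v + 2 * (1 / real (Suc n))) - 2 * G (v + 1 / real (Suc n)) + G v) / (1 / real (Suc n))\<^sup>2) \<longlonglongrightarrow> d"
proof (rule LIMSEQ_I)
  fix \<rho> :: real assume rho: "\<rho> > 0"
  obtain s where s: "s > 0" "!!k. \<bar>k\<bar> < s ==> \<bar>g (v + k) - g v - d * k\<bar> \<le> (\<rho> / 6) * \<bar>k\<bar>"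
  proof -
    have "((%h. (g (v + h) - g v) / h) \<longlongrightarrow> d) (at 0)" using d by (simp add: DERIV_def)
    then obtain s where s: "s > 0" "!!h. h \<noteq> 0 ==> norm (h - 0) < s ==> norm ((g (v + h) - g v) / h - d) < \<rho> / 6"
      using rho unfolding LIM_eq by (metis divide_pos_pos zero_less_numeral)
    show thesis
    proof (rule that[OF s(1)])
      fix k :: real assume k: "\<bar>k\<bar> < s"
      show "\<bar>g (v + k) - g v - d * k\<bar> \<le> (\<rho> / 6) * \<bar>k\<bar>"
      proof (cases "k = 0")
        case False
        have e: "g (v + k) - g v - d * k = ((g (v + k) - g v) / k - d) * k" using False by (simp add: field_simps)
        show ?thesis unfolding e abs_mult using s(2)[OF False] k by (intro mult_right_mono) auto
      qed simp
    qed
  qed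
  obtain N where N: "1 / real (Suc N) < s / 2" using nat_approx_posE[of "s / 2"] s(1) by auto
  show "\<exists>no. \<forall>n\<ge>no. norm ((G (v + 2 * (1 / real (Suc n))) - 2 * G (v + 1 / real (Suc n)) + G v) / (1 / real (Suc n))\<^sup>2 - d) < \<rho>"
  proof (intro exI allI impI)
    fix n assume n: "N \<le> n"
    define h where "h = 1 / real (Suc n)"
    have h: "h > 0" by (simp add: h_def)
    have "h \<le> 1 / real (Suc N)" using n by (simp add: h_def frac_le)
    then have hs: "h < s / 2" using N by simp
    obtain \<xi> where xi: "0 < \<xi>" "\<xi> < h" "G (v + 2 * h) - 2 * G (v + h) + G v = h * (g (v + h + \<xi>) - g (v + \<xi>))"
      using second_difference_mean_value[OF G h] .
    have 1: "\<bar>g (v + (h + \<xi>)) - g v - d * (h + \<xi>)\<bar> \<le> (\<rho> / 6) * \<bar>h + \<xi>\<bar>" by (rule s(2)) (use xi hs in auto)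
    have 2: "\<bar>g (v + \<xi>) - g v - d * \<xi>\<bar> \<le> (\<rho> / 6) * \<bar>\<xi>\<bar>" by (rule s(2)) (use xi hs h in auto)
    have "(\<rho> / 6) * \<bar>h + \<xi>\<bar> \<le> (\<rho> / 6) * (2 * h)" "(\<rho> / 6) * \<bar>\<xi>\<bar> \<le> (\<rho> / 6) * h"
      using xi rho by (auto intro!: mult_left_mono)
    moreover have "(g (v + h + \<xi>) - g (v + \<xi>)) - d * h
        = (g (v + (h + \<xi>)) - g v - d * (h + \<xi>)) - (g (v + \<xi>) - g v - d * \<xi>)" by (simp add: algebra_simps)
    moreover have "(\<rho> / 6) * (2 * h) + (\<rho> / 6) * h = \<rho> / 2 * h" by simp
    ultimately have "\<bar>(g (v + h + \<xi>) - g (v + \<xi>)) - d * h\<bar> \<le> \<rho> / 2 * h"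
      using 1 2 abs_triangle_ineq4[of "g (v + (h + \<xi>)) - g v - d * (h + \<xi>)" "g (v + \<xi>) - g v - d * \<xi>"] by linarith
    then have "\<bar>((g (v + h + \<xi>) - g (v + \<xi>)) - d * h) / h\<bar> \<le> \<rho> / 2" using h by (simp add: pos_divide_le_eq)
    moreover have "((g (v + h + \<xi>) - g (v + \<xi>)) - d * h) / h = (G (v + 2 * h) - 2 * G (v + h) + G v) / h\<^sup>2 - d"
      unfolding xi(3) using h by (simp add: field_simps power2_eq_square)
    ultimately have "\<bar>(G (v + 2 * h) - 2 * G (v + h) + G v) / h\<^sup>2 - d\<bar> \<le> \<rho> / 2" by simp
    then show "norm ((G (v + 2 * (1 / real (Suc n))) - 2 * G (v + 1 / real (Suc n)) + G v) / (1 / real (Suc n))\<^sup>2 - d) < \<rho>"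
      unfolding h_def[symmetric] using rho by simp
  qed
qed

text \<open>Double Steklov averages of the entropy; the fluxes converge up to additive constants.\<close>

lemma entropy_pair_smooth_approx:
  assumes f: "Lip_loc UNIV f" and lip: "Lip_loc UNIV \<eta>" "Lip_loc UNIV q" and cv: "convex_on UNIV \<eta>"
    and fl: "entropy_flux f \<eta> q" and C: "0 < C"
  obtains \<eta>0 \<eta>1 \<eta>2 Q :: "nat => real => real" and c B where
    "!!n s. DERIV (\<eta>0 n) s :> \<eta>1 n s" "!!n s. DERIV (\<eta>1 n) s :> \<eta>2 n s"
    "!!n. continuous_on UNIV (\<eta>2 n)" "!!n s. DERIV (Q n) s :> \<eta>2 n s * f s" "!!n s. 0 \<le> \<eta>2 n s"
    "!!v. (%n. \<eta>0 n v) \<longlonglongrightarrow> \<eta> v"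
    "!!v. \<bar>v\<bar> \<le> C ==> (%n. \<eta>1 n v * f v - Q n v - c n) \<longlonglongrightarrow> q v"
    "!!n v. \<bar>v\<bar> \<le> C ==> \<bar>\<eta>0 n v\<bar> \<le> B" "!!n v. \<bar>v\<bar> \<le> C ==> \<bar>\<eta>1 n v * f v - Q n v - c n\<bar> \<le> B"
proof -
  have ce: "continuous_on UNIV \<eta>" "continuous_on UNIV f" using Lip_loc_continuous lip f by blast+
  \<comment> \<open>Second difference quotients of the double antiderivative \<open>K\<close>
    average \<open>\<eta>\<close>; the same operator \<open>\<Delta>\<close> applied to
    \<open>H\<close> and to \<open>\<eta>\<close> gives the first and second derivatives of these
    averages, and the last is nonnegative by convexity.\<close>
  obtain H where H: "!!s. DERIV H s :> \<eta> s" using real_antiderivative[OF ce(1)] by blast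
  have cH: "continuous_on UNIV H" using DERIV_isCont[OF H] by (simp add: continuous_at_imp_continuous_on)
  obtain K where K: "!!s. DERIV K s :> H s" using real_antiderivative[OF cH] by blast
  define h where "h = (%n. 1 / real (Suc n))"
  have h: "h n > 0" "h n \<le> 1" for n by (simp_all add: h_def)
  define \<Delta> where "\<Delta> = (%(G :: real => real) n v. (G (v + 2 * h n) - 2 * G (v + h n) + G v) / (h n)\<^sup>2)"
  have dD: "DERIV (\<Delta> G n) s :> \<Delta> g n s" if G: "!!s. DERIV G s :> g s" for G g n s
    unfolding \<Delta>_def by (rule DERIV_cdivide) (auto intro!: derivative_eq_intros DERIV_chain2[OF G])
  have e2c: "continuous_on UNIV (\<Delta> \<eta> n)" for n
    unfolding \<Delta>_def by (intro continuous_intros continuous_on_compose2[OF ce(1)]) (use h[of n] in auto)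
  have e2p: "0 \<le> \<Delta> \<eta> n s" for n s
  proof -
    have "\<eta> ((1 - 1/2) *\<^sub>R s + (1/2) *\<^sub>R (s + 2 * h n)) \<le> (1 - 1/2) * \<eta> s + (1/2) * \<eta> (s + 2 * h n)"
      by (rule convex_onD[OF cv]) auto
    moreover have "(1 - 1/2) *\<^sub>R s + (1/2) *\<^sub>R (s + 2 * h n) = s + h n" by (simp add: field_simps)
    ultimately show ?thesis unfolding \<Delta>_def by (intro divide_nonneg_nonneg) auto
  qed
  have "\<exists>Q. \<forall>s. DERIV Q s :> \<Delta> \<eta> n s * f s" for n
    using real_antiderivative[OF continuous_on_mult[OF e2c ce(2)]] by blast
  then obtain Q where Q: "!!n s. DERIV (Q n) s :> \<Delta> \<eta> n s * f s" by metis
  \<comment> \<open>The second difference at \<open>v\<close> looks ahead as far as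
    \<open>v + 2 * h n\<close> with \<open>h n \<le> 1\<close>, hence the extra 2.\<close>
  obtain Le where Le: "Le-lipschitz_on {-C..C+2} \<eta>" using Lip_loc_interval[OF lip(1)] by blast
  obtain Lf where Lf: "Lf-lipschitz_on {-C..C} f" using Lip_loc_interval[OF f] by blast
  obtain Lq where Lq: "Lq-lipschitz_on {-C..C} q" using Lip_loc_interval[OF lip(2)] by blast
  have L0: "0 \<le> Le" "0 \<le> Lf" using Le Lf by (auto intro: lipschitz_on_nonneg)
  have lim0: "(%n. \<Delta> K n v) \<longlonglongrightarrow> \<eta> v" for v
    using second_difference_quotient_tendsto[OF K H] unfolding \<Delta>_def h_def .
  obtain Be where Be: "!!s. s \<in> {-C..C+2} ==> \<bar>\<eta> s\<bar> \<le> Be"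
    by (rule continuous_Icc_bounded[OF ce(1)]) (rule that)
  have b0: "\<bar>\<Delta> K n v\<bar> \<le> Be" if v: "\<bar>v\<bar> \<le> C" for n v
  proof -
    obtain \<xi> where xi: "0 < \<xi>" "\<xi> < h n" "K (v + 2 * h n) - 2 * K (v + h n) + K v = h n * (H (v + h n + \<xi>) - H (v + \<xi>))"
      using second_difference_mean_value[OF K h(1)] .
    have "v + \<xi> < v + h n + \<xi>" using h(1)[of n] by simp
    then obtain z where z: "v + \<xi> < z" "z < v + h n + \<xi>" "H (v + h n + \<xi>) - H (v + \<xi>) = (v + h n + \<xi> - (v + \<xi>)) * \<eta> z"
      using MVT2[of "v + \<xi>" "v + h n + \<xi>" H \<eta>] H by blast
    have "\<Delta> K n v = \<eta> z" unfolding \<Delta>_def xi(3) z(3) using h(1)[of n] by (simp add: power2_eq_square)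
    moreover have "z \<in> {-C..C+2}" using z xi v h(2)[of n] by auto
    ultimately show ?thesis using Be by simp
  qed
  have b1: "\<bar>\<Delta> H n v\<bar> \<le> Le" if v: "\<bar>v\<bar> \<le> C" for n v
  proof -
    obtain \<xi> where xi: "0 < \<xi>" "\<xi> < h n" "H (v + 2 * h n) - 2 * H (v + h n) + H v = h n * (\<eta> (v + h n + \<xi>) - \<eta> (v + \<xi>))"
      using second_difference_mean_value[OF H h(1)] .
    have m: "v + h n + \<xi> \<in> {-C..C+2}" "v + \<xi> \<in> {-C..C+2}" using xi v h[of n] by auto
    have "\<bar>\<eta> (v + h n + \<xi>) - \<eta> (v + \<xi>)\<bar> \<le> Le * h n" using lipschitz_onD[OF Le m] h(1)[of n] by (simp add: dist_real_def)
    then have "\<bar>(\<eta> (v + h n + \<xi>) - \<eta> (v + \<xi>)) / h n\<bar> \<le> Le" using h(1)[of n] by (simp add: pos_divide_le_eq)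
    moreover have "\<Delta> H n v = (\<eta> (v + h n + \<xi>) - \<eta> (v + \<xi>)) / h n" unfolding \<Delta>_def xi(3) using h(1)[of n] by (simp add: power2_eq_square)
    ultimately show ?thesis by simp
  qed
  define q' where "q' = (%n v. \<Delta> H n v * f v - Q n v)"
  \<comment> \<open>An entropy flux is determined up to a constant; \<open>c\<close> adjusts the
    smooth flux to the value of \<open>q\<close> at \<open>- C\<close>.\<close>
  define c where "c = (%n. q' n (- C) - q (- C))"
  have ae: "AE x in lborel. \<exists>a b. DERIV \<eta> x :> a \<and> DERIV f x :> b \<and> DERIV q x :> a * b"
    using fl by (simp add: entropy_flux_def AE_completion_iff)
  define P where "P = (%x. SOME a. DERIV \<eta> x :> a)"
  define F where "F = (%x. SOME b. DERIV f x :> b)"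
  have ae': "AE x in lborel. DERIV \<eta> x :> P x \<and> DERIV f x :> F x \<and> DERIV q x :> P x * F x"
    using ae
  proof eventually_elim
    case (elim x)
    then obtain a b where ab: "DERIV \<eta> x :> a" "DERIV f x :> b" "DERIV q x :> a * b" by blast
    have "P x = a" unfolding P_def using ab(1) DERIV_unique by (intro some_equality) blast+
    moreover have "F x = b" unfolding F_def using ab(2) DERIV_unique by (intro some_equality) blast+
    ultimately show ?case
      using ab by simp
  qed
  obtain F' where F': "F' \<in> borel_measurable borel" "AE x in lborel. x \<in> {-C<..<C} --> F x = F' x"
    by (rule lipschitz_AE_deriv_borel[OF Lf, of F]) (rule eventually_mono[OF ae'], blast, rule that)
  obtain P' where P': "P' \<in> borel_measurable borel" "AE x in lborel. x \<in> {-C<..<C} --> P x = P' x"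
    by (rule lipschitz_AE_deriv_borel[OF lipschitz_on_subset[OF Le], of "-C" C P]) (simp, rule eventually_mono[OF ae'], blast, rule that)
  have good: "AE x in lborel. x \<in> {-C<..<C} --> DERIV \<eta> x :> P' x \<and> DERIV f x :> F' x \<and> DERIV q x :> P' x * F' x"
    using ae' F'(2) P'(2) by eventually_elim auto
  have D1m: "\<Delta> H n \<in> borel_measurable borel" for n
  proof -
    have "continuous_on UNIV (\<Delta> H n)" using DERIV_isCont[OF dD[OF H]] by (simp add: continuous_at_imp_continuous_on)
    then show ?thesis by (rule borel_measurable_continuous_onI)
  qed
  have Fb: "\<bar>F' x\<bar> \<le> Lf" if x: "x \<in> {-C<..<C}" and d: "DERIV f x :> F' x" for x
  proof -
    have "\<forall>\<^sub>F y in at x. \<bar>(f y - f x) / (y - x)\<bar> \<le> Lf"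
    proof -
      have "\<forall>\<^sub>F y in at x. y \<in> {-C<..<C}" using x by (intro eventually_at_in_open') auto
      moreover have "\<forall>\<^sub>F y in at x. y \<noteq> x" by (rule eventually_neq_at_within)
      ultimately show ?thesis
      proof eventually_elim
        case (elim y)
        note y = elim(1-2)
        have "\<bar>f y - f x\<bar> \<le> Lf * \<bar>y - x\<bar>" using lipschitz_onD[OF Lf, of y x] x y by (simp add: dist_real_def)
        then show ?case using y by (simp add: abs_divide pos_divide_le_eq)
      qed
    qed
    moreover have "((%y. \<bar>(f y - f x) / (y - x)\<bar>) \<longlongrightarrow> \<bar>F' x\<bar>) (at x)"
      using d unfolding has_field_derivative_iff by (rule tendsto_rabs)
    ultimately show ?thesis using tendsto_upperbound trivial_limit_at by blast
  qed
  \<comment> \<open>Almost everywhere \<open>q' n\<close> has derivative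
    \<open>\<Delta> H n * F'\<close>, bounded by \<open>Le * Lf\<close> and convergent to the
    derivative of \<open>q\<close>. Its increments from \<open>- C\<close> therefore converge by
    dominated convergence.\<close>
  have int: "(%n. q' n v - q' n (-C)) \<longlonglongrightarrow> q v - q (-C)" "!!n. \<bar>q' n v - q' n (-C)\<bar> \<le> Le * Lf * (2 * C)" if v: "-C < v" "v \<le> C" for v
  proof -
    let ?I = "indicator {-C..v} :: real => real"
    have sub: "x \<in> {-C<..<v} ==> x \<in> {-C<..<C}" for x using v by auto
    have e: "integrable lborel (%x. ?I x * (\<Delta> H n x * F' x))" "(LBINT x. ?I x * (\<Delta> H n x * F' x)) = q' n v - q' n (-C)" for n
    proof -
      obtain M where M: "M-lipschitz_on {-C..C} (q' n)" unfolding q'_def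
        using product_minus_antiderivative_lipschitz[OF dD[OF H] e2c Q Lf] by blast
      have M': "M-lipschitz_on {-C..v} (q' n)" by (rule lipschitz_on_subset[OF M]) (use v in auto)
      have "AE x in lborel. x \<in> {-C<..<v} --> DERIV (q' n) x :> \<Delta> H n x * F' x"
        using good
      proof eventually_elim
        case (elim x)
        note a = elim
        show ?case
        proof
          assume "x \<in> {-C<..<v}"
          then have d: "DERIV f x :> F' x" using a sub by blast
          show "DERIV (q' n) x :> \<Delta> H n x * F' x" unfolding q'_def
            by (rule derivative_eq_intros dD[OF H] d Q refl)+ simp
        qed
      qed
      note r = lipschitz_real_integral_deriv[OF v(1) M' this borel_measurable_times[OF D1m F'(1)]]
      show "integrable lborel (%x. ?I x * (\<Delta> H n x * F' x))" "(LBINT x. ?I x * (\<Delta> H n x * F' x)) = q' n v - q' n (-C)"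
        using r by simp_all
    qed
    have e0: "(LBINT x. ?I x * (P' x * F' x)) = q v - q (-C)"
    proof (rule lipschitz_real_integral_deriv(2)[OF v(1) lipschitz_on_subset[OF Lq] _ borel_measurable_times[OF P'(1) F'(1)]])
      show "AE x in lborel. x \<in> {-C<..<v} --> DERIV q x :> P' x * F' x"
        using good by eventually_elim (use v in auto)
    qed (use v in auto)
    have iB: "integrable lborel (%x. ?I x * (Le * Lf))"
      by (intro integrable_mult_left integrable_real_indicator) (auto simp: emeasure_lborel_Icc_eq)
    have null: "AE x in lborel. x \<noteq> -C" "AE x in lborel. x \<noteq> v" by (rule AE_lborel_singleton)+
    have bd: "AE x in lborel. \<bar>?I x * (\<Delta> H n x * F' x)\<bar> \<le> ?I x * (Le * Lf)" for n
      using good null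
    proof eventually_elim
      case (elim x)
      note a = elim(1) and n = elim(2-3)
      show ?case
      proof (cases "x \<in> {-C..v}")
        case True
        then have x: "x \<in> {-C<..<C}" using n v by auto
        have "\<bar>\<Delta> H n x * F' x\<bar> \<le> Le * Lf" unfolding abs_mult
          using b1[of x n] Fb[OF x] a x L0 by (intro mult_mono) auto
        then show ?thesis using True by simp
      qed simp
    qed
    have "(%n. LBINT x. ?I x * (\<Delta> H n x * F' x)) \<longlonglongrightarrow> (LBINT x. ?I x * (P' x * F' x))"
    proof (rule integral_dominated_convergence[OF _ _ iB])
      show "(%x. ?I x * (P' x * F' x)) \<in> borel_measurable lborel" using P'(1) F'(1) by measurable
      show "(%x. ?I x * (\<Delta> H n x * F' x)) \<in> borel_measurable lborel" for n using e(1) by (rule borel_measurable_integrable)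
      show "AE x in lborel. norm (?I x * (\<Delta> H n x * F' x)) \<le> ?I x * (Le * Lf)" for n using bd[of n] by simp
      show "AE x in lborel. (%n. ?I x * (\<Delta> H n x * F' x)) \<longlonglongrightarrow> ?I x * (P' x * F' x)"
        using good null
      proof eventually_elim
        case (elim x)
        note a = elim(1) and n = elim(2-3)
        show ?case
        proof (cases "x \<in> {-C..v}")
          case True
          then have "DERIV \<eta> x :> P' x" using a n v by auto
          then have "(%n. \<Delta> H n x) \<longlonglongrightarrow> P' x" using second_difference_quotient_tendsto[OF H] unfolding \<Delta>_def h_def by blast
          then show ?thesis by (intro tendsto_mult tendsto_const)
        qed simp
      qed
    qed
    then show "(%n. q' n v - q' n (-C)) \<longlonglongrightarrow> q v - q (-C)" unfolding e e0 .
    show "\<bar>q' n v - q' n (-C)\<bar> \<le> Le * Lf * (2 * C)" for n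
    proof -
      have "\<bar>LBINT x. ?I x * (\<Delta> H n x * F' x)\<bar> \<le> (LBINT x. \<bar>?I x * (\<Delta> H n x * F' x)\<bar>)"
        using integral_norm_bound[of lborel "%x. ?I x * (\<Delta> H n x * F' x)"] by simp
      also have "\<dots> \<le> (LBINT x. ?I x * (Le * Lf))" by (rule integral_mono_AE[OF integrable_abs[OF e(1)] iB bd])
      also have "\<dots> = (v + C) * (Le * Lf)" using v by simp
      also have "\<dots> \<le> (2 * C) * (Le * Lf)" using v L0 by (intro mult_right_mono) auto
      finally show ?thesis unfolding e by (simp add: algebra_simps)
    qed
  qed
  have int': "(%n. q' n v - c n) \<longlonglongrightarrow> q v" "\<bar>q' n v - c n\<bar> \<le> Le * Lf * (2 * C) + \<bar>q (-C)\<bar>" if v: "\<bar>v\<bar> \<le> C" for v n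
  proof -
    have "(%n. q' n v - c n) \<longlonglongrightarrow> q v \<and> \<bar>q' n v - c n\<bar> \<le> Le * Lf * (2 * C) + \<bar>q (-C)\<bar>"
    proof (cases "v = -C")
      case True then show ?thesis using L0 C by (simp add: c_def)
    next
      case False
      then have v': "-C < v" "v \<le> C" using v by auto
      have eq: "q' n v - c n = (q' n v - q' n (-C)) + q (-C)" for n by (simp add: c_def)
      show ?thesis unfolding eq using tendsto_add[OF int(1)[OF v'] tendsto_const[of "q (-C)"]] int(2)[OF v', of n] by auto
    qed
    then show "(%n. q' n v - c n) \<longlonglongrightarrow> q v" "\<bar>q' n v - c n\<bar> \<le> Le * Lf * (2 * C) + \<bar>q (-C)\<bar>" by blast+
  qed
  define B where "B = \<bar>Be\<bar> + (Le * Lf * (2 * C) + \<bar>q (-C)\<bar>)"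
  have bB: "0 \<le> Le * Lf * (2 * C) + \<bar>q (-C)\<bar>" using L0 C by simp
  show thesis
  proof (rule that[of "\<Delta> K" "\<Delta> H" "\<Delta> \<eta>" Q c B, OF dD[OF K] dD[OF H] e2c Q e2p lim0])
    show "(%n. \<Delta> H n v * f v - Q n v - c n) \<longlonglongrightarrow> q v" if "\<bar>v\<bar> \<le> C" for v using int'(1)[OF that] unfolding q'_def .
    show "\<bar>\<Delta> K n v\<bar> \<le> B" if "\<bar>v\<bar> \<le> C" for n v using b0[OF that, of n] bB unfolding B_def by linarith
    show "\<bar>\<Delta> H n v * f v - Q n v - c n\<bar> \<le> B" if "\<bar>v\<bar> \<le> C" for n v using int'(2)[OF that, of n] unfolding q'_def B_def by linarith
  qed
qed

text \<open>The constants \<open>c n\<close> may be subtracted from the smooth fluxes without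
  changing the integral, since \<open>phix\<close> integrates to zero; after that the pairs converge
  pointwise and boundedly on the range of \<open>U\<close>.\<close>

lemma local_entropy_lipschitz:
  assumes f: "Lip_loc UNIV f" "convex_on UNIV f" and w: "L-lipschitz_on UNIV w"
    and U: "U \<in> borel_measurable borel" "!!z. \<bar>U z\<bar> \<le> C" and C: "0 < C"
    and gr: "grad_on (ball p R) w (%z. - f (U z)) U"
    and dw: "AE z in lborel. z \<in> ball p R --> DERIV (%y. w (fst z, y)) (snd z) :> U z"
    and ge: "!!y a b. y \<in> ball p R ==> subdiff w y a b ==> 0 \<le> a + f b"
    and phi: "has_partials phi phit phix" "continuous_on UNIV phi" "continuous_on UNIV phit" "continuous_on UNIV phix"
      "!!z. z \<notin> cball p s ==> phi z = 0" "!!z. 0 \<le> phi z" and s: "s < R"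
    and lip: "Lip_loc UNIV \<eta>" "Lip_loc UNIV q" and cv: "convex_on UNIV \<eta>" and fl: "entropy_flux f \<eta> q"
  shows "0 \<le> (LBINT z. \<eta> (U z) * phit z + q (U z) * phix z)"
proof -
  obtain \<eta>0 \<eta>1 \<eta>2 Q :: "nat => real => real" and c B where
    d: "!!n s. DERIV (\<eta>0 n) s :> \<eta>1 n s" "!!n s. DERIV (\<eta>1 n) s :> \<eta>2 n s"
    "!!n. continuous_on UNIV (\<eta>2 n)" "!!n s. DERIV (Q n) s :> \<eta>2 n s * f s" "!!n s. 0 \<le> \<eta>2 n s"
    and l: "!!v. (%n. \<eta>0 n v) \<longlonglongrightarrow> \<eta> v" "!!v. \<bar>v\<bar> \<le> C ==> (%n. \<eta>1 n v * f v - Q n v - c n) \<longlonglongrightarrow> q v"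
    and b: "!!n v. \<bar>v\<bar> \<le> C ==> \<bar>\<eta>0 n v\<bar> \<le> B" "!!n v. \<bar>v\<bar> \<le> C ==> \<bar>\<eta>1 n v * f v - Q n v - c n\<bar> \<le> B"
    by (rule entropy_pair_smooth_approx[OF f(1) lip cv fl C]) (rule that)
  have ce: "continuous_on UNIV (\<eta>0 n)" "continuous_on UNIV (%v. \<eta>1 n v * f v - Q n v - c n)" for n
    using DERIV_isCont[OF d(1)] DERIV_isCont[OF d(2)] DERIV_isCont[OF d(4)] Lip_loc_continuous[OF f(1)]
    by (auto simp: continuous_at_imp_continuous_on intro!: continuous_on_diff continuous_on_mult continuous_on_const)
  have cq: "continuous_on UNIV \<eta>" "continuous_on UNIV q" using Lip_loc_continuous lip by blast+
  have m: "(%z. X (U z)) \<in> borel_measurable lborel" if "continuous_on UNIV X" for X :: "real => real"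
    unfolding measurable_lborel2 by (rule measurable_compose[OF U(1) borel_measurable_continuous_onI[OF that]])
  have phi0: "phi z = 0" if "norm p + s < norm z" for z
    using that norm_triangle_ineq[of p "z - p"] by (intro phi(5)) (simp add: dist_norm norm_minus_commute)
  have z: "integrable lborel phit" "integrable lborel phix" "(LBINT z. phix z) = 0"
  proof -
    show "integrable lborel phit" by (rule compact_partials_integral_zero(1)[OF phi(1-4) phi0])
    show "integrable lborel phix" by (rule compact_partials_integral_zero(3)[OF phi(1-4) phi0])
    show "(LBINT z. phix z) = 0" by (rule compact_partials_integral_zero(4)[OF phi(1-4) phi0])
  qed
  have mp: "phit \<in> borel_measurable lborel" "phix \<in> borel_measurable lborel" using z by (auto intro: borel_measurable_integrable)
  define I where "I = (%n z. \<eta>0 n (U z) * phit z + (\<eta>1 n (U z) * f (U z) - Q n (U z) - c n) * phix z)"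
  have Im: "I n \<in> borel_measurable lborel" for n
    unfolding I_def by (intro borel_measurable_add borel_measurable_times m[OF ce(1)] m[OF ce(2)] mp)
  have iB: "integrable lborel (%z. B * \<bar>phit z\<bar> + B * \<bar>phix z\<bar>)" using z by auto
  have bd: "norm (I n z) \<le> B * \<bar>phit z\<bar> + B * \<bar>phix z\<bar>" for n z
  proof -
    have "\<bar>\<eta>0 n (U z) * phit z\<bar> \<le> B * \<bar>phit z\<bar>" unfolding abs_mult using b(1)[OF U(2)] by (intro mult_right_mono) auto
    moreover have "\<bar>(\<eta>1 n (U z) * f (U z) - Q n (U z) - c n) * phix z\<bar> \<le> B * \<bar>phix z\<bar>"
      unfolding abs_mult using b(2)[OF U(2)] by (intro mult_right_mono) auto
    ultimately show ?thesis unfolding I_def real_norm_def by (rule order_trans[OF abs_triangle_ineq add_mono])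
  qed
  have Ii: "integrable lborel (I n)" for n
    by (rule Bochner_Integration.integrable_bound[OF iB Im]) (use order_trans[OF bd abs_ge_self] in auto)
  have nonneg: "0 \<le> (LBINT z. I n z)" for n
  proof -
    have "0 \<le> (LBINT z. \<eta>0 n (U z) * phit z + (\<eta>1 n (U z) * f (U z) - Q n (U z)) * phix z)"
      by (rule local_entropy[OF f w U gr dw ge phi s d])
    also have "(%z. \<eta>0 n (U z) * phit z + (\<eta>1 n (U z) * f (U z) - Q n (U z)) * phix z) = (%z. I n z + c n * phix z)"
      by (simp add: I_def algebra_simps)
    also have "(LBINT z. I n z + c n * phix z) = (LBINT z. I n z)" using Ii z by simp
    finally show ?thesis .
  qed
  have "(%n. LBINT z. I n z) \<longlonglongrightarrow> (LBINT z. \<eta> (U z) * phit z + q (U z) * phix z)"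
  proof (rule integral_dominated_convergence[OF _ Im iB])
    show "(%z. \<eta> (U z) * phit z + q (U z) * phix z) \<in> borel_measurable lborel"
      by (intro borel_measurable_add borel_measurable_times m[OF cq(1)] m[OF cq(2)] mp)
    show "AE z in lborel. (%n. I n z) \<longlonglongrightarrow> \<eta> (U z) * phit z + q (U z) * phix z"
      unfolding I_def by (intro AE_I2 tendsto_add tendsto_mult l U tendsto_const)
  qed (use bd in auto)
  then show ?thesis by (rule LIMSEQ_le_const) (use nonneg in blast)
qed

section \<open>From local to global test functions\<close>

text \<open>Multiplying the test function by translated mollifiers and integrating over the translation.\<close>

lemma localize_test_function:
  fixes A B :: "plane => real"
  assumes A: "A \<in> borel_measurable borel" "!!z. \<bar>A z\<bar> \<le> M" and B: "B \<in> borel_measurable borel" "!!z. \<bar>B z\<bar> \<le> M"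
    and phi: "has_partials phi phit phix" "continuous_on UNIV phi" "continuous_on UNIV phit" "continuous_on UNIV phix"
      "!!z. R < norm z ==> phi z = 0" "!!z. 0 \<le> phi z" and h0: "0 < h0"
    and loc: "!!y psi psit psix. has_partials psi psit psix ==> continuous_on UNIV psi ==> continuous_on UNIV psit ==> continuous_on UNIV psix ==>
        (!!z. 0 \<le> psi z) ==> (!!z. z \<notin> cball y h0 ==> psi z = 0) ==> (!!z. phi z = 0 ==> psi z = 0) ==>
        0 \<le> (LBINT z. A z * psit z + B z * psix z)"
  shows "0 \<le> (LBINT z. A z * phit z + B z * phix z)"
proof -
  have z: "phit z = 0" "phix z = 0" if "R < norm z" for z
    using has_partials_zero_outside[OF phi(1) closed_cball, of 0 R z] phi(5) that by (auto simp: dist_norm)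
  define G where "G = (%z. A z * phit z + B z * phix z)"
  obtain c0 where c0: "!!z. \<bar>phi z\<bar> \<le> c0" using continuous_support_bounded[OF phi(2,5)] by blast
  obtain c1 where c1: "!!z. \<bar>phit z\<bar> \<le> c1" using continuous_support_bounded[OF phi(3) z(1)] by blast
  obtain c2 where c2: "!!z. \<bar>phix z\<bar> \<le> c2" using continuous_support_bounded[OF phi(4) z(2)] by blast
  have mp: "phi \<in> borel_measurable borel" "phit \<in> borel_measurable borel" "phix \<in> borel_measurable borel"
    using phi(2-4) by (auto intro: borel_measurable_continuous_onI)
  have mG: "G \<in> borel_measurable borel" "(%z. A z * phi z) \<in> borel_measurable borel" "(%z. B z * phi z) \<in> borel_measurable borel"
    unfolding G_def using A B mp by auto
  have mb: "\<bar>x * y\<bar> \<le> M * c" if "\<bar>x\<bar> \<le> M" "\<bar>y\<bar> \<le> c" for x y c unfolding abs_mult using that by (intro mult_mono) auto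
  have Gb: "\<bar>G z\<bar> \<le> M * c1 + M * c2" for z
    unfolding G_def by (rule order_trans[OF abs_triangle_ineq add_mono[OF mb[OF A(2) c1] mb[OF B(2) c2]]])
  have Gz: "!!z. R < norm z ==> G z = 0" "!!z. R < norm z ==> A z * phi z = 0" "!!z. R < norm z ==> B z * phi z = 0"
    using z phi(5) by (auto simp: G_def)
  have i: "integrable lborel G" "integrable lborel (%z. A z * phi z)" "integrable lborel (%z. B z * phi z)"
  proof -
    show "integrable lborel G" by (rule integrable_bounded_support[OF mG(1) Gb Gz(1)])
    show "integrable lborel (%z. A z * phi z)" by (rule integrable_bounded_support[OF mG(2) mb[OF A(2) c0] Gz(2)])
    show "integrable lborel (%z. B z * phi z)" by (rule integrable_bounded_support[OF mG(3) mb[OF B(2) c0] Gz(3)])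
  qed
  have key: "0 \<le> (LBINT y. conv G (mo n) y)" if n: "1 / real (Suc n) < h0" for n
  proof -
    define h where "h = 1 / real (Suc n)"
    have h: "h > 0" "h < h0" using n by (simp_all add: h_def)
    have bm: "bump_fun (moll h)" by (rule moll_bump_fun[OF h(1)])
    obtain mt mx where p: "bump_fun mt" "bump_fun mx" "has_partials (moll h) mt mx" using bump_fun_partials[OF bm] .
    have ref: "bump_fun \<kappa> ==> (%z. \<kappa> (y - z)) \<in> borel_measurable borel" for \<kappa> y
      using bump_fun_continuous[OF bump_fun_reflect] by (rule borel_measurable_continuous_onI)
    have ik: "integrable lborel (%z. X z * \<kappa> (y - z))" if X: "integrable lborel X" and k: "bump_fun \<kappa>" for X \<kappa> y
    proof -
      obtain c where c: "!!z. \<bar>\<kappa> z\<bar> \<le> c" using bump_fun_bounded[OF k] by blast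
      have "(%z. \<kappa> (y - z)) \<in> borel_measurable lborel" using ref[OF k] by simp
      then show ?thesis by (rule integrable_mult_bounded[OF X _ c])
    qed
    \<comment> \<open>\<open>loc\<close> is applied to \<open>phi\<close> times the mollifier seen
      from \<open>y\<close>; the product rule adds two terms with differentiated kernels.\<close>
    have T: "0 \<le> conv G (moll h) y - conv (%z. A z * phi z) mt y - conv (%z. B z * phi z) mx y" for y
    proof -
      have cr: "continuous_on UNIV (%z. \<kappa> (y - z))" if "bump_fun \<kappa>" for \<kappa> by (rule bump_fun_continuous[OF bump_fun_reflect[OF that]])
      have c: "continuous_on UNIV (%z. phi z * moll h (y - z))"
        "continuous_on UNIV (%z. phi z * - mt (y - z) + phit z * moll h (y - z))"
        "continuous_on UNIV (%z. phi z * - mx (y - z) + phix z * moll h (y - z))"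
        by (intro continuous_on_add continuous_on_mult continuous_on_minus phi(2-4) cr[OF bm] cr[OF p(1)] cr[OF p(2)])+
      have nn: "0 \<le> phi z * moll h (y - z)" for z using phi(6) moll_nonneg[OF h(1)] by simp
      have sup: "phi z * moll h (y - z) = 0" if "z \<notin> cball y h0" for z
        using that h moll_zero[OF h(1), of "y - z"] by (simp add: dist_norm)
      have "0 \<le> (LBINT z. A z * (phi z * - mt (y - z) + phit z * moll h (y - z)) + B z * (phi z * - mx (y - z) + phix z * moll h (y - z)))"
        by (rule loc[OF has_partials_mult[OF phi(1) has_partials_reflect[OF p(3)]] c nn sup]) simp_all
      also have "\<dots> = (LBINT z. G z * moll h (y - z) - (A z * phi z) * mt (y - z) - (B z * phi z) * mx (y - z))"
        by (simp add: G_def algebra_simps)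
      also have "\<dots> = conv G (moll h) y - conv (%z. A z * phi z) mt y - conv (%z. B z * phi z) mx y"
        unfolding conv_def using ik[OF i(1) bm] ik[OF i(2) p(1)] ik[OF i(3) p(2)] by simp
      finally show ?thesis .
    qed
    \<comment> \<open>Integrated over the translation \<open>y\<close>, the terms with
      differentiated kernels vanish, being derivatives of compactly supported convolutions. This
      does the work of a partition of unity.\<close>
    have zi: "integrable lborel (conv X mt) \<and> (LBINT y. conv X mt y) = 0 \<and> integrable lborel (conv X mx) \<and> (LBINT y. conv X mx y) = 0"
      if X: "integrable lborel X" and XR: "!!z. R < norm z ==> X z = 0" for X
    proof -
      have s: "conv X (moll h) z = 0" if z: "R + h < norm z" for z by (rule conv_moll_support[OF h(1) XR z])
      note r = conv_has_partials[OF X bm p(3)] conv_bump_continuous[OF X bm] conv_bump_continuous[OF X p(1)] conv_bump_continuous[OF X p(2)]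
      show ?thesis
        by (intro conjI; rule compact_partials_integral_zero(1)[OF r s] compact_partials_integral_zero(2)[OF r s]
            compact_partials_integral_zero(3)[OF r s] compact_partials_integral_zero(4)[OF r s]; assumption)
    qed
    have "0 \<le> (LBINT y. conv G (moll h) y - conv (%z. A z * phi z) mt y - conv (%z. B z * phi z) mx y)"
      using T by (intro Bochner_Integration.integral_nonneg) auto
    also have "\<dots> = (LBINT y. conv G (moll h) y)"
      using conv_moll_contraction(1)[OF i(1) h(1)] zi[OF i(2) Gz(2)] zi[OF i(3) Gz(3)] by simp
    finally show ?thesis by (simp add: mo_def h_def)
  qed
  have "(%n. LBINT y. conv G (mo n) y) \<longlonglongrightarrow> (LBINT z. G z)"
  proof (rule LIM_zero_cancel, rule Lim_null_comparison)
    have ci: "integrable lborel (conv G (mo n))" for n unfolding mo_def by (rule conv_moll_contraction(1)[OF i(1) mo_pos])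
    show "\<forall>\<^sub>F n in sequentially. norm ((LBINT y. conv G (mo n) y) - (LBINT z. G z)) \<le> (LBINT z. \<bar>conv G (mo n) z - G z\<bar>)"
    proof (intro always_eventually allI)
      fix n
      have "(LBINT y. conv G (mo n) y) - (LBINT z. G z) = (LBINT z. conv G (mo n) z - G z)" using ci i(1) by simp
      then show "norm ((LBINT y. conv G (mo n) y) - (LBINT z. G z)) \<le> (LBINT z. \<bar>conv G (mo n) z - G z\<bar>)"
        using integral_norm_bound[of lborel "%z. conv G (mo n) z - G z"] by simp
    qed
    show "(%n. LBINT z. \<bar>conv G (mo n) z - G z\<bar>) \<longlonglongrightarrow> 0" by (rule conv_mo_L1[OF mG(1) Gb Gz(1)])
  qed
  then have "0 \<le> (LBINT z. G z)"
  proof (rule LIMSEQ_le_const)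
    obtain N where N: "1 / real (Suc N) < h0" using nat_approx_posE[OF h0] by blast
    show "\<exists>N. \<forall>n\<ge>N. 0 \<le> (LBINT y. conv G (mo n) y)"
    proof (intro exI allI impI key)
      fix n assume "N \<le> n"
      then have "1 / real (Suc n) \<le> 1 / real (Suc N)" by (simp add: frac_le)
      then show "1 / real (Suc n) < h0" using N by (rule le_less_trans)
    qed
  qed
  then show ?thesis unfolding G_def .
qed

lemma differentiable_partials:
  assumes "phi differentiable (at p)"
  shows "(phi has_derivative (%v. d_t phi p * fst v + d_x phi p * snd v)) (at p)"
    "DERIV (%s. phi (s, snd p)) (fst p) :> d_t phi p"
    "DERIV (%y. phi (fst p, y)) (snd p) :> d_x phi p"
proof -
  obtain D where D: "(phi has_derivative D) (at p)" using assms unfolding differentiable_def by blast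
  have lin: "D (c *\<^sub>R v) = c * D v" "D (v + v') = D v + D v'" for c v v'
    using linear_cmul[OF has_derivative_linear[OF D]] linear_add[OF has_derivative_linear[OF D]] by simp_all
  have Dp: "(phi has_derivative D) (at (fst p, snd p))" using D by (simp only: prod.collapse)
  have 1: "DERIV (%s. phi (s, snd p)) (fst p) :> D (1, 0)" unfolding has_field_derivative_def
  proof -
    have "((%s. (s, snd p)) has_derivative (%h. (h, 0))) (at (fst p))" by (intro has_derivative_Pair has_derivative_ident has_derivative_const)
    from has_derivative_compose[OF this Dp] have "((%s. phi (s, snd p)) has_derivative (%h. D (h, 0))) (at (fst p))" .
    moreover have "(%h. D (h, 0)) = (*) (D (1, 0))"
    proof
      fix h show "D (h, 0) = D (1, 0) * h" using lin(1)[of h "(1, 0)"] by (simp add: mult.commute)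
    qed
    ultimately show "((%s. phi (s, snd p)) has_derivative (*) (D (1, 0))) (at (fst p))" by (simp only:)
  qed
  have 2: "DERIV (%y. phi (fst p, y)) (snd p) :> D (0, 1)" unfolding has_field_derivative_def
  proof -
    have "((%y. (fst p, y)) has_derivative (%h. (0, h))) (at (snd p))" by (intro has_derivative_Pair has_derivative_ident has_derivative_const)
    from has_derivative_compose[OF this Dp] have "((%y. phi (fst p, y)) has_derivative (%h. D (0, h))) (at (snd p))" .
    moreover have "(%h. D (0, h)) = (*) (D (0, 1))"
    proof
      fix h show "D (0, h) = D (0, 1) * h" using lin(1)[of h "(0, 1)"] by (simp add: mult.commute)
    qed
    ultimately show "((%y. phi (fst p, y)) has_derivative (*) (D (0, 1))) (at (snd p))" by (simp only:)
  qed
  have d: "d_t phi p = D (1, 0)" "d_x phi p = D (0, 1)" unfolding d_t_def d_x_def by (rule DERIV_imp_deriv[OF 1], rule DERIV_imp_deriv[OF 2])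
  show "DERIV (%s. phi (s, snd p)) (fst p) :> d_t phi p"
    "DERIV (%y. phi (fst p, y)) (snd p) :> d_x phi p" unfolding d by (rule 1, rule 2)
  have "D v = d_t phi p * fst v + d_x phi p * snd v" for v
  proof -
    have "D (fst v *\<^sub>R (1, 0) + snd v *\<^sub>R (0, 1)) = fst v * D (1, 0) + snd v * D (0, 1)" unfolding lin ..
    then show ?thesis unfolding d by (simp add: mult.commute)
  qed
  then have "D = (%v. d_t phi p * fst v + d_x phi p * snd v)" by (rule ext)
  then show "(phi has_derivative (%v. d_t phi p * fst v + d_x phi p * snd v)) (at p)" using D by simp
qed

lemma test_function_partials:
  assumes "phi \<in> test_functions \<Omega>"
  shows "has_partials phi (d_t phi) (d_x phi)" "continuous_on UNIV phi" "continuous_on UNIV (d_t phi)" "continuous_on UNIV (d_x phi)"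
proof -
  have c: "C_k_on k UNIV phi" for k using assms by (simp add: test_functions_def)
  have d: "phi differentiable (at p)" for p using c[of "Suc 0"] unfolding C_k_on.simps by blast
  show "has_partials phi (d_t phi) (d_x phi)" unfolding has_partials_def
    using differentiable_partials(2)[OF d, of "(_, _)"] differentiable_partials(3)[OF d, of "(_, _)"] by simp
  show "continuous_on UNIV phi" using c[of 0] by simp
  show "continuous_on UNIV (d_t phi)" "continuous_on UNIV (d_x phi)" using c[of "Suc 0"] by simp_all
qed

text \<open>\<open>ge\<close> packages the subdifferential inequality for all local representatives
  of \<open>u\<close> and its potential. Potentials exist near each point only, so the test function
  is localised at a scale given by a Lebesgue number of a cover of its support by balls that carry a
  potential.\<close>

lemma weak_entropy_inequality:
  assumes f: "Lip_loc UNIV f" "convex_on UNIV f" and Om: "open \<Omega>" and u: "Linf_loc \<Omega> u"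
    and wd: "weak_div_eq_0 \<Omega> u (%p. f (u p))"
    and ge: "!!y r w U C L a b. 0 < r ==> cball y r \<subseteq> \<Omega> ==> L-lipschitz_on UNIV w ==> U \<in> borel_measurable borel ==>
        (!!z. \<bar>U z\<bar> \<le> C) ==> (AE z in lborel. z \<in> cball y r --> u z = U z) ==>
        grad_on (ball y r) w (%z. - f (U z)) U ==> subdiff w y a b ==> 0 \<le> a + f b"
    and lip: "Lip_loc UNIV \<eta>" "Lip_loc UNIV q" and cv: "convex_on UNIV \<eta>" and fl: "entropy_flux f \<eta> q"
    and phi: "phi \<in> test_functions \<Omega>" "!!z. 0 \<le> phi z"
  shows "weak_div \<Omega> (%p. \<eta> (u p)) (%p. q (u p)) phi \<le> 0"
proof -
  note phip = test_function_partials[OF phi(1)]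
  define S where "S = closure {p. phi p \<noteq> 0}"
  have S: "compact S" "S \<subseteq> \<Omega>" using phi(1) by (simp_all add: test_functions_def S_def)
  have S0: "z \<in> S" if "phi z \<noteq> 0" for z
    using that closure_subset[of "{p. phi p \<noteq> 0}"] by (auto simp: S_def)
  have cS: "closed S" by (simp add: S_def)
  have OmL: "\<Omega> \<in> sets lebesgue" using Om by (simp add: borel_open)
  have um: "u \<in> borel_measurable (lebesgue_on \<Omega>)" using u by (simp add: Linf_loc_def)
  have ce: "continuous_on UNIV \<eta>" "continuous_on UNIV q" "continuous_on UNIV f" using Lip_loc_continuous lip f by blast+
  have mm: "(%p. \<eta> (u p)) \<in> borel_measurable (lebesgue_on \<Omega>)" "(%p. q (u p)) \<in> borel_measurable (lebesgue_on \<Omega>)"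
    using measurable_compose[OF um borel_measurable_continuous_onI[OF ce(1)]] measurable_compose[OF um borel_measurable_continuous_onI[OF ce(2)]] .
  show ?thesis
  proof (cases "S = {}")
    \<comment> \<open>The main case uses the distance to the support, which asks for a nonempty
      set.\<close>
    case True
    have "phi z = 0" if "z \<notin> S" for z using S0 that by blast
    from weak_div_lborel[where A'="%_. 0" and B'="%_. 0", OF OmL cS S(2) this phip(1,3,4) mm] True show ?thesis by simp
  next
    case False
    define \<G> where "\<G> = {ball p r | p r. ball p r \<subseteq> \<Omega> \<and> (\<exists>w. potential f (ball p r) u w)}"
    have op: "open G" if "G \<in> \<G>" for G using that unfolding \<G>_def by auto
    have cov: "S \<subseteq> \<Union>\<G>"
    proof
      fix p assume "p \<in> S"
      then obtain r w where "r > 0" "ball p r \<subseteq> \<Omega>" "potential f (ball p r) u w" using local_potential[OF f(1) Om u wd] S(2) by blast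
      then have "ball p r \<in> \<G>" "p \<in> ball p r" unfolding \<G>_def by (blast, simp)
      then show "p \<in> \<Union>\<G>" by blast
    qed
    obtain e where e: "0 < e" "!!x. x \<in> S ==> \<exists>G\<in>\<G>. ball x e \<subseteq> G"
      by (rule Heine_Borel_lemma[OF S(1) cov op]) (assumption, rule that)
    \<comment> \<open>A compact neighbourhood of the support, so that one Borel representative
      \<open>U\<close> serves all local pieces.\<close>
    define K where "K = {z. infdist z S \<le> e / 2}"
    have cK: "compact K" unfolding K_def by (rule compact_infdist_le[OF False S(1) half_gt_zero[OF e(1)]])
    have bK: "cball x (e / 2) \<subseteq> K" if "x \<in> S" for x
    proof
      fix z assume "z \<in> cball x (e / 2)"
      then show "z \<in> K" using infdist_le[OF that, of z] by (simp add: K_def dist_commute)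
    qed
    have be: "cball x (e / 2) \<subseteq> ball x e" for x :: "plane" using e(1) by auto
    have KO: "K \<subseteq> \<Omega>"
    proof
      fix z assume z: "z \<in> K"
      obtain x where x: "x \<in> S" "infdist z S = dist z x" using infdist_attains_inf[OF cS False] by blast
      then have "z \<in> cball x (e / 2)" using z by (simp add: K_def dist_commute)
      moreover obtain G where "G \<in> \<G>" "ball x e \<subseteq> G" using e(2)[OF x(1)] by blast
      ultimately show "z \<in> \<Omega>" using be[of x] unfolding \<G>_def by blast
    qed
    obtain U C0 where U: "U \<in> borel_measurable borel" "0 \<le> C0" "!!z. \<bar>U z\<bar> \<le> C0" "AE z in lborel. z \<in> K --> u z = U z"
      by (rule Linf_loc_borel[OF u OmL cK KO]) (rule that)
    define C where "C = C0 + 1"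
    have C: "0 < C" "\<bar>U z\<bar> \<le> C" for z using U(2) U(3)[of z] by (simp_all add: C_def)
    have UK: "AE z in lborel. z \<in> X --> u z = U z" if "X \<subseteq> K" for X
      by (rule eventually_mono[OF U(4)]) (use that in blast)
    obtain M1 where M1: "!!z. \<bar>\<eta> (U z)\<bar> \<le> M1" using continuous_bounded_comp[where U=U, OF ce(1) C(2)] by blast
    obtain M2 where M2: "!!z. \<bar>q (U z)\<bar> \<le> M2" using continuous_bounded_comp[where U=U, OF ce(2) C(2)] by blast
    define M where "M = max M1 M2"
    have M: "\<bar>\<eta> (U z)\<bar> \<le> M" "\<bar>q (U z)\<bar> \<le> M" for z unfolding M_def by (rule max.coboundedI1[OF M1], rule max.coboundedI2[OF M2])
    have m: "(%z. \<eta> (U z)) \<in> borel_measurable borel" "(%z. q (U z)) \<in> borel_measurable borel"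
      using measurable_compose[OF U(1) borel_measurable_continuous_onI[OF ce(1)]] measurable_compose[OF U(1) borel_measurable_continuous_onI[OF ce(2)]] .
    obtain R where R: "!!z. R < norm z ==> phi z = 0"
    proof -
      obtain R where "!!z. z \<in> S ==> norm z \<le> R" using compact_imp_bounded[OF S(1)] unfolding bounded_iff by blast
      then show thesis using S0 that[of R] by (meson not_le)
    qed
    have "0 \<le> (LBINT z. \<eta> (U z) * d_t phi z + q (U z) * d_x phi z)"
    proof (rule localize_test_function[OF m(1) M(1) m(2) M(2) phip R phi(2), where ?h0.0="e / 8"])
      \<comment> \<open>A piece supported in a ball of radius \<open>e / 8\<close> that is not
        identically zero meets \<open>S\<close> at some \<open>x\<close>, hence lies in
        \<open>cball x (e / 4)\<close>, well inside the ball of radius \<open>e / 2\<close> on which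
        the extended potential is used.\<close>
      show "0 < e / 8" using e(1) by simp
      fix y psi psit psix
      assume psi: "has_partials psi psit psix" "continuous_on UNIV psi" "continuous_on UNIV psit" "continuous_on UNIV psix" "!!z. 0 \<le> psi z"
        and psi0: "!!z. z \<notin> cball y (e / 8) ==> psi z = 0" "!!z. phi z = 0 ==> psi z = 0"
      show "0 \<le> (LBINT z. \<eta> (U z) * psit z + q (U z) * psix z)"
      proof (cases "\<exists>x. psi x \<noteq> 0")
        case False
        then have "psit z = 0" "psix z = 0" for z using has_partials_zero_outside[OF psi(1) closed_empty, of z] by auto
        then show ?thesis by simp
      next
        case True
        then obtain x where x: "psi x \<noteq> 0" by blast
        have xS: "x \<in> S" using psi0(2) x S0 by blast
        have dxy: "dist y x \<le> e / 8" using psi0(1)[of x] x by auto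
        obtain p r w where G: "ball x e \<subseteq> ball p r" "ball p r \<subseteq> \<Omega>" "potential f (ball p r) u w" using e(2)[OF xS] unfolding \<G>_def by blast
        have sub: "cball x (e / 2) \<subseteq> ball p r" using be G(1) by blast
        have xp: "x \<in> ball p r" using G(1) e(1) by (meson centre_in_ball subsetD)
        have e2: "e / 2 > 0" using e(1) by simp
        note uU = UK[OF bK[OF xS]]
        obtain W L where W: "L-lipschitz_on UNIV W" "!!z. z \<in> cball x (e / 2) ==> W z = w z" "grad_on (ball x (e / 2)) W (%z. - f (U z)) U"
          using potential_local_grad[OF G(3) open_ball xp sub e2 uU] by blast
        show ?thesis
        proof (rule local_entropy_lipschitz[OF f W(1) U(1) C(2) C(1) W(3) _ _ psi(1-4) _ psi(5) _ lip cv fl, where s="e / 4"])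
          show "AE z in lborel. z \<in> ball x (e / 2) --> DERIV (%y. W (fst z, y)) (snd z) :> U z"
            using potential_AE[OF G(3)] uU
          proof eventually_elim
            case (elim z)
            note a = elim(1) and b = elim(2)
            show ?case
            proof
              assume z: "z \<in> ball x (e / 2)"
              then have zc: "z \<in> cball x (e / 2)" by simp
              have d: "DERIV (%y. w (fst z, y)) (snd z) :> U z" using a b zc sub by auto
              have "continuous_on UNIV (%y::real. (fst z, y))" by (intro continuous_intros)
              then have "open ((%y. (fst z, y)) -` ball x (e / 2))" by (rule open_vimage[OF open_ball])
              moreover have "snd z \<in> (%y. (fst z, y)) -` ball x (e / 2)" using z by simp
              ultimately have "\<forall>\<^sub>F y in nhds (snd z). y \<in> (%y. (fst z, y)) -` ball x (e / 2)" by (rule eventually_nhds_in_open)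
              then have "\<forall>\<^sub>F y in nhds (snd z). W (fst z, y) = w (fst z, y)"
                by (rule eventually_mono) (simp add: W(2))
              with d show "DERIV (%y. W (fst z, y)) (snd z) :> U z" by (rule DERIV_transform_nhds)
            qed
          qed
          show "psi z = 0" if "z \<notin> cball x (e / 4)" for z
            using that dxy dist_triangle[of x z y] by (intro psi0(1)) (simp add: dist_commute)
          show "e / 4 < e / 2" using e(1) by simp
          fix a b y' assume y: "y' \<in> ball x (e / 2)" and sd: "subdiff W y' a b"
          define r' where "r' = (e / 2 - dist x y') / 2"
          have "dist x y' < e / 2" using y by simp
          then have r': "r' > 0" unfolding r'_def by simp
          have sb: "cball y' r' \<subseteq> ball x (e / 2)"
          proof
            fix k assume "k \<in> cball y' r'"
            then have "dist y' k \<le> r'" by simp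
            then show "k \<in> ball x (e / 2)" using dist_triangle[of x k y'] y unfolding r'_def mem_ball by argo
          qed
          have cs: "cball y' r' \<subseteq> cball x (e / 2)" using sb ball_subset_cball by blast
          have g: "grad_on (ball y' r') W (%z. - f (U z)) U"
            unfolding grad_on_def by (rule eventually_mono[OF W(3)[unfolded grad_on_def]]) (use sb ball_subset_cball in blast)
          show "0 \<le> a + f b"
            by (rule ge[OF r' _ W(1) U(1) C(2) UK g sd]) (use cs bK[OF xS] KO in blast)+
        qed
      qed
    qed
    moreover have "weak_div \<Omega> (%p. \<eta> (u p)) (%p. q (u p)) phi = - (LBINT z. \<eta> (U z) * d_t phi z + q (U z) * d_x phi z)"
    proof (rule weak_div_lborel[OF OmL cS S(2) _ phip(1,3,4) mm m])
      have "S \<subseteq> K"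
      proof
        fix x assume "x \<in> S"
        moreover have "x \<in> cball x (e / 2)" using e(1) by simp
        ultimately show "x \<in> K" using bK by blast
      qed
      then show "AE z in lborel. z \<in> S --> \<eta> (u z) = \<eta> (U z) \<and> q (u z) = q (U z)"
        by (intro eventually_mono[OF U(4)]) auto
      show "phi z = 0" if "z \<notin> S" for z using S0 that by blast
    qed
    ultimately show ?thesis by simp
  qed
qed

text \<open>Touching from above or below by a function differentiable at \<open>p\<close> makes its
  gradient there a super- or subdifferential of \<open>w\<close>; the two inequalities are then
  \<open>semidiff_le\<close> and \<open>ge\<close>.\<close>

lemma potential_viscosity_solution:
  assumes f: "Lip_loc UNIV f" "convex_on UNIV f" and Om: "open \<Omega>" and u: "Linf_loc \<Omega> u"
    and ge: "!!y r w U C L a b. 0 < r ==> cball y r \<subseteq> \<Omega> ==> L-lipschitz_on UNIV w ==> U \<in> borel_measurable borel ==>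
        (!!z. \<bar>U z\<bar> \<le> C) ==> (AE z in lborel. z \<in> cball y r --> u z = U z) ==>
        grad_on (ball y r) w (%z. - f (U z)) U ==> subdiff w y a b ==> 0 \<le> a + f b"
    and w: "potential f \<Omega> u w"
  shows "viscosity_solution f \<Omega> w"
  unfolding viscosity_solution_def
proof (intro conjI allI impI ballI)
  show "continuous_on \<Omega> w"
  proof (rule continuous_at_imp_continuous_on, rule ballI)
    fix p assume "p \<in> \<Omega>"
    then obtain r where r: "r > 0" "cball p r \<subseteq> \<Omega>" using Om open_contains_cball by blast
    have "Lip_loc \<Omega> w" using w by (simp add: potential_def)
    then obtain L where "L-lipschitz_on (cball p r) w" by (rule Lip_loc_compact_lipschitz[OF _ compact_cball r(2)])
    then have "continuous_on (ball p r) w" by (rule continuous_on_subset[OF lipschitz_on_continuous_on]) (rule ball_subset_cball)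
    then show "isCont w p" using r(1) by (simp add: continuous_on_eq_continuous_at)
  qed
next
  fix phi p
  assume phi: "C_k_on 1 \<Omega> phi" and p: "p \<in> \<Omega>"
  obtain r where r: "r > 0" "cball p r \<subseteq> \<Omega>" using Om p open_contains_cball by blast
  have OmL: "\<Omega> \<in> sets lebesgue" using Om by (simp add: borel_open)
  obtain U C where U: "U \<in> borel_measurable borel" "0 \<le> C" "!!z. \<bar>U z\<bar> \<le> C" "AE z in lborel. z \<in> cball p r --> u z = U z"
    by (rule Linf_loc_borel[OF u OmL compact_cball r(2)]) (rule that)
  obtain W L where W: "L-lipschitz_on UNIV W" "!!z. z \<in> cball p r ==> W z = w z" "grad_on (ball p r) W (%z. - f (U z)) U"
    using potential_local_grad[OF w Om p r(2,1) U(4)] by blast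
  have Wp: "W p = w p" using W(2) r(1) by simp
  have "phi differentiable (at p)" using phi p unfolding One_nat_def C_k_on.simps by blast
  note phid = differentiable_partials(1)[OF this]
  have near: "\<exists>d>0. \<forall>y\<in>ball p d. \<bar>phi y - phi p - lin p (d_t phi p) (d_x phi p) y\<bar> \<le> eps * norm (y - p)" if e: "eps > 0" for eps
  proof -
    obtain d where d: "d > 0 \<and> (\<forall>y. norm (y - p) < d -->
        norm (phi y - phi p - (d_t phi p * fst (y - p) + d_x phi p * snd (y - p))) \<le> eps * norm (y - p))"
      by (rule exE[OF phid[unfolded has_derivative_at_alt, THEN conjunct2, rule_format, OF e]])
    note d = d[THEN conjunct1] d[THEN conjunct2, rule_format]
    show ?thesis
    proof (intro exI[of _ d] conjI ballI d(1))
      fix y assume "y \<in> ball p d"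
      then have "norm (y - p) < d" by (simp add: dist_norm norm_minus_commute)
      from d(2)[OF this] show "\<bar>phi y - phi p - lin p (d_t phi p) (d_x phi p) y\<bar> \<le> eps * norm (y - p)" by simp
    qed
  qed
  have loc: "\<exists>d>0. ball p d \<subseteq> cball p r \<and> (\<forall>y\<in>ball p d. P y)" if ev: "\<forall>\<^sub>F y in nhds p. P y" for P
  proof -
    obtain d where d: "d > 0 \<and> (\<forall>y. dist y p < d --> P y)" by (rule exE[OF ev[unfolded eventually_nhds_metric]])
    show ?thesis
    proof (intro exI[of _ "min d r"] conjI ballI)
      fix y assume "y \<in> ball p (min d r)"
      then have "dist y p < d" by (simp add: dist_commute)
      then show "P y" using d by blast
    qed (use d r(1) in auto)
  qed
  show "d_t phi p + f (d_x phi p) \<le> 0" if max: "\<forall>\<^sub>F y in nhds p. w y - phi y \<le> w p - phi p"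
  proof (rule semidiff_le[OF f W(1) r(1) U(1,3) W(3)], rule disjI1)
    show "superdiff W p (d_t phi p) (d_x phi p)" unfolding superdiff_def
    proof (intro allI impI)
      fix eps :: real assume e: "0 < eps"
      obtain d1 where d1: "d1 > 0" "!!y. y \<in> ball p d1 ==> \<bar>phi y - phi p - lin p (d_t phi p) (d_x phi p) y\<bar> \<le> eps * norm (y - p)"
        using near[OF e] by blast
      obtain d2 where d2: "d2 > 0 \<and> ball p d2 \<subseteq> cball p r \<and> (\<forall>y\<in>ball p d2. w y - phi y \<le> w p - phi p)"
        by (rule exE[OF loc[OF max]])
      note d2 = d2[THEN conjunct1] d2[THEN conjunct2, THEN conjunct1] d2[THEN conjunct2, THEN conjunct2, rule_format]
      show "\<exists>r>0. \<forall>y\<in>ball p r. W y \<le> W p + lin p (d_t phi p) (d_x phi p) y + eps * norm (y - p)"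
      proof (intro exI[of _ "min d1 d2"] conjI ballI)
        fix y assume "y \<in> ball p (min d1 d2)"
        then have y: "y \<in> ball p d1" "y \<in> ball p d2" by auto
        then have "W y = w y" using W(2) d2(2) by blast
        then show "W y \<le> W p + lin p (d_t phi p) (d_x phi p) y + eps * norm (y - p)" 
          using abs_le_D1[OF d1(2)[OF y(1)]] d2(3)[OF y(2)] Wp by linarith
      qed (use d1(1) d2(1) in simp)
    qed
  qed
  show "d_t phi p + f (d_x phi p) \<ge> 0" if min: "\<forall>\<^sub>F y in nhds p. w y - phi y \<ge> w p - phi p"
  proof (rule ge[OF r W(1) U(1,3,4) W(3)])
    show "subdiff W p (d_t phi p) (d_x phi p)" unfolding subdiff_def
    proof (intro allI impI)
      fix eps :: real assume e: "0 < eps"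
      obtain d1 where d1: "d1 > 0" "!!y. y \<in> ball p d1 ==> \<bar>phi y - phi p - lin p (d_t phi p) (d_x phi p) y\<bar> \<le> eps * norm (y - p)"
        using near[OF e] by blast
      obtain d2 where d2: "d2 > 0 \<and> ball p d2 \<subseteq> cball p r \<and> (\<forall>y\<in>ball p d2. w y - phi y \<ge> w p - phi p)"
        by (rule exE[OF loc[OF min]])
      note d2 = d2[THEN conjunct1] d2[THEN conjunct2, THEN conjunct1] d2[THEN conjunct2, THEN conjunct2, rule_format]
      show "\<exists>r>0. \<forall>y\<in>ball p r. W p + lin p (d_t phi p) (d_x phi p) y - eps * norm (y - p) \<le> W y"
      proof (intro exI[of _ "min d1 d2"] conjI ballI)
        fix y assume "y \<in> ball p (min d1 d2)"
        then have y: "y \<in> ball p d1" "y \<in> ball p d2" by auto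
        then have "W y = w y" using W(2) d2(2) by blast
        then show "W p + lin p (d_t phi p) (d_x phi p) y - eps * norm (y - p) \<le> W y" 
          using abs_le_D2[OF d1(2)[OF y(1)]] d2(3)[OF y(2)] Wp by linarith
      qed (use d1(1) d2(1) in simp)
    qed
  qed
qed

lemma Linf_loc_comp_L1_loc:
  fixes X :: "real => real"
  assumes u: "Linf_loc \<Omega> u" and Om: "open \<Omega>" and X: "continuous_on UNIV X"
  shows "L1_loc \<Omega> (%p. X (u p))"
  unfolding L1_loc_def
proof (intro allI impI)
  fix K assume K: "compact K" "K \<subseteq> \<Omega>"
  have OmL: "\<Omega> \<in> sets lebesgue" using Om by (simp add: borel_open)
  have KL: "K \<in> sets lborel" using K(1) by (simp add: borel_compact)
  obtain U C where U: "U \<in> borel_measurable borel" "0 \<le> C" "!!z. \<bar>U z\<bar> \<le> C" "AE z in lborel. z \<in> K --> u z = U z"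
    by (rule Linf_loc_borel[OF u OmL K]) (rule that)
  obtain B where B: "!!z. \<bar>X (U z)\<bar> \<le> B" using continuous_bounded_comp[where U=U, OF X U(3)] by blast
  have um: "u \<in> borel_measurable (lebesgue_on \<Omega>)" using u by (simp add: Linf_loc_def)
  have Xm: "X \<in> borel_measurable borel" by (rule borel_measurable_continuous_onI[OF X])
  have "(%p. indicator \<Omega> p *\<^sub>R X (u p)) \<in> borel_measurable lebesgue"
    using measurable_compose[OF um Xm] OmL by (subst borel_measurable_restrict_space_iff[symmetric]) auto
  then have "(%p. indicator K p *\<^sub>R (indicator \<Omega> p *\<^sub>R X (u p))) \<in> borel_measurable lebesgue"
    by (rule borel_measurable_scaleR[OF borel_measurable_indicator[OF sets_completionI_sets[OF KL]]])
  also have "(%p. indicator K p *\<^sub>R (indicator \<Omega> p *\<^sub>R X (u p))) = (%p. indicator K p *\<^sub>R X (u p))"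
    using K(2) by (auto simp: indicator_def fun_eq_iff)
  finally have m: "(%p. indicator K p *\<^sub>R X (u p)) \<in> borel_measurable lebesgue" .
  have "integrable lborel (%p. indicator K p *\<^sub>R B)"
    using emeasure_compact_finite[OF K(1)] KL by (intro integrable_scaleR_left integrable_real_indicator) auto
  then have "integrable lborel (%p. indicator K p *\<^sub>R X (U p))"
  proof (rule Bochner_Integration.integrable_bound)
    show "(%p. indicator K p *\<^sub>R X (U p)) \<in> borel_measurable lborel"
      using measurable_compose[OF U(1) Xm] KL by (intro borel_measurable_scaleR borel_measurable_indicator) auto
    show "AE p in lborel. norm (indicator K p *\<^sub>R X (U p)) \<le> norm (indicator K p *\<^sub>R B)"
      using order_trans[OF B abs_ge_self] by (intro AE_I2) (auto simp: indicator_def)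
  qed
  then have "integrable lebesgue (%p. indicator K p *\<^sub>R X (U p))"
    using integrable_completion[of "%p. indicator K p *\<^sub>R X (U p)" lborel] borel_measurable_integrable by blast
  then show "set_integrable lebesgue K (%p. X (u p))" unfolding set_integrable_def
  proof (rule integrable_cong_AE_imp[OF _ m])
    have "AE p in lborel. indicator K p *\<^sub>R X (U p) = indicator K p *\<^sub>R X (u p)"
      by (rule eventually_mono[OF U(4)]) (simp add: indicator_def)
    then show "AE p in lebesgue. indicator K p *\<^sub>R X (U p) = indicator K p *\<^sub>R X (u p)" by (simp add: AE_completion_iff)
  qed
qed

text \<open>The closed form \<open>u dx - f(u) dt\<close> may have periods on a domain with holes,
  so existence of \<open>w\<close> is asserted on open simply connected subsets, while the viscosity
  statement covers every potential on \<open>\<Omega>\<close>. The entropy statement is obtained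
  locally and is not tied to a global potential.\<close>

theorem theorem2p3:
  fixes f \<eta> q :: "real \<Rightarrow> real"
    and \<Omega> :: "(real \<times> real) set"
    and u :: "real \<times> real \<Rightarrow> real"
    and \<mu> :: "(real \<times> real) measure"
  assumes "Lip_loc UNIV f" and "convex_on UNIV f"
    and "open \<Omega>" and "\<Omega> \<subseteq> {0<..} \<times> UNIV"
    and "Linf_loc \<Omega> u"
    and "weak_div_eq_0 \<Omega> u (\<lambda>p. f (u p))"
    and "Lip_loc UNIV \<eta>" and "strictly_convex \<eta>"
    and "Lip_loc UNIV q" and "entropy_flux f \<eta> q"
    and "radon_measure_on \<Omega> \<mu>"
    and "\<forall>p\<in>\<Omega>. Liminf (at_right 0) (\<lambda>r. ennreal (1 / r) * emeasure \<mu> (ball p r)) = 0"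
    and "weak_div_le_measure \<Omega> (\<lambda>p. \<eta> (u p)) (\<lambda>p. q (u p)) \<mu>"
  shows "(\<forall>\<Omega>'\<subseteq>\<Omega>. open \<Omega>' \<longrightarrow> simply_connected \<Omega>' \<longrightarrow> (\<exists>w. potential f \<Omega>' u w)) \<and>
         (\<forall>w. potential f \<Omega> u w \<longrightarrow> viscosity_solution f \<Omega> w) \<and>
         entropy_solution f \<Omega> u"
proof -
  note f = assms(1,2)
  have um: "u \<in> borel_measurable (lebesgue_on \<Omega>)" using assms(5) by (simp add: Linf_loc_def)
  \<comment> \<open>The given entropy pair and the measure enter through this inequality alone; both
    the viscosity property and the inequalities for all other entropies are drawn from it.\<close>
  have ge: "0 \<le> a + f b" if r: "0 < r" "cball y r \<subseteq> \<Omega>" and w: "L-lipschitz_on UNIV w"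
    and U: "U \<in> borel_measurable borel" "!!z. \<bar>U z\<bar> \<le> C" "AE z in lborel. z \<in> cball y r --> u z = U z"
    and g: "grad_on (ball y r) w (%z. - f (U z)) U" and sd: "subdiff w y a b" for y r w U C L a b
  proof -
    have "y \<in> \<Omega>" using r by auto
    then have li: "Liminf (at_right 0) (%r. ennreal (1 / r) * emeasure \<mu> (ball y r)) = 0" using assms(12) by blast
    show ?thesis
      by (rule subdiff_ge[OF f(1) assms(7,9) f(2) assms(8,10) assms(3,11) li um assms(13) w r U g sd])
  qed
  have 1: "\<exists>w. potential f \<Omega>' u w" if "\<Omega>' \<subseteq> \<Omega>" "open \<Omega>'" "simply_connected \<Omega>'" for \<Omega>'
    by (rule simply_connected_potential[OF f(1) assms(3,5,6) that])
  have 2: "viscosity_solution f \<Omega> w" if "potential f \<Omega> u w" for w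
    by (rule potential_viscosity_solution[OF f assms(3,5) ge that])
  have 3: "entropy_solution f \<Omega> u"
    unfolding entropy_solution_def weak_div_le_0_def
  proof (intro conjI allI impI ballI)
    show "L1_loc \<Omega> u" using assms(6) by (simp add: weak_div_eq_0_def)
    show "weak_div_eq_0 \<Omega> u (%p. f (u p))" by (rule assms(6))
    fix \<eta>' q' assume e: "Lip_loc UNIV \<eta>'" "Lip_loc UNIV q'" "convex_on UNIV \<eta>'" "entropy_flux f \<eta>' q'"
    show "L1_loc \<Omega> (%p. \<eta>' (u p))" "L1_loc \<Omega> (%p. q' (u p))"
      by (rule Linf_loc_comp_L1_loc[OF assms(5,3) Lip_loc_continuous], rule e)+
    fix \<phi> assume "\<phi> \<in> test_functions \<Omega>" "\<forall>p. 0 \<le> \<phi> p"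
    then show "weak_div \<Omega> (%p. \<eta>' (u p)) (%p. q' (u p)) \<phi> \<le> 0"
      by (intro weak_entropy_inequality[OF f assms(3,5,6) ge e]) auto
  qed
  show ?thesis using 1 2 3 by blast
qed

end
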